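(* Let $p(t) = (t-\lambda_1)^{k_1}\cdots (t-\lambda_n)^{k_n}$ be a polynomial, with $\lambda_1,\dots,\lambda_n\in\mathbb{C}$ pairwise distinct, such that $k_i\ge 2$ for $i=1,\ldots,n$. Then the universal $C^*$-algebra of the relation $p(b)=0$, $\|b\|\le 1$ is semiprojective.
   Context: The universal $C^*$-algebra of the relation $p(b)=0$, $\|b\|\le 1$ is the unital $C^*$-algebra $D$ generated (together with its unit) by an element $b$ with $p(b)=0$, $\|b\|\le 1$ (the constant term of $p$ being multiplied by the unit), such that for every unital $C^*$-algebra $B$ and every $x\in B$ with $p(x)=0$, $\|x\|\le 1$ there is a unique unital $*$-homomorphism $D\to B$ sending $b$ to $x$. It is assumed that this universal $C^*$-algebra exists, i.e. that the relation has at least one representation on a nonzero Hilbert space. Ideals of $C^*$-algebras are closed and two-sided. A $C^*$-algebra $D$ is semiprojective if for any $C^*$-algebra $A$, any increasing chain of ideals $I_1\subseteq I_2\subseteq\cdots$ in $A$, and every $*$-homomorphism $\phi: D\to A/I$, where $I=\overline{\bigcup_n I_n}$, there exist $n$ and a $*$-homomorphism $\tilde\phi: D\to A/I_n$ such that $\phi$ is the composition of $\tilde\phi$ with the canonical surjection $A/I_n\to A/I$. *)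

theory Defs
  imports
    "HOL-Analysis.Analysis"
    "HOL-Computational_Algebra.Polynomial"
    "HOL-Algebra.QuotRing"
    "HOL-Algebra.Module"
begin

section \<open>C*-algebras\<close>

text \<open>
  C*-algebras are carrier-based, so that quotients and quantification over algebras are available
  inside formulas.  The field \<open>one\<close> inherited from the ring record is meaningful only in the
  unital case and is unconstrained otherwise.
\<close>

record 'a cstar = "(complex, 'a) module" +
  adj :: "'a \<Rightarrow> 'a"
  nrm :: "'a \<Rightarrow> real"

locale cstar_algebra = abelian_group A for A :: "'a cstar" (structure) +
  assumes mult_closed: "\<lbrakk>x \<in> carrier A; y \<in> carrier A\<rbrakk> \<Longrightarrow> x \<otimes> y \<in> carrier A"
    and mult_assoc: "\<lbrakk>x \<in> carrier A; y \<in> carrier A; z \<in> carrier A\<rbrakk>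
          \<Longrightarrow> (x \<otimes> y) \<otimes> z = x \<otimes> (y \<otimes> z)"
    and mult_distr_right: "\<lbrakk>x \<in> carrier A; y \<in> carrier A; z \<in> carrier A\<rbrakk>
          \<Longrightarrow> (x \<oplus> y) \<otimes> z = x \<otimes> z \<oplus> y \<otimes> z"
    and mult_distr_left: "\<lbrakk>x \<in> carrier A; y \<in> carrier A; z \<in> carrier A\<rbrakk>
          \<Longrightarrow> z \<otimes> (x \<oplus> y) = z \<otimes> x \<oplus> z \<otimes> y"
    and scale_closed: "x \<in> carrier A \<Longrightarrow> c \<odot> x \<in> carrier A"
    and scale_add_left: "x \<in> carrier A \<Longrightarrow> (c + d) \<odot> x = c \<odot> x \<oplus> d \<odot> x"
    and scale_add_right: "\<lbrakk>x \<in> carrier A; y \<in> carrier A\<rbrakk> \<Longrightarrow> c \<odot> (x \<oplus> y) = c \<odot> x \<oplus> c \<odot> y"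
    and scale_scale: "x \<in> carrier A \<Longrightarrow> (c * d) \<odot> x = c \<odot> (d \<odot> x)"
    and scale_one: "x \<in> carrier A \<Longrightarrow> 1 \<odot> x = x"
    and scale_mult_left: "\<lbrakk>x \<in> carrier A; y \<in> carrier A\<rbrakk> \<Longrightarrow> (c \<odot> x) \<otimes> y = c \<odot> (x \<otimes> y)"
    and scale_mult_right: "\<lbrakk>x \<in> carrier A; y \<in> carrier A\<rbrakk> \<Longrightarrow> x \<otimes> (c \<odot> y) = c \<odot> (x \<otimes> y)"
    and adj_closed: "x \<in> carrier A \<Longrightarrow> adj A x \<in> carrier A"
    and adj_adj: "x \<in> carrier A \<Longrightarrow> adj A (adj A x) = x"
    and adj_add: "\<lbrakk>x \<in> carrier A; y \<in> carrier A\<rbrakk> \<Longrightarrow> adj A (x \<oplus> y) = adj A x \<oplus> adj A y"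
    and adj_scale: "x \<in> carrier A \<Longrightarrow> adj A (c \<odot> x) = cnj c \<odot> adj A x"
    and adj_mult: "\<lbrakk>x \<in> carrier A; y \<in> carrier A\<rbrakk> \<Longrightarrow> adj A (x \<otimes> y) = adj A y \<otimes> adj A x"
    and nrm_nonneg: "x \<in> carrier A \<Longrightarrow> 0 \<le> nrm A x"
    and nrm_eq_zero_iff: "x \<in> carrier A \<Longrightarrow> nrm A x = 0 \<longleftrightarrow> x = \<zero>"
    and nrm_triangle: "\<lbrakk>x \<in> carrier A; y \<in> carrier A\<rbrakk> \<Longrightarrow> nrm A (x \<oplus> y) \<le> nrm A x + nrm A y"
    and nrm_scale: "x \<in> carrier A \<Longrightarrow> nrm A (c \<odot> x) = cmod c * nrm A x"
    and nrm_mult: "\<lbrakk>x \<in> carrier A; y \<in> carrier A\<rbrakk> \<Longrightarrow> nrm A (x \<otimes> y) \<le> nrm A x * nrm A y"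
    and cstar_identity: "x \<in> carrier A \<Longrightarrow> nrm A (adj A x \<otimes> x) = (nrm A x)\<^sup>2"
    and complete: "\<lbrakk>range s \<subseteq> carrier A;
          \<forall>e>0. \<exists>N. \<forall>m\<ge>N. \<forall>n\<ge>N. nrm A (s m \<ominus> s n) < e\<rbrakk>
          \<Longrightarrow> \<exists>l\<in>carrier A. (\<lambda>n. nrm A (s n \<ominus> l)) \<longlonglongrightarrow> 0"

locale unital_cstar_algebra = cstar_algebra +
  assumes one_closed: "\<one> \<in> carrier A"
    and one_mult: "x \<in> carrier A \<Longrightarrow> \<one> \<otimes> x = x"
    and mult_one: "x \<in> carrier A \<Longrightarrow> x \<otimes> \<one> = x"

definition star_hom :: "'a cstar \<Rightarrow> 'b cstar \<Rightarrow> ('a \<Rightarrow> 'b) set" where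
  "star_hom A B = {f. f \<in> hom A B \<and> f \<in> hom (add_monoid A) (add_monoid B) \<and>
     (\<forall>c. \<forall>x\<in>carrier A. f (c \<odot>\<^bsub>A\<^esub> x) = c \<odot>\<^bsub>B\<^esub> f x) \<and>
     (\<forall>x\<in>carrier A. f (adj A x) = adj B (f x))}"

definition nrm_closure :: "'a cstar \<Rightarrow> 'a set \<Rightarrow> 'a set" where
  "nrm_closure A S = {x \<in> carrier A. \<forall>e>0. \<exists>y\<in>S. nrm A (x \<ominus>\<^bsub>A\<^esub> y) < e}"

section \<open>Ideals and quotients\<close>

definition cstar_ideal :: "'a set \<Rightarrow> 'a cstar \<Rightarrow> bool" where
  "cstar_ideal I A \<longleftrightarrow> additive_subgroup I A \<and>
     (\<forall>c. \<forall>x\<in>I. c \<odot>\<^bsub>A\<^esub> x \<in> I) \<and>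
     (\<forall>a\<in>carrier A. \<forall>x\<in>I. a \<otimes>\<^bsub>A\<^esub> x \<in> I \<and> x \<otimes>\<^bsub>A\<^esub> a \<in> I) \<and>
     nrm_closure A I = I"

text \<open>
  The underlying ring operations are those of \<^const>\<open>FactRing\<close>; the norm of a coset is the
  infimum of the norms of its elements.
\<close>

definition cstar_quot :: "'a cstar \<Rightarrow> 'a set \<Rightarrow> 'a set cstar" where
  "cstar_quot A I =
     \<lparr>carrier = a_rcosets\<^bsub>A\<^esub> I, mult = rcoset_mult A I, one = I +>\<^bsub>A\<^esub> \<one>\<^bsub>A\<^esub>,
      zero = I, add = set_add A,
      smult = (\<lambda>c X. \<Union>x\<in>X. I +>\<^bsub>A\<^esub> (c \<odot>\<^bsub>A\<^esub> x)),
      adj = (\<lambda>X. \<Union>x\<in>X. I +>\<^bsub>A\<^esub> adj A x),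
      nrm = (\<lambda>X. INF x\<in>X. nrm A x)\<rparr>"

text \<open>For ideals \<open>I \<subseteq> J\<close>, the canonical surjection from \<open>A/I\<close> to \<open>A/J\<close>, sending \<open>I + x\<close> to \<open>J + x\<close>.\<close>

definition quot_proj :: "'a cstar \<Rightarrow> 'a set \<Rightarrow> 'a set \<Rightarrow> 'a set" where
  "quot_proj A J X = (\<Union>x\<in>X. J +>\<^bsub>A\<^esub> x)"

section \<open>Semiprojectivity\<close>

text \<open>
  The algebra \<open>A\<close> ranges over all C*-algebras carried by a subset of the type \<open>'a\<close>; a statement with
  \<open>'a\<close> free covers all of them.
\<close>

definition semiprojective :: "'a itself \<Rightarrow> 'd cstar \<Rightarrow> bool" where
  "semiprojective (_ :: 'a itself) D \<longleftrightarrow>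
     (\<forall>(A :: 'a cstar) (I :: nat \<Rightarrow> 'a set) \<phi>.
        cstar_algebra A \<and> (\<forall>n. cstar_ideal (I n) A) \<and> (\<forall>n. I n \<subseteq> I (Suc n)) \<and>
        \<phi> \<in> star_hom D (cstar_quot A (nrm_closure A (\<Union>n. I n))) \<longrightarrow>
        (\<exists>n. \<exists>\<psi> \<in> star_hom D (cstar_quot A (I n)).
           \<forall>d\<in>carrier D. \<phi> d = quot_proj A (nrm_closure A (\<Union>n. I n)) (\<psi> d)))"

section \<open>The universal C*-algebra of a polynomial relation\<close>

definition cstar_poly :: "'a cstar \<Rightarrow> complex poly \<Rightarrow> 'a \<Rightarrow> 'a" where
  "cstar_poly A p x = (\<Oplus>\<^bsub>A\<^esub>i\<in>{..degree p}. coeff p i \<odot>\<^bsub>A\<^esub> (x [^]\<^bsub>A\<^esub> i))"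

definition satisfies_relation :: "'a cstar \<Rightarrow> complex poly \<Rightarrow> 'a \<Rightarrow> bool" where
  "satisfies_relation A p x \<longleftrightarrow>
     x \<in> carrier A \<and> cstar_poly A p x = \<zero>\<^bsub>A\<^esub> \<and> nrm A x \<le> 1"

definition unital_cstar_subalgebra :: "'a set \<Rightarrow> 'a cstar \<Rightarrow> bool" where
  "unital_cstar_subalgebra S A \<longleftrightarrow> additive_subgroup S A \<and> \<one>\<^bsub>A\<^esub> \<in> S \<and>
     (\<forall>c. \<forall>x\<in>S. c \<odot>\<^bsub>A\<^esub> x \<in> S) \<and> (\<forall>x\<in>S. \<forall>y\<in>S. x \<otimes>\<^bsub>A\<^esub> y \<in> S) \<and>
     (\<forall>x\<in>S. adj A x \<in> S) \<and> nrm_closure A S = S"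

definition generated_by :: "'a cstar \<Rightarrow> 'a \<Rightarrow> bool" where
  "generated_by A x \<longleftrightarrow> \<Inter>{S. unital_cstar_subalgebra S A \<and> x \<in> S} = carrier A"

text \<open>
  The universal property below quantifies over the unital C*-algebras \<open>B\<close> carried by a subset of
  \<open>nat \<Rightarrow> real\<close>.  This is no restriction.  The image of a unital *-homomorphism sending the
  generator \<open>b\<close> to \<open>x\<close> lies in the C*-subalgebra of \<open>B\<close> generated by \<open>x\<close> and the unit, so only this
  subalgebra matters; it has a countable dense subset \<open>{d n | n}\<close>, and
  \<open>y \<mapsto> (\<lambda>n. \<parallel>y - d n\<parallel>)\<close> maps it injectively into \<open>nat \<Rightarrow> real\<close>.
  Homomorphisms are taken extensional so that uniqueness refers to their values on the carrier.
\<close>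

definition universal_cstar_algebra :: "complex poly \<Rightarrow> 'd cstar \<Rightarrow> 'd \<Rightarrow> bool" where
  "universal_cstar_algebra p D b \<longleftrightarrow>
     unital_cstar_algebra D \<and> satisfies_relation D p b \<and> generated_by D b \<and>
     (\<forall>(B :: (nat \<Rightarrow> real) cstar) x.
        unital_cstar_algebra B \<and> satisfies_relation B p x \<longrightarrow>
        (\<exists>!f. f \<in> extensional (carrier D) \<and> f \<in> star_hom D B \<and> f \<one>\<^bsub>D\<^esub> = \<one>\<^bsub>B\<^esub> \<and> f b = x))"

section \<open>Representations on Hilbert spaces\<close>

class complex_hilbert_space = banach +
  fixes scaleC :: "complex \<Rightarrow> 'a \<Rightarrow> 'a"
    and cinner :: "'a \<Rightarrow> 'a \<Rightarrow> complex"
  assumes scaleR_scaleC: "scaleR r x = scaleC (complex_of_real r) x"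
    and scaleC_add_left: "scaleC (c + d) x = scaleC c x + scaleC d x"
    and scaleC_add_right: "scaleC c (x + y) = scaleC c x + scaleC c y"
    and scaleC_scaleC: "scaleC c (scaleC d x) = scaleC (c * d) x"
    and cinner_commute: "cinner x y = cnj (cinner y x)"
    and cinner_add_left: "cinner (x + y) z = cinner x z + cinner y z"
    and cinner_scaleC_left: "cinner (scaleC c x) y = c * cinner x y"
    and cinner_self: "cinner x x = complex_of_real ((norm x)\<^sup>2)"

definition relation_operator :: "complex poly \<Rightarrow> ('h::complex_hilbert_space \<Rightarrow> 'h) \<Rightarrow> bool" where
  "relation_operator p T \<longleftrightarrow>
     bounded_linear T \<and> (\<forall>c v. T (scaleC c v) = scaleC c (T v)) \<and> onorm T \<le> 1 \<and>
     (\<forall>v. (\<Sum>i\<le>degree p. scaleC (coeff p i) ((T ^^ i) v)) = 0)"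

text \<open>A type \<open>'h\<close> that occurs only in this hypothesis is existentially quantified by it.\<close>

definition has_representation :: "'h::complex_hilbert_space itself \<Rightarrow> complex poly \<Rightarrow> bool" where
  "has_representation (_ :: 'h itself) p \<longleftrightarrow>
     (\<exists>v :: 'h. v \<noteq> 0) \<and> (\<exists>T :: 'h \<Rightarrow> 'h. relation_operator p T)"

end

theory Submission imports Defs begin

text \<open>
  By the universal property it suffices to lift a contraction \<open>x\<close> with \<open>p x = 0\<close> along
  \<open>A/I\<^sub>n \<rightarrow> A/I\<close> for large \<open>n\<close>, together with the projection that is the image of the unit.  For a contraction
  the factors of \<open>p\<close> with \<open>\<bar>\<lambda>\<^sub>i\<bar> > 1\<close> cancel and those with \<open>\<bar>\<lambda>\<^sub>i\<bar> = 1\<close> become simple.  For large \<open>n\<close> the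
  spectral idempotents of \<open>x\<close> lift, and after a similarity they are orthogonal projections.  In the
  corner of each of them \<open>x - \<lambda>\<^sub>i\<close> is nilpotent, and nilpotents of a given order lift along every surjection: a lift whose
  \<open>k\<close>-th power is small can be cut down to an exact nilpotent nearby, and a whole sequence of such cuts is glued
  by a quasicentral approximate unit of the kernel, so that the successive corrections converge.  A last
  similarity \<open>H\<^bsup>1/2\<^esup> Y H\<^bsup>-1/2\<^esup>\<close>, with \<open>H = 1 + \<Sum>\<^sub>m Y*\<^sup>m (Y*Y - 1)\<^sub>+ Y\<^sup>m\<close>, restores the bound \<open>1\<close> on the norm
  without changing the image of \<open>Y\<close>.
\<close>

text \<open>Cutting an approximate nilpotent down to an exact one also changes its image, while
  gluing restores the image at the price of a power that is merely small. Hence the two alternate: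
  each round keeps the image, makes the power as small as desired, and moves the element by an
  amount governed by the power it started with, so the moves can be made summable. The index n
  enters in one way only: finitely many fixed elements have norm below 1/4 in the limit quotient,
  and hence already in some \<open>A/I\<^sub>n\<close>. The bound 1/4 ensures that the square 1 + 4
  (e e - e) of 2 e - 1 has an invertible square root, which makes the idempotent near e explicit.
  Unimodular eigenvalues resist the last similarity, because powers of Y do not decay there; they
  are kept on exact reducing projections, where Y is already isometric. The analysis lives in type
  classes and avoids spectra: positivity is a norm condition, and order bounds replace the spectrum.
  Carrier-based algebras enter as coordinates of one big unital algebra, and corners account for the
  different units.\<close>

section \<open>C*-algebras carried by whole types\<close>

class cstar0 = real_normed_algebra + banach +
  fixes cscale :: "complex \<Rightarrow> 'a \<Rightarrow> 'a" and star :: "'a \<Rightarrow> 'a"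
  assumes cscale_of_real: "cscale (complex_of_real r) x = r *\<^sub>R x"
    and cscale_add_left: "cscale (c + d) x = cscale c x + cscale d x"
    and cscale_add_right: "cscale c (x + y) = cscale c x + cscale c y"
    and cscale_cscale: "cscale c (cscale d x) = cscale (c * d) x"
    and cscale_mult_left: "cscale c x * y = cscale c (x * y)"
    and cscale_mult_right: "x * cscale c y = cscale c (x * y)"
    and norm_cscale: "norm (cscale c x) = cmod c * norm x"
    and star_star [simp]: "star (star x) = x"
    and star_add: "star (x + y) = star x + star y"
    and star_cscale: "star (cscale c x) = cscale (cnj c) (star x)"
    and star_mult: "star (x * y) = star y * star x"
    and norm_star_mult: "norm (star x * x) = (norm x)\<^sup>2"

text \<open>\<open>real_normed_algebra_1\<close> brings \<open>norm 1 = 1\<close>, so algebras of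
  this class are nonzero. Corners and quotients, which may vanish, stay carrier-based and are
  embedded into a larger algebra of this class.\<close>

class cstar1 = cstar0 + real_normed_algebra_1

lemma cscale_one [simp]: "cscale 1 (x::'a::cstar0) = x"
  using cscale_of_real[of 1 x] by simp

lemma cscale_zero_right [simp]: "cscale c (0::'a::cstar0) = 0"
  using norm_cscale[of c "0::'a"] by simp

lemma cscale_zero_left [simp]: "cscale 0 (x::'a::cstar0) = 0"
  using norm_cscale[of 0 "x"] by simp

lemma cscale_minus_right: "cscale c (- (x::'a::cstar0)) = - cscale c x"
  using cscale_add_right[of c x "- x"] by (simp add: eq_neg_iff_add_eq_0 add.commute)

lemma cscale_diff_right: "cscale c (x - (y::'a::cstar0)) = cscale c x - cscale c y"
  using cscale_add_right[of c x "- y"] by (simp add: cscale_minus_right)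

lemma cscale_minus_left: "cscale (- c) (x::'a::cstar0) = - cscale c x"
  using cscale_add_left[of c "- c" x] by (simp add: eq_neg_iff_add_eq_0 add.commute)

lemma bounded_linear_cscale: "bounded_linear (cscale c :: 'a \<Rightarrow> 'a::cstar0)"
proof (rule bounded_linear_intro[where K = "cmod c"])
  show "cscale c (r *\<^sub>R x) = r *\<^sub>R cscale c x" for r and x :: 'a
    by (simp add: cscale_cscale mult.commute flip: cscale_of_real)
qed (simp_all add: cscale_add_right norm_cscale mult.commute)

lemma star_zero [simp]: "star 0 = (0::'a::cstar0)"
  using star_cscale[of 0 "0::'a"] by simp

lemma star_minus: "star (- x) = - star (x::'a::cstar0)"
  using star_add[of x "- x"] by (simp add: eq_neg_iff_add_eq_0 add.commute)

lemma star_diff: "star (x - y) = star x - star (y::'a::cstar0)"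
  using star_add[of x "- y"] by (simp add: star_minus)

lemma star_scaleR: "star (r *\<^sub>R x) = r *\<^sub>R star (x::'a::cstar0)"
  using star_cscale[of "of_real r" x] by (simp add: cscale_of_real)

lemma norm_star [simp]: "norm (star x) = norm (x::'a::cstar0)"
proof -
  have le: "norm x \<le> norm (star x)" for x :: 'a
  proof (cases "x = 0")
    case False
    have "norm x * norm x \<le> norm (star x) * norm x"
      using norm_star_mult[of x] norm_mult_ineq[of "star x" x] by (simp add: power2_eq_square)
    then show ?thesis using False by simp
  qed simp
  show ?thesis using le[of x] le[of "star x"] by simp
qed

lemma bounded_linear_star: "bounded_linear (star :: 'a \<Rightarrow> 'a::cstar0)"
  by (rule bounded_linear_intro[where K = 1]) (simp_all add: star_add star_scaleR)

lemmas tendsto_star = bounded_linear.tendsto[OF bounded_linear_star]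
lemmas star_sum = linear_sum[OF bounded_linear.linear[OF bounded_linear_star]]

lemma star_mult_self_eq_0: "star x * x = 0 \<Longrightarrow> (x::'a::cstar0) = 0"
  using norm_star_mult[of x] by simp

lemma star_one [simp]: "star 1 = (1::'a::cstar1)"
  by (metis mult.left_neutral star_mult mult.right_neutral star_star)

lemma star_of_real [simp]: "star (of_real r) = (of_real r::'a::cstar1)"
  by (simp add: of_real_def star_scaleR)

lemma star_power: "star (x ^ n) = star (x::'a::cstar1) ^ n"
  by (induction n) (simp_all add: star_mult power_commutes)

subsection \<open>Square roots\<close>

text \<open>Iteration for the fixed point y = (x + y y) / 2, that is (1 - y)^2 = 1 - x. The iterates
  are polynomials in x with nonnegative coefficients, hence dominated by the scalar iterates; this
  covers the boundary case \<open>norm x = 1\<close>, on which positivity depends.\<close>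

fun sqrt_iter :: "'a::real_algebra_1 \<Rightarrow> nat \<Rightarrow> 'a" where
  "sqrt_iter x 0 = 0"
| "sqrt_iter x (Suc n) = (1/2) *\<^sub>R (x + sqrt_iter x n * sqrt_iter x n)"

definition sqrt_one_minus :: "'a::{real_normed_algebra_1,banach} \<Rightarrow> 'a" where
  "sqrt_one_minus x = 1 - lim (sqrt_iter x)"

lemma sqrt_iter_real:
  fixes r :: real
  assumes "0 \<le> r" "r \<le> 1"
  shows "0 \<le> sqrt_iter r n" "sqrt_iter r n \<le> 1" "sqrt_iter r n \<le> sqrt_iter r (Suc n)"
proof -
  have *: "0 \<le> sqrt_iter r n \<and> sqrt_iter r n \<le> 1" for n
  proof (induction n)
    case (Suc n)
    then have "sqrt_iter r n * sqrt_iter r n \<le> 1" by (simp add: mult_le_one)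
    then show ?case using Suc assms by simp
  qed simp
  then show "0 \<le> sqrt_iter r n" "sqrt_iter r n \<le> 1" by auto
  show "sqrt_iter r n \<le> sqrt_iter r (Suc n)"
  proof (induction n)
    case (Suc n)
    have "sqrt_iter r n * sqrt_iter r n \<le> sqrt_iter r (Suc n) * sqrt_iter r (Suc n)"
      using Suc *[of n] by (intro mult_mono) (auto simp del: sqrt_iter.simps intro: order_trans)
    then show ?case by simp
  qed (use assms in auto)
qed

text \<open>Scalar domination, including increments. The identity a a - b b = a (a - b) + (a - b) b
  makes the induction work in a noncommutative algebra.\<close>

lemma sqrt_iter_norm:
  fixes x :: "'a::real_normed_algebra_1"
  assumes "norm x \<le> r" "r \<le> 1"
  shows "norm (sqrt_iter x n) \<le> sqrt_iter r n"
    "norm (sqrt_iter x (Suc n) - sqrt_iter x n) \<le> sqrt_iter r (Suc n) - sqrt_iter r n"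
proof -
  have r0: "0 \<le> r" using assms norm_ge_zero order_trans by blast
  have 1: "norm (sqrt_iter x n) \<le> sqrt_iter r n" for n
  proof (induction n)
    case (Suc n)
    have "norm (sqrt_iter x n * sqrt_iter x n) \<le> sqrt_iter r n * sqrt_iter r n"
      using Suc by (meson mult_mono norm_ge_zero norm_mult_ineq order_trans)
    then have "norm (x + sqrt_iter x n * sqrt_iter x n) \<le> r + sqrt_iter r n * sqrt_iter r n"
      using assms(1) by (meson add_mono norm_triangle_ineq order_trans)
    then show ?case by simp
  qed simp
  then show "norm (sqrt_iter x n) \<le> sqrt_iter r n" .
  show "norm (sqrt_iter x (Suc n) - sqrt_iter x n) \<le> sqrt_iter r (Suc n) - sqrt_iter r n"
  proof (induction n)
    case 0
    show ?case using assms by simp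
  next
    case (Suc n)
    define a b where "a = sqrt_iter x (Suc n)" and "b = sqrt_iter x n"
    define u v where "u = sqrt_iter r (Suc n)" and "v = sqrt_iter r n"
    have le: "norm a \<le> u" "norm b \<le> v" "norm (a - b) \<le> u - v"
      using 1[of "Suc n"] 1[of n] Suc unfolding a_def b_def u_def v_def by auto
    have u0: "0 \<le> u - v" "0 \<le> u" using le norm_ge_zero order_trans by blast+
    have "norm (a * a - b * b) = norm (a * (a - b) + (a - b) * b)"
      by (simp add: algebra_simps)
    also have "\<dots> \<le> u * (u - v) + (u - v) * v"
      using le u0
      by (intro order_trans[OF norm_triangle_ineq] add_mono order_trans[OF norm_mult_ineq] mult_mono) auto
    also have "\<dots> = u * u - v * v" by (simp add: algebra_simps)
    finally have d: "norm (a * a - b * b) \<le> u * u - v * v" .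
    have "sqrt_iter x (Suc (Suc n)) - sqrt_iter x (Suc n) = (1/2) *\<^sub>R (a * a - b * b)"
      unfolding a_def b_def by (simp add: algebra_simps del: scaleR_half_double)
    moreover have "sqrt_iter r (Suc (Suc n)) - sqrt_iter r (Suc n) = (1/2) * (u * u - v * v)"
      unfolding u_def v_def by (simp add: algebra_simps)
    ultimately show ?case using d by simp
  qed
qed

text \<open>At 1 the scalar iterates increase and stay below 1, so their increments are summable,
  and they dominate the increments at x.\<close>

lemma sqrt_iter_convergent:
  fixes x :: "'a::{real_normed_algebra_1,banach}"
  assumes "norm x \<le> 1"
  shows "sqrt_iter x \<longlonglongrightarrow> lim (sqrt_iter x)"
proof -
  have "Bseq (sqrt_iter (1::real))"
    using sqrt_iter_real[of 1] by (intro BseqI'[where K = 1]) auto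
  moreover have "incseq (sqrt_iter (1::real))"
    using sqrt_iter_real(3)[of 1] by (intro incseq_SucI) auto
  ultimately have "convergent (sqrt_iter (1::real))"
    using Bseq_mono_convergent incseq_def by blast
  then have "summable (\<lambda>n. sqrt_iter (1::real) (Suc n) - sqrt_iter 1 n)"
    using summable_iff_convergent' telescope_summable convergent_LIMSEQ_iff by blast
  then have "summable (\<lambda>n. sqrt_iter x (Suc n) - sqrt_iter x n)"
    by (rule summable_comparison_test'[where N = 0]) (use sqrt_iter_norm(2)[of x 1] assms in auto)
  then have "convergent (\<lambda>n. \<Sum>i<n. sqrt_iter x (Suc i) - sqrt_iter x i)"
    by (simp add: summable_iff_convergent)
  then have "convergent (sqrt_iter x)"
    by (simp add: sum_lessThan_telescope del: sqrt_iter.simps(2))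
  then show ?thesis by (simp add: convergent_LIMSEQ_iff)
qed

lemma sqrt_one_minus_lim:
  fixes x :: "'a::{real_normed_algebra_1,banach}"
  assumes "norm x \<le> 1"
  shows "(\<lambda>n. 1 - sqrt_iter x n) \<longlonglongrightarrow> sqrt_one_minus x"
  unfolding sqrt_one_minus_def by (intro tendsto_intros sqrt_iter_convergent assms)

lemma sqrt_one_minus_square:
  fixes x :: "'a::{real_normed_algebra_1,banach}"
  assumes "norm x \<le> 1"
  shows "sqrt_one_minus x * sqrt_one_minus x = 1 - x"
proof -
  define y where "y = lim (sqrt_iter x)"
  have y: "sqrt_iter x \<longlonglongrightarrow> y" unfolding y_def by (rule sqrt_iter_convergent[OF assms])
  have "(\<lambda>n. sqrt_iter x (Suc n)) \<longlonglongrightarrow> (1/2) *\<^sub>R (x + y * y)"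
    unfolding sqrt_iter.simps by (intro tendsto_intros y)
  with LIMSEQ_Suc[OF y] have "y = (1/2) *\<^sub>R (x + y * y)" using LIMSEQ_unique by blast
  then have "y + y = x + y * y" by (metis scaleR_half_double scaleR_right_distrib)
  then show ?thesis unfolding sqrt_one_minus_def y_def[symmetric]
    by (simp add: algebra_simps)
qed

lemma sqrt_one_minus_commute:
  fixes x :: "'a::{real_normed_algebra_1,banach}"
  assumes "norm x \<le> 1" "z * x = x * z"
  shows "z * sqrt_one_minus x = sqrt_one_minus x * z"
proof -
  have "z * sqrt_iter x n = sqrt_iter x n * z" for n
    by (induction n) (use assms(2) in \<open>simp_all add: algebra_simps\<close>, metis mult.assoc)
  then have "(\<lambda>n. z * (1 - sqrt_iter x n)) = (\<lambda>n. (1 - sqrt_iter x n) * z)"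
    by (simp add: algebra_simps)
  moreover have "(\<lambda>n. z * (1 - sqrt_iter x n)) \<longlonglongrightarrow> z * sqrt_one_minus x"
    "(\<lambda>n. (1 - sqrt_iter x n) * z) \<longlonglongrightarrow> sqrt_one_minus x * z"
    by (intro tendsto_intros sqrt_one_minus_lim assms)+
  ultimately show ?thesis using LIMSEQ_unique by metis
qed

lemma sqrt_one_minus_star:
  fixes x :: "'a::cstar1"
  assumes "norm x \<le> 1" "star x = x"
  shows "star (sqrt_one_minus x) = sqrt_one_minus x"
proof -
  have "star (sqrt_iter x n) = sqrt_iter x n" for n
    by (induction n) (simp_all add: star_add star_scaleR star_mult assms)
  then have "(\<lambda>n. star (1 - sqrt_iter x n)) = (\<lambda>n. 1 - sqrt_iter x n)"
    by (simp add: star_diff)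
  then show ?thesis
    using tendsto_star[OF sqrt_one_minus_lim[OF assms(1)]] sqrt_one_minus_lim[OF assms(1)]
      LIMSEQ_unique by metis
qed

subsection \<open>Positive elements\<close>

text \<open>For self-adjoint a the norm condition expresses that the spectrum lies in [0, 2 t]; in
  this form the spectrum itself never occurs. Sums become immediate from the triangle inequality,
  whereas squares and \<open>star x * x\<close> require work.\<close>

definition pos :: "'a::cstar1 \<Rightarrow> bool" where
  "pos a \<longleftrightarrow> star a = a \<and> (\<exists>t\<ge>0. norm (of_real t - a) \<le> t)"

lemma pos_star: "pos a \<Longrightarrow> star a = a"
  by (simp add: pos_def)

lemma posI: "star a = a \<Longrightarrow> norm (of_real t - a) \<le> t \<Longrightarrow> pos a"
  unfolding pos_def by (meson norm_ge_zero order_trans)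

lemma pos_add: assumes "pos a" "pos b" shows "pos (a + b)"
proof -
  obtain s t where "norm (of_real s - a) \<le> s" "norm (of_real t - b) \<le> t"
    using assms unfolding pos_def by blast
  then have "norm (of_real (s + t) - (a + b)) \<le> s + t"
    using norm_triangle_ineq[of "of_real s - a" "of_real t - b"] by (simp add: algebra_simps)
  then show ?thesis by (intro posI[where t = "s + t"]) (use assms in \<open>simp_all add: star_add pos_star\<close>)
qed

lemma pos_of_real [simp]: "0 \<le> r \<Longrightarrow> pos (of_real r)"
  by (rule posI[where t = r]) auto

lemma pos_zero [simp]: "pos 0"
  using pos_of_real[of 0] by simp

lemma pos_one [simp]: "pos 1"
  using pos_of_real[of 1] by simp

lemma pos_scaleR: assumes "pos a" "0 \<le> r" shows "pos (r *\<^sub>R a)"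
proof -
  obtain t where t: "norm (of_real t - a) \<le> t" using assms unfolding pos_def by blast
  have "norm (of_real (r * t) - r *\<^sub>R a) = r * norm (of_real t - a)"
    using assms(2) by (simp add: of_real_def flip: scaleR_scaleR scaleR_diff_right)
  also have "\<dots> \<le> r * t" by (intro mult_left_mono t assms)
  finally show ?thesis
    by (intro posI[where t = "r * t"]) (use assms in \<open>simp_all add: star_scaleR pos_star\<close>)
qed

lemma pos_sum: "(\<And>i. i \<in> I \<Longrightarrow> pos (f i)) \<Longrightarrow> pos (sum f I)"
  by (induction I rule: infinite_finite_induct) (auto intro: pos_add)

text \<open>The norm condition says that 1 - a / t is a contraction, so
  \<open>sqrt_one_minus\<close> applies to it. As a limit of polynomials in a, the root commutes
  with everything that commutes with a.\<close>

lemma pos_sqrt: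
  assumes "pos a"
  obtains s where "star s = s" "s * s = a" "\<And>z. z * a = a * z \<Longrightarrow> z * s = s * z"
proof -
  obtain t where t: "0 \<le> t" "norm (of_real t - a) \<le> t" using assms unfolding pos_def by blast
  show ?thesis
  proof (cases "t = 0")
    case True
    then show ?thesis using t that[of 0] by simp
  next
    case False
    define x where "x = 1 - (1/t) *\<^sub>R a"
    have x1: "norm x \<le> 1"
    proof -
      have "x = (1/t) *\<^sub>R (of_real t - a)"
        using False unfolding x_def by (simp add: of_real_def algebra_simps)
      then have "norm x = (1/t) * norm (of_real t - a)" using t by simp
      also have "\<dots> \<le> (1/t) * t" using t by (intro mult_left_mono) auto
      finally show ?thesis using False by simp
    qed
    have xs: "star x = x" unfolding x_def by (simp add: star_diff star_scaleR pos_star[OF assms])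
    define s where "s = sqrt t *\<^sub>R sqrt_one_minus x"
    have "star s = s" unfolding s_def by (simp add: star_scaleR sqrt_one_minus_star x1 xs)
    moreover have "s * s = a"
      unfolding s_def using sqrt_one_minus_square[OF x1] t False by (simp add: x_def)
    moreover have "z * s = s * z" if "z * a = a * z" for z
    proof -
      have "z * x = x * z" unfolding x_def using that by (simp add: algebra_simps)
      from sqrt_one_minus_commute[OF x1 this] show ?thesis unfolding s_def by simp
    qed
    ultimately show ?thesis using that by blast
  qed
qed

text \<open>For a contraction s and c = sqrt (1 - s s) the element s + i c is unitary. Its imaginary
  part c is then a contraction, so 1 - s s = c c has norm at most 1, which is the condition in
  \<open>pos\<close> with t = 1.\<close>

lemma pos_square: assumes "star s = s" shows "pos (s * (s::'a::cstar1))"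
proof -
  have *: "norm (1 - s * s) \<le> 1" if s: "star s = s" "norm s \<le> 1" for s :: 'a
  proof -
    define c where "c = sqrt_one_minus (s * s)"
    have ss: "norm (s * s) \<le> 1" using norm_star_mult[of s] s by (simp add: abs_square_le_1)
    have c: "c * c = 1 - s * s" "star c = c" "s * c = c * s"
      unfolding c_def by (auto simp: sqrt_one_minus_square ss star_mult s mult.assoc
          intro!: sqrt_one_minus_star sqrt_one_minus_commute)
    define u where "u = s + cscale \<i> c"
    have us: "star u = s - cscale \<i> c"
      unfolding u_def by (simp add: star_add star_cscale s c cscale_minus_left)
    have "cscale (-1) (1::'a) = -1" using cscale_minus_left[of 1 "1::'a"] by simp
    then have "star u * u = 1"
      unfolding us unfolding u_def using c(1,3) cscale_minus_left[of 1 "c * c"]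
      by (simp add: algebra_simps cscale_mult_left cscale_mult_right cscale_cscale cscale_diff_right)
    then have u1: "norm u = 1" using norm_star_mult[of u]
      by (metis norm_one norm_ge_zero power2_eq_1_iff le_minus_one_simps(3) not_le)
    have "cscale \<i> c = (1/2) *\<^sub>R (u - star u)"
      unfolding us unfolding u_def by (simp add: scaleR_2[symmetric])
    then have "norm (cscale \<i> c) \<le> (1/2) * (norm u + norm (star u))"
      using norm_triangle_ineq4[of u "star u"] by simp
    then have "norm c \<le> 1" using u1 by (simp add: norm_cscale)
    moreover have "norm (c * c) = (norm c)\<^sup>2" using norm_star_mult[of c] c(2) by simp
    ultimately show ?thesis using c(1) by (simp add: abs_square_le_1)
  qed
  show ?thesis
  proof (cases "s = 0")
    case False
    define r where "r = inverse (norm s) *\<^sub>R s"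
    have "norm (1 - r * r) \<le> 1"
      by (rule *) (use False in \<open>simp_all add: r_def star_scaleR assms\<close>)
    then have "pos (r * r)" by (intro posI[where t = 1]) (auto simp: star_mult r_def star_scaleR assms)
    then have "pos ((norm s)\<^sup>2 *\<^sub>R (r * r))" by (intro pos_scaleR) auto
    moreover have "(norm s)\<^sup>2 *\<^sub>R (r * r) = s * s" using False by (simp add: r_def power2_eq_square field_simps)
    ultimately show ?thesis by simp
  qed simp
qed

text \<open>Commuting positive elements have commuting self-adjoint roots s and t, so that the
  product is the square of the self-adjoint element s t.\<close>

lemma pos_mult: assumes "pos a" "pos b" "a * b = b * a" shows "pos (a * b)"
proof -
  obtain s where s: "star s = s" "s * s = a" "\<And>z. z * a = a * z \<Longrightarrow> z * s = s * z"
    using pos_sqrt[OF assms(1)] by blast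
  obtain t where t: "star t = t" "t * t = b" "\<And>z. z * b = b * z \<Longrightarrow> z * t = t * z"
    using pos_sqrt[OF assms(2)] by blast
  have "b * s = s * b" using s(3)[of b] assms(3) by simp
  then have st: "s * t = t * s" using t(3)[of s] by simp
  have "(s * t) * (s * t) = a * b" by (metis mult.assoc s(2) st t(2))
  moreover have "star (s * t) = s * t" by (simp add: star_mult s t st)
  ultimately show ?thesis using pos_square by metis
qed

text \<open>The unitary trick at scale n: with s a root of (n - a)(n + a), the element u = a + i s
  satisfies \<open>star u * u = n * n\<close>, and a is its real part.\<close>

lemma norm_le_of_pos:
  assumes "pos (of_real m - a)" "pos (of_real m + a)" "0 \<le> m"
  shows "norm (a::'a::cstar1) \<le> m"
proof (rule field_le_epsilon)
  fix e :: real assume "0 < e"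
  define n where "n = m + e"
  have n: "0 < n" using \<open>0 < e\<close> assms(3) unfolding n_def by simp
  have p: "pos (of_real n - a)" "pos (of_real n + a)"
    using pos_add[OF assms(1) pos_of_real[of e]] pos_add[OF assms(2) pos_of_real[of e]] \<open>0 < e\<close>
    unfolding n_def by (simp_all add: algebra_simps)
  have as: "star a = a" using pos_star[OF assms(2)] by (simp add: star_add)
  have comm: "(of_real n - a) * (of_real n + a) = (of_real n + a) * (of_real n - a)"
    by (simp add: algebra_simps of_real_def)
  obtain s where s: "star s = s" "s * s = (of_real n - a) * (of_real n + a)"
    "\<And>z. z * ((of_real n - a) * (of_real n + a)) = (of_real n - a) * (of_real n + a) * z \<Longrightarrow> z * s = s * z"
    using pos_sqrt[OF pos_mult[OF p comm]] by blast
  have ss: "s * s = of_real (n * n) - a * a"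
    using s(2) by (simp add: algebra_simps of_real_def)
  have "a * s = s * a"
    by (rule s(3)) (simp add: algebra_simps of_real_def)
  define u where "u = a + cscale \<i> s"
  have us: "star u = a - cscale \<i> s"
    unfolding u_def by (simp add: star_add star_cscale s as cscale_minus_left)
  have "star u * u = a * a + s * s"
    unfolding us unfolding u_def using \<open>a * s = s * a\<close> cscale_minus_left[of 1 "s * s"]
    by (simp add: algebra_simps cscale_mult_left cscale_mult_right cscale_cscale cscale_diff_right)
  then have "star u * u = of_real (n * n)" using ss by simp
  then have "(norm u)\<^sup>2 = n\<^sup>2" using norm_star_mult[of u] n by (simp add: power2_eq_square norm_of_real del: of_real_mult)
  then have un: "norm u = n" using n by (simp add: power2_eq_iff_nonneg)
  have "a = (1/2) *\<^sub>R (u + star u)"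
    unfolding us unfolding u_def by (simp add: scaleR_2[symmetric])
  then have "norm a \<le> (1/2) * (norm u + norm (star u))"
    using norm_triangle_ineq[of u "star u"] by simp
  then show "norm a \<le> m + e" using un n_def by simp
qed

lemma pos_antisym: "pos a \<Longrightarrow> pos (- a) \<Longrightarrow> a = 0"
  using norm_le_of_pos[of 0 a] by simp

lemma pos_norm_minus: "star a = a \<Longrightarrow> norm a \<le> r \<Longrightarrow> pos (of_real r - a)"
  by (rule posI[where t = r]) (simp_all add: star_diff)

lemma pos_norm_plus: "star a = a \<Longrightarrow> norm a \<le> r \<Longrightarrow> pos (of_real r + a)"
  using pos_norm_minus[of "- a" r] by (simp add: star_minus)

lemma pos_of_real_iff: "pos (of_real r :: 'a::cstar1) \<longleftrightarrow> 0 \<le> r"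
proof
  assume "pos (of_real r :: 'a)"
  then obtain t where t: "0 \<le> t" "norm (of_real t - of_real r :: 'a) \<le> t"
    unfolding pos_def by blast
  then have "\<bar>t - r\<bar> \<le> t" by (metis norm_of_real of_real_diff)
  then show "0 \<le> r" by simp
qed simp

subsection \<open>Polynomials\<close>

text \<open>Coefficients act through a central embedding, so that one development serves both the
  real polynomials of the functional calculus (\<open>rp\<close>) and the complex ones of the
  relation (\<open>cp\<close>).\<close>

locale poly_eval =
  fixes emb :: "'c::comm_ring_1 \<Rightarrow> 'a::ring_1"
  assumes emb_add: "emb (c + d) = emb c + emb d"
    and emb_mult: "emb (c * d) = emb c * emb d"
    and emb_one: "emb 1 = 1"
    and emb_central: "emb c * x = x * emb c"
begin

definition pev :: "'c poly \<Rightarrow> 'a \<Rightarrow> 'a" where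
  "pev p x = fold_coeffs (\<lambda>c y. emb c + x * y) p 0"

lemma emb_zero [simp]: "emb 0 = 0"
  using emb_add[of 0 0] by simp

lemma pev_0 [simp]: "pev 0 x = 0"
  by (simp add: pev_def)

lemma pev_pCons: "pev (pCons c p) x = emb c + x * pev p x"
  by (cases "p = 0 \<and> c = 0") (auto simp: pev_def fold_coeffs_pCons_not_0_0_eq fold_coeffs_pCons_coeff_not_0_eq)

lemma pev_add: "pev (p + q) x = pev p x + pev q x"
  by (induction p q rule: poly_induct2) (simp_all add: pev_pCons emb_add algebra_simps)

lemma pev_smult: "pev (Polynomial.smult c p) x = emb c * pev p x"
  by (induction p) (simp_all add: pev_pCons emb_mult algebra_simps, metis emb_central mult.assoc)

lemma pev_minus: "pev (- p) x = - pev p x"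
  using pev_add[of p "- p" x] by (simp add: eq_neg_iff_add_eq_0 add.commute)

lemma pev_diff: "pev (p - q) x = pev p x - pev q x"
  using pev_add[of p "- q" x] by (simp add: pev_minus)

lemma pev_mult: "pev (p * q) x = pev p x * pev q x"
  by (induction p) (simp_all add: pev_pCons pev_add pev_smult algebra_simps)

lemma pev_const [simp]: "pev [:c:] x = emb c"
  by (simp add: pev_pCons)

lemma pev_1 [simp]: "pev 1 x = 1"
  using pev_const[of 1 x] by (simp add: emb_one one_pCons)

lemma pev_linear: "pev [:c, 1:] x = emb c + x"
  by (simp add: pev_pCons emb_one)

lemma pev_power: "pev (p ^ n) x = pev p x ^ n"
  by (induction n) (simp_all add: pev_mult)

lemma pev_sum: "pev (sum f I) x = (\<Sum>i\<in>I. pev (f i) x)"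
  by (induction I rule: infinite_finite_induct) (simp_all add: pev_add)

lemma pev_comm: "z * x = x * z \<Longrightarrow> z * pev p x = pev p x * z"
  by (induction p) (simp_all add: pev_pCons algebra_simps emb_central, metis mult.assoc)

lemma pev_comm2: "pev p x * pev q x = pev q x * pev p x"
  by (metis mult.commute pev_mult)

lemma pev_pcompose: "pev (pcompose p q) x = pev p (pev q x)"
  by (induction p) (simp_all add: pcompose_pCons pev_add pev_mult pev_pCons)

lemma pev_altdef: "pev p x = (\<Sum>i\<le>degree p. emb (coeff p i) * x ^ i)"
proof (induction p)
  case (pCons c p)
  have "(\<Sum>i\<le>degree (pCons c p). emb (coeff (pCons c p) i) * x ^ i)
      = emb c + x * (\<Sum>i\<le>degree p. emb (coeff p i) * x ^ i)"
  proof (cases "p = 0")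
    case False
    then have "degree (pCons c p) = Suc (degree p)" by simp
    then show ?thesis
      by (simp add: sum.atMost_Suc_shift sum_distrib_left mult.assoc[symmetric] emb_central[of _ x] del: sum.atMost_Suc)
  qed simp
  then show ?case using pCons by (simp add: pev_pCons)
qed simp

end

interpretation rp: poly_eval "of_real :: real \<Rightarrow> 'a::real_algebra_1"
  by standard (simp_all add: of_real_def scaleR_add_left)

interpretation cp: poly_eval "\<lambda>c. cscale c (1::'a::cstar1)"
  by standard (simp_all add: cscale_add_left cscale_cscale cscale_mult_left cscale_mult_right mult.commute)

lemma real_poly_eqI: assumes "\<And>t::real. poly p t = poly q t" shows "p = q"
proof -
  have "poly p = poly q" by (rule ext) (rule assms)
  then show ?thesis by (simp only: poly_eq_poly_eq_iff)
qed

lemma rp_X [simp]: "rp.pev [:0, 1:] a = a"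
  by (simp add: rp.pev_pCons)

lemma rp_one_minus_X [simp]: "rp.pev [:1, -1:] a = 1 - a"
  by (simp add: rp.pev_pCons)

lemma rp_star: "star a = a \<Longrightarrow> star (rp.pev p a) = rp.pev p (a::'a::cstar1)"
  by (induction p) (simp_all add: rp.pev_pCons star_add star_mult rp.pev_comm)

subsection \<open>Bernstein polynomials and the norm estimate for polynomials\<close>

definition bern :: "nat \<Rightarrow> nat \<Rightarrow> real poly" where
  "bern n i = Polynomial.smult (of_nat (n choose i)) ([:0, 1:] ^ i * [:1, -1:] ^ (n - i))"

lemma poly_bern: "poly (bern n i) t = Bernstein n i t"
  by (simp add: bern_def Bernstein_def mult.assoc)

lemma sum_bern: "(\<Sum>i\<le>n. bern n i) = 1"
proof -
  have "poly (\<Sum>i\<le>n. bern n i) = poly 1"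
    by (rule ext) (simp add: poly_sum poly_bern)
  then show ?thesis by (simp add: poly_eq_poly_eq_iff)
qed

text \<open>The variance t (1 - t) / n of a binomial mean, as an identity of polynomials, so that it
  can be evaluated at an element of an algebra.\<close>

lemma sum_bern_variance:
  assumes "n > 0"
  shows "(\<Sum>i\<le>n. bern n i * [:- (real i / real n), 1:]\<^sup>2) = Polynomial.smult (1 / real n) ([:0, 1:] * [:1, -1:])"
proof -
  have "poly (\<Sum>i\<le>n. bern n i * [:- (real i / real n), 1:]\<^sup>2) t
      = poly (Polynomial.smult (1 / real n) ([:0, 1:] * [:1, -1:])) t" for t
  proof -
    have "poly (\<Sum>i\<le>n. bern n i * [:- (real i / real n), 1:]\<^sup>2) t
       = (\<Sum>i\<le>n. Bernstein n i t * (t - real i / real n)\<^sup>2)"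
      by (simp add: poly_sum poly_bern power2_eq_square algebra_simps)
    also have "\<dots> = (\<Sum>i\<le>n. t\<^sup>2 * Bernstein n i t + (1 / (real n)\<^sup>2 - 2 * t / real n) * (real i * Bernstein n i t)
        + 1 / (real n)\<^sup>2 * (real i * (real i - 1) * Bernstein n i t))"
      using assms by (intro sum.cong) (auto simp: field_simps power2_eq_square)
    also have "\<dots> = t\<^sup>2 * 1 + (1 / (real n)\<^sup>2 - 2 * t / real n) * (real n * t)
        + 1 / (real n)\<^sup>2 * (real n * (real n - 1) * t\<^sup>2)"
      unfolding sum.distrib sum_distrib_left[symmetric] sum_k_Bernstein sum_kk_Bernstein sum_Bernstein by simp
    also have "\<dots> = poly (Polynomial.smult (1 / real n) ([:0, 1:] * [:1, -1:])) t"
      using assms by (simp add: field_simps power2_eq_square)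
    finally show ?thesis .
  qed
  then show ?thesis by (rule real_poly_eqI)
qed

text \<open>Uniformity in c is the point: K has to be fixed before the number of Bernstein nodes is
  chosen. Horner's recursion carries the difference quotient and its bound along.\<close>

lemma divided_difference:
  assumes "norm (a::'a::cstar1) \<le> 1"
  shows "\<exists>K. \<forall>c. \<bar>c\<bar> \<le> 1 \<longrightarrow> (\<exists>s. p - [:poly p c:] = [:- c, 1:] * s \<and> norm (rp.pev s a) \<le> K)"
proof (induction p)
  case 0
  show ?case by (rule exI[where x = 0]) (auto intro: exI[where x = 0])
next
  case (pCons e q)
  then obtain K where K: "\<And>c. \<bar>c\<bar> \<le> 1 \<Longrightarrow> \<exists>s. q - [:poly q c:] = [:- c, 1:] * s \<and> norm (rp.pev s a) \<le> K"
    by blast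
  have "\<exists>s. pCons e q - [:poly (pCons e q) c:] = [:- c, 1:] * s \<and> norm (rp.pev s a) \<le> norm (rp.pev q a) + K"
    if c: "\<bar>c\<bar> \<le> 1" for c
  proof -
    obtain s where s: "q - [:poly q c:] = [:- c, 1:] * s" "norm (rp.pev s a) \<le> K" using K[OF c] by blast
    have "pCons e q - [:poly (pCons e q) c:] = [:- c, 1:] * q + Polynomial.smult c (q - [:poly q c:])"
      by (rule real_poly_eqI) (simp add: algebra_simps)
    also have "\<dots> = [:- c, 1:] * (q + Polynomial.smult c s)"
      unfolding s(1) by (simp add: ring_distribs)
    finally have 1: "pCons e q - [:poly (pCons e q) c:] = [:- c, 1:] * (q + Polynomial.smult c s)" .
    have "norm (of_real c * rp.pev s a) \<le> 1 * K"
      using c s(2) by (intro order_trans[OF norm_mult_ineq] mult_mono) auto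
    then have "norm (rp.pev (q + Polynomial.smult c s) a) \<le> norm (rp.pev q a) + K"
      using norm_triangle_ineq[of "rp.pev q a" "of_real c * rp.pev s a"] by (simp add: rp.pev_add rp.pev_smult)
    with 1 show ?thesis by blast
  qed
  then show ?case by blast
qed

lemma pos_bern:
  assumes "pos (a::'a::cstar1)" "pos (1 - a)"
  shows "pos (rp.pev (bern n i) a)"
proof -
  have "pos (a ^ i)" for i
    by (induction i) (auto intro!: pos_mult assms simp: power_commutes)
  moreover have "pos ((1 - a) ^ i)" for i
    by (induction i) (auto intro!: pos_mult assms simp: power_commutes)
  moreover have "a ^ i * (1 - a) ^ j = (1 - a) ^ j * a ^ i" for i j
    using rp.pev_comm2[of "[:0, 1:] ^ i" a "[:1, -1:] ^ j"] by (simp add: rp.pev_power)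
  ultimately have "pos (a ^ i * (1 - a) ^ (n - i))" by (intro pos_mult) auto
  then have "pos (real (n choose i) *\<^sub>R (a ^ i * (1 - a) ^ (n - i)))" by (rule pos_scaleR) simp
  then show ?thesis
    by (simp add: bern_def rp.pev_smult rp.pev_mult rp.pev_power scaleR_conv_of_real)
qed

text \<open>Bernstein's approximation argument, carried out inside the algebra. At the node c one
  has p = p(c) + (X - c) s; completing the square trades the cross term for l/2 (X - c)^2 and s^2 /
  (2 l). Against the Bernstein weights the first sums to a variance of order 1/n, and the second is
  controlled by K.\<close>

lemma pos_poly_unit_interval:
  fixes a :: "'a::cstar1"
  assumes "pos a" "pos (1 - a)" and le: "\<And>t. t \<in> {0..1} \<Longrightarrow> poly p t \<le> m" and "0 < e"
  shows "pos (of_real (m + e) - rp.pev p a)"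
proof -
  have as: "star a = a" using assms(1) pos_star by blast
  have a1: "norm a \<le> 1"
    by (rule norm_le_of_pos) (use assms in \<open>auto intro: pos_add\<close>)
  obtain K0 where K0: "\<And>c. \<bar>c\<bar> \<le> 1 \<Longrightarrow> \<exists>s. p - [:poly p c:] = [:- c, 1:] * s \<and> norm (rp.pev s a) \<le> K0"
    using divided_difference[OF a1, of p] by blast
  define K where "K = max 1 K0"
  \<comment> \<open>With this value K^2 / (2 l) equals e / 2, one half of the slack. The choice of n
    bounds the variance term l / (2 n) by the other half.\<close>
  define l where "l = K\<^sup>2 / e"
  have K: "K \<ge> 1" "l > 0" using \<open>0 < e\<close> unfolding K_def l_def by auto
  obtain n :: nat where n: "real n > l / e" using reals_Archimedean2 by blast
  then have n0: "n > 0" using K \<open>0 < e\<close> by (metis divide_pos_pos gr0I less_trans of_nat_0 order_less_irrefl)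
  define c where "c i = real i / real n" for i
  have c: "0 \<le> c i \<and> c i \<le> 1" if "i \<le> n" for i using that n0 unfolding c_def by simp
  have "\<forall>i\<in>{..n}. \<exists>s. p - [:poly p (c i):] = [:- c i, 1:] * s \<and> norm (rp.pev s a) \<le> K"
  proof
    fix i assume "i \<in> {..n}"
    then have "\<bar>c i\<bar> \<le> 1" using c by auto
    from K0[OF this] show "\<exists>s. p - [:poly p (c i):] = [:- c i, 1:] * s \<and> norm (rp.pev s a) \<le> K"
      unfolding K_def by (meson max.coboundedI2 order_refl order_trans)
  qed
  then obtain s where s: "\<And>i. i \<le> n \<Longrightarrow> p - [:poly p (c i):] = [:- c i, 1:] * s i"
    "\<And>i. i \<le> n \<Longrightarrow> norm (rp.pev (s i) a) \<le> K"
    by (auto dest!: bchoice)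
  define b where "b i = rp.pev (bern n i) a" for i
  have b: "pos (b i)" for i unfolding b_def by (rule pos_bern[OF assms(1,2)])
  define sq where "sq i = Polynomial.smult (1/2) ((Polynomial.smult (sqrt l) [:- c i, 1:] - Polynomial.smult (1 / sqrt l) (s i))\<^sup>2)" for i
  have *: "bern n i * ([:m + e:] - p) = bern n i * [:m - poly p (c i):] + bern n i * sq i
     + bern n i * Polynomial.smult (1 / (2 * l)) ([:K\<^sup>2:] - (s i)\<^sup>2) + bern n i * [:e/2:] - Polynomial.smult (l/2) (bern n i * [:- c i, 1:]\<^sup>2)"
    if "i \<le> n" for i
  proof -
    have p: "p = [:poly p (c i):] + [:- c i, 1:] * s i" using s(1)[OF that] by (simp add: algebra_simps)
    have "poly ([:m + e:] - p) t = poly ([:m - poly p (c i):] + sq i + Polynomial.smult (1 / (2 * l)) ([:K\<^sup>2:] - (s i)\<^sup>2)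
      + [:e/2:] - Polynomial.smult (l/2) ([:- c i, 1:]\<^sup>2)) t" for t
    proof -
      define x y where "x = t - c i" and "y = poly (s i) t"
      have "poly p t = poly p (c i) + x * y"
        by (subst p) (simp add: x_def y_def algebra_simps)
      moreover have "poly (sq i) t = (l * x\<^sup>2 - 2 * (x * y) + y\<^sup>2 / l) / 2"
      proof -
        have "poly (sq i) t = (sqrt l * x - y / sqrt l)\<^sup>2 / 2"
          by (simp add: sq_def x_def y_def algebra_simps)
        also have "(sqrt l * x - y / sqrt l)\<^sup>2 = (sqrt l)\<^sup>2 * x\<^sup>2 - 2 * (x * y) + y\<^sup>2 / (sqrt l)\<^sup>2"
          using K(2) by (simp add: power2_diff power_mult_distrib power_divide)
        finally show ?thesis using K(2) by simp
      qed
      moreover have "1 / (2 * l) * K\<^sup>2 = e / 2" using \<open>0 < e\<close> K unfolding l_def by simp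
      ultimately show ?thesis
        using K(2) by (simp add: x_def[symmetric] y_def[symmetric] right_diff_distrib)
    qed
    then have eq: "[:m + e:] - p = [:m - poly p (c i):] + sq i + Polynomial.smult (1 / (2 * l)) ([:K\<^sup>2:] - (s i)\<^sup>2)
      + [:e/2:] - Polynomial.smult (l/2) ([:- c i, 1:]\<^sup>2)" by (rule real_poly_eqI)
    show ?thesis unfolding eq by (simp only: distrib_left right_diff_distrib mult_smult_right)
  qed
  have smult_sum': "(\<Sum>i\<in>I. Polynomial.smult d (f i)) = Polynomial.smult d (sum f I)"
    for d :: real and f :: "nat \<Rightarrow> real poly" and I
    by (induction I rule: infinite_finite_induct) (simp_all add: smult_add_right)
  have "[:m + e:] - p = (\<Sum>i\<le>n. bern n i * ([:m + e:] - p))"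
    by (simp add: sum_bern flip: sum_distrib_right)
  also have "\<dots> = (\<Sum>i\<le>n. bern n i * [:m - poly p (c i):]) + (\<Sum>i\<le>n. bern n i * sq i)
     + (\<Sum>i\<le>n. bern n i * Polynomial.smult (1 / (2 * l)) ([:K\<^sup>2:] - (s i)\<^sup>2)) + (\<Sum>i\<le>n. bern n i * [:e/2:])
     - Polynomial.smult (l/2) (\<Sum>i\<le>n. bern n i * [:- c i, 1:]\<^sup>2)"
    unfolding sum.distrib[symmetric] sum_subtractf[symmetric] smult_sum'[symmetric]
    by (intro sum.cong refl *) simp
  also have "(\<Sum>i\<le>n. bern n i * [:- c i, 1:]\<^sup>2) = Polynomial.smult (1 / real n) ([:0, 1:] * [:1, -1:])"
    unfolding c_def by (rule sum_bern_variance[OF n0])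
  also have "(\<Sum>i\<le>n. bern n i * [:e/2:]) = [:e/2:]"
    by (simp only: sum_bern sum_distrib_right[symmetric] mult_1_left)
  finally have eq: "[:m + e:] - p = (\<Sum>i\<le>n. bern n i * [:m - poly p (c i):]) + (\<Sum>i\<le>n. bern n i * sq i)
     + (\<Sum>i\<le>n. bern n i * Polynomial.smult (1 / (2 * l)) ([:K\<^sup>2:] - (s i)\<^sup>2)) + [:e/2:]
     - Polynomial.smult (l/2) (Polynomial.smult (1 / real n) ([:0, 1:] * [:1, -1:]))" .
  have ps: "pos (rp.pev (bern n i) a * rp.pev q a)" if "pos (rp.pev q a)" for i q
    using b[of i] that unfolding b_def by (intro pos_mult rp.pev_comm2)
  have p1: "pos (\<Sum>i\<le>n. rp.pev (bern n i) a * rp.pev [:m - poly p (c i):] a)"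
  proof (intro pos_sum ps)
    fix i assume "i \<in> {..n}"
    then have "poly p (c i) \<le> m" using le c by auto
    then show "pos (rp.pev [:m - poly p (c i):] a)" by (simp only: rp.pev_const pos_of_real_iff)
  qed
  have p2: "pos (\<Sum>i\<le>n. rp.pev (bern n i) a * rp.pev (sq i) a)"
  proof (intro pos_sum ps)
    fix i
    define z where "z = rp.pev (Polynomial.smult (sqrt l) [:- c i, 1:] - Polynomial.smult (1 / sqrt l) (s i)) a"
    have "rp.pev (sq i) a = (1/2) *\<^sub>R (z * z)"
      unfolding sq_def z_def by (simp only: rp.pev_smult power2_eq_square rp.pev_mult scaleR_conv_of_real)
    moreover have "star z = z" unfolding z_def by (rule rp_star[OF as])
    ultimately show "pos (rp.pev (sq i) a)" using pos_scaleR[OF pos_square, of z "1/2"] by simp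
  qed
  have p3: "pos (\<Sum>i\<le>n. rp.pev (bern n i) a * rp.pev (Polynomial.smult (1 / (2 * l)) ([:K\<^sup>2:] - (s i)\<^sup>2)) a)"
  proof (intro pos_sum ps)
    fix i assume "i \<in> {..n}"
    define z where "z = rp.pev (s i) a"
    have z: "star z = z" "norm z \<le> K" unfolding z_def using s(2) \<open>i \<in> {..n}\<close> rp_star[OF as] by auto
    have "norm (z * z) \<le> K\<^sup>2" using z norm_star_mult[of z] by (simp add: power_mono)
    then have "pos (of_real (K\<^sup>2) - z * z)"
      by (intro pos_norm_minus) (auto simp: star_mult z)
    then have "pos ((1 / (2 * l)) *\<^sub>R (of_real (K\<^sup>2) - z * z))" using K by (intro pos_scaleR) auto
    then show "pos (rp.pev (Polynomial.smult (1 / (2 * l)) ([:K\<^sup>2:] - (s i)\<^sup>2)) a)"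
      by (simp only: z_def rp.pev_smult rp.pev_diff power2_eq_square rp.pev_mult rp.pev_const scaleR_conv_of_real of_real_mult)
  qed
  \<comment> \<open>1 - a (1 - a) = (1 - a) + a a, so the evaluated variance polynomial is at most
    1.\<close>
  have "pos (1 - a * (1 - a))"
    using pos_add[OF assms(2) pos_square[OF as]] by (simp add: algebra_simps)
  then have "pos ((l / (2 * n)) *\<^sub>R (1 - a * (1 - a)))" using K by (intro pos_scaleR) auto
  moreover have "l / (2 * n) \<le> e / 2" using n \<open>0 < e\<close> n0 by (simp add: field_simps)
  then have "pos (of_real (e / 2 - l / (2 * n)) :: 'a)" by (intro pos_of_real) simp
  ultimately have p4: "pos ((l / (2 * n)) *\<^sub>R (1 - a * (1 - a)) + of_real (e / 2 - l / (2 * n)))"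
    by (rule pos_add)
  have "of_real (m + e) - rp.pev p a = rp.pev ([:m + e:] - p) a"
    by (simp only: rp.pev_diff rp.pev_const)
  also have "\<dots> = (\<Sum>i\<le>n. rp.pev (bern n i) a * rp.pev [:m - poly p (c i):] a) + (\<Sum>i\<le>n. rp.pev (bern n i) a * rp.pev (sq i) a)
     + (\<Sum>i\<le>n. rp.pev (bern n i) a * rp.pev (Polynomial.smult (1 / (2 * l)) ([:K\<^sup>2:] - (s i)\<^sup>2)) a)
     + (of_real (e / 2) - of_real (l/2) * (of_real (1 / n) * (rp.pev [:0, 1:] a * rp.pev [:1, -1:] a)))"
    unfolding eq by (simp only: rp.pev_diff rp.pev_add rp.pev_smult rp.pev_mult rp.pev_sum rp.pev_const add_diff_eq)
  also have "of_real (e / 2) - of_real (l/2) * (of_real (1 / n) * (rp.pev [:0, 1:] a * rp.pev [:1, -1:] a))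
     = (l / (2 * n)) *\<^sub>R (1 - a * (1 - a)) + of_real (e / 2 - l / (2 * n))"
    by (simp add: rp.pev_pCons of_real_def algebra_simps)
  finally show ?thesis using pos_add[OF pos_add[OF pos_add[OF p1 p2] p3] p4] by simp
qed

subsection \<open>Continuous functional calculus\<close>

text \<open>The order interval takes the place of the statement that the spectrum of a lies in
  [l, r].\<close>

definition between :: "real \<Rightarrow> real \<Rightarrow> 'a::cstar1 \<Rightarrow> bool" where
  "between l r a \<longleftrightarrow> pos (a - of_real l) \<and> pos (of_real r - a)"

lemma between_star: "between l r a \<Longrightarrow> star a = a"
  unfolding between_def by (metis pos_star star_diff star_of_real diff_add_cancel)

lemma between_norm: "star a = a \<Longrightarrow> norm a \<le> R \<Longrightarrow> between (- R) R a"
  unfolding between_def using pos_norm_plus[of a R] pos_norm_minus[of a R] by (simp add: add.commute)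

lemma norm_le_between: "between (- R) R a \<Longrightarrow> 0 \<le> R \<Longrightarrow> norm a \<le> R"
  unfolding between_def by (intro norm_le_of_pos) (auto simp: add.commute)

lemma pos_imp_between: "pos a \<Longrightarrow> norm a \<le> R \<Longrightarrow> between 0 R a"
  unfolding between_def using pos_star pos_norm_minus by auto

lemma between_Int: "between l r a \<Longrightarrow> between l' r' a \<Longrightarrow> between (max l l') (min r r') a"
  by (auto simp: between_def max_def min_def)

lemma between_mono: assumes "between l r a" "l' \<le> l" "r \<le> r'" shows "between l' r' a"
proof -
  have "pos (a - of_real l + of_real (l - l'))" "pos (of_real r - a + of_real (r' - r))"
    using assms by (auto intro!: pos_add simp: between_def simp del: of_real_diff)
  then show ?thesis by (simp add: between_def algebra_simps)
qed

lemma between_le: assumes "between l r (a::'a::cstar1)" shows "l \<le> r"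
proof -
  have "pos (of_real (r - l) :: 'a)"
    using pos_add[of "a - of_real l" "of_real r - a"] assms by (simp add: between_def)
  then show ?thesis by (simp only: pos_of_real_iff)
qed

lemma rp_of_real: "rp.pev p (of_real l) = of_real (poly p l)"
  by (induction p) (simp_all add: rp.pev_pCons)

text \<open>An affine substitution reduces to the unit interval. The degenerate interval is
  separate, because a is then a scalar by antisymmetry.\<close>

lemma pos_poly:
  fixes a :: "'a::cstar1"
  assumes "between l r a" and le: "\<And>t. t \<in> {l..r} \<Longrightarrow> poly p t \<le> m" and "0 < e"
  shows "pos (of_real (m + e) - rp.pev p a)"
proof (cases "l = r")
  case True
  have "a = of_real l"
    using assms(1) pos_antisym[of "a - of_real l"] by (simp add: between_def True)
  then have "of_real (m + e) - rp.pev p a = of_real (m + e - poly p l)"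
    by (simp add: rp_of_real)
  then show ?thesis using le[of l] True \<open>0 < e\<close> by (simp only: pos_of_real_iff) simp
next
  case False
  then have lr: "l < r" using between_le[OF assms(1)] by simp
  define b where "b = inverse (r - l) *\<^sub>R (a - of_real l)"
  have "pos b" using assms(1) lr unfolding b_def between_def by (intro pos_scaleR) auto
  have a: "a = rp.pev [:l, r - l:] b"
    using lr unfolding b_def by (simp add: rp.pev_pCons of_real_def flip: scaleR_diff_left)
  have "1 - b = inverse (r - l) *\<^sub>R (of_real (r - l) - (a - of_real l))"
    using lr unfolding b_def by (simp add: of_real_def scaleR_diff_right flip: scaleR_diff_left)
  also have "\<dots> = inverse (r - l) *\<^sub>R (of_real r - a)" by simp
  finally have "pos (1 - b)" using assms(1) lr unfolding between_def by (auto intro: pos_scaleR)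
  have "pos (of_real (m + e) - rp.pev (pcompose p [:l, r - l:]) b)"
  proof (rule pos_poly_unit_interval[OF \<open>pos b\<close> \<open>pos (1 - b)\<close> _ \<open>0 < e\<close>])
    fix t :: real assume t: "t \<in> {0..1}"
    have "0 \<le> t * (r - l)" "t * (r - l) \<le> 1 * (r - l)"
      using t lr by (auto intro!: mult_right_mono simp del: mult_1_left)
    then show "poly (p \<circ>\<^sub>p [:l, r - l:]) t \<le> m" by (auto simp: poly_pcompose intro!: le)
  qed
  then show ?thesis unfolding rp.pev_pcompose a[symmetric] .
qed

lemma rp_norm_le:
  assumes "between l r a" and le: "\<And>t. t \<in> {l..r} \<Longrightarrow> \<bar>poly p t\<bar> \<le> m"
  shows "norm (rp.pev p a) \<le> m"
proof (rule field_le_epsilon)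
  fix e :: real assume "0 < e"
  have "0 \<le> m" using le[of l] between_le[OF assms(1)] by force
  moreover have "pos (of_real (m + e) - rp.pev p a)"
    using le by (intro pos_poly[OF assms(1) _ \<open>0 < e\<close>]) (simp add: abs_le_iff)
  moreover have "pos (of_real (m + e) - rp.pev (- p) a)"
    using le by (intro pos_poly[OF assms(1) _ \<open>0 < e\<close>]) (simp add: abs_le_iff)
  ultimately show "norm (rp.pev p a) \<le> m + e"
    using \<open>0 < e\<close> by (intro norm_le_of_pos) (auto simp: rp.pev_minus)
qed

lemma pos_epsilon:
  assumes "star a = a" "\<And>e. 0 < e \<Longrightarrow> pos (of_real e + a)"
  shows "pos (a::'a::cstar1)"
proof (rule posI[where t = "norm a"])
  show "norm (of_real (norm a) - a) \<le> norm a"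
  proof (rule field_le_epsilon)
    fix e :: real assume "0 < e"
    have "of_real (norm a + e) - (of_real (norm a) - a) = of_real e + a"
      "of_real (norm a + e) + (of_real (norm a) - a) = of_real (norm a + e) + (of_real (norm a) - a)" by auto
    moreover have "pos (of_real (norm a + e) + (of_real (norm a) - a))"
      using \<open>0 < e\<close> by (intro pos_add pos_norm_minus pos_of_real assms) auto
    ultimately show "norm (of_real (norm a) - a) \<le> norm a + e"
      using assms(2)[OF \<open>0 < e\<close>] \<open>0 < e\<close> by (intro norm_le_of_pos) auto
  qed
qed (rule assms)

lemma pos_closed:
  assumes "\<And>n. pos (f n)" "f \<longlonglongrightarrow> (a::'a::cstar1)"
  shows "pos a"
proof (rule pos_epsilon)
  have "star (f n) = f n" for n using assms(1) pos_star by blast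
  then have "f \<longlonglongrightarrow> star a" using tendsto_star[OF assms(2)] by simp
  then show as: "star a = a" using LIMSEQ_unique assms(2) by blast
  fix e :: real assume "0 < e"
  then obtain n where n: "norm (f n - a) < e" using assms(2) LIMSEQ_D by blast
  have "of_real e + a = f n + (of_real e - (f n - a))" by simp
  moreover have "pos (of_real e - (f n - a))"
    by (rule pos_norm_minus) (use n as assms(1) pos_star in \<open>auto simp: star_diff\<close>)
  ultimately show "pos (of_real e + a)" using pos_add[OF assms(1)] by metis
qed

lemma weierstrass_real:
  fixes f :: "real \<Rightarrow> real"
  assumes "continuous_on {l..r} f" "0 < e"
  shows "\<exists>p. \<forall>t\<in>{l..r}. \<bar>f t - poly p t\<bar> < e"
proof -
  obtain g where g: "real_polynomial_function g" "\<And>x. x \<in> {l..r} \<Longrightarrow> \<bar>f x - g x\<bar> < e"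
    using Stone_Weierstrass_real_polynomial_function[OF compact_Icc assms] by blast
  obtain c n where "g = (\<lambda>x. \<Sum>i\<le>n. c i * x ^ i)"
    using g(1) real_polynomial_function_iff_sum by blast
  then have "g = poly (\<Sum>i\<le>n. monom (c i) i)" by (simp add: poly_sum poly_monom fun_eq_iff)
  then show ?thesis using g(2) by blast
qed

text \<open>Continuous functional calculus of a self-adjoint element, with arbitrary polynomial
  approximations on [-norm a, norm a]. \<open>fc_lim\<close> shows that the choice is immaterial.
  The functions are defined on all of R, which is why later ones are truncated with
  \<open>max\<close>.\<close>

definition fc :: "(real \<Rightarrow> real) \<Rightarrow> 'a::cstar1 \<Rightarrow> 'a" where
  "fc f a = lim (\<lambda>n. rp.pev (SOME p. \<forall>t\<in>{- norm a..norm a}. \<bar>f t - poly p t\<bar> < inverse (Suc n)) a)"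

lemma fc_lim:
  fixes a :: "'a::cstar1"
  assumes a: "star a = a" and f: "continuous_on UNIV f"
    and p: "\<And>n t. t \<in> {- norm a..norm a} \<Longrightarrow> \<bar>f t - poly (p n) t\<bar> \<le> e n" and e: "e \<longlonglongrightarrow> 0"
  shows "(\<lambda>n. rp.pev (p n) a) \<longlonglongrightarrow> fc f a"
proof -
  define q where "q n = (SOME p. \<forall>t\<in>{- norm a..norm a}. \<bar>f t - poly p t\<bar> < inverse (real (Suc n)))" for n
  have q: "\<bar>f t - poly (q n) t\<bar> < inverse (Suc n)" if "t \<in> {- norm a..norm a}" for n t
  proof -
    have "\<exists>p. \<forall>t\<in>{- norm a..norm a}. \<bar>f t - poly p t\<bar> < inverse (real (Suc n))"
      by (intro weierstrass_real continuous_on_subset[OF f]) auto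
    from someI_ex[OF this] that show ?thesis unfolding q_def by blast
  qed
  note b = between_norm[OF a order_refl]
  have d: "norm (rp.pev (q n) a - rp.pev (q m) a) \<le> inverse (Suc n) + inverse (Suc m)" for n m
    unfolding rp.pev_diff[symmetric]
  proof (rule rp_norm_le[OF b])
    fix t assume "t \<in> {- norm a..norm a}"
    from q[OF this, of n] q[OF this, of m] show "\<bar>poly (q n - q m) t\<bar> \<le> inverse (Suc n) + inverse (Suc m)"
      by simp
  qed
  have "Cauchy (\<lambda>n. rp.pev (q n) a)"
  proof (rule CauchyI)
    fix e :: real assume "0 < e"
    then obtain N where N: "inverse (real (Suc N)) < e / 2" using reals_Archimedean[of "e/2"] by auto
    have "norm (rp.pev (q m) a - rp.pev (q n) a) < e" if "N \<le> m" "N \<le> n" for m n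
    proof -
      have "inverse (real (Suc m)) \<le> inverse (real (Suc N))" "inverse (real (Suc n)) \<le> inverse (real (Suc N))"
        using that by (auto intro!: le_imp_inverse_le)
      then show ?thesis using d[of m n] N by linarith
    qed
    then show "\<exists>M. \<forall>m\<ge>M. \<forall>n\<ge>M. norm (rp.pev (q m) a - rp.pev (q n) a) < e" by blast
  qed
  then have l: "(\<lambda>n. rp.pev (q n) a) \<longlonglongrightarrow> fc f a"
    unfolding fc_def q_def by (simp add: Cauchy_convergent_iff convergent_LIMSEQ_iff)
  have le: "norm (rp.pev (p n) a - rp.pev (q n) a) \<le> e n + inverse (Suc n)" for n
    unfolding rp.pev_diff[symmetric]
  proof (rule rp_norm_le[OF b])
    fix t assume "t \<in> {- norm a..norm a}"
    from q[OF this, of n] p[OF this, of n] show "\<bar>poly (p n - q n) t\<bar> \<le> e n + inverse (Suc n)"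
      by simp
  qed
  have "(\<lambda>n. e n + inverse (real (Suc n))) \<longlonglongrightarrow> 0"
    using tendsto_add[OF e LIMSEQ_inverse_real_of_nat] by simp
  from Lim_null_comparison[OF always_eventually[OF allI[OF le]] this]
  have "(\<lambda>n. rp.pev (p n) a - rp.pev (q n) a) \<longlonglongrightarrow> 0" .
  from tendsto_add[OF this l] show ?thesis by simp
qed

lemma poly_approx_seq:
  assumes "continuous_on UNIV (f::real \<Rightarrow> real)"
  obtains p where "\<And>n t. t \<in> {- R..R} \<Longrightarrow> \<bar>f t - poly (p n) t\<bar> \<le> inverse (Suc n)"
proof -
  have "\<exists>p. \<forall>t\<in>{- R..R}. \<bar>f t - poly p t\<bar> < inverse (Suc n)" for n
    by (intro weierstrass_real continuous_on_subset[OF assms]) auto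
  then obtain p where "\<And>n. \<forall>t\<in>{- R..R}. \<bar>f t - poly (p n) t\<bar> < inverse (Suc n)" by metis
  then show ?thesis using that less_imp_le by metis
qed

lemma fc_lim_seq:
  assumes "star a = a" "continuous_on UNIV f" "norm a \<le> R"
    "\<And>n t. t \<in> {- R..R} \<Longrightarrow> \<bar>f t - poly (p n) t\<bar> \<le> inverse (Suc n)"
  shows "(\<lambda>n. rp.pev (p n) a) \<longlonglongrightarrow> fc f a"
  by (rule fc_lim[OF assms(1,2) _ LIMSEQ_inverse_real_of_nat]) (use assms in auto)

lemma fc_poly: "star a = a \<Longrightarrow> fc (poly p) a = rp.pev p a"
  by (rule LIMSEQ_unique[OF fc_lim[where p = "\<lambda>_. p" and e = "\<lambda>_. 0"] tendsto_const])
    (auto intro!: continuous_intros)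

lemma fc_const: "star a = a \<Longrightarrow> fc (\<lambda>_. c) a = of_real c"
  using fc_poly[of a "[:c:]"] by (simp add: poly_pCons[abs_def])

lemma fc_id: "star a = a \<Longrightarrow> fc (\<lambda>t. t) a = a"
  using fc_poly[of a "[:0, 1:]"] by (simp add: poly_pCons[abs_def])

lemma fc_add:
  assumes a: "star a = a" and f: "continuous_on UNIV f" and g: "continuous_on UNIV g"
  shows "fc (\<lambda>t. f t + g t) a = fc f a + fc g a"
proof -
  obtain p where p: "\<And>n t. t \<in> {- norm a..norm a} \<Longrightarrow> \<bar>f t - poly (p n) t\<bar> \<le> inverse (Suc n)"
    using poly_approx_seq[OF f] by blast
  obtain q where q: "\<And>n t. t \<in> {- norm a..norm a} \<Longrightarrow> \<bar>g t - poly (q n) t\<bar> \<le> inverse (Suc n)"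
    using poly_approx_seq[OF g] by blast
  have "(\<lambda>n. rp.pev (p n + q n) a) \<longlonglongrightarrow> fc (\<lambda>t. f t + g t) a"
  proof (rule fc_lim[OF a])
    fix n t assume "t \<in> {- norm a..norm a}"
    from p[OF this, of n] q[OF this, of n]
    show "\<bar>f t + g t - poly (p n + q n) t\<bar> \<le> inverse (Suc n) + inverse (Suc n)" by (simp add: abs_le_iff)
  next
    show "(\<lambda>n. inverse (real (Suc n)) + inverse (real (Suc n))) \<longlonglongrightarrow> 0"
      using tendsto_add[OF LIMSEQ_inverse_real_of_nat LIMSEQ_inverse_real_of_nat] by simp
  qed (intro continuous_intros f g)
  moreover have "(\<lambda>n. rp.pev (p n + q n) a) \<longlonglongrightarrow> fc f a + fc g a"
    unfolding rp.pev_add by (intro tendsto_add fc_lim_seq[OF a _ order_refl] f g p q) auto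
  ultimately show ?thesis by (rule LIMSEQ_unique)
qed

lemma continuous_bounded_interval:
  assumes "continuous_on UNIV (h::real \<Rightarrow> real)"
  shows "\<exists>M. \<forall>t\<in>{l..r}. \<bar>h t\<bar> \<le> M"
proof -
  have "compact (h ` {l..r})"
    by (intro compact_continuous_image continuous_on_subset[OF assms]) auto
  then show ?thesis by (auto dest!: compact_imp_bounded simp: bounded_iff)
qed

lemma fc_mult:
  assumes a: "star a = a" and f: "continuous_on UNIV f" and g: "continuous_on UNIV g"
  shows "fc (\<lambda>t. f t * g t) a = fc f a * fc g a"
proof -
  obtain p where p: "\<And>n t. t \<in> {- norm a..norm a} \<Longrightarrow> \<bar>f t - poly (p n) t\<bar> \<le> inverse (Suc n)"
    using poly_approx_seq[OF f] by blast
  obtain q where q: "\<And>n t. t \<in> {- norm a..norm a} \<Longrightarrow> \<bar>g t - poly (q n) t\<bar> \<le> inverse (Suc n)"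
    using poly_approx_seq[OF g] by blast
  obtain M where M: "\<And>t. t \<in> {- norm a..norm a} \<Longrightarrow> \<bar>f t\<bar> \<le> M"
    using continuous_bounded_interval[OF f] by blast
  obtain L where L: "\<And>t. t \<in> {- norm a..norm a} \<Longrightarrow> \<bar>g t\<bar> \<le> L"
    using continuous_bounded_interval[OF g] by blast
  have "(\<lambda>n. rp.pev (p n * q n) a) \<longlonglongrightarrow> fc (\<lambda>t. f t * g t) a"
  proof (rule fc_lim[OF a])
    fix n t assume t: "t \<in> {- norm a..norm a}"
    define i where "i = inverse (real (Suc n))"
    have i: "0 \<le> i" "i \<le> 1" unfolding i_def by (auto simp: inverse_le_1_iff)
    have d: "\<bar>f t - poly (p n) t\<bar> \<le> i" "\<bar>g t - poly (q n) t\<bar> \<le> i"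
      using p[OF t] q[OF t] unfolding i_def by auto
    then have ql: "\<bar>poly (q n) t\<bar> \<le> L + 1" using L[OF t] i by linarith
    have "f t * g t - poly (p n * q n) t = f t * (g t - poly (q n) t) + (f t - poly (p n) t) * poly (q n) t"
      by (simp add: algebra_simps)
    also have "\<bar>\<dots>\<bar> \<le> \<bar>f t\<bar> * \<bar>g t - poly (q n) t\<bar> + \<bar>f t - poly (p n) t\<bar> * \<bar>poly (q n) t\<bar>"
      by (metis abs_mult abs_triangle_ineq)
    also have "\<dots> \<le> M * i + i * (L + 1)"
      using M[OF t] d ql i by (intro add_mono mult_mono) auto
    finally show "\<bar>f t * g t - poly (p n * q n) t\<bar> \<le> M * inverse (Suc n) + inverse (Suc n) * (L + 1)"
      unfolding i_def .
  next
    show "(\<lambda>n. M * inverse (real (Suc n)) + inverse (real (Suc n)) * (L + 1)) \<longlonglongrightarrow> 0"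
      using tendsto_add[OF tendsto_mult[OF tendsto_const LIMSEQ_inverse_real_of_nat]
          tendsto_mult[OF LIMSEQ_inverse_real_of_nat tendsto_const], of M "L + 1"] by simp
  qed (intro continuous_intros f g)
  moreover have "(\<lambda>n. rp.pev (p n * q n) a) \<longlonglongrightarrow> fc f a * fc g a"
    unfolding rp.pev_mult by (intro tendsto_mult fc_lim_seq[OF a _ order_refl] f g p q) auto
  ultimately show ?thesis by (rule LIMSEQ_unique)
qed

lemma fc_scale:
  assumes "star a = a" "continuous_on UNIV f"
  shows "fc (\<lambda>t. c * f t) a = c *\<^sub>R fc f a"
  using fc_mult[OF assms(1) continuous_on_const assms(2), of c] by (simp add: fc_const assms scaleR_conv_of_real)

lemma fc_diff:
  assumes "star a = a" "continuous_on UNIV f" "continuous_on UNIV g"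
  shows "fc (\<lambda>t. f t - g t) a = fc f a - fc g a"
proof -
  have "fc (\<lambda>t. f t + (-1) * g t) a = fc f a + fc (\<lambda>t. (-1) * g t) a"
    by (intro fc_add assms continuous_intros)
  also have "fc (\<lambda>t. (-1) * g t) a = (-1) *\<^sub>R fc g a" by (intro fc_scale assms)
  finally show ?thesis by simp
qed

lemma fc_sum:
  assumes "star a = a" "finite I" "\<And>i. i \<in> I \<Longrightarrow> continuous_on UNIV (f i)"
  shows "fc (\<lambda>t. \<Sum>i\<in>I. f i t) a = (\<Sum>i\<in>I. fc (f i) a)"
  using assms(2,3)
proof (induction I rule: finite_induct)
  case empty
  show ?case using fc_const[OF assms(1), of 0] by simp
next
  case (insert i I)
  then show ?case by (simp add: fc_add assms(1) continuous_on_sum)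
qed

lemma fc_comm_op: "star a = a \<Longrightarrow> continuous_on UNIV f \<Longrightarrow> continuous_on UNIV g \<Longrightarrow> fc f a * fc g a = fc g a * fc f a"
  by (simp add: mult.commute flip: fc_mult)

text \<open>Polynomials satisfy the intertwining relation, and limits inherit it. It serves to pass
  between \<open>star z * z\<close> and \<open>z * star z\<close>, and, with b = 1, to evaluate a
  function on a projection on which a acts as the identity.\<close>

lemma fc_intertwine:
  fixes a b :: "'a::cstar1"
  assumes "star a = a" "star b = b" "continuous_on UNIV f" "z * b = a * z"
  shows "z * fc f b = fc f a * z"
proof -
  define R where "R = max (norm a) (norm b)"
  obtain p where p: "\<And>n t. t \<in> {- R..R} \<Longrightarrow> \<bar>f t - poly (p n) t\<bar> \<le> inverse (Suc n)"
    using poly_approx_seq[OF assms(3)] by blast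
  have "z * rp.pev q b = rp.pev q a * z" for q
  proof (induction q)
    case (pCons c q)
    have "z * (b * rp.pev q b) = a * (rp.pev q a * z)"
      by (metis assms(4) mult.assoc pCons.IH)
    then show ?case by (simp add: rp.pev_pCons distrib_left distrib_right rp.emb_central mult.assoc)
  qed simp
  then have "(\<lambda>n. z * rp.pev (p n) b) = (\<lambda>n. rp.pev (p n) a * z)" by simp
  moreover have "(\<lambda>n. z * rp.pev (p n) b) \<longlonglongrightarrow> z * fc f b"
    by (intro tendsto_mult tendsto_const fc_lim_seq[where R = R] assms p) (simp add: R_def)
  moreover have "(\<lambda>n. rp.pev (p n) a * z) \<longlonglongrightarrow> fc f a * z"
    by (intro tendsto_mult tendsto_const fc_lim_seq[where R = R] assms p) (simp add: R_def)
  ultimately show ?thesis using LIMSEQ_unique by metis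
qed

lemma fc_norm_le:
  assumes b: "between l r a" and f: "continuous_on UNIV f" and le: "\<And>t. t \<in> {l..r} \<Longrightarrow> \<bar>f t\<bar> \<le> m"
  shows "norm (fc f a) \<le> m"
proof -
  note a = between_star[OF b]
  obtain p where p: "\<And>n t. t \<in> {- norm a..norm a} \<Longrightarrow> \<bar>f t - poly (p n) t\<bar> \<le> inverse (Suc n)"
    using poly_approx_seq[OF f] by blast
  have "norm (rp.pev (p n) a) \<le> m + inverse (Suc n)" for n
  proof (rule rp_norm_le[OF between_Int[OF b between_norm[OF a order_refl]]])
    fix t assume "t \<in> {max l (- norm a)..min r (norm a)}"
    then show "\<bar>poly (p n) t\<bar> \<le> m + inverse (Suc n)" using p[of t n] le[of t] by auto
  qed
  moreover have "(\<lambda>n. m + inverse (real (Suc n))) \<longlonglongrightarrow> m + 0"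
    by (intro tendsto_add tendsto_const LIMSEQ_inverse_real_of_nat)
  moreover have "(\<lambda>n. norm (rp.pev (p n) a)) \<longlonglongrightarrow> norm (fc f a)"
    by (intro tendsto_norm fc_lim_seq[OF a f order_refl] p)
  ultimately show ?thesis using LIMSEQ_le[of _ "norm (fc f a)" _ m] by auto
qed

text \<open>Only values on an order interval of a matter, so a truncated function such as
  \<open>\<lambda>t. sqrt (max c t)\<close> may stand for the root itself once a is bounded
  below.\<close>

lemma fc_cong:
  assumes "between l r a" "continuous_on UNIV f" "continuous_on UNIV g" "\<And>t. t \<in> {l..r} \<Longrightarrow> f t = g t"
  shows "fc f a = fc g a"
proof -
  have "norm (fc (\<lambda>t. f t - g t) a) \<le> 0"
    by (rule fc_norm_le[OF assms(1)]) (use assms in \<open>auto intro: continuous_intros\<close>)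
  then show ?thesis by (simp add: fc_diff between_star[OF assms(1)] assms)
qed

lemma fc_star: "star a = a \<Longrightarrow> continuous_on UNIV f \<Longrightarrow> star (fc f a) = fc f a"
proof -
  assume a: "star a = a" and f: "continuous_on UNIV f"
  obtain p where p: "\<And>n t. t \<in> {- norm a..norm a} \<Longrightarrow> \<bar>f t - poly (p n) t\<bar> \<le> inverse (Suc n)"
    using poly_approx_seq[OF f] by blast
  have l: "(\<lambda>n. rp.pev (p n) a) \<longlonglongrightarrow> fc f a" by (intro fc_lim_seq[OF a f order_refl] p)
  from tendsto_star[OF this] have "(\<lambda>n. rp.pev (p n) a) \<longlonglongrightarrow> star (fc f a)" by (simp add: rp_star[OF a])
  with l show ?thesis using LIMSEQ_unique by blast
qed

lemma fc_pos:
  assumes b: "between l r a" and f: "continuous_on UNIV f" and le: "\<And>t. t \<in> {l..r} \<Longrightarrow> 0 \<le> f t"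
  shows "pos (fc f a)"
proof -
  note a = between_star[OF b]
  have "fc f a = fc (\<lambda>t. sqrt (max 0 (f t)) * sqrt (max 0 (f t))) a"
    by (rule fc_cong[OF b f]) (use le in \<open>auto intro!: continuous_intros f\<close>)
  also have "\<dots> = fc (\<lambda>t. sqrt (max 0 (f t))) a * fc (\<lambda>t. sqrt (max 0 (f t))) a"
    by (intro fc_mult a continuous_intros f)
  also have "pos \<dots>"
    by (intro pos_square fc_star a continuous_intros f)
  finally show ?thesis .
qed

lemma fc_between:
  assumes b: "between l r a" and f: "continuous_on UNIV f" and le: "\<And>t. t \<in> {l..r} \<Longrightarrow> m \<le> f t \<and> f t \<le> M"
  shows "between m M (fc f a)"
proof -
  note a = between_star[OF b]
  have "pos (fc (\<lambda>t. f t - m) a)" "pos (fc (\<lambda>t. M - f t) a)"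
    using le by (auto intro!: fc_pos[OF b] continuous_intros f)
  then show ?thesis using a f by (simp add: between_def fc_diff fc_const)
qed

lemma rp_fc:
  assumes a: "star a = a" and g: "continuous_on UNIV g"
  shows "rp.pev p (fc g a) = fc (\<lambda>t. poly p (g t)) a"
proof (induction p)
  case 0
  then show ?case using fc_const[OF a, of 0] by simp
next
  case (pCons c p)
  have "fc (\<lambda>t. poly (pCons c p) (g t)) a = fc (\<lambda>t. c + g t * poly p (g t)) a" by simp
  also have "\<dots> = of_real c + fc g a * fc (\<lambda>t. poly p (g t)) a"
    by (simp add: fc_add fc_mult fc_const a g continuous_intros)
  finally show ?case using pCons by (simp add: rp.pev_pCons)
qed

lemma fc_compose:
  assumes a: "star a = a" and f: "continuous_on UNIV f" and g: "continuous_on UNIV g"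
  shows "fc f (fc g a) = fc (\<lambda>t. f (g t)) a"
proof -
  obtain K where K: "\<And>t. t \<in> {- norm a..norm a} \<Longrightarrow> \<bar>g t\<bar> \<le> K"
    using continuous_bounded_interval[OF g] by blast
  have nb: "norm (fc g a) \<le> K" by (rule fc_norm_le[OF between_norm[OF a order_refl] g K])
  obtain p where p: "\<And>n t. t \<in> {- K..K} \<Longrightarrow> \<bar>f t - poly (p n) t\<bar> \<le> inverse (Suc n)"
    using poly_approx_seq[OF f] by blast
  have fg: "continuous_on UNIV (\<lambda>t. f (g t))"
    by (rule continuous_on_compose2[OF f g]) auto
  have "(\<lambda>n. rp.pev (p n) (fc g a)) \<longlonglongrightarrow> fc f (fc g a)"
    by (rule fc_lim_seq[OF fc_star[OF a g] f nb p])
  moreover have "(\<lambda>n. rp.pev (p n) (fc g a)) \<longlonglongrightarrow> fc (\<lambda>t. f (g t)) a"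
  proof -
    have "norm (fc (\<lambda>t. poly (p n) (g t)) a - fc (\<lambda>t. f (g t)) a) \<le> inverse (Suc n)" for n
    proof -
      have "norm (fc (\<lambda>t. poly (p n) (g t) - f (g t)) a) \<le> inverse (Suc n)"
      proof (rule fc_norm_le[OF between_norm[OF a order_refl]])
        fix t assume "t \<in> {- norm a..norm a}"
        from K[OF this] have "g t \<in> {- K..K}" by auto
        from p[OF this] show "\<bar>poly (p n) (g t) - f (g t)\<bar> \<le> inverse (Suc n)" by (metis abs_minus_commute)
      qed (intro continuous_intros g fg)
      then show ?thesis by (simp add: fc_diff a g fg continuous_intros)
    qed
    then have "(\<lambda>n. fc (\<lambda>t. poly (p n) (g t)) a - fc (\<lambda>t. f (g t)) a) \<longlonglongrightarrow> 0"
      by (rule Lim_null_comparison[OF always_eventually[OF allI] LIMSEQ_inverse_real_of_nat])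
    then show ?thesis unfolding rp_fc[OF a g] by (simp add: LIM_zero_iff)
  qed
  ultimately show ?thesis by (rule LIMSEQ_unique)
qed

text \<open>A polynomial is Lipschitz on each bounded set of an algebra, and f is uniformly close to
  a polynomial on [-R, R].\<close>

lemma fc_uniform_continuous:
  assumes f: "continuous_on UNIV f" and "0 < e"
  shows "\<exists>d>0. \<forall>a b::'a::cstar1. star a = a \<and> star b = b \<and> norm a \<le> R \<and> norm b \<le> R \<and> norm (a - b) < d
    \<longrightarrow> norm (fc f a - fc f b) < e"
proof (cases "0 \<le> R")
  case False
  then show ?thesis by (intro exI[where x = 1]) (auto dest: order_trans[OF norm_ge_zero])
next
  case True
  obtain p where p: "\<And>t. t \<in> {- R..R} \<Longrightarrow> \<bar>f t - poly p t\<bar> < e / 3"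
    using weierstrass_real[OF continuous_on_subset[OF f subset_UNIV], of "e/3" "- R" R] \<open>0 < e\<close> by fastforce
  have ap: "norm (fc f a - rp.pev p a) \<le> e / 3" if "star a = a" "norm a \<le> R" for a :: 'a
  proof -
    have "norm (fc (\<lambda>t. f t - poly p t) a) \<le> e / 3"
      by (rule fc_norm_le[OF between_norm[OF that]])
        (use p less_imp_le in \<open>auto intro!: continuous_intros f\<close>)
    then show ?thesis by (simp add: fc_diff fc_poly that f continuous_intros)
  qed
  have "\<exists>K\<ge>0. \<forall>a b::'a. norm a \<le> R \<and> norm b \<le> R \<longrightarrow> norm (rp.pev q a) \<le> K \<and> norm (rp.pev q a - rp.pev q b) \<le> K * norm (a - b)" for q
  proof (induction q)
    case 0
    show ?case by (intro exI[where x = 0]) auto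
  next
    case (pCons c q)
    then obtain K where K0: "K \<ge> 0" "\<forall>a b::'a. norm a \<le> R \<and> norm b \<le> R \<longrightarrow>
        norm (rp.pev q a) \<le> K \<and> norm (rp.pev q a - rp.pev q b) \<le> K * norm (a - b)"
      by (elim exE conjE)
    have Ka: "norm (rp.pev q a) \<le> K" if "norm a \<le> R" for a :: 'a
      using K0(2)[rule_format, OF conjI[OF that that]] by simp
    have Kb: "norm (rp.pev q a - rp.pev q b) \<le> K * norm (a - b)" if "norm a \<le> R" "norm b \<le> R" for a b :: 'a
      using K0(2)[rule_format, OF conjI[OF that]] by simp
    note K = K0(1) Ka Kb
    have "norm (rp.pev (pCons c q) a) \<le> \<bar>c\<bar> + R * K + K" if "norm a \<le> R" for a :: 'a
    proof -
      have "norm (a * rp.pev q a) \<le> R * K"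
        using that K(2)[OF that] True by (intro order_trans[OF norm_mult_ineq] mult_mono) auto
      then show ?thesis using norm_triangle_ineq[of "of_real c" "a * rp.pev q a"] K(1)
        by (simp add: rp.pev_pCons)
    qed
    moreover have "norm (rp.pev (pCons c q) a - rp.pev (pCons c q) b) \<le> (\<bar>c\<bar> + R * K + K) * norm (a - b)"
      if "norm a \<le> R" "norm b \<le> R" for a b :: 'a
    proof -
      have "rp.pev (pCons c q) a - rp.pev (pCons c q) b = a * (rp.pev q a - rp.pev q b) + (a - b) * rp.pev q b"
        by (simp add: rp.pev_pCons algebra_simps)
      also have "norm \<dots> \<le> R * (K * norm (a - b)) + norm (a - b) * K"
        using that K(2)[OF that(2)] K(3)[OF that] True K(1)
        by (intro order_trans[OF norm_triangle_ineq] add_mono order_trans[OF norm_mult_ineq] mult_mono) auto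
      also have "\<dots> \<le> (\<bar>c\<bar> + R * K + K) * norm (a - b)" by (simp add: algebra_simps)
      finally show ?thesis .
    qed
    moreover have "0 \<le> \<bar>c\<bar> + R * K + K" using True K(1) by simp
    ultimately show ?case by blast
  qed
  from this[of p] obtain K where "K \<ge> 0" "\<forall>a b::'a. norm a \<le> R \<and> norm b \<le> R \<longrightarrow>
      norm (rp.pev p a) \<le> K \<and> norm (rp.pev p a - rp.pev p b) \<le> K * norm (a - b)"
    by (elim exE conjE)
  then have K: "K \<ge> 0" "\<And>a b::'a. norm a \<le> R \<Longrightarrow> norm b \<le> R \<Longrightarrow> norm (rp.pev p a - rp.pev p b) \<le> K * norm (a - b)"
    by auto
  have "norm (fc f a - fc f b) < e" if "star a = a" "star b = b" "norm a \<le> R" "norm b \<le> R" "norm (a - b) < e / (3 * (K + 1))" for a b :: 'a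
  proof -
    have "K * norm (a - b) \<le> K * (e / (3 * (K + 1)))" using that K by (intro mult_left_mono) auto
    also have "\<dots> < e / 3" using K(1) \<open>0 < e\<close> by (simp add: field_simps)
    finally have 1: "norm (rp.pev p a - rp.pev p b) < e / 3" using K(2)[OF that(3,4)] by simp
    have "fc f a - fc f b = (fc f a - rp.pev p a) + (rp.pev p a - rp.pev p b) - (fc f b - rp.pev p b)" by simp
    then have "norm (fc f a - fc f b) \<le> norm (fc f a - rp.pev p a) + norm (rp.pev p a - rp.pev p b) + norm (fc f b - rp.pev p b)"
      by (metis (no_types) norm_triangle_ineq4 norm_triangle_ineq add_right_mono order_trans)
    then show ?thesis using ap[OF that(1,3)] ap[OF that(2,4)] 1 by simp
  qed
  moreover have "0 < e / (3 * (K + 1))" using K(1) \<open>0 < e\<close> by simp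
  ultimately show ?thesis by blast
qed

text \<open>One d serves all a and z of bounded norm, as required for a whole sequence of
  quasicentral units. Polynomials satisfy a commutator estimate linear in the commutator with a, and
  f is approximated by one of them.\<close>

lemma fc_almost_commute:
  assumes f: "continuous_on UNIV f" and "0 < e"
  shows "\<exists>d>0. \<forall>a z::'a::cstar1. star a = a \<and> norm a \<le> R \<and> norm z \<le> M \<and> norm (z * a - a * z) < d
    \<longrightarrow> norm (z * fc f a - fc f a * z) < e"
proof (cases "0 \<le> R \<and> 0 \<le> M")
  case False
  then show ?thesis by (intro exI[where x = 1]) (auto dest: order_trans[OF norm_ge_zero])
next
  case True
  define e' where "e' = e / (4 * (M + 1))"
  have e': "0 < e'" "2 * (M * e') \<le> e / 2" using True \<open>0 < e\<close> unfolding e'_def by (auto simp: field_simps)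
  obtain p where p: "\<And>t. t \<in> {- R..R} \<Longrightarrow> \<bar>f t - poly p t\<bar> < e'"
    using weierstrass_real[OF continuous_on_subset[OF f subset_UNIV], of e' "- R" R] e' by fastforce
  have ap: "norm (fc f a - rp.pev p a) \<le> e'" if "star a = a" "norm a \<le> R" for a :: 'a
  proof -
    have "norm (fc (\<lambda>t. f t - poly p t) a) \<le> e'"
      by (rule fc_norm_le[OF between_norm[OF that]])
        (use p less_imp_le in \<open>auto intro!: continuous_intros f\<close>)
    then show ?thesis by (simp add: fc_diff fc_poly that f continuous_intros)
  qed
  have "\<exists>K\<ge>0. \<forall>a z::'a. norm a \<le> R \<longrightarrow> norm (rp.pev q a) \<le> K \<and> norm (z * rp.pev q a - rp.pev q a * z) \<le> K * norm (z * a - a * z)" for q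
  proof (induction q)
    case 0
    show ?case by (intro exI[where x = 0]) auto
  next
    case (pCons c q)
    then obtain K where K0: "K \<ge> 0" "\<forall>a z::'a. norm a \<le> R \<longrightarrow>
        norm (rp.pev q a) \<le> K \<and> norm (z * rp.pev q a - rp.pev q a * z) \<le> K * norm (z * a - a * z)"
      by (elim exE conjE)
    have K: "K \<ge> 0" "\<And>a::'a. norm a \<le> R \<Longrightarrow> norm (rp.pev q a) \<le> K"
      "\<And>a z::'a. norm a \<le> R \<Longrightarrow> norm (z * rp.pev q a - rp.pev q a * z) \<le> K * norm (z * a - a * z)"
      using K0(1) K0(2)[rule_format] by auto
    have "norm (rp.pev (pCons c q) a) \<le> \<bar>c\<bar> + R * K + K" if "norm a \<le> R" for a :: 'a
    proof -
      have "norm (a * rp.pev q a) \<le> R * K"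
        using that K(2)[OF that] True by (intro order_trans[OF norm_mult_ineq] mult_mono) auto
      then show ?thesis using norm_triangle_ineq[of "of_real c" "a * rp.pev q a"] K(1)
        by (simp add: rp.pev_pCons)
    qed
    moreover have "norm (z * rp.pev (pCons c q) a - rp.pev (pCons c q) a * z) \<le> (\<bar>c\<bar> + R * K + K) * norm (z * a - a * z)"
      if "norm a \<le> R" for a z :: 'a
    proof -
      have "z * rp.pev (pCons c q) a - rp.pev (pCons c q) a * z = a * (z * rp.pev q a - rp.pev q a * z) + (z * a - a * z) * rp.pev q a"
        by (simp add: rp.pev_pCons algebra_simps rp.emb_central)
      also have "norm \<dots> \<le> R * (K * norm (z * a - a * z)) + norm (z * a - a * z) * K"
        using that K(2)[OF that] K(3)[OF that] True K(1)
        by (intro order_trans[OF norm_triangle_ineq] add_mono order_trans[OF norm_mult_ineq] mult_mono) auto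
      also have "\<dots> \<le> (\<bar>c\<bar> + R * K + K) * norm (z * a - a * z)" by (simp add: algebra_simps)
      finally show ?thesis .
    qed
    moreover have "0 \<le> \<bar>c\<bar> + R * K + K" using True K(1) by simp
    ultimately show ?case by blast
  qed
  from this[of p] obtain K where "K \<ge> 0" "\<forall>a z::'a. norm a \<le> R \<longrightarrow>
      norm (rp.pev p a) \<le> K \<and> norm (z * rp.pev p a - rp.pev p a * z) \<le> K * norm (z * a - a * z)"
    by (elim exE conjE)
  then have K: "K \<ge> 0" "\<And>a z::'a. norm a \<le> R \<Longrightarrow> norm (z * rp.pev p a - rp.pev p a * z) \<le> K * norm (z * a - a * z)"
    by auto
  have "norm (z * fc f a - fc f a * z) < e" if "star a = a" "norm a \<le> R" "norm z \<le> M" "norm (z * a - a * z) < e / (2 * (K + 1))" for a z :: 'a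
  proof -
    define r where "r = fc f a - rp.pev p a"
    have "K * norm (z * a - a * z) \<le> K * (e / (2 * (K + 1)))" using that K by (intro mult_left_mono) auto
    also have "\<dots> < e / 2" using K(1) \<open>0 < e\<close> by (simp add: field_simps)
    finally have 1: "norm (z * rp.pev p a - rp.pev p a * z) < e / 2" using K(2)[OF that(2)] by (rule le_less_trans[rotated])
    have r: "norm r \<le> e'" unfolding r_def by (rule ap[OF that(1,2)])
    have zr: "norm (z * r) \<le> M * e'" "norm (r * z) \<le> e' * M"
      using that r e' True by (intro order_trans[OF norm_mult_ineq] mult_mono; simp)+
    have "z * fc f a - fc f a * z = (z * rp.pev p a - rp.pev p a * z) + (z * r - r * z)"
      unfolding r_def by (simp add: algebra_simps)
    also have "norm \<dots> \<le> norm (z * rp.pev p a - rp.pev p a * z) + (norm (z * r) + norm (r * z))"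
      by (meson norm_triangle_ineq norm_triangle_ineq4 add_left_mono order_trans)
    also have "\<dots> < e" using 1 zr e' by (simp add: mult.commute)
    finally show ?thesis .
  qed
  moreover have "0 < e / (2 * (K + 1))" using K(1) \<open>0 < e\<close> by simp
  ultimately show ?thesis by blast
qed

subsection \<open>Positivity of \<open>x* x\<close>\<close>

text \<open>Let n be the negative part of c = \<open>star x * x\<close> and z = x n. Then
  \<open>star z * z\<close> is - n n n, hence negative, while \<open>z * star z + star z * z\<close>
  is a sum of squares of self-adjoint elements, so \<open>z * star z\<close> is positive.
  Intertwining the positive parts of the two products by z forces z to vanish, and with it
  n.\<close>

lemma pos_star_mult: "pos (star x * (x::'a::cstar1))"
proof -
  define c where "c = star x * x"
  have cs: "star c = c" unfolding c_def by (simp add: star_mult)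
  define h :: "real \<Rightarrow> real" where "h t = max 0 (- t)" for t
  have h: "continuous_on UNIV h" unfolding h_def by (intro continuous_intros)
  define n where "n = fc h c"
  have ns: "star n = n" unfolding n_def by (intro fc_star cs h)
  define z where "z = x * n"
  have zz: "star z * z = n * c * n" unfolding z_def c_def by (simp add: star_mult ns mult.assoc)
  have hh: "fc (\<lambda>t. h t * h t * h t) c = n * n * n"
    unfolding n_def by (simp add: fc_mult cs h continuous_on_mult)
  have "n * c * n = fc (\<lambda>t. h t * t * h t) c"
    unfolding n_def by (simp add: fc_mult fc_id cs h continuous_on_mult)
  also have "(\<lambda>t. h t * t * h t) = (\<lambda>t. - 1 * (h t * h t * h t))"
    by (auto simp: h_def fun_eq_iff max_def)
  also have "fc \<dots> c = (- 1) *\<^sub>R (n * n * n)"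
    unfolding hh[symmetric] by (intro fc_scale cs h continuous_on_mult)
  finally have zz2: "star z * z = - (n * n * n)"
    unfolding zz by simp
  have p1: "pos (- (star z * z))"
  proof -
    have "pos (fc (\<lambda>t. h t * h t * h t) c)"
      by (rule fc_pos[OF between_norm[OF cs order_refl]]) (auto intro!: continuous_intros h simp: h_def)
    then show ?thesis unfolding zz2 hh by simp
  qed
  have p2: "pos (z * star z + star z * z)"
  proof -
    define u v where "u = z + star z" and "v = cscale \<i> (z - star z)"
    have "star u = u" "star v = v"
      unfolding u_def v_def by (simp_all add: star_add star_cscale star_diff cscale_minus_left cscale_diff_right)
    then have "pos ((1/2) *\<^sub>R (u * u + v * v))" by (intro pos_scaleR pos_add pos_square) auto
    moreover have "v * v = - ((z - star z) * (z - star z))"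
      unfolding v_def by (simp add: cscale_mult_left cscale_mult_right cscale_cscale cscale_minus_left)
    then have "u * u + v * v = 2 *\<^sub>R (z * star z + star z * z)"
      unfolding u_def by (simp add: algebra_simps scaleR_2)
    ultimately show ?thesis by simp
  qed
  have p3: "pos (z * star z)" using pos_add[OF p2 p1] by simp
  define g :: "real \<Rightarrow> real" where "g t = max 0 t" for t
  have g: "continuous_on UNIV g" unfolding g_def by (intro continuous_intros)
  have zs: "star (star z * z) = star z * z" "star (z * star z) = z * star z" by (simp_all add: star_mult)
  \<comment> \<open>This replaces the comparison of the spectra of the two products: the left side
    is 0 because \<open>star z * z\<close> is negative, and the right side is
    \<open>z * star z * z\<close>.\<close>
  have "z * fc g (star z * z) = fc g (z * star z) * z"
    by (rule fc_intertwine[OF zs(2) zs(1) g]) (simp add: mult.assoc)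
  moreover have "fc g (star z * z) = fc (\<lambda>_. 0) (star z * z)"
  proof (rule fc_cong[where l = "- norm (star z * z)" and r = 0])
    show "between (- norm (star z * z)) 0 (star z * z)"
      using p1 between_norm[OF zs(1) order_refl] by (simp add: between_def)
  qed (auto simp: g_def intro!: g[unfolded g_def])
  moreover have "fc g (z * star z) = fc (\<lambda>t. t) (z * star z)"
    by (rule fc_cong[OF pos_imp_between[OF p3 order_refl] g]) (auto simp: g_def)
  ultimately have "z * star z * z = 0" by (simp add: fc_const fc_id zs)
  then have "star (star z * z) * (star z * z) = 0" by (simp add: zs mult.assoc)
  then have "star z * z = 0" by (rule star_mult_self_eq_0)
  then have "n * n * n = 0" using zz2 by simp
  then have "star (n * n) * (n * n) = 0" by (simp add: star_mult ns mult.assoc)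
  then have "star n * n = 0" using star_mult_self_eq_0 ns by metis
  then have n0: "n = 0" by (rule star_mult_self_eq_0)
  have "c = fc (\<lambda>t. g t - h t) c"
    using fc_id[OF cs] by (simp add: g_def h_def max_def if_distrib cong: if_cong)
  also have "\<dots> = fc g c - n" unfolding n_def by (intro fc_diff cs g h)
  also have "pos (fc g c - n)"
    unfolding n0 using fc_pos[OF between_norm[OF cs order_refl] g] by (simp add: g_def)
  finally show ?thesis unfolding c_def .
qed

lemma pos_conj: assumes "pos b" shows "pos (star x * b * x)"
proof -
  obtain s where "star s = s" "s * s = b" using pos_sqrt[OF assms] by blast
  then have "star x * b * x = star (s * x) * (s * x)" by (auto simp: star_mult mult.assoc)
  then show ?thesis using pos_star_mult by metis
qed

lemma pos_norm_mono: assumes "pos a" "pos (b - a)" shows "norm a \<le> norm b"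
proof (rule norm_le_of_pos)
  have "star b = b" using pos_add[OF assms] pos_star by simp
  then have "pos (of_real (norm b) - b)" by (rule pos_norm_minus) simp
  from pos_add[OF this assms(2)] show "pos (of_real (norm b) - a)" by simp
  show "pos (of_real (norm b) + a)" by (intro pos_add assms) simp
qed simp

lemma norm_sq_le: assumes "pos (of_real (m\<^sup>2) - star x * x)" "0 \<le> m" shows "norm x \<le> m"
proof -
  have "norm (star x * x) \<le> norm (of_real (m\<^sup>2) :: 'a)"
    using pos_norm_mono[OF pos_star_mult assms(1)] .
  then have "(norm x)\<^sup>2 \<le> m\<^sup>2" by (simp only: norm_star_mult norm_of_real) simp
  then show ?thesis using assms(2) power2_le_imp_le by blast
qed

subsection \<open>Unital *-homomorphisms\<close>

text \<open>Surjectivity is not part of the locale: every lifting statement starts from an element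
  \<open>\<rho> X\<close> of the range and only replaces X by another preimage.\<close>

locale star_homo =
  fixes \<rho> :: "'a::cstar1 \<Rightarrow> 'b::cstar1"
  assumes hom_add: "\<rho> (x + y) = \<rho> x + \<rho> y"
    and hom_mult: "\<rho> (x * y) = \<rho> x * \<rho> y"
    and hom_cscale: "\<rho> (cscale c x) = cscale c (\<rho> x)"
    and hom_star: "\<rho> (star x) = star (\<rho> x)"
    and hom_one: "\<rho> 1 = 1"
begin

lemma hom_scaleR: "\<rho> (r *\<^sub>R x) = r *\<^sub>R \<rho> x"
  using hom_cscale[of "of_real r" x] by (simp add: cscale_of_real)

lemma hom_zero [simp]: "\<rho> 0 = 0" using hom_add[of 0 0] by simp

lemma hom_minus: "\<rho> (- x) = - \<rho> x"
  using hom_add[of x "- x"] by (simp add: eq_neg_iff_add_eq_0 add.commute)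

lemma hom_diff: "\<rho> (x - y) = \<rho> x - \<rho> y"
  using hom_add[of x "- y"] by (simp add: hom_minus)

lemma hom_of_real [simp]: "\<rho> (of_real r) = of_real r"
  by (simp add: of_real_def hom_scaleR hom_one)

lemma hom_sum: "\<rho> (sum f I) = (\<Sum>i\<in>I. \<rho> (f i))"
  by (induction I rule: infinite_finite_induct) (simp_all add: hom_add)

lemma hom_power: "\<rho> (x ^ n) = \<rho> x ^ n"
  by (induction n) (simp_all add: hom_mult hom_one)

text \<open>The image of (norm x)^2 - \<open>star x * x\<close> is the square of a self-adjoint
  element, because the difference has a square root that \<open>\<rho>\<close> maps along;
  positivity thus passes to the image.\<close>

lemma hom_norm_le: "norm (\<rho> x) \<le> norm x"
proof (rule norm_sq_le)
  have "pos (of_real ((norm x)\<^sup>2) - star x * x)"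
    by (rule pos_norm_minus) (simp_all add: star_mult norm_star_mult)
  then obtain s where s: "star s = s" "s * s = of_real ((norm x)\<^sup>2) - star x * x" by (rule pos_sqrt)
  have "of_real ((norm x)\<^sup>2) - star (\<rho> x) * \<rho> x = \<rho> (of_real ((norm x)\<^sup>2) - star x * x)"
    by (simp only: hom_diff hom_of_real hom_mult hom_star)
  also have "\<dots> = \<rho> s * \<rho> s" by (simp only: s(2)[symmetric] hom_mult)
  finally show "pos (of_real ((norm x)\<^sup>2) - star (\<rho> x) * \<rho> x)"
    using pos_square[of "\<rho> s"] s(1) by (simp flip: hom_star)
qed simp

lemma hom_bounded_linear: "bounded_linear \<rho>"
  by (rule bounded_linear_intro[where K = 1]) (simp_all add: hom_add hom_scaleR hom_norm_le)

lemmas hom_tendsto = bounded_linear.tendsto[OF hom_bounded_linear]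

lemma hom_fc:
  assumes "star a = a" "continuous_on UNIV f"
  shows "\<rho> (fc f a) = fc f (\<rho> a)"
proof -
  obtain p where p: "\<And>n t. t \<in> {- norm a..norm a} \<Longrightarrow> \<bar>f t - poly (p n) t\<bar> \<le> inverse (Suc n)"
    using poly_approx_seq[OF assms(2)] by blast
  have "\<rho> (rp.pev q a) = rp.pev q (\<rho> a)" for q
    by (induction q) (simp_all add: rp.pev_pCons hom_add hom_mult)
  moreover have "(\<lambda>n. \<rho> (rp.pev (p n) a)) \<longlonglongrightarrow> \<rho> (fc f a)"
    by (intro hom_tendsto fc_lim_seq[OF assms order_refl] p)
  moreover have "(\<lambda>n. rp.pev (p n) (\<rho> a)) \<longlonglongrightarrow> fc f (\<rho> a)"
    by (rule fc_lim_seq[OF _ assms(2) hom_norm_le p]) (simp_all add: assms(1) flip: hom_star)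
  ultimately show ?thesis using LIMSEQ_unique by simp
qed

end

lemma fc_of_real: "continuous_on UNIV f \<Longrightarrow> fc f (of_real c :: 'a::cstar1) = of_real (f c)"
proof -
  assume f: "continuous_on UNIV f"
  have "fc f (of_real c :: 'a) = fc (\<lambda>_. f c) (of_real c)"
    by (rule fc_cong[where l = c and r = c]) (auto simp: between_def f)
  also have "\<dots> = of_real (f c)" by (rule fc_const) simp
  finally show ?thesis .
qed

lemma pos_diff_fc:
  assumes "between l r a" "continuous_on UNIV f" "continuous_on UNIV g" "\<And>t. t \<in> {l..r} \<Longrightarrow> f t \<le> g t"
  shows "pos (fc g a - fc f a)"
proof -
  have "pos (fc (\<lambda>t. g t - f t) a)"
    by (rule fc_pos[OF assms(1)]) (use assms in \<open>auto intro: continuous_intros\<close>)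
  then show ?thesis by (simp add: fc_diff between_star[OF assms(1)] assms)
qed

subsection \<open>Quasicentral approximate units\<close>

context star_homo
begin

text \<open>Multiply a by f (star a * a), where f is 1 on [0, m^2] and m / sqrt t beyond. The factor
  caps the norm at m and maps to 1, since in the image the argument already lies in
  [0, m^2].\<close>

lemma norm_lift:
  assumes "norm (\<rho> a) \<le> m" "0 < m"
  shows "\<exists>b. \<rho> b = \<rho> a \<and> norm b \<le> m"
proof -
  define f :: "real \<Rightarrow> real" where "f t = m / sqrt (max t (m\<^sup>2))" for t
  have sp: "0 < sqrt (max t (m\<^sup>2))" for t using assms(2) by (simp add: less_max_iff_disj)
  have f: "continuous_on UNIV f" unfolding f_def using sp by (intro continuous_intros) (metis less_irrefl)
  have f1: "f t = 1" if "t \<le> m\<^sup>2" for t using that assms(2) by (simp add: f_def max_def)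
  define h where "h = star a * a"
  have h: "pos h" "star h = h" unfolding h_def by (simp_all add: pos_star_mult star_mult)
  define b where "b = a * fc f h"
  have "star b * b = fc f h * h * fc f h"
    unfolding b_def h_def[symmetric] using h by (simp add: star_mult fc_star f h_def mult.assoc)
  also have "\<dots> = fc (\<lambda>t. f t * t * f t) h"
    using h f by (simp add: fc_mult fc_id continuous_on_mult)
  also have "norm \<dots> \<le> m\<^sup>2"
  proof (rule fc_norm_le[OF pos_imp_between[OF h(1) order_refl]])
    fix t assume "t \<in> {0..norm h}"
    then have t: "0 \<le> t" by simp
    have "f t * t * f t \<le> m\<^sup>2"
    proof (cases "t \<le> m\<^sup>2")
      case False
      then have "f t * t * f t = m\<^sup>2 * (t / (sqrt t * sqrt t))" by (simp add: f_def max_def power2_eq_square)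
      also have "\<dots> \<le> m\<^sup>2" using t by (simp add: mult_left_le)
      finally show ?thesis .
    qed (simp add: f1)
    moreover have "0 \<le> f t * t * f t" using t assms(2) sp[of t] unfolding f_def by simp
    ultimately show "\<bar>f t * t * f t\<bar> \<le> m\<^sup>2" by simp
  qed (intro continuous_intros f)
  finally have "norm b \<le> m" using assms(2) by (simp add: norm_star_mult)
  moreover have "\<rho> b = \<rho> a"
  proof -
    have rh: "\<rho> h = star (\<rho> a) * \<rho> a" unfolding h_def by (simp add: hom_mult hom_star)
    have "norm (\<rho> h) \<le> m\<^sup>2" unfolding rh norm_star_mult using assms by (simp add: power_mono)
    then have "between 0 (m\<^sup>2) (\<rho> h)" unfolding rh by (intro pos_imp_between pos_star_mult)
    then have "fc f (\<rho> h) = fc (\<lambda>_. 1) (\<rho> h)" by (rule fc_cong) (auto simp: f1 intro: f)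
    also have "\<dots> = 1" by (subst fc_const) (simp_all add: rh star_mult)
    finally show ?thesis unfolding b_def by (simp add: hom_mult hom_fc h f)
  qed
  ultimately show ?thesis by blast
qed

text \<open>u = h / (h + d) with h the sum of all \<open>b * star b\<close>. Each
  \<open>b * star b\<close> lies below h, so the squared norm of (1 - u) b is at most the supremum
  of t d^2 / (t + d)^2, which does not exceed d.\<close>

lemma approximate_unit:
  assumes "finite B" "\<And>b. b \<in> B \<Longrightarrow> \<rho> b = 0" "0 < e"
  shows "\<exists>u. \<rho> u = 0 \<and> between 0 1 u \<and> (\<forall>b\<in>B. norm (b - u * b) < e)"
proof -
  \<comment> \<open>The estimate bounds the squared norm by d; half of e leaves room for the strict
    inequality.\<close>
  define d where "d = (e/2)\<^sup>2"
  have d: "0 < d" using assms unfolding d_def by simp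
  define f :: "real \<Rightarrow> real" where "f t = max 0 t / (max 0 t + d)" for t
  have nz: "max 0 t + d \<noteq> 0" for t using d by (simp add: add_nonneg_pos less_imp_neq[symmetric] max_def)
  have f: "continuous_on UNIV f" unfolding f_def using nz by (intro continuous_intros) auto
  define h where "h = (\<Sum>b\<in>B. b * star b)"
  have bb: "pos (b * star b)" for b :: 'a using pos_star_mult[of "star b"] by simp
  have h: "pos h" unfolding h_def by (intro pos_sum bb)
  then have hs: "star h = h" by (rule pos_star)
  note hb = pos_imp_between[OF h order_refl]
  define u where "u = fc f h"
  have us: "star u = u" unfolding u_def by (intro fc_star hs f)
  have "\<rho> u = 0"
  proof -
    have "\<rho> h = 0" unfolding h_def using assms(2) by (simp add: hom_sum hom_mult)
    then show ?thesis unfolding u_def using fc_of_real[OF f, of 0] by (simp add: hom_fc hs f) (simp add: f_def)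
  qed
  moreover have "between 0 1 u"
    unfolding u_def by (rule fc_between[OF hb f]) (use d in \<open>auto simp: f_def\<close>)
  moreover have "norm (b - u * b) < e" if "b \<in> B" for b
  proof -
    have v: "1 - u = fc (\<lambda>t. 1 - f t) h" unfolding u_def using hs f by (simp add: fc_diff fc_const)
    define x where "x = star b * (1 - u)"
    have "star x * x = (1 - u) * (b * star b) * (1 - u)"
      unfolding x_def by (simp add: star_mult star_diff us mult.assoc)
    moreover have "pos ((1 - u) * h * (1 - u) - (1 - u) * (b * star b) * (1 - u))"
    proof -
      have "h - b * star b = (\<Sum>c\<in>B - {b}. c * star c)"
        unfolding h_def using assms(1) that by (simp add: sum_diff1)
      then have "pos (h - b * star b)" by (simp add: pos_sum bb)
      from pos_conj[OF this, of "1 - u"] show ?thesis by (simp add: star_diff us algebra_simps)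
    qed
    ultimately have "norm (star x * x) \<le> norm ((1 - u) * h * (1 - u))"
      using pos_norm_mono[OF pos_star_mult] by metis
    also have "(1 - u) * h * (1 - u) = fc (\<lambda>t. (1 - f t) * t * (1 - f t)) h"
      unfolding v using hs f by (simp add: fc_mult fc_id continuous_on_mult continuous_on_diff)
    also have "norm \<dots> \<le> d"
    proof (rule fc_norm_le[OF hb])
      fix t assume "t \<in> {0..norm h}"
      then have t: "0 \<le> t" by simp
      have "1 - f t = d / (t + d)" using t d by (simp add: f_def field_simps)
      then have "(1 - f t) * t * (1 - f t) = d * (t * d / ((t + d) * (t + d)))" by simp
      also have "\<dots> \<le> d * 1"
      proof (intro mult_left_mono)
        have "t * d \<le> (t + d) * (t + d)" using t d by (simp add: algebra_simps)
        moreover have "0 < (t + d) * (t + d)" using t d by (intro mult_pos_pos) auto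
        ultimately show "t * d / ((t + d) * (t + d)) \<le> 1" by (subst divide_le_eq_1_pos)
      qed (use d in simp)
      finally have "(1 - f t) * t * (1 - f t) \<le> d" by simp
      moreover have "0 \<le> (1 - f t) * t * (1 - f t)" using t by (simp add: mult.commute[of _ t] mult.assoc)
      ultimately show "\<bar>(1 - f t) * t * (1 - f t)\<bar> \<le> d" by simp
    qed (intro continuous_intros f)
    finally have "(norm x)\<^sup>2 \<le> (e/2)\<^sup>2" unfolding d_def by (simp add: norm_star_mult)
    then have "norm x \<le> e / 2" using assms(3) power2_le_imp_le by force
    moreover have "star x = b - u * b" unfolding x_def by (simp add: star_mult star_diff us algebra_simps)
    ultimately show ?thesis using assms(3) norm_star[of x] by simp
  qed
  ultimately show ?thesis by blast
qed

text \<open>Commutators with earlier units lie in the kernel. If the next unit w nearly fixes T and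
  \<open>star a * T\<close> for such a commutator T, then \<open>star T * w * a\<close> and
  \<open>star T * a * w\<close> are both close to \<open>star T * a\<close>, so
  \<open>star T\<close> almost annihilates the commutator of w with a.\<close>

lemma almost_orthogonal_units:
  assumes "finite B" "\<And>b. b \<in> B \<Longrightarrow> \<rho> b = 0" "finite F" "0 < e"
  shows "\<exists>v. \<forall>j<(N::nat). \<rho> (v j) = 0 \<and> between 0 1 (v j) \<and> (\<forall>b\<in>B. norm (b - v j * b) < e) \<and>
    (\<forall>i<j. \<forall>a\<in>F. norm (star (v i * a - a * v i) * (v j * a - a * v j)) < e)"
proof (induction N)
  case (Suc N)
  then obtain v where v: "\<And>j. j < N \<Longrightarrow> \<rho> (v j) = 0 \<and> between 0 1 (v j) \<and> (\<forall>b\<in>B. norm (b - v j * b) < e) \<and>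
    (\<forall>i<j. \<forall>a\<in>F. norm (star (v i * a - a * v i) * (v j * a - a * v j)) < e)" by blast
  define M where "M = 1 + (\<Sum>a\<in>F. norm a)"
  have M: "norm a \<le> M" if "a \<in> F" for a
    unfolding M_def using member_le_sum[of a F norm] that assms(3) by auto
  have M0: "0 < M" unfolding M_def by (simp add: add_pos_nonneg sum_nonneg)
  define T where "T i a = v i * a - a * v i" for i a
  define S where "S = B \<union> (\<Union>i\<in>{..<N}. T i ` F) \<union> (\<Union>i\<in>{..<N}. (\<lambda>a. star a * T i a) ` F)"
  have S1: "finite S" unfolding S_def using assms by auto
  have S2: "\<rho> b = 0" if "b \<in> S" for b
    using that v assms(2) unfolding S_def T_def by (auto simp: hom_mult hom_diff)
  have S3: "0 < e / (2 * (M + 1))" using assms(4) M0 by simp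
  from approximate_unit[OF S1 S2 S3] obtain w where w: "\<rho> w = 0" "between 0 1 w" "\<And>b. b \<in> S \<Longrightarrow> norm (b - w * b) < e / (2 * (M + 1))"
    by blast
  have ws: "star w = w" by (rule between_star[OF w(2)])
  have le: "e / (2 * (M + 1)) \<le> e / 2" "M * (e / (2 * (M + 1))) < e / 2"
    using assms(4) M0 by (auto simp: field_simps)
  have wB: "norm (b - w * b) < e" if "b \<in> B" for b
  proof -
    have "b \<in> S" using that unfolding S_def by simp
    from w(3)[OF this] le(1) assms(4) show ?thesis by linarith
  qed
  have wT: "norm (star (T i a) * (w * a - a * w)) < e" if "i < N" "a \<in> F" for i a
  proof -
    have 1: "norm (star (T i a) - star (T i a) * w) < e / (2 * (M + 1))"
      using w(3)[of "T i a"] that norm_star[of "T i a - w * T i a"] unfolding S_def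
      by (auto simp: star_diff star_mult ws)
    have 2: "norm (star (T i a) * a - star (T i a) * a * w) < e / (2 * (M + 1))"
      using w(3)[of "star a * T i a"] that norm_star[of "star a * T i a - w * (star a * T i a)"] unfolding S_def
      by (auto simp: star_diff star_mult ws)
    define p q where "p = star (T i a) * a - star (T i a) * a * w" and "q = star (T i a) - star (T i a) * w"
    have "star (T i a) * (w * a - a * w) = p - q * a"
      unfolding p_def q_def by (simp add: algebra_simps)
    also have "norm \<dots> \<le> norm p + norm q * norm a"
      by (meson norm_triangle_ineq4 norm_mult_ineq add_left_mono order_trans)
    also have "\<dots> \<le> e / (2 * (M + 1)) + e / (2 * (M + 1)) * M"
      using 1 2 M[OF that(2)] M0 assms(4) unfolding p_def q_def by (intro add_mono mult_mono) auto
    also have "\<dots> < e" using le mult.commute[of M "e / (2 * (M + 1))"] by linarith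
    finally show ?thesis .
  qed
  have "\<forall>j<Suc N. \<rho> ((v(N := w)) j) = 0 \<and> between 0 1 ((v(N := w)) j) \<and> (\<forall>b\<in>B. norm (b - (v(N := w)) j * b) < e) \<and>
    (\<forall>i<j. \<forall>a\<in>F. norm (star ((v(N := w)) i * a - a * (v(N := w)) i) * ((v(N := w)) j * a - a * (v(N := w)) j)) < e)"
    using v w wB wT unfolding T_def by (auto simp: less_Suc_eq)
  then show ?case by blast
qed simp

text \<open>Averaging works because the commutators of the successive approximate units with a fixed element
  are almost orthogonal, so that their sum grows only like the square root of their number.\<close>

lemma quasicentral_unit:
  assumes "finite B" "\<And>b. b \<in> B \<Longrightarrow> \<rho> b = 0" "finite F" "0 < e"
  shows "\<exists>u. \<rho> u = 0 \<and> between 0 1 u \<and> (\<forall>b\<in>B. norm (b - u * b) < e) \<and> (\<forall>a\<in>F. norm (u * a - a * u) < e)"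
proof -
  define M where "M = 1 + (\<Sum>a\<in>F. norm a)"
  have M: "norm a \<le> M" if "a \<in> F" for a
    unfolding M_def using member_le_sum[of a F norm] that assms(3) by auto
  have M0: "0 < M" unfolding M_def by (simp add: add_pos_nonneg sum_nonneg)
  \<comment> \<open>The squared norm of the averaged commutator is at most d + 4 M^2 / N:
    off-diagonal pairs contribute d each, and the N diagonal ones 4 M^2 each. The choices of d and N
    keep the sum below e^2.\<close>
  define d where "d = min e (e\<^sup>2 / 4)"
  have d: "0 < d" "d \<le> e" "d \<le> e\<^sup>2 / 4" using assms(4) unfolding d_def by auto
  obtain N :: nat where N: "real N > 16 * M\<^sup>2 / e\<^sup>2" using reals_Archimedean2 by blast
  have N0: "0 < real N" using N by (rule le_less_trans[rotated]) simp
  obtain v where v: "\<forall>j<N. \<rho> (v j) = 0 \<and> between 0 1 (v j) \<and> (\<forall>b\<in>B. norm (b - v j * b) < d) \<and>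
    (\<forall>i<j. \<forall>a\<in>F. norm (star (v i * a - a * v i) * (v j * a - a * v j)) < d)"
    using almost_orthogonal_units[OF assms(1,2,3) d(1)] by blast
  define u where "u = (1 / real N) *\<^sub>R (\<Sum>j<N. v j)"
  have "\<rho> u = 0" unfolding u_def using v by (simp add: hom_scaleR hom_sum)
  moreover have "between 0 1 u"
  proof -
    have "(1 / real N) *\<^sub>R (\<Sum>j<N. (1::'a)) = 1"
      using N0 by (simp only: sum_constant_scaleR scaleR_scaleR card_lessThan) simp
    then have "1 - u = (1 / real N) *\<^sub>R (\<Sum>j<N. 1 - v j)"
      unfolding u_def by (simp only: sum_subtractf scaleR_diff_right)
    moreover have "pos ((1 / real N) *\<^sub>R (\<Sum>j<N. 1 - v j))" "pos u"
      unfolding u_def using v by (auto intro!: pos_scaleR pos_sum simp: between_def)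
    ultimately show ?thesis by (simp add: between_def)
  qed
  moreover have "norm (b - u * b) < e" if "b \<in> B" for b
  proof -
    have "(1 / real N) *\<^sub>R (\<Sum>j<N. b) = b"
      using N0 by (simp only: sum_constant_scaleR scaleR_scaleR card_lessThan) simp
    then have "b - u * b = (1 / real N) *\<^sub>R (\<Sum>j<N. b - v j * b)"
      unfolding u_def by (simp only: sum_subtractf scaleR_diff_right sum_distrib_right mult_scaleR_left)
    also have "norm \<dots> \<le> (1 / real N) * (\<Sum>j<N. norm (b - v j * b))"
      using N0 by (simp add: norm_sum mult_left_mono divide_right_mono)
    also have "\<dots> < (1 / real N) * (\<Sum>j<N. d)"
      using N0 v that by (intro mult_strict_left_mono sum_strict_mono) auto
    also have "\<dots> \<le> e" using N0 d by simp
    finally show ?thesis .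
  qed
  moreover have "norm (u * a - a * u) < e" if a: "a \<in> F" for a
  proof -
    define T where "T j = v j * a - a * v j" for j
    define C where "C = (\<Sum>j<N. T j)"
    have Tn: "norm (T j) \<le> 2 * M" if "j < N" for j
    proof -
      have "norm (v j) \<le> 1" using v that by (intro norm_le_between) (auto intro: between_mono)
      then have "norm (v j * a) \<le> 1 * M" "norm (a * v j) \<le> M * 1"
        using M[OF a] M0 by (intro order_trans[OF norm_mult_ineq] mult_mono; simp)+
      then show ?thesis unfolding T_def using norm_triangle_ineq4[of "v j * a" "a * v j"] by simp
    qed
    have TT: "norm (star (T i) * T j) \<le> d + (if i = j then 4 * M\<^sup>2 else 0)" if "i < N" "j < N" for i j
    proof -
      consider "i = j" | "i < j" | "j < i" by linarith
      then show ?thesis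
      proof cases
        case 1
        have "(norm (T j))\<^sup>2 \<le> (2 * M)\<^sup>2" by (rule power_mono[OF Tn[OF that(2)]]) simp
        then show ?thesis using 1 d by (simp add: norm_star_mult power_mult_distrib)
      next
        case 2
        then show ?thesis using v that a unfolding T_def by (auto intro: less_imp_le)
      next
        case 3
        have "norm (star (T i) * T j) = norm (star (T j) * T i)"
          by (metis norm_star star_mult star_star)
        then show ?thesis using 3 v that a unfolding T_def by (auto intro: less_imp_le)
      qed
    qed
    have "star C * C = (\<Sum>i<N. \<Sum>j<N. star (T i) * T j)"
      unfolding C_def by (simp add: star_sum sum_product)
    also have "norm \<dots> \<le> (\<Sum>i<N. \<Sum>j<N. d + (if i = j then 4 * M\<^sup>2 else 0))"
      using TT by (intro order_trans[OF norm_sum] sum_mono) auto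
    also have "\<dots> = real N * real N * d + real N * (4 * M\<^sup>2)"
      by (simp add: sum.distrib distrib_left)
    finally have C2: "(norm C)\<^sup>2 \<le> real N * real N * d + real N * (4 * M\<^sup>2)" by (simp add: norm_star_mult)
    have "u * a - a * u = (1 / real N) *\<^sub>R C"
      unfolding u_def C_def T_def by (simp add: sum_subtractf scaleR_diff_right sum_distrib_right sum_distrib_left)
    then have "(norm (u * a - a * u))\<^sup>2 = (norm C)\<^sup>2 / (real N * real N)"
      by (simp add: power_divide power2_eq_square)
    also have "\<dots> \<le> (real N * real N * d + real N * (4 * M\<^sup>2)) / (real N * real N)"
      by (intro divide_right_mono C2) simp
    also have "\<dots> = d + 4 * M\<^sup>2 / real N" using N0 by (simp add: field_simps)
    also have "\<dots> < e\<^sup>2"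
    proof -
      have "4 * M\<^sup>2 / real N < e\<^sup>2 / 2" using N N0 assms(4) M0
        by (simp add: field_simps) (smt (verit) zero_less_power mult_pos_pos)
      moreover have "0 < e\<^sup>2" using assms(4) by simp
      ultimately show ?thesis using d(3) by linarith
    qed
    finally show ?thesis using assms(4) by (simp add: power2_less_imp_less)
  qed
  ultimately show ?thesis by blast
qed

end

subsection \<open>Asymptotic bounds\<close>

text \<open>The upper limit of the norms is at most c. In this form errors that vanish along the
  sequence of quasicentral units simply disappear from estimates.\<close>

definition asy_le :: "(nat \<Rightarrow> 'a::real_normed_vector) \<Rightarrow> real \<Rightarrow> bool" where
  "asy_le x c \<longleftrightarrow> (\<forall>e>0. \<forall>\<^sub>F n in sequentially. norm (x n) \<le> c + e)"

lemma asy_leI: "(\<And>n. norm (x n) \<le> c) \<Longrightarrow> asy_le x c"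
  unfolding asy_le_def by (intro allI impI always_eventually) (meson le_add_same_cancel1 less_imp_le order_trans)

lemma asy_le_mono: "asy_le x c \<Longrightarrow> c \<le> d \<Longrightarrow> asy_le x d"
  unfolding asy_le_def by (auto elim!: eventually_mono)

lemma asy_le_add: assumes "asy_le x c" "asy_le y d" shows "asy_le (\<lambda>n. x n + y n) (c + d)"
  unfolding asy_le_def
proof (intro allI impI)
  fix e :: real assume "0 < e"
  then have "\<forall>\<^sub>F n in sequentially. norm (x n) \<le> c + e/2" "\<forall>\<^sub>F n in sequentially. norm (y n) \<le> d + e/2"
    using assms unfolding asy_le_def by (meson half_gt_zero)+
  then show "\<forall>\<^sub>F n in sequentially. norm (x n + y n) \<le> c + d + e"
    by eventually_elim (use norm_triangle_ineq in \<open>smt (verit) field_sum_of_halves\<close>)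
qed

lemma asy_le_minus: "asy_le x c \<Longrightarrow> asy_le (\<lambda>n. - x n) c"
  by (simp add: asy_le_def)

lemma asy_le_mult:
  fixes x y :: "nat \<Rightarrow> 'a::real_normed_algebra"
  assumes "asy_le x c" "asy_le y d" "0 \<le> c" "0 \<le> d" shows "asy_le (\<lambda>n. x n * y n) (c * d)"
  unfolding asy_le_def
proof (intro allI impI)
  fix e :: real assume e: "0 < e"
  define t where "t = min 1 (e / (c + d + 1))"
  have t: "0 < t" "t \<le> 1" "t \<le> e / (c + d + 1)" using e assms unfolding t_def by auto
  then have te: "t * (c + d + 1) \<le> e" using assms by (simp add: pos_le_divide_eq)
  have tt: "t * t \<le> t * 1" using t by (intro mult_left_mono) auto
  have "\<forall>\<^sub>F n in sequentially. norm (x n) \<le> c + t" "\<forall>\<^sub>F n in sequentially. norm (y n) \<le> d + t"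
    using assms t unfolding asy_le_def by auto
  then show "\<forall>\<^sub>F n in sequentially. norm (x n * y n) \<le> c * d + e"
  proof eventually_elim
    case (elim n)
    have "norm (x n * y n) \<le> (c + t) * (d + t)"
      using elim assms t by (intro order_trans[OF norm_mult_ineq] mult_mono) auto
    also have "\<dots> \<le> c * d + t * (c + d + 1)" using tt by (simp add: algebra_simps)
    finally show ?case using te by simp
  qed
qed

lemma asy_le_mult0:
  fixes x y :: "nat \<Rightarrow> 'a::real_normed_algebra"
  assumes "asy_le x 0" "\<And>n. norm (y n) \<le> K"
  shows "asy_le (\<lambda>n. x n * y n) 0" "asy_le (\<lambda>n. y n * x n) 0"
proof -
  have "0 \<le> K" using assms(2)[of 0] norm_ge_zero order_trans by blast
  then show "asy_le (\<lambda>n. x n * y n) 0" "asy_le (\<lambda>n. y n * x n) 0"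
    using asy_le_mult[OF assms(1) asy_leI[OF assms(2)]] asy_le_mult[OF asy_leI[OF assms(2)] assms(1)] by auto
qed

lemma asy_le_sum:
  assumes "finite I" "\<And>i. i \<in> I \<Longrightarrow> asy_le (f i) (c i)"
  shows "asy_le (\<lambda>n. \<Sum>i\<in>I. f i n) (\<Sum>i\<in>I. c i)"
  using assms by (induction I rule: finite_induct) (auto intro: asy_leI asy_le_add)

lemma asy_le_sum0:
  assumes "finite I" "\<And>i. i \<in> I \<Longrightarrow> asy_le (f i) 0"
  shows "asy_le (\<lambda>n. \<Sum>i\<in>I. f i n) 0"
  using asy_le_sum[of I f "\<lambda>_. 0"] assms by simp

lemma asy_le_add0: "asy_le x c \<Longrightarrow> asy_le y 0 \<Longrightarrow> asy_le (\<lambda>n. x n + y n) c"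
  using asy_le_add[of x c y 0] by simp

lemma asy_le_cong: "asy_le x c \<Longrightarrow> (\<And>n. x n = y n) \<Longrightarrow> asy_le y c"
  by (simp add: asy_le_def)

lemma asy_le_0I: "x \<longlonglongrightarrow> 0 \<Longrightarrow> asy_le x 0"
  unfolding asy_le_def
  by (intro allI impI eventually_mono[OF order_tendstoD(2)[OF tendsto_norm_zero]]) auto

lemma asy_le_star: "asy_le x c \<Longrightarrow> asy_le (\<lambda>n. star (x n :: 'a::cstar0)) c"
  by (simp add: asy_le_def)

lemma asy_le_commutator_power:
  fixes g x :: "nat \<Rightarrow> 'a::real_normed_algebra_1"
  assumes "asy_le (\<lambda>n. g n * x n - x n * g n) 0" "\<And>n. norm (x n) \<le> K"
  shows "asy_le (\<lambda>n. g n * x n ^ r - x n ^ r * g n) 0"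
proof (induction r)
  case 0
  show ?case by (rule asy_leI) simp
next
  case (Suc r)
  have "norm (x n ^ r) \<le> K ^ r" for n
    using norm_power_ineq power_mono[OF assms(2) norm_ge_zero] order_trans by blast
  note 1 = asy_le_mult0(1)[where y = "\<lambda>n. x n ^ r", OF assms(1) this]
    and 2 = asy_le_mult0(2)[where y = x, OF Suc assms(2)]
  show ?case
    by (rule asy_le_cong[OF asy_le_add0[OF 1 2]]) (simp add: algebra_simps)
qed

subsection \<open>Gluing along a chain of nilpotents\<close>

text \<open>The sum is the diagonal operator of the T i compressed by the column of the g i, which
  is an isometry. Without matrices: with c i = T i g i and S the sum, positivity of the sum of |c i
  - g i S|^2 yields \<open>star S * S\<close> \<le> sum of \<open>star (c i) * c i\<close> \<le>
  m^2.\<close>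

lemma partition_norm_le:
  fixes g T :: "'i \<Rightarrow> 'a::cstar1"
  assumes "finite I" "\<And>i. i \<in> I \<Longrightarrow> star (g i) = g i" "(\<Sum>i\<in>I. g i * g i) = 1"
    and T: "\<And>i. i \<in> I \<Longrightarrow> norm (T i) \<le> m" and "0 \<le> m"
  shows "norm (\<Sum>i\<in>I. g i * T i * g i) \<le> m"
proof (rule norm_sq_le)
  define c where "c i = T i * g i" for i
  define S where "S = (\<Sum>i\<in>I. g i * c i)"
  have Ss: "(\<Sum>i\<in>I. g i * T i * g i) = S" unfolding S_def c_def by (simp add: mult.assoc)
  have "pos (\<Sum>i\<in>I. star (c i - g i * S) * (c i - g i * S))"
    by (intro pos_sum pos_star_mult)
  also have "(\<Sum>i\<in>I. star (c i - g i * S) * (c i - g i * S))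
    = (\<Sum>i\<in>I. star (c i) * c i - star (c i) * g i * S - star S * (g i * c i) + star S * (g i * g i) * S)"
    by (intro sum.cong) (auto simp: star_diff star_mult assms algebra_simps)
  also have "\<dots> = (\<Sum>i\<in>I. star (c i) * c i) - (\<Sum>i\<in>I. star (c i) * g i) * S - star S * S + star S * (\<Sum>i\<in>I. g i * g i) * S"
    by (simp add: sum.distrib sum_subtractf S_def[symmetric] flip: sum_distrib_left sum_distrib_right)
  also have "(\<Sum>i\<in>I. star (c i) * g i) = star S"
    unfolding S_def by (simp add: star_sum star_mult assms)
  finally have 1: "pos ((\<Sum>i\<in>I. star (c i) * c i) - star S * S)" by (simp add: assms)
  have "pos (\<Sum>i\<in>I. g i * (of_real (m\<^sup>2) - star (T i) * T i) * g i)"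
  proof (rule pos_sum)
    fix i assume i: "i \<in> I"
    have "norm (star (T i) * T i) \<le> m\<^sup>2" unfolding norm_star_mult by (intro power_mono T i) simp
    then have "pos (of_real (m\<^sup>2) - star (T i) * T i)" by (intro pos_norm_minus) (auto simp: star_mult)
    from pos_conj[OF this, of "g i"] show "pos (g i * (of_real (m\<^sup>2) - star (T i) * T i) * g i)"
      using assms(2)[OF i] by simp
  qed
  also have "(\<Sum>i\<in>I. g i * (of_real (m\<^sup>2) - star (T i) * T i) * g i)
     = (\<Sum>i\<in>I. of_real (m\<^sup>2) * (g i * g i) - star (c i) * c i)"
    by (intro sum.cong) (auto simp: c_def star_mult assms of_real_def algebra_simps)
  also have "\<dots> = of_real (m\<^sup>2) - (\<Sum>i\<in>I. star (c i) * c i)"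
    by (simp add: sum_subtractf assms flip: sum_distrib_left)
  finally have 2: "pos (of_real (m\<^sup>2) - (\<Sum>i\<in>I. star (c i) * c i))" .
  show "pos (of_real (m\<^sup>2) - star (\<Sum>i\<in>I. g i * T i * g i) * (\<Sum>i\<in>I. g i * T i * g i))"
    unfolding Ss using pos_add[OF 1 2] by simp
qed (rule assms)

definition ramp :: "real \<Rightarrow> real" where "ramp t = min 1 (max 0 t)"

lemma ramp_mono: "s \<le> t \<Longrightarrow> ramp s \<le> ramp t"
  by (auto simp: ramp_def)

lemma continuous_ramp [continuous_intros]: "continuous_on S f \<Longrightarrow> continuous_on S (\<lambda>x. ramp (f x))"
  unfolding ramp_def by (intro continuous_intros)

text \<open>Tents with peaks at i / L: a partition of unity on [0, 1] in which only neighbouring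
  members overlap. At t = 0 only the member 0 survives, at t = 1 only the member L.\<close>

definition hat :: "nat \<Rightarrow> nat \<Rightarrow> real \<Rightarrow> real" where
  "hat L i t = ramp (real L * t - real i + 1) - ramp (real L * t - real i)"

lemma continuous_hat: "continuous_on S (hat L i)"
  unfolding hat_def[abs_def] by (intro continuous_intros)

lemma hat_nonneg: "0 \<le> hat L i t"
  unfolding hat_def using ramp_mono[of "real L * t - real i" "real L * t - real i + 1"] by simp

lemma hat_le_1: "hat L i t \<le> 1"
  by (auto simp: hat_def ramp_def)

lemma sum_hat: assumes "0 \<le> t" "t \<le> 1" shows "(\<Sum>i\<le>L. hat L i t) = 1"
proof -
  have "(\<Sum>i\<le>n. hat L i t) = ramp (real L * t + 1) - ramp (real L * t - real n)" for n
    by (induction n) (auto simp: hat_def)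
  moreover have "real L * t \<le> real L * 1" using assms by (intro mult_left_mono) auto
  ultimately show ?thesis using assms by (simp add: ramp_def)
qed

lemma hat_disjoint: "i + 2 \<le> l \<Longrightarrow> hat L i t * hat L l t = 0"
  by (auto simp: hat_def ramp_def)

lemma hat_disjoint': "\<not> (l \<le> i + 1 \<and> i \<le> l + 1) \<Longrightarrow> hat L i t * hat L l t = 0"
  using hat_disjoint[of i l L t] hat_disjoint[of l i L t] by (simp add: mult.commute not_le) linarith

text \<open>Away from i = 0 the tent lies below L t. Thus the square of the root of the i-th tent at
  v is dominated by L v, and it annihilates asymptotically whatever v annihilates.\<close>

lemma hat_le: "1 \<le> i \<Longrightarrow> 0 \<le> t \<Longrightarrow> hat L i t \<le> real L * t"
proof -
  assume "1 \<le> i" "0 \<le> t"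
  then have "1 \<le> real i" "0 \<le> real L * t" by auto
  then show ?thesis by (auto simp: hat_def ramp_def)
qed

lemma hat_1: "i \<le> L \<Longrightarrow> hat L i 1 = (if i = L then 1 else 0)"
  by (auto simp: hat_def ramp_def)

context star_homo
begin

text \<open>With u quasicentral in the kernel and v = 1 - u, the tents of v select Y 0 where v is
  small and Y L where v is near 1; v maps to 1, so the glued element has the image of Y L. Near the
  i-th tent it differs from Y i only through the neighbours, by at most 2 \<open>\<mu>\<close>, so
  its k-th power is small. Only Y 0 has to be nilpotent upstairs; the other Y i need nilpotent
  images.\<close>

lemma glue_nilpotents:
  assumes R: "1 \<le> R" "\<And>i. i \<le> L \<Longrightarrow> norm (Y i) \<le> R"
    and Y0: "Y 0 ^ k = 0" and Yk: "\<And>i. i \<le> L \<Longrightarrow> \<rho> (Y i) ^ k = 0"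
    and step: "\<And>i. i < L \<Longrightarrow> norm (\<rho> (Y (Suc i)) - \<rho> (Y i)) \<le> \<mu>" "0 < \<mu>"
    and near: "norm (Y 0 - X) \<le> \<eta>" "\<And>i. i \<le> L \<Longrightarrow> norm (\<rho> (Y i) - \<rho> X) \<le> \<eta>" "0 < \<eta>"
    and "0 < \<epsilon>"
  shows "\<exists>Z. \<rho> Z = \<rho> (Y L) \<and> norm (Z - X) \<le> \<eta> + \<epsilon> \<and> norm (Z ^ k) \<le> 6 * (real k * (2 * \<mu>) * R ^ k) + \<epsilon>"
proof -
  \<comment> \<open>For i = 0 the difference Y 0 - X is kept as it is, since the tent at 0 does not
    suppress kernel elements. For i > 0 a lift of the right norm suffices, as the discrepancy lies
    in the kernel.\<close>
  have "\<exists>T. norm T \<le> \<eta> \<and> \<rho> T = \<rho> (Y i - X) \<and> (i = 0 \<longrightarrow> T = Y 0 - X)" if "i \<le> L" for i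
  proof (cases "i = 0")
    case False
    then show ?thesis using norm_lift[of "Y i - X" \<eta>] near that by (auto simp: hom_diff)
  qed (use near in auto)
  then obtain T where T: "\<And>i. i \<le> L \<Longrightarrow> norm (T i) \<le> \<eta>" "\<And>i. i \<le> L \<Longrightarrow> \<rho> (T i) = \<rho> (Y i - X)" "T 0 = Y 0 - X"
    by (metis le0)
  have "\<exists>D. norm D \<le> \<mu> \<and> \<rho> D = \<rho> (Y l - Y i)" if "i \<le> L" "l \<le> L" "l = Suc i \<or> i = Suc l" for i l
  proof -
    have "norm (\<rho> (Y l - Y i)) \<le> \<mu>"
      using that step(1)[of i] step(1)[of l] by (auto simp: hom_diff norm_minus_commute)
    then show ?thesis using norm_lift step(2) by blast
  qed
  then obtain D where D: "\<And>i l. i \<le> L \<Longrightarrow> l \<le> L \<Longrightarrow> l = Suc i \<or> i = Suc l \<Longrightarrow> norm (D i l) \<le> \<mu>"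
    "\<And>i l. i \<le> L \<Longrightarrow> l \<le> L \<Longrightarrow> l = Suc i \<or> i = Suc l \<Longrightarrow> \<rho> (D i l) = \<rho> (Y l - Y i)"
    by metis
  define F where "F = insert X (Y ` {..L})"
  \<comment> \<open>Kernel elements that the tents must suppress: the discrepancies of the two
    families of lifts, and the powers Y i ^ k, which are zero only in the image.\<close>
  define B0 where "B0 = (\<lambda>i. Y i - X - T i) ` {..L} \<union> (\<lambda>i. Y i ^ k) ` {..L} \<union>
    (\<lambda>(i, l). Y l - Y i - D i l) ` {(i, l). i \<le> L \<and> l \<le> L \<and> (l = Suc i \<or> i = Suc l)}"
  define B where "B = B0 \<union> star ` B0"
  have "finite {(i, l). i \<le> L \<and> l \<le> L \<and> (l = Suc i \<or> i = Suc l)}"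
    by (rule finite_subset[of _ "{..L} \<times> {..L}"]) auto
  then have fin: "finite F" "finite B" unfolding F_def B_def B0_def by auto
  have B0: "\<rho> b = 0" if "b \<in> B0" for b
    using that T(2) D(2) Yk unfolding B0_def by (auto simp: hom_diff hom_power)
  then have B: "\<rho> b = 0" if "b \<in> B" for b
    using that unfolding B_def by (auto simp: hom_star)
  have "\<exists>u. \<rho> u = 0 \<and> between 0 1 u \<and> (\<forall>b\<in>B. norm (b - u * b) < inverse (Suc n)) \<and>
     (\<forall>a\<in>F. norm (u * a - a * u) < inverse (Suc n))" for n
    by (rule quasicentral_unit[OF fin(2) B fin(1)]) auto
  then obtain u where u: "\<And>n. \<rho> (u n) = 0" "\<And>n. between 0 1 (u n)"
    "\<And>n b. b \<in> B \<Longrightarrow> norm (b - u n * b) < inverse (Suc n)"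
    "\<And>n a. a \<in> F \<Longrightarrow> norm (u n * a - a * u n) < inverse (Suc n)"
    by metis
  define v where "v n = 1 - u n" for n
  have vb: "between 0 1 (v n)" for n using u(2)[of n] by (simp add: between_def v_def)
  have vs: "star (v n) = v n" for n by (rule between_star[OF vb])
  have vn: "norm (v n) \<le> 1" for n by (rule norm_le_between[OF between_mono[OF vb]]) auto
  define h where "h i t = sqrt (hat L i t)" for i t
  have h: "continuous_on UNIV (h i)" for i
    unfolding h_def[abs_def] by (intro continuous_intros continuous_hat)
  have hh: "(\<lambda>t. h i t * h i t) = hat L i" for i unfolding h_def using hat_nonneg by auto
  define g where "g i n = fc (h i) (v n)" for i n
  have gs: "star (g i n) = g i n" for i n unfolding g_def by (rule fc_star[OF vs h])
  have gn: "norm (g i n) \<le> 1" for i n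
    unfolding g_def by (rule fc_norm_le[OF vb h]) (simp add: h_def hat_nonneg hat_le_1)
  have gg: "g i n * g i n = fc (hat L i) (v n)" for i n
    unfolding g_def fc_mult[OF vs h h, symmetric] hh by (rule refl)
  have gc: "g i n * g l n = g l n * g i n" for i l n
    unfolding g_def by (rule fc_comm_op[OF vs h h])
  have gsum: "(\<Sum>i\<le>L. g i n * g i n) = 1" for n
  proof -
    have "(\<Sum>i\<le>L. g i n * g i n) = fc (\<lambda>t. \<Sum>i\<le>L. hat L i t) (v n)"
      unfolding gg by (rule fc_sum[symmetric]) (auto simp: vs continuous_hat)
    also have "\<dots> = fc (\<lambda>_. 1) (v n)"
      by (rule fc_cong[OF vb]) (auto intro!: continuous_intros continuous_hat simp: sum_hat)
    finally show ?thesis by (simp add: fc_const vs)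
  qed
  have g0: "g i n * g l n = 0" if "\<not> (l \<le> i + 1 \<and> i \<le> l + 1)" for i l n
  proof -
    have "h i t * h l t = 0" for t
      unfolding h_def real_sqrt_mult[symmetric] using hat_disjoint'[OF that] by simp
    then have "(\<lambda>t. h i t * h l t) = (\<lambda>_. 0)" by auto
    then show ?thesis unfolding g_def fc_mult[OF vs h h, symmetric] by (simp add: fc_const vs)
  qed
  have com: "asy_le (\<lambda>n. g i n * a - a * g i n) 0" if "a \<in> F" for i a
    unfolding asy_le_def
  proof (intro allI impI)
    fix e :: real assume "0 < e"
    \<comment> \<open>The modulus is independent of n, so it applies to all v n at once.\<close>
    obtain d where d: "0 < d" "\<And>b z::'a. star b = b \<Longrightarrow> norm b \<le> 1 \<Longrightarrow> norm z \<le> norm a \<Longrightarrow>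
      norm (z * b - b * z) < d \<Longrightarrow> norm (z * fc (h i) b - fc (h i) b * z) < e"
      using fc_almost_commute[OF h \<open>0 < e\<close>, where 'a = 'a, of 1 "norm a" i] by blast
    have "\<forall>\<^sub>F n in sequentially. inverse (real (Suc n)) < d"
      using order_tendstoD(2)[OF LIMSEQ_inverse_real_of_nat d(1)] .
    then show "\<forall>\<^sub>F n in sequentially. norm (g i n * a - a * g i n) \<le> 0 + e"
    proof eventually_elim
      case (elim n)
      have "norm (a * v n - v n * a) < d"
        using u(4)[OF that, of n] elim by (simp add: v_def algebra_simps)
      from d(2)[OF vs vn order_refl this] show ?case unfolding g_def by (simp add: norm_minus_commute)
    qed
  qed
  have vB: "(\<lambda>n. v n * b) \<longlonglongrightarrow> 0" if "b \<in> B" for b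
    by (rule Lim_null_comparison[OF always_eventually[OF allI] LIMSEQ_inverse_real_of_nat])
      (use less_imp_le[OF u(3)[OF that]] in \<open>simp add: v_def algebra_simps\<close>)
  have gB: "asy_le (\<lambda>n. g i n * b) 0" if "b \<in> B" "1 \<le> i" for i b
  proof -
    have le: "norm (g i n * b) \<le> sqrt (real L * norm b * norm (v n * b))" for n
    proof -
      \<comment> \<open>From g i ^ 2 \<le> L v, the squared norm of g i b is at most L (norm b)
        (norm (v b)), which tends to 0.\<close>
      have "pos (fc (\<lambda>t. real L * t) (v n) - fc (hat L i) (v n))"
        by (rule pos_diff_fc[OF vb]) (auto intro!: continuous_intros continuous_hat hat_le that)
      then have "pos (star b * (real L *\<^sub>R v n - g i n * g i n) * b)"
        by (intro pos_conj) (simp add: gg fc_scale fc_id vs continuous_on_id)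
      then have "pos (star b * (real L *\<^sub>R v n) * b - star (g i n * b) * (g i n * b))"
        by (simp add: star_mult gs algebra_simps)
      from pos_norm_mono[OF pos_star_mult this]
      have "(norm (g i n * b))\<^sup>2 \<le> norm (real L *\<^sub>R (star b * (v n * b)))"
        by (simp add: norm_star_mult mult.assoc)
      also have "\<dots> \<le> real L * (norm b * norm (v n * b))"
        using norm_mult_ineq[of "star b" "v n * b"] by (simp add: mult_left_mono)
      finally show ?thesis by (simp add: real_le_rsqrt mult.assoc)
    qed
    have "(\<lambda>n. sqrt (real L * norm b * norm (v n * b))) \<longlonglongrightarrow> sqrt (real L * norm b * norm (0::'a))"
      by (intro tendsto_intros vB that)
    then have "(\<lambda>n. sqrt (real L * norm b * norm (v n * b))) \<longlonglongrightarrow> 0" by simp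
    from Lim_null_comparison[OF always_eventually[OF allI[OF le]] this] show ?thesis by (rule asy_le_0I)
  qed
  have gB': "asy_le (\<lambda>n. b * g i n) 0" if "b \<in> B" "1 \<le> i" for i b
  proof -
    have "star b \<in> B" using that unfolding B_def by (auto simp: image_iff)
    from asy_le_star[OF gB[OF this that(2)]] show ?thesis by (simp add: star_mult gs)
  qed
  define Z where "Z n = (\<Sum>i\<le>L. g i n * Y i * g i n)" for n
  have Zn: "norm (Z n) \<le> R" for n
    unfolding Z_def by (rule partition_norm_le) (use R gs gsum in auto)
  have YF: "Y i \<in> F" if "i \<le> L" for i using that unfolding F_def by auto
  have XF: "X \<in> F" unfolding F_def by auto
  have near_Z: "asy_le (\<lambda>n. Z n - X) \<eta>"
  proof -
    have 1: "asy_le (\<lambda>n. \<Sum>i\<le>L. g i n * T i * g i n) \<eta>"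
      by (intro asy_leI partition_norm_le) (use gs gsum T near in auto)
    have 2: "asy_le (\<lambda>n. g i n * (Y i - X - T i) * g i n) 0" if "i \<le> L" for i
    proof (cases "i = 0")
      case True
      then show ?thesis by (intro asy_leI) (simp add: T)
    next
      case False
      have "Y i - X - T i \<in> B" unfolding B_def B0_def using that by auto
      from asy_le_mult0(1)[OF gB[OF this, of i] gn[of i]] show ?thesis using False by simp
    qed
    have 3: "asy_le (\<lambda>n. g i n * ((g i n * X - X * g i n))) 0" for i
      by (rule asy_le_mult0(2)[OF com[OF XF] gn])
    have "asy_le (\<lambda>n. (\<Sum>i\<le>L. g i n * T i * g i n) + ((\<Sum>i\<le>L. g i n * (Y i - X - T i) * g i n)
         + - (\<Sum>i\<le>L. g i n * (g i n * X - X * g i n)))) \<eta>"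
      using 2 3 by (intro asy_le_add0[OF 1] asy_le_add0 asy_le_minus asy_le_sum0) auto
    then show ?thesis
    proof (rule asy_le_cong)
      fix n
      have "X = (\<Sum>i\<le>L. g i n * g i n) * X" by (simp add: gsum)
      also have "\<dots> = (\<Sum>i\<le>L. g i n * g i n * X)" by (simp add: sum_distrib_right)
      finally have X: "X = (\<Sum>i\<le>L. g i n * g i n * X)" .
      have "(\<Sum>i\<le>L. g i n * T i * g i n) + ((\<Sum>i\<le>L. g i n * (Y i - X - T i) * g i n)
         + - (\<Sum>i\<le>L. g i n * (g i n * X - X * g i n)))
        = (\<Sum>i\<le>L. g i n * Y i * g i n - g i n * g i n * X)"
        unfolding sum_negf[symmetric] sum.distrib[symmetric] by (intro sum.cong) (auto simp: algebra_simps)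
      also have "\<dots> = Z n - X" unfolding Z_def using X by (simp add: sum_subtractf)
      finally show "(\<Sum>i\<le>L. g i n * T i * g i n) + ((\<Sum>i\<le>L. g i n * (Y i - X - T i) * g i n)
         + - (\<Sum>i\<le>L. g i n * (g i n * X - X * g i n))) = Z n - X" .
    qed
  qed
  have comZ: "asy_le (\<lambda>n. g i n * Z n - Z n * g i n) 0" for i
  proof -
    have "asy_le (\<lambda>n. \<Sum>l\<le>L. g l n * ((g i n * Y l - Y l * g i n) * g l n)) 0"
      by (intro asy_le_sum0 asy_le_mult0(2)[OF _ gn] asy_le_mult0(1)[OF _ gn] com YF) auto
    then show ?thesis
    proof (rule asy_le_cong)
      fix n
      have "g i n * Z n - Z n * g i n = (\<Sum>l\<le>L. (g i n * g l n) * Y l * g l n - g l n * Y l * (g l n * g i n))"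
        unfolding Z_def by (simp add: sum_distrib_left sum_distrib_right sum_subtractf mult.assoc)
      also have "\<dots> = (\<Sum>l\<le>L. g l n * ((g i n * Y l - Y l * g i n) * g l n))"
      proof (rule sum.cong[OF refl])
        fix l
        show "(g i n * g l n) * Y l * g l n - g l n * Y l * (g l n * g i n) = g l n * ((g i n * Y l - Y l * g i n) * g l n)"
        proof -
          have "g l n * Y l * (g l n * g i n) = g l n * Y l * (g i n * g l n)" by (simp only: gc[of l n i])
          moreover have "(g i n * g l n) * Y l * g l n = (g l n * g i n) * Y l * g l n" by (simp only: gc[of i n l])
          ultimately show ?thesis by (simp add: algebra_simps)
        qed
      qed
      finally show "(\<Sum>l\<le>L. g l n * ((g i n * Y l - Y l * g i n) * g l n)) = g i n * Z n - Z n * g i n" by simp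
    qed
  qed
  have loc: "asy_le (\<lambda>n. Z n * g i n - Y i * g i n) (2 * \<mu>)" if i: "i \<le> L" for i
  proof -
    \<comment> \<open>The index i itself drops out because Y i - Y i = 0, and distant tents do not
      meet; at most two indices remain, hence the factor 2.\<close>
    define N where "N = {l. l \<le> L \<and> (l = Suc i \<or> i = Suc l)}"
    have N: "finite N" "card N \<le> 2" "N \<subseteq> {..L}" "i \<notin> N"
    proof -
      have "N \<subseteq> {Suc i, i - 1}" unfolding N_def by auto
      moreover have "card {Suc i, i - 1} \<le> 2" by (simp add: card_insert_if)
      ultimately show "finite N" "card N \<le> 2" using card_mono[of "{Suc i, i - 1}" N] finite_subset by auto
    qed (auto simp: N_def)
    have 1: "asy_le (\<lambda>n. \<Sum>l\<in>N. g l n * D i l * g l n * g i n) (\<Sum>l\<in>N. \<mu>)"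
    proof (intro asy_le_sum N asy_leI)
      fix l n assume "l \<in> N"
      then have "norm (D i l) \<le> \<mu>" using D(1) i unfolding N_def by auto
      then have "norm (g l n * D i l * g l n * g i n) \<le> 1 * \<mu> * 1 * 1"
        using step(2) gn by (intro order_trans[OF norm_mult_ineq] mult_mono) auto
      then show "norm (g l n * D i l * g l n * g i n) \<le> \<mu>" by simp
    qed
    have 2: "asy_le (\<lambda>n. g l n * (Y l - Y i - D i l) * g l n * g i n) 0" if "l \<in> N" for l
    proof -
      have b: "Y l - Y i - D i l \<in> B" using that i unfolding B_def B0_def N_def by force
      show ?thesis
      proof (cases "l = 0")
        case False
        then show ?thesis by (intro asy_le_mult0(1)[OF _ gn] gB b) auto
      next
        \<comment> \<open>Here l = 0, whose tent does not suppress the kernel; but then i = 1, and g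
          i is moved next to the kernel element by commuting it past g l.\<close>
        case True
        then have "1 \<le> i" using that unfolding N_def by auto
        from asy_le_mult0(1)[where y = "g l", OF asy_le_mult0(2)[where y = "g l", OF gB'[OF b this] gn] gn]
        show ?thesis by (rule asy_le_cong) (simp add: mult.assoc gc[of i])
      qed
    qed
    have 3: "asy_le (\<lambda>n. (g l n * Y i - Y i * g l n) * (g l n * g i n)) 0" for l
      by (rule asy_le_mult0(1)[OF com[OF YF[OF i]]], rule order_trans[OF norm_mult_ineq], rule mult_mono[OF gn gn]) auto
    have "asy_le (\<lambda>n. (\<Sum>l\<in>N. g l n * D i l * g l n * g i n) + ((\<Sum>l\<in>N. g l n * (Y l - Y i - D i l) * g l n * g i n)
       + (\<Sum>l\<le>L. (g l n * Y i - Y i * g l n) * (g l n * g i n)))) (\<Sum>l\<in>N. \<mu>)"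
      using 2 3 N by (intro asy_le_add0[OF 1] asy_le_add0 asy_le_sum0) auto
    then have "asy_le (\<lambda>n. Z n * g i n - Y i * g i n) (\<Sum>l\<in>N. \<mu>)"
    proof (rule asy_le_cong)
      fix n
      have "(\<Sum>l\<le>L. g l n * (Y l - Y i) * g l n * g i n) = (\<Sum>l\<in>N. g l n * (Y l - Y i) * g l n * g i n)"
      proof (rule sum.mono_neutral_right)
        show "\<forall>l\<in>{..L} - N. g l n * (Y l - Y i) * g l n * g i n = 0"
        proof
          fix l assume "l \<in> {..L} - N"
          then have "l = i \<or> \<not> (i \<le> l + 1 \<and> l \<le> i + 1)" unfolding N_def by auto
          then show "g l n * (Y l - Y i) * g l n * g i n = 0" using g0[of i l n] by (auto simp: mult.assoc)
        qed
      qed (use N in auto)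
      also have "\<dots> = (\<Sum>l\<in>N. g l n * D i l * g l n * g i n) + (\<Sum>l\<in>N. g l n * (Y l - Y i - D i l) * g l n * g i n)"
        unfolding sum.distrib[symmetric] by (intro sum.cong) (auto simp: algebra_simps)
      finally have e1: "(\<Sum>l\<le>L. g l n * (Y l - Y i) * g l n * g i n) =
        (\<Sum>l\<in>N. g l n * D i l * g l n * g i n) + (\<Sum>l\<in>N. g l n * (Y l - Y i - D i l) * g l n * g i n)" .
      have "Y i * g i n = Y i * (\<Sum>l\<le>L. g l n * g l n) * g i n" by (simp add: gsum)
      also have "\<dots> = (\<Sum>l\<le>L. Y i * g l n * g l n * g i n)"
        by (simp add: sum_distrib_left sum_distrib_right mult.assoc)
      finally have "Z n * g i n - Y i * g i n = (\<Sum>l\<le>L. g l n * Y l * g l n * g i n - Y i * g l n * g l n * g i n)"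
        unfolding Z_def by (simp add: sum_subtractf sum_distrib_right)
      also have "\<dots> = (\<Sum>l\<le>L. g l n * (Y l - Y i) * g l n * g i n) + (\<Sum>l\<le>L. (g l n * Y i - Y i * g l n) * (g l n * g i n))"
        unfolding sum.distrib[symmetric] by (intro sum.cong) (auto simp: algebra_simps)
      finally show "(\<Sum>l\<in>N. g l n * D i l * g l n * g i n) + ((\<Sum>l\<in>N. g l n * (Y l - Y i - D i l) * g l n * g i n)
       + (\<Sum>l\<le>L. (g l n * Y i - Y i * g l n) * (g l n * g i n))) = Z n * g i n - Y i * g i n"
        unfolding e1 by simp
    qed
    then show ?thesis
    proof (rule asy_le_mono)
      have "real (card N) * \<mu> \<le> 2 * \<mu>" using N(2) step(2) by (intro mult_right_mono) auto
      then show "(\<Sum>l\<in>N. \<mu>) \<le> 2 * \<mu>" by simp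
    qed
  qed
  have locr: "asy_le (\<lambda>n. Z n ^ r * g i n - Y i ^ r * g i n) (real r * (2 * \<mu>) * R ^ r)" if i: "i \<le> L" for i r
  proof (induction r)
    case 0
    show ?case by (rule asy_leI) simp
  next
    case (Suc r)
    have Yr: "norm (Y i ^ r) \<le> R ^ r"
      using norm_power_ineq[of "Y i" r] power_mono[OF R(2)[OF i] norm_ge_zero, of r] by linarith
    have 1: "asy_le (\<lambda>n. Z n * (Z n ^ r * g i n - Y i ^ r * g i n)) (R * (real r * (2 * \<mu>) * R ^ r))"
      using R step by (intro asy_le_mult[OF asy_leI[OF Zn] Suc]) auto
    have 2: "asy_le (\<lambda>n. (Z n * g i n - Y i * g i n) * Y i ^ r) (2 * \<mu> * R ^ r)"
      using R step by (intro asy_le_mult[OF loc[OF i] asy_leI[OF Yr]]) auto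
    have c: "asy_le (\<lambda>n. g i n * Y i ^ r - Y i ^ r * g i n) 0"
      by (rule asy_le_commutator_power[OF com[OF YF[OF i]] order_refl])
    have 3: "asy_le (\<lambda>n. - (Z n * (g i n * Y i ^ r - Y i ^ r * g i n))) 0"
      by (intro asy_le_minus asy_le_mult0(2)[OF c Zn])
    have 4: "asy_le (\<lambda>n. Y i * (g i n * Y i ^ r - Y i ^ r * g i n)) 0"
      by (intro asy_le_mult0(2)[OF c order_refl])
    have "asy_le (\<lambda>n. (Z n * (Z n ^ r * g i n - Y i ^ r * g i n) + (Z n * g i n - Y i * g i n) * Y i ^ r)
       + (- (Z n * (g i n * Y i ^ r - Y i ^ r * g i n)) + Y i * (g i n * Y i ^ r - Y i ^ r * g i n)))
       (R * (real r * (2 * \<mu>) * R ^ r) + 2 * \<mu> * R ^ r)"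
      by (intro asy_le_add0 asy_le_add 1 2 3 4)
    then have "asy_le (\<lambda>n. Z n ^ Suc r * g i n - Y i ^ Suc r * g i n) (R * (real r * (2 * \<mu>) * R ^ r) + 2 * \<mu> * R ^ r)"
      by (rule asy_le_cong) (simp add: algebra_simps)
    then show ?case
    proof (rule asy_le_mono)
      \<comment> \<open>The induction adds 2 \<open>\<mu>\<close> R^r to R times the previous bound;
        R \<ge> 1 absorbs this into the next power.\<close>
      have "2 * \<mu> * R ^ r * 1 \<le> 2 * \<mu> * R ^ r * R" using R step by (intro mult_left_mono) auto
      then show "R * (real r * (2 * \<mu>) * R ^ r) + 2 * \<mu> * R ^ r \<le> real (Suc r) * (2 * \<mu>) * R ^ Suc r"
        by (simp add: algebra_simps)
    qed
  qed
  define c where "c = real k * (2 * \<mu>) * R ^ k"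
  have c0: "0 \<le> c" unfolding c_def using R step by simp
  have Zg: "asy_le (\<lambda>n. Z n ^ k * g i n) c" if i: "i \<le> L" for i
  proof -
    have "asy_le (\<lambda>n. Y i ^ k * g i n) 0"
    proof (cases "i = 0")
      case True
      then show ?thesis by (intro asy_leI) (simp add: Y0)
    next
      case False
      moreover have "Y i ^ k \<in> B" unfolding B_def B0_def using i by auto
      ultimately show ?thesis by (intro gB') auto
    qed
    from asy_le_add0[OF locr[OF i, of k] this] show ?thesis unfolding c_def by (rule asy_le_cong) simp
  qed
  define N' where "N' i = {l. l \<le> L \<and> l \<le> i + 1 \<and> i \<le> l + 1}" for i
  have N': "finite (N' i)" "card (N' i) \<le> 3" "N' i \<subseteq> {..L}" for i
  proof -
    have "N' i \<subseteq> {i - 1, i, Suc i}" unfolding N'_def by auto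
    moreover have "card {i - 1, i, Suc i} \<le> 3" by (simp add: card_insert_if)
    ultimately show "finite (N' i)" "card (N' i) \<le> 3"
      using card_mono[of "{i - 1, i, Suc i}" "N' i"] finite_subset by auto
  qed (auto simp: N'_def)
  \<comment> \<open>Next to g i the factor Z^k may be multiplied by the sum of g l^2 over the at
    most three l meeting i. This turns bounds on Z^k g l into bounds on a matrix entry to which
    \<open>partition_norm_le\<close> applies.\<close>
  define W where "W i n = (\<Sum>l\<in>N' i. Z n ^ k * g l n * g l n)" for i n
  have W: "asy_le (W i) (3 * c)" for i
  proof -
    have "asy_le (\<lambda>n. \<Sum>l\<in>N' i. Z n ^ k * g l n * g l n) (\<Sum>l\<in>N' i. c * 1)"
    proof (intro asy_le_sum N' asy_le_mult[OF _ asy_leI[OF gn]])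
      fix l assume "l \<in> N' i" then show "asy_le (\<lambda>n. Z n ^ k * g l n) c" using N'(3) Zg by blast
    qed (use c0 in auto)
    then show ?thesis unfolding W_def[abs_def]
    proof (rule asy_le_mono)
      have "real (card (N' i)) * c \<le> 3 * c" using N'(2)[of i] c0 by (intro mult_right_mono) auto
      then show "(\<Sum>l\<in>N' i. c * 1) \<le> 3 * c" by simp
    qed
  qed
  have Wg: "g i n * W i n * g i n = g i n * Z n ^ k * g i n" if "i \<le> L" for i n
  proof -
    have "g i n = (\<Sum>l\<le>L. g l n * g l n) * g i n" by (simp add: gsum)
    also have "\<dots> = (\<Sum>l\<le>L. g l n * (g l n * g i n))" by (simp add: sum_distrib_right mult.assoc)
    also have "\<dots> = (\<Sum>l\<in>N' i. g l n * (g l n * g i n))"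
    proof (rule sum.mono_neutral_right)
      show "\<forall>l\<in>{..L} - N' i. g l n * (g l n * g i n) = 0"
      proof
        fix l assume "l \<in> {..L} - N' i"
        then have "\<not> (i \<le> l + 1 \<and> l \<le> i + 1)" unfolding N'_def by auto
        then show "g l n * (g l n * g i n) = 0" using g0[of i l n] by simp
      qed
    qed (use N' in auto)
    finally have gi: "g i n = (\<Sum>l\<in>N' i. g l n * (g l n * g i n))" .
    have "W i n * g i n = Z n ^ k * (\<Sum>l\<in>N' i. g l n * (g l n * g i n))"
      unfolding W_def by (simp add: sum_distrib_left sum_distrib_right mult.assoc)
    then show ?thesis unfolding gi[symmetric] by (simp add: mult.assoc)
  qed
  have Zk: "asy_le (\<lambda>n. Z n ^ k) (6 * c)"
  proof -
    have 1: "asy_le (\<lambda>n. \<Sum>i\<le>L. g i n * W i n * g i n) (3 * c)"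
      unfolding asy_le_def
    proof (intro allI impI)
      fix e :: real assume "0 < e"
      then have "\<forall>i\<in>{..L}. \<forall>\<^sub>F n in sequentially. norm (W i n) \<le> 3 * c + e"
        using W unfolding asy_le_def by auto
      then have "\<forall>\<^sub>F n in sequentially. \<forall>i\<in>{..L}. norm (W i n) \<le> 3 * c + e"
        by (intro eventually_ball_finite) auto
      then show "\<forall>\<^sub>F n in sequentially. norm (\<Sum>i\<le>L. g i n * W i n * g i n) \<le> 3 * c + e"
      proof eventually_elim
        case (elim n)
        show ?case by (rule partition_norm_le) (use elim gs gsum c0 \<open>0 < e\<close> in auto)
      qed
    qed
    have 2: "asy_le (\<lambda>n. - ((g i n * Z n ^ k - Z n ^ k * g i n) * g i n)) 0" for i
      by (intro asy_le_minus asy_le_mult0(1)[OF _ gn] asy_le_commutator_power[OF comZ Zn])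
    have "asy_le (\<lambda>n. (\<Sum>i\<le>L. g i n * W i n * g i n) + (\<Sum>i\<le>L. - ((g i n * Z n ^ k - Z n ^ k * g i n) * g i n))) (3 * c)"
      by (intro asy_le_add0[OF 1] asy_le_sum0 2) auto
    then have "asy_le (\<lambda>n. Z n ^ k) (3 * c)"
    proof (rule asy_le_cong)
      fix n
      have "(\<Sum>i\<le>L. g i n * W i n * g i n) + (\<Sum>i\<le>L. - ((g i n * Z n ^ k - Z n ^ k * g i n) * g i n))
        = (\<Sum>i\<le>L. Z n ^ k * (g i n * g i n))"
        unfolding sum.distrib[symmetric] by (intro sum.cong) (auto simp: Wg[unfolded mult.assoc] algebra_simps)
      also have "\<dots> = Z n ^ k" by (simp add: gsum flip: sum_distrib_left)
      finally show "(\<Sum>i\<le>L. g i n * W i n * g i n) + (\<Sum>i\<le>L. - ((g i n * Z n ^ k - Z n ^ k * g i n) * g i n)) = Z n ^ k" .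
    qed
    \<comment> \<open>The argument yields 3 c; the stated factor 6 leaves room.\<close>
    then show ?thesis by (rule asy_le_mono) (use c0 in simp)
  qed
  have "\<forall>\<^sub>F n in sequentially. norm (Z n - X) \<le> \<eta> + \<epsilon>" "\<forall>\<^sub>F n in sequentially. norm (Z n ^ k) \<le> 6 * c + \<epsilon>"
    using near_Z Zk \<open>0 < \<epsilon>\<close> unfolding asy_le_def by auto
  then have "\<forall>\<^sub>F n in sequentially. norm (Z n - X) \<le> \<eta> + \<epsilon> \<and> norm (Z n ^ k) \<le> 6 * c + \<epsilon>"
    by eventually_elim auto
  then obtain n where n: "norm (Z n - X) \<le> \<eta> + \<epsilon>" "norm (Z n ^ k) \<le> 6 * c + \<epsilon>"
    using eventually_happens'[OF sequentially_bot] by blast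
  have gL: "\<rho> (g i n) = of_real (if i = L then 1 else 0)" if "i \<le> L" for i
  proof -
    have "\<rho> (v n) = of_real 1" by (simp add: v_def hom_diff hom_one u)
    then have "\<rho> (g i n) = fc (h i) (of_real 1)" unfolding g_def by (simp only: hom_fc[OF vs h])
    also have "\<dots> = of_real (h i 1)" by (rule fc_of_real[OF h])
    finally show ?thesis using hat_1[OF that] by (simp add: h_def)
  qed
  have "\<rho> (Z n) = (\<Sum>i\<le>L. if i = L then \<rho> (Y L) else 0)"
    unfolding Z_def hom_sum by (intro sum.cong refl) (auto simp: hom_mult gL)
  then have "\<rho> (Z n) = \<rho> (Y L)" by (simp add: sum.delta)
  with n show ?thesis unfolding c_def by blast
qed

end

subsection \<open>Truncation to a nilpotent\<close>

text \<open>
  The positive element \<open>G = \<Sum>\<^sub>j N\<^bsup>2j\<^esup> X\<^sup>j X*\<^sup>j\<close> satisfies \<open>X G X* \<le> N\<^bsup>-2\<^esup> G\<close> as soon as \<open>X\<^sup>k\<close> is small,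
  so \<open>X\<close> raises the position \<open>ln G / (2 ln N)\<close>, which ranges over about \<open>[0, k - 1]\<close>, by almost 1,
  up to a small error.  Cutting \<open>X\<close> down to the part that raises the position by at least \<open>1 - 1/2k\<close>
  leaves an element which is exactly nilpotent.
\<close>

definition weight :: "real \<Rightarrow> nat \<Rightarrow> 'a::cstar1 \<Rightarrow> 'a" where
  "weight N k x = (\<Sum>j<k. (N ^ (2 * j)) *\<^sub>R (x ^ j * star (x ^ j)))"

definition position :: "real \<Rightarrow> nat \<Rightarrow> 'a::cstar1 \<Rightarrow> 'a" where
  "position N k x = inverse (2 * ln N) *\<^sub>R fc (\<lambda>t. ln (max 1 t)) (weight N k x)"

text \<open>A ramp of width 1 / (8 k) that starts at (1 - 1 / (2 k)) j. One application of x raises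
  the position by almost 1, so steps of length 1 - 1 / (2 k) leave a margin of 1 / (2 k).\<close>

definition level :: "nat \<Rightarrow> nat \<Rightarrow> real \<Rightarrow> real" where
  "level k j l = ramp (8 * real k * (l - (1 - 1 / (2 * real k)) * real j))"

text \<open>The same ramp shifted by its own width: it starts where \<open>level\<close> has reached
  1, which makes \<open>layer_upper\<close> exact, and reaches 1 at a distance 1 / (4 k) beyond the
  threshold, half of the margin.\<close>

definition upper :: "nat \<Rightarrow> nat \<Rightarrow> real \<Rightarrow> real" where
  "upper k j l = ramp (8 * real k * (l - (1 - 1 / (2 * real k)) * real j) - 1)"

definition layer :: "nat \<Rightarrow> nat \<Rightarrow> real \<Rightarrow> real" where
  "layer k j l = (if j = 0 then 1 else level k j l) - level k (Suc j) l"

text \<open>Only passages from layer j to above threshold j + 1 are kept, for j up to k - 2. From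
  the topmost layer no room is left to rise, and that part of x is dropped.\<close>

definition trunc :: "real \<Rightarrow> nat \<Rightarrow> 'a::cstar1 \<Rightarrow> 'a" where
  "trunc N k x = (\<Sum>j<k - 1. fc (upper k (Suc j)) (position N k x) * x * fc (layer k j) (position N k x))"

lemma continuous_level: "continuous_on S (level k j)"
  unfolding level_def[abs_def] by (intro continuous_intros)

lemma continuous_upper: "continuous_on S (upper k j)"
  unfolding upper_def[abs_def] by (intro continuous_intros)

lemma continuous_layer: "continuous_on S (layer k j)"
  unfolding layer_def[abs_def] by (cases "j = 0") (auto intro!: continuous_intros continuous_level)

lemma continuous_ln_max: "continuous_on S (\<lambda>t::real. ln (max 1 t))"
  by (intro continuous_intros) auto

lemma ramp_bounds: "0 \<le> ramp t" "ramp t \<le> 1"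
  by (auto simp: ramp_def)

lemma level_bounds: "0 \<le> level k j l" "level k j l \<le> 1"
  by (auto simp: level_def ramp_bounds)

lemma level_le: "k > 0 \<Longrightarrow> level k (Suc j) l \<le> level k j l"
  unfolding level_def by (intro ramp_mono mult_left_mono) (auto simp: field_simps)

lemma layer_bounds: "k > 0 \<Longrightarrow> 0 \<le> layer k j l \<and> layer k j l \<le> 1"
  using level_le[of k j l] level_bounds[of k j l] level_bounds[of k "Suc j" l] by (auto simp: layer_def)

lemma upper_bounds: "0 \<le> upper k j l" "upper k j l \<le> 1"
  by (auto simp: upper_def ramp_bounds)

text \<open>Where \<open>upper\<close> at Suc l is nonzero, all levels up to Suc l are already 1, so
  the lower layers, being differences of them, vanish.\<close>

lemma layer_upper:
  assumes "k > 0" "j \<le> l"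
  shows "layer k j t * upper k (Suc l) t = 0"
proof (cases "upper k (Suc l) t = 0")
  case False
  have *: "(1 - 1 / (2 * real k)) * real i \<le> (1 - 1 / (2 * real k)) * real (Suc l)" if "i \<le> Suc l" for i
    using assms that by (intro mult_left_mono) (auto simp: field_simps)
  from False have "1 < 8 * real k * (t - (1 - 1 / (2 * real k)) * real (Suc l))"
    by (auto simp: upper_def ramp_def)
  moreover have "8 * real k * (t - (1 - 1 / (2 * real k)) * real (Suc l)) \<le> 8 * real k * (t - (1 - 1 / (2 * real k)) * real i)"
    if "i \<le> Suc l" for i using *[OF that] by (intro mult_left_mono) auto
  ultimately have "level k i t = 1" if "i \<le> Suc l" for i
    using that unfolding level_def ramp_def by (smt (verit))
  then have "layer k j t = 0" using assms by (auto simp: layer_def)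
  then show ?thesis by simp
qed simp

lemma weight_star: "star (weight N k x) = weight N k x"
  by (simp add: weight_def star_sum star_scaleR star_mult)

lemma weight_pos:
  assumes "k > 0" "N > 0" shows "pos (weight N k x - 1)"
proof -
  have "weight N k x = (\<Sum>j<Suc (k - 1). (N ^ (2 * j)) *\<^sub>R (x ^ j * star (x ^ j)))"
    unfolding weight_def using assms by simp
  also have "\<dots> = 1 + (\<Sum>j<k - 1. (N ^ (2 * Suc j)) *\<^sub>R (x ^ Suc j * star (x ^ Suc j)))"
    by (subst sum.lessThan_Suc_shift) simp
  finally have "weight N k x - 1 = (\<Sum>j<k - 1. (N ^ (2 * Suc j)) *\<^sub>R (x ^ Suc j * star (x ^ Suc j)))" by simp
  moreover have "pos (\<Sum>j<k - 1. (N ^ (2 * Suc j)) *\<^sub>R (x ^ Suc j * star (x ^ Suc j)))"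
  proof (intro pos_sum pos_scaleR)
    fix j show "pos (x ^ Suc j * star (x ^ Suc j))" using pos_star_mult[of "star (x ^ Suc j)"] by simp
  qed (use assms in simp)
  ultimately show ?thesis by simp
qed

lemma weight_norm:
  assumes "k > 0" "N \<ge> 1" "norm x \<le> 1" shows "norm (weight N k x) \<le> real k * N ^ (2 * (k - 1))"
proof -
  have "norm (weight N k x) \<le> (\<Sum>j<k. N ^ (2 * (k - 1)))"
    unfolding weight_def
  proof (intro order_trans[OF norm_sum] sum_mono)
    fix j assume "j \<in> {..<k}"
    have "norm (x ^ j) \<le> 1" using norm_power_ineq[of x j] power_le_one[OF norm_ge_zero assms(3)] order_trans by blast
    then have "norm (x ^ j * star (x ^ j)) \<le> 1 * 1"
      by (intro order_trans[OF norm_mult_ineq] mult_mono) auto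
    then have "norm (N ^ (2 * j) *\<^sub>R (x ^ j * star (x ^ j))) \<le> N ^ (2 * j) * 1"
      using assms by (simp add: mult_left_le)
    also have "\<dots> \<le> N ^ (2 * (k - 1))" using \<open>j \<in> {..<k}\<close> assms by (simp add: power_increasing)
    finally show "norm (N ^ (2 * j) *\<^sub>R (x ^ j * star (x ^ j))) \<le> N ^ (2 * (k - 1))" .
  qed
  then show ?thesis by simp
qed

text \<open>Conjugating the weight by x shifts its terms by one, so the difference telescopes to the
  zeroth term minus the k-th. The bound on the norm of x^k puts the latter below the former.\<close>

lemma weight_raised:
  assumes "k > 0" "N \<ge> 1" "norm (x ^ k) \<le> inverse (N ^ k)"
  shows "pos (inverse (N\<^sup>2) *\<^sub>R weight N k x - x * weight N k x * star x)"
proof -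
  have N: "N > 0" using assms by simp
  define w where "w j = x ^ j * star (x ^ j)" for j
  have xw: "x * w j * star x = w (Suc j)" for j
    unfolding w_def by (simp add: star_mult star_power mult.assoc power_Suc2[of "star x"] del: power_Suc) (simp add: mult.assoc)
  define u where "u j = inverse (N\<^sup>2) *\<^sub>R (N ^ (2 * j) *\<^sub>R w j)" for j
  have "x * weight N k x * star x = (\<Sum>j<k. N ^ (2 * j) *\<^sub>R w (Suc j))"
    unfolding weight_def w_def[symmetric]
    by (simp add: sum_distrib_left sum_distrib_right xw)
  also have "\<dots> = (\<Sum>j<k. u (Suc j))"
  proof (rule sum.cong[OF refl])
    fix j
    have "inverse (N\<^sup>2) * N ^ (2 * Suc j) = N ^ (2 * j)" using N by (simp add: power2_eq_square field_simps)
    then show "N ^ (2 * j) *\<^sub>R w (Suc j) = u (Suc j)" unfolding u_def scaleR_scaleR by simp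
  qed
  also have "inverse (N\<^sup>2) *\<^sub>R weight N k x - (\<Sum>j<k. u (Suc j)) = (\<Sum>j<k. u j - u (Suc j))"
    unfolding weight_def w_def[symmetric] u_def by (simp add: scaleR_sum_right sum_subtractf)
  also have "\<dots> = u 0 - u k" by (rule sum_lessThan_telescope')
  finally have eq: "inverse (N\<^sup>2) *\<^sub>R weight N k x - x * weight N k x * star x = u 0 - u k" .
  have "norm (w k) \<le> inverse (N ^ k) * inverse (N ^ k)"
    unfolding w_def using assms(3) N by (intro order_trans[OF norm_mult_ineq] mult_mono) auto
  then have "norm (N ^ (2 * k) *\<^sub>R w k) \<le> N ^ (2 * k) * (inverse (N ^ k) * inverse (N ^ k))"
    using N by (simp add: mult_left_mono)
  also have "\<dots> = 1" using N by (simp add: power_mult power2_eq_square field_simps power_even_eq)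
  finally have "pos (of_real 1 - N ^ (2 * k) *\<^sub>R w k)"
    by (intro pos_norm_minus) (auto simp: w_def star_mult star_scaleR)
  then have "pos (inverse (N\<^sup>2) *\<^sub>R (1 - N ^ (2 * k) *\<^sub>R w k))" using N by (intro pos_scaleR) auto
  moreover have "inverse (N\<^sup>2) *\<^sub>R (1 - N ^ (2 * k) *\<^sub>R w k) = u 0 - u k"
    unfolding u_def by (simp add: w_def scaleR_diff_right)
  ultimately show ?thesis unfolding eq by simp
qed

text \<open>Chain of orders: g^2 \<le> q G turns f x g^2 (star x) f into at most q f (x G star x) f,
  the hypothesis on raising gives q c f G f, and f^2 t \<le> p ends it.\<close>

lemma raised_norm_le:
  assumes G: "between 1 R (G::'a::cstar1)" and raise: "pos (c *\<^sub>R G - x * G * star x)" "0 \<le> c"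
    and f: "continuous_on UNIV f" "\<And>t. t \<in> {1..R} \<Longrightarrow> (f t)\<^sup>2 * t \<le> p"
    and g: "continuous_on UNIV g" "\<And>t. t \<in> {1..R} \<Longrightarrow> (g t)\<^sup>2 \<le> q * t" "0 \<le> q"
  shows "(norm (fc f G * x * fc g G))\<^sup>2 \<le> p * q * c"
proof -
  note Gs = between_star[OF G]
  define a b where "a = fc f G" and "b = fc g G"
  have ab: "star a = a" "star b = b" unfolding a_def b_def by (simp_all add: fc_star Gs f g)
  define y where "y = star (a * x * b)"
  have "pos (fc (\<lambda>t. q * t) G - fc (\<lambda>t. g t * g t) G)"
    by (rule pos_diff_fc[OF G]) (use g in \<open>auto intro!: continuous_intros simp: power2_eq_square\<close>)
  then have "pos (q *\<^sub>R G - b * b)"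
    unfolding b_def fc_scale[OF Gs continuous_on_id] by (simp add: fc_mult fc_id Gs g)
  from pos_conj[OF this, of "star x * a"]
  have 1: "pos (q *\<^sub>R (a * (x * G * star x) * a) - star y * y)"
    unfolding y_def by (simp add: star_mult ab algebra_simps)
  have "pos (q *\<^sub>R (a * (c *\<^sub>R G - x * G * star x) * a))"
    using pos_scaleR[OF pos_conj[OF raise(1), of a] g(3)] ab by simp
  from pos_add[OF 1 this] have "pos ((q * c) *\<^sub>R (a * G * a) - star y * y)"
    by (simp add: algebra_simps)
  from pos_norm_mono[OF pos_star_mult this] have "(norm y)\<^sup>2 \<le> q * c * norm (a * G * a)"
    using g(3) raise(2) by (simp add: norm_star_mult)
  also have "a * G * a = fc (\<lambda>t. f t * t * f t) G"
    unfolding a_def by (simp add: fc_mult fc_id Gs f continuous_on_mult)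
  also have "norm \<dots> \<le> p"
    by (rule fc_norm_le[OF G])
      (use f in \<open>auto intro!: continuous_intros simp: power2_eq_square algebra_simps\<close>)
  finally have "(norm y)\<^sup>2 \<le> q * c * p" using g(3) raise(2) by (simp add: mult_left_mono)
  then show ?thesis unfolding y_def a_def[symmetric] b_def[symmetric] by (simp add: mult.commute mult.left_commute)
qed

lemma fc_position:
  assumes "continuous_on UNIV f"
  shows "fc f (position N k x) = fc (\<lambda>t. f (inverse (2 * ln N) * ln (max 1 t))) (weight N k x)"
proof -
  have "position N k x = fc (\<lambda>t. inverse (2 * ln N) * ln (max 1 t)) (weight N k x)"
    unfolding position_def by (rule fc_scale[symmetric]) (auto simp: weight_star continuous_ln_max)
  then show ?thesis
    by (simp only:) (rule fc_compose, auto intro!: weight_star assms continuous_intros)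
qed

lemma position_star: "star (position N k x) = position N k x"
  by (simp add: position_def star_scaleR fc_star weight_star continuous_ln_max)

lemma position_powr:
  fixes N t y :: real
  assumes "N > 1" "t \<ge> 1"
  shows "inverse (2 * ln N) * ln (max 1 t) < y \<Longrightarrow> t \<le> N powr (2 * y)"
    "y \<le> inverse (2 * ln N) * ln (max 1 t) \<Longrightarrow> N powr (2 * y) \<le> t"
proof -
  have l: "0 < ln N" using assms by simp
  assume "inverse (2 * ln N) * ln (max 1 t) < y"
  then have "ln t \<le> 2 * y * ln N" using l assms by (simp add: field_simps max_def)
  then have "exp (ln t) \<le> exp (2 * y * ln N)" by (simp only: exp_le_cancel_iff)
  then show "t \<le> N powr (2 * y)" using assms by (simp add: powr_def)
next
  have l: "0 < ln N" using assms by simp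
  assume "y \<le> inverse (2 * ln N) * ln (max 1 t)"
  then have "2 * y * ln N \<le> ln t" using l assms by (simp add: field_simps max_def)
  then have "exp (2 * y * ln N) \<le> exp (ln t)" by (simp only: exp_le_cancel_iff)
  then show "N powr (2 * y) \<le> t" using assms by (simp add: powr_def)
qed

text \<open>Both omitted parts are of the form f(G) x g(G) and are small by
  \<open>raised_norm_le\<close>: x would have to start high and fail to rise by 1 - 1 / (4 k), or
  start in the top layer, above which the weight is bounded by R.\<close>

lemma trunc_error:
  assumes k: "k > 0" and N: "N > 1" and x: "norm x \<le> 1" "norm (x ^ k) \<le> inverse (N ^ k)"
  shows "norm (trunc N k x - x) \<le> 2 * real k * N powr (- 1 / (4 * real k))"
proof -
  define G where "G = weight N k x"
  define P where "P = position N k x"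
  have Ps: "star P = P" unfolding P_def by (rule position_star)
  define R where "R = real k * N ^ (2 * (k - 1))"
  have Gb: "between 1 R G"
  proof -
    have "pos (of_real R - G)" unfolding R_def G_def
      by (intro pos_norm_minus weight_star weight_norm) (use k N x in auto)
    then show ?thesis using weight_pos[OF k, of N x] N by (simp add: between_def G_def)
  qed
  have raise: "pos (inverse (N\<^sup>2) *\<^sub>R G - x * G * star x)" "0 \<le> inverse (N\<^sup>2)"
    unfolding G_def using weight_raised[OF k _ x(2)] N by auto
  define l where "l t = inverse (2 * ln N) * ln (max 1 t)" for t
  have lc: "continuous_on UNIV l" unfolding l_def by (intro continuous_intros) auto
  have l0: "0 \<le> l t" for t unfolding l_def using N by simp
  have fl: "fc f P = fc (\<lambda>t. f (l t)) G" if "continuous_on UNIV f" for f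
    unfolding P_def l_def G_def by (rule fc_position[OF that])
  define b where "b = 1 - 1 / (2 * real k)"
  have b: "0 \<le> b" "b \<le> 1" unfolding b_def using k by (auto simp: field_simps)
  have c: "continuous_on UNIV (\<lambda>t. f (l t))" if "continuous_on UNIV f" for f :: "real \<Rightarrow> real"
    by (rule continuous_on_compose2[OF that lc]) auto
  have err: "norm (fc (\<lambda>l. 1 - upper k (Suc j) l) P * x * fc (layer k j) P) \<le> N powr (- 1 / (4 * real k))" for j
  proof -
    \<comment> \<open>The position at which \<open>upper\<close> of Suc j has reached 1. It exceeds
      the start b j of the layer by 1 - 1 / (4 k), so the product of the three bounds has exponent -
      1 / (2 k), and its root - 1 / (4 k).\<close>
    define y where "y = b * real (Suc j) + 1 / (4 * real k)"
    have "(norm (fc (\<lambda>t. 1 - upper k (Suc j) (l t)) G * x * fc (\<lambda>t. layer k j (l t)) G))\<^sup>2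
      \<le> N powr (2 * y) * N powr (- 2 * (b * real j)) * inverse (N\<^sup>2)"
    proof (rule raised_norm_le[OF Gb raise])
      fix t assume t: "t \<in> {1..R}"
      show "(1 - upper k (Suc j) (l t))\<^sup>2 * t \<le> N powr (2 * y)"
      proof (cases "l t < y")
        case True
        then have "t \<le> N powr (2 * y)" using position_powr(1)[OF N, of t y] t unfolding l_def by auto
        moreover have "(1 - upper k (Suc j) (l t))\<^sup>2 * t \<le> 1 * t"
          using upper_bounds[of k "Suc j" "l t"] t by (intro mult_right_mono power_le_one) auto
        ultimately show ?thesis by simp
      next
        case False
        then have "8 * real k * y \<le> 8 * real k * l t" by (intro mult_left_mono) auto
        moreover have "8 * real k * y = 8 * real k * (b * real (Suc j)) + 2"
          unfolding y_def using k by (simp add: distrib_left)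
        ultimately have "upper k (Suc j) (l t) = 1"
          unfolding upper_def b_def[symmetric] by (simp add: ramp_def right_diff_distrib)
        then show ?thesis by simp
      qed
      show "(layer k j (l t))\<^sup>2 \<le> N powr (- 2 * (b * real j)) * t"
      proof (cases "b * real j \<le> l t")
        case True
        then have "N powr (2 * (b * real j)) \<le> t" using position_powr(2)[OF N, of t] t unfolding l_def by auto
        then have "N powr (- 2 * (b * real j)) * N powr (2 * (b * real j)) \<le> N powr (- 2 * (b * real j)) * t"
          by (intro mult_left_mono) auto
        then have "1 \<le> N powr (- 2 * (b * real j)) * t" using N by (simp flip: powr_add)
        moreover have "(layer k j (l t))\<^sup>2 \<le> 1" using layer_bounds[OF k] by (intro power_le_one) auto
        ultimately show ?thesis by simp
      next
        case False
        then have "j \<noteq> 0" using l0[of t] by (cases "j = 0") auto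
        moreover have "8 * real k * (l t - b * real j) \<le> 0"
          using False by (intro mult_nonneg_nonpos) auto
        then have "level k j (l t) = 0" by (simp add: level_def b_def[symmetric] ramp_def)
        then have "level k (Suc j) (l t) = 0" using level_le[OF k, of j "l t"] ramp_bounds(1) by (metis level_def order_antisym)
        ultimately have "layer k j (l t) = 0" using \<open>level k j (l t) = 0\<close> by (simp add: layer_def)
        then show ?thesis using t by simp
      qed
    qed (auto intro!: continuous_intros c continuous_upper continuous_layer)
    also have "\<dots> = (N powr (- 1 / (4 * real k)))\<^sup>2"
    proof -
      have "inverse (N\<^sup>2) = N powr (- 2)" using N by (simp add: powr_minus powr_numeral)
      then have "N powr (2 * y) * N powr (- 2 * (b * real j)) * inverse (N\<^sup>2) = N powr (2 * y + - 2 * (b * real j) + - 2)"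
        by (simp only: powr_add)
      also have "2 * y + - 2 * (b * real j) + - 2 = - 1 / (4 * real k) + - 1 / (4 * real k)"
        unfolding y_def b_def using k by (simp add: field_simps)
      finally show ?thesis by (simp only: powr_add power2_eq_square)
    qed
    finally have "norm (fc (\<lambda>t. 1 - upper k (Suc j) (l t)) G * x * fc (\<lambda>t. layer k j (l t)) G) \<le> N powr (- 1 / (4 * real k))"
      by (rule power2_le_imp_le) simp
    then show ?thesis by (simp add: fl continuous_intros continuous_upper continuous_layer)
  qed
  \<comment> \<open>Partial sums of the layers telescope to 1 - th n, with th 0 = 1 and otherwise th
    n equal to the n-th level.\<close>
  define th where "th j l = (if j = 0 then 1 else level k j l)" for j l
  have th: "continuous_on UNIV (th j)" for j
    unfolding th_def[abs_def] by (cases "j = 0") (auto intro!: continuous_intros continuous_level)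
  have last: "norm (x * fc (th (k - 1)) P) \<le> real k * N powr (- 1 / (4 * real k))"
  proof -
    define j where "j = k - 1"
    have j: "real j = real k - 1" unfolding j_def using k by simp
    \<comment> \<open>Nothing is cut on the left here: the norm bound R of the weight plays the role
      of p, and the exponent becomes - 1 - 1 / k.\<close>
    have "(norm (fc (\<lambda>t. 1) G * x * fc (\<lambda>t. th j (l t)) G))\<^sup>2
      \<le> R * N powr (- 2 * (b * real j)) * inverse (N\<^sup>2)"
    proof (rule raised_norm_le[OF Gb raise])
      fix t assume t: "t \<in> {1..R}"
      show "1\<^sup>2 * t \<le> R" using t by simp
      show "(th j (l t))\<^sup>2 \<le> N powr (- 2 * (b * real j)) * t"
      proof (cases "b * real j \<le> l t")
        case True
        then have "N powr (2 * (b * real j)) \<le> t" using position_powr(2)[OF N, of t] t unfolding l_def by auto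
        then have "N powr (- 2 * (b * real j)) * N powr (2 * (b * real j)) \<le> N powr (- 2 * (b * real j)) * t"
          by (intro mult_left_mono) auto
        then have "1 \<le> N powr (- 2 * (b * real j)) * t" using N by (simp flip: powr_add)
        moreover have "(th j (l t))\<^sup>2 \<le> 1" unfolding th_def level_def using ramp_bounds by (intro power_le_one) auto
        ultimately show ?thesis by simp
      next
        case False
        then have "j \<noteq> 0" using l0[of t] by (cases "j = 0") auto
        moreover have "8 * real k * (l t - b * real j) \<le> 0"
          using False by (intro mult_nonneg_nonpos) auto
        then have "level k j (l t) = 0" by (simp add: level_def b_def[symmetric] ramp_def)
        ultimately have "th j (l t) = 0" by (simp add: th_def)
        then show ?thesis using t by simp
      qed
    qed (auto intro!: continuous_intros c th)
    also have "\<dots> \<le> (real k * N powr (- 1 / (4 * real k)))\<^sup>2"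
    proof -
      have i1: "inverse (N\<^sup>2) = N powr (- 2)" using N by (simp add: powr_minus powr_numeral)
      have i2: "N ^ (2 * (k - 1)) = N powr (2 * real j)"
        using N powr_realpow[of N "2 * (k - 1)"] by (simp add: j_def)
      have "R * N powr (- 2 * (b * real j)) * inverse (N\<^sup>2) = real k * N powr (2 * real j + - 2 * (b * real j) + - 2)"
        unfolding R_def by (simp only: i1 i2 powr_add mult.assoc)
      also have "2 * real j + - 2 * (b * real j) + - 2 = - 1 - 1 / real k"
        unfolding j b_def using k by (simp add: field_simps)
      also have "real k * N powr (- 1 - 1 / real k) \<le> real k * real k * N powr (- 1 / (4 * real k) + - 1 / (4 * real k))"
      proof (intro mult_mono powr_mono)
        have "- 1 / (4 * real k) + - 1 / (4 * real k) = - (1 / 2) * (1 / real k)" by simp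
        moreover have "0 \<le> 1 / real k" by simp
        ultimately show "- 1 - 1 / real k \<le> - 1 / (4 * real k) + - 1 / (4 * real k)" by linarith
      qed (use k N in auto)
      also have "\<dots> = (real k * N powr (- 1 / (4 * real k)))\<^sup>2"
        unfolding powr_add power2_eq_square by simp
      finally show ?thesis .
    qed
    finally have "norm (fc (\<lambda>t. 1) G * x * fc (\<lambda>t. th j (l t)) G) \<le> real k * N powr (- 1 / (4 * real k))"
      by (rule power2_le_imp_le) simp
    then show ?thesis using fc_const[OF between_star[OF Gb], of 1] by (simp add: fl th j_def)
  qed
  have "x = (\<Sum>j<n. x * fc (layer k j) P) + x * fc (th n) P" for n
  proof (induction n)
    case 0
    have "fc (th 0) P = 1" unfolding th_def using fc_const[OF Ps, of 1] by simp
    then show ?case by simp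
  next
    case (Suc n)
    have "layer k n = (\<lambda>l. th n l - th (Suc n) l)" by (auto simp: layer_def th_def)
    then have "fc (layer k n) P = fc (th n) P - fc (th (Suc n)) P" by (simp add: fc_diff Ps th)
    then have "(\<Sum>j<Suc n. x * fc (layer k j) P) + x * fc (th (Suc n)) P = (\<Sum>j<n. x * fc (layer k j) P) + x * fc (th n) P"
      by (simp add: right_diff_distrib)
    also have "\<dots> = x" by (rule Suc.IH[symmetric])
    finally show ?case by (rule sym)
  qed
  from this[of "k - 1"] have "x - trunc N k x = (\<Sum>j<k - 1. x * fc (layer k j) P - fc (upper k (Suc j)) P * x * fc (layer k j) P) + x * fc (th (k - 1)) P"
    unfolding trunc_def P_def[symmetric] by (simp add: sum_subtractf algebra_simps)
  also have "\<dots> = (\<Sum>j<k - 1. fc (\<lambda>l. 1 - upper k (Suc j) l) P * x * fc (layer k j) P) + x * fc (th (k - 1)) P"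
    by (simp add: fc_diff fc_const Ps continuous_upper algebra_simps)
  also have "norm \<dots> \<le> (\<Sum>j<k - 1. N powr (- 1 / (4 * real k))) + real k * N powr (- 1 / (4 * real k))"
    by (intro order_trans[OF norm_triangle_ineq] add_mono last order_trans[OF norm_sum] sum_mono err)
  also have "\<dots> \<le> 2 * real k * N powr (- 1 / (4 * real k))"
    using k by (simp add: algebra_simps of_nat_diff)
  finally show ?thesis by (simp add: norm_minus_commute)
qed

text \<open>By \<open>layer_upper\<close> a summand ending above j + 1 can only be followed by one
  starting in a layer beyond j. Each further factor raises the lowest index, and only k - 1 indices
  exist.\<close>

lemma trunc_nilpotent:
  assumes k: "k > 0" shows "trunc N k x ^ k = 0"
proof -
  define P where "P = position N k x"
  have Ps: "star P = P" unfolding P_def by (rule position_star)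
  define E where "E j = fc (upper k (Suc j)) P" for j
  define F where "F j = fc (layer k j) P" for j
  have FE: "F i * E j = 0" if "i \<le> j" for i j
  proof -
    have "F i * E j = fc (\<lambda>t. layer k i t * upper k (Suc j) t) P"
      unfolding F_def E_def by (simp add: fc_mult Ps continuous_layer continuous_upper)
    also have "\<dots> = 0" using fc_const[OF Ps, of 0] by (simp add: layer_upper[OF k that])
    finally show ?thesis .
  qed
  have tr: "trunc N k x = (\<Sum>j<k - 1. E j * x * F j)"
    unfolding trunc_def P_def[symmetric] E_def F_def ..
  have "\<exists>z. trunc N k x ^ Suc r = (\<Sum>j\<in>{r..<k - 1}. E j * z j)" for r
  proof (induction r)
    case 0
    show ?case by (rule exI[where x = "\<lambda>j. x * F j"]) (simp add: tr mult.assoc atLeast0LessThan)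
  next
    case (Suc r)
    then obtain z where z: "trunc N k x ^ Suc r = (\<Sum>j\<in>{r..<k - 1}. E j * z j)" by blast
    define z' where "z' i = x * F i * (\<Sum>j\<in>{r..<k - 1}. E j * z j)" for i
    have "trunc N k x ^ Suc (Suc r) = trunc N k x * trunc N k x ^ Suc r" by simp
    also have "\<dots> = (\<Sum>i<k - 1. E i * x * F i) * (\<Sum>j\<in>{r..<k - 1}. E j * z j)" by (subst z) (subst tr, rule refl)
    also have "\<dots> = (\<Sum>i<k - 1. E i * z' i)"
      by (simp add: sum_distrib_right z'_def mult.assoc)
    also have "\<dots> = (\<Sum>i\<in>{Suc r..<k - 1}. E i * z' i)"
    proof (rule sum.mono_neutral_right)
      show "\<forall>i\<in>{..<k - 1} - {Suc r..<k - 1}. E i * z' i = 0"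
      proof
        fix i assume "i \<in> {..<k - 1} - {Suc r..<k - 1}"
        then have "i \<le> r" by auto
        then have "F i * (E j * z j) = 0" if "j \<in> {r..<k - 1}" for j
          using that FE[of i j] by (simp flip: mult.assoc)
        then show "E i * z' i = 0" by (simp add: z'_def sum_distrib_left mult.assoc)
      qed
    qed auto
    finally show ?case by blast
  qed
  from this[of "k - 1"] show ?thesis using k by simp
qed

lemma trunc_norm:
  assumes k: "k > 0" "norm x \<le> 1" shows "norm (trunc N k x) \<le> real k"
proof -
  define P where "P = position N k x"
  have Pb: "between (- norm P) (norm P) P"
    unfolding P_def by (rule between_norm[OF position_star order_refl])
  have "norm (trunc N k x) \<le> (\<Sum>j<k - 1. 1 * 1 * 1)"
    unfolding trunc_def P_def[symmetric]
  proof (intro order_trans[OF norm_sum] sum_mono)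
    fix j
    have "norm (fc (upper k (Suc j)) P) \<le> 1"
      by (rule fc_norm_le[OF Pb continuous_upper]) (simp add: upper_bounds)
    moreover have "norm (fc (layer k j) P) \<le> 1"
      by (rule fc_norm_le[OF Pb continuous_layer]) (simp add: layer_bounds k)
    ultimately show "norm (fc (upper k (Suc j)) P * x * fc (layer k j) P) \<le> 1 * 1 * 1"
      using k by (intro order_trans[OF norm_mult_ineq] mult_mono) auto
  qed
  then show ?thesis by simp
qed

lemma (in star_homo) hom_trunc: "\<rho> (trunc N k x) = trunc N k (\<rho> x)"
proof -
  have "\<rho> (weight N k x) = weight N k (\<rho> x)"
    by (simp add: weight_def hom_sum hom_scaleR hom_mult hom_star hom_power)
  then have "\<rho> (position N k x) = position N k (\<rho> x)"
    by (simp add: position_def hom_scaleR hom_fc weight_star continuous_ln_max)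
  then show ?thesis
    by (simp add: trunc_def hom_sum hom_mult hom_fc position_star continuous_upper continuous_layer)
qed

lemma tendsto_fc:
  fixes a :: "'b \<Rightarrow> 'a::cstar1"
  assumes f: "continuous_on UNIV f" and a: "(a \<longlongrightarrow> l) F" "\<And>x. star (a x) = a x" "star l = l"
  shows "((\<lambda>x. fc f (a x)) \<longlongrightarrow> fc f l) F"
proof (rule tendstoI)
  fix e :: real assume "0 < e"
  obtain d where d: "0 < d" "\<And>a b::'a. star a = a \<Longrightarrow> star b = b \<Longrightarrow> norm a \<le> norm l + 1 \<Longrightarrow>
    norm b \<le> norm l + 1 \<Longrightarrow> norm (a - b) < d \<Longrightarrow> norm (fc f a - fc f b) < e"
    using fc_uniform_continuous[OF f \<open>0 < e\<close>, where 'a = 'a and R = "norm l + 1"] by blast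
  have "\<forall>\<^sub>F x in F. dist (a x) l < min d 1" by (rule tendstoD[OF a(1)]) (use d(1) in simp)
  then show "\<forall>\<^sub>F x in F. dist (fc f (a x)) (fc f l) < e"
  proof eventually_elim
    case (elim x)
    have "norm (a x) \<le> norm l + norm (a x - l)" using norm_triangle_ineq[of l "a x - l"] by simp
    then show ?case using elim d(2)[OF a(2,3), of x] by (simp add: dist_norm)
  qed
qed

text \<open>This makes the truncations a path in N, which can be subdivided into arbitrarily small
  steps for gluing.\<close>

lemma continuous_trunc: "continuous_on {1<..} (\<lambda>N. trunc N k (x::'a::cstar1))"
  unfolding continuous_on_def
proof
  fix N :: real assume N: "N \<in> {1<..}"
  have id: "((\<lambda>N. N) \<longlongrightarrow> N) (at N within {1<..})" by (rule tendsto_ident_at)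
  have w: "((\<lambda>N. weight N k x) \<longlongrightarrow> weight N k x) (at N within {1<..})"
    unfolding weight_def by (intro tendsto_intros id)
  have p: "((\<lambda>N. position N k x) \<longlongrightarrow> position N k x) (at N within {1<..})"
    unfolding position_def using N
    by (intro tendsto_intros id tendsto_fc w continuous_ln_max weight_star) auto
  show "((\<lambda>N. trunc N k x) \<longlongrightarrow> trunc N k x) (at N within {1<..})"
    unfolding trunc_def
    by (intro tendsto_intros tendsto_fc p continuous_upper continuous_layer position_star)
qed

subsection \<open>Lifting nilpotents\<close>

context star_homo
begin

text \<open>The chain runs through truncations of X for parameters from N to a large M and ends at X
  itself. Its start is nilpotent upstairs, its images are nilpotent throughout, and its end has the
  wanted image. The distance moved depends on N alone, whereas the power can be made smaller than
  any \<open>\<delta>\<close>.\<close>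

lemma improve_nilpotent:
  assumes k: "k > 0" and N: "N > 1" and X: "norm X \<le> 1" "norm (X ^ k) \<le> inverse (N ^ k)" "\<rho> X ^ k = 0"
    and "0 < \<delta>"
  shows "\<exists>Z. \<rho> Z = \<rho> X \<and> norm (Z - X) \<le> 4 * real k * N powr (- 1 / (4 * real k)) \<and> norm (Z ^ k) \<le> \<delta>"
proof -
  define \<eta> where "\<eta> = 2 * real k * N powr (- 1 / (4 * real k))"
  have \<eta>: "0 < \<eta>" unfolding \<eta>_def using k N by simp
  define R where "R = real k + 1"
  \<comment> \<open>Chosen so that the bound of \<open>glue_nilpotents\<close> equals
    \<open>\<delta>\<close> / 2; R = k + 1 bounds all members of the chain.\<close>
  define \<mu> where "\<mu> = \<delta> / (24 * real k * R ^ k)"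
  have R: "1 \<le> R" "0 < R ^ k" unfolding R_def by auto
  have \<mu>: "0 < \<mu>" unfolding \<mu>_def using R k \<open>0 < \<delta>\<close> by simp
  have \<mu>\<delta>: "6 * (real k * (2 * \<mu>) * R ^ k) = \<delta> / 2"
    unfolding \<mu>_def using k R by (simp add: field_simps)
  have "((\<lambda>N::real. 2 * real k * N powr (- 1 / (4 * real k))) \<longlongrightarrow> 2 * real k * 0) at_top"
    using k by (intro tendsto_intros tendsto_neg_powr filterlim_ident) auto
  then have "\<forall>\<^sub>F N in at_top. 2 * real k * N powr (- 1 / (4 * real k)) < \<mu>"
    by (rule order_tendstoD(2)) (use \<mu> in simp)
  then have "\<forall>\<^sub>F M in at_top. 2 * real k * M powr (- 1 / (4 * real k)) < \<mu> \<and> N < M"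
    using eventually_gt_at_top by (rule eventually_conj)
  then obtain M where M: "2 * real k * M powr (- 1 / (4 * real k)) < \<mu>" "N < M"
    by (auto simp: eventually_at_top_linorder)
  have "uniformly_continuous_on {N..M} (\<lambda>N. trunc N k (\<rho> X))"
    by (intro compact_uniformly_continuous continuous_on_subset[OF continuous_trunc]) (use N in auto)
  then obtain d where d: "0 < d" "\<And>s t. s \<in> {N..M} \<Longrightarrow> t \<in> {N..M} \<Longrightarrow> \<bar>s - t\<bar> < d \<Longrightarrow>
    norm (trunc s k (\<rho> X) - trunc t k (\<rho> X)) < \<mu>"
    using \<mu> unfolding uniformly_continuous_on_def dist_norm by (metis abs_minus_commute real_norm_def)
  obtain L :: nat where L: "real L > (M - N) / d" using reals_Archimedean2 by blast
  have L0: "0 < real L" using L M d(1) by (smt (verit) divide_nonneg_pos)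
  define n where "n i = N + real i * ((M - N) / real L)" for i
  have n: "N \<le> n i \<and> n i \<le> M" if "i \<le> L" for i
  proof -
    have "real i * ((M - N) / real L) \<le> real L * ((M - N) / real L)"
      using that M L0 by (intro mult_right_mono) auto
    then show ?thesis unfolding n_def using M L0 by simp
  qed
  have nL: "n L = M" "n 0 = N" unfolding n_def using L0 by auto
  have nd: "\<bar>n (Suc i) - n i\<bar> < d" for i
  proof -
    have "n (Suc i) - n i = (M - N) / real L" unfolding n_def of_nat_Suc distrib_right by simp
    also have "\<dots> < d" using L L0 d(1) by (simp add: field_simps)
    finally have "n (Suc i) - n i < d" .
    moreover have "0 \<le> n (Suc i) - n i" unfolding n_def of_nat_Suc distrib_right using M L0 by simp
    ultimately show ?thesis by simp
  qed
  have rX: "norm (\<rho> X) \<le> 1" using hom_norm_le X(1) order_trans by blast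
  have te: "norm (trunc (n i) k (\<rho> X) - \<rho> X) \<le> 2 * real k * n i powr (- 1 / (4 * real k))" if "i \<le> L" for i
    by (rule trunc_error[OF k _ rX]) (use n[OF that] N X(3) in auto)
  \<comment> \<open>The jump from the last truncation, at M, to X is below \<open>\<mu>\<close> in
    the image by the choice of M.\<close>
  define Y where "Y i = (if i \<le> L then trunc (n i) k X else X)" for i
  have "\<exists>Z. \<rho> Z = \<rho> (Y (Suc L)) \<and> norm (Z - X) \<le> \<eta> + min \<eta> (\<delta> / 2) \<and>
    norm (Z ^ k) \<le> 6 * (real k * (2 * \<mu>) * R ^ k) + min \<eta> (\<delta> / 2)"
  proof (rule glue_nilpotents)
    show "norm (Y i) \<le> R" for i
      unfolding Y_def R_def using trunc_norm[OF k X(1), of "n i"] X(1) by auto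
    show "Y 0 ^ k = 0" by (simp add: Y_def trunc_nilpotent[OF k])
    show "\<rho> (Y i) ^ k = 0" for i by (simp add: Y_def hom_trunc trunc_nilpotent[OF k] X)
    show "norm (\<rho> (Y (Suc i)) - \<rho> (Y i)) \<le> \<mu>" if "i < Suc L" for i
    proof (cases "i = L")
      case True
      then show ?thesis using te[of L] M by (simp add: Y_def hom_trunc norm_minus_commute nL)
    next
      case False
      then have "norm (trunc (n (Suc i)) k (\<rho> X) - trunc (n i) k (\<rho> X)) < \<mu>"
        using d(2)[OF _ _ nd] n that by auto
      then show ?thesis using False that by (simp add: Y_def hom_trunc)
    qed
    show "norm (Y 0 - X) \<le> \<eta>"
      using trunc_error[OF k N X(1,2)] by (simp add: Y_def nL \<eta>_def)
    show "norm (\<rho> (Y i) - \<rho> X) \<le> \<eta>" for i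
    proof (cases "i \<le> L")
      case True
      have "n i powr (- 1 / (4 * real k)) \<le> N powr (- 1 / (4 * real k))"
        using n[OF True] N by (intro powr_mono2') auto
      then have "2 * real k * n i powr (- 1 / (4 * real k)) \<le> \<eta>" unfolding \<eta>_def by (intro mult_left_mono) auto
      then show ?thesis using te[OF True] True by (simp add: Y_def hom_trunc)
    qed (use \<eta> in \<open>simp add: Y_def\<close>)
  qed (use R \<mu> \<eta> \<open>0 < \<delta>\<close> in auto)
  then obtain Z where "\<rho> Z = \<rho> (Y (Suc L))" "norm (Z - X) \<le> \<eta> + min \<eta> (\<delta> / 2)"
    "norm (Z ^ k) \<le> \<delta> / 2 + min \<eta> (\<delta> / 2)" unfolding \<mu>\<delta> by blast
  then show ?thesis unfolding \<eta>_def by (intro exI[where x = Z]) (auto simp: Y_def)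
qed

text \<open>The starting point of the iteration. The chain consists of the multiples (i / L) X from
  0 to X: its first member is nilpotent upstairs, and every image is nilpotent because multiples of
  a nilpotent are.\<close>

lemma almost_nilpotent_lift:
  assumes k: "k > 0" and X: "norm X \<le> 1 / 2" "\<rho> X ^ k = 0" and "0 < \<delta>"
  shows "\<exists>Z. \<rho> Z = \<rho> X \<and> norm Z \<le> 3 / 4 \<and> norm (Z ^ k) \<le> \<delta>"
proof -
  obtain L :: nat where "real L > 24 * real k / \<delta>" using reals_Archimedean2 by blast
  moreover have "0 \<le> 24 * real k / \<delta>" using \<open>0 < \<delta>\<close> by simp
  ultimately have "24 * real k / \<delta> < real L" "0 < real L" by linarith+
  then have L: "0 < real L" "12 * real k / real L \<le> \<delta> / 2"
    using \<open>0 < \<delta>\<close> by (simp_all add: pos_divide_less_eq pos_divide_le_eq mult.commute)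
  define Y where "Y i = (real i / real L) *\<^sub>R X" for i
  have rX: "norm (\<rho> X) \<le> 1 / 2" using hom_norm_le X(1) order_trans by blast
  have scale: "\<bar>c\<bar> * norm (\<rho> X) \<le> \<bar>c\<bar> * (1 / 2)" "\<bar>c\<bar> * norm X \<le> \<bar>c\<bar> * (1 / 2)" for c :: real
    by (rule mult_left_mono[OF rX abs_ge_zero], rule mult_left_mono[OF X(1) abs_ge_zero])
  have frac: "real i / real L \<le> 1" if "i \<le> L" for i using that L by simp
  have "\<exists>Z. \<rho> Z = \<rho> (Y L) \<and> norm (Z - 0) \<le> 1 / 2 + min (1/4) (\<delta> / 2) \<and>
    norm (Z ^ k) \<le> 6 * (real k * (2 * (1 / real L)) * 1 ^ k) + min (1/4) (\<delta> / 2)"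
  proof (rule glue_nilpotents)
    show "norm (Y i) \<le> 1" if "i \<le> L" for i
      using scale(2)[of "real i / real L"] frac[OF that] by (simp add: Y_def)
    show "Y 0 ^ k = 0" using k by (simp add: Y_def zero_power)
    show "\<rho> (Y i) ^ k = 0" for i using X by (simp add: Y_def hom_scaleR scaleR_power)
    show "norm (\<rho> (Y (Suc i)) - \<rho> (Y i)) \<le> 1 / real L" for i
    proof -
      have "\<rho> (Y (Suc i)) - \<rho> (Y i) = (1 / real L) *\<^sub>R \<rho> X"
        unfolding Y_def hom_scaleR scaleR_diff_left[symmetric] by (simp add: diff_divide_distrib[symmetric])
      moreover have "norm (\<rho> X) \<le> 1" using rX by simp
      ultimately show ?thesis by (simp add: divide_right_mono)
    qed
    show "norm (\<rho> (Y i) - \<rho> 0) \<le> 1 / 2" if "i \<le> L" for i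
    proof -
      have "(real i / real L) * norm (\<rho> X) \<le> 1 * (1 / 2)" using frac[OF that] rX by (intro mult_mono) auto
      then show ?thesis by (simp add: Y_def hom_scaleR)
    qed
  qed (use L \<open>0 < \<delta>\<close> in \<open>auto simp: Y_def\<close>)
  then obtain Z where Z: "\<rho> Z = \<rho> (Y L)" "norm Z \<le> 1 / 2 + min (1/4) (\<delta> / 2)"
    "norm (Z ^ k) \<le> 12 * real k / real L + min (1/4) (\<delta> / 2)" by (auto simp: mult.assoc)
  moreover have "Y L = X" unfolding Y_def using L by simp
  ultimately show ?thesis using L(2) by (intro exI[where x = Z]) auto
qed

text \<open>Iterating \<open>improve_nilpotent\<close> gives a Cauchy sequence with constant image
  whose k-th powers tend to 0. X is first scaled down, because truncation requires
  contractions.\<close>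

lemma nilpotent_lift:
  assumes k: "k > 0" and X: "\<rho> X ^ k = 0"
  shows "\<exists>Y. \<rho> Y = \<rho> X \<and> Y ^ k = 0"
proof -
  define c where "c = inverse (2 * (norm X + 1))"
  have c: "0 < c" unfolding c_def by (simp add: add_nonneg_pos)
  define X' where "X' = c *\<^sub>R X"
  have X': "norm X' \<le> 1 / 2" "\<rho> X' ^ k = 0"
  proof -
    have "norm X' = norm X / (2 * (norm X + 1))" unfolding X'_def c_def by (simp add: field_simps abs_of_nonneg)
    also have "\<dots> \<le> 1 / 2" by (subst pos_divide_le_eq) (auto simp: add_nonneg_pos)
    finally show "norm X' \<le> 1 / 2" .
    show "\<rho> X' ^ k = 0" unfolding X'_def using X by (simp add: hom_scaleR scaleR_power)
  qed
  have "\<exists>N>1. 4 * real k * N powr (- 1 / (4 * real k)) \<le> (1/2) ^ (m + 4)" for m :: nat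
  proof -
    have "((\<lambda>N::real. 4 * real k * N powr (- 1 / (4 * real k))) \<longlongrightarrow> 4 * real k * 0) at_top"
      using k by (intro tendsto_intros tendsto_neg_powr filterlim_ident) auto
    then have "\<forall>\<^sub>F N in at_top. 4 * real k * N powr (- 1 / (4 * real k)) < (1/2) ^ (m + 4)"
      by (rule order_tendstoD(2)) simp
    then have "\<forall>\<^sub>F N in at_top. 4 * real k * N powr (- 1 / (4 * real k)) < (1/2) ^ (m + 4) \<and> 1 < N"
      using eventually_gt_at_top by (rule eventually_conj)
    then show ?thesis using less_imp_le by (fastforce simp: eventually_at_top_linorder)
  qed
  then obtain N where N: "\<And>m. N m > 1" "\<And>m. 4 * real k * N m powr (- 1 / (4 * real k)) \<le> (1/2) ^ (m + 4)"
    by metis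
  \<comment> \<open>The first bound is what the next improvement step with parameter N m demands,
    the second makes the powers vanish in the limit.\<close>
  define \<delta> where "\<delta> m = min (inverse (N m ^ k)) ((1/2) ^ m)" for m
  have \<delta>: "0 < \<delta> m" for m unfolding \<delta>_def using N(1)[of m] by simp
  \<comment> \<open>The norm budget starts at 3/4 and grows by less than what remains to 1, so every
    member of the sequence stays a contraction.\<close>
  define Q where "Q m Z \<longleftrightarrow> \<rho> Z = \<rho> X' \<and> norm Z \<le> 1 - (1/2) ^ (m + 2) \<and> norm (Z ^ k) \<le> \<delta> m" for m Z
  have "\<exists>f. \<forall>m. Q m (f m) \<and> norm (f (Suc m) - f m) \<le> (1/2) ^ (m + 4)"
  proof (rule dependent_nat_choice)
    show "\<exists>Z. Q 0 Z" using almost_nilpotent_lift[OF k X' \<delta>[of 0]] unfolding Q_def by auto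
    fix Z m assume Q: "Q m Z"
    have "norm Z \<le> 1" "norm (Z ^ k) \<le> inverse (N m ^ k)" "\<rho> Z ^ k = 0"
      using Q X'(2) unfolding Q_def \<delta>_def by (auto intro: order_trans)
    from improve_nilpotent[OF k N(1) this \<delta>[of "Suc m"]]
    obtain W where W: "\<rho> W = \<rho> Z" "norm (W - Z) \<le> (1/2) ^ (m + 4)" "norm (W ^ k) \<le> \<delta> (Suc m)"
      using N(2)[of m] order_trans by blast
    have "norm W \<le> norm Z + norm (W - Z)" using norm_triangle_ineq[of Z "W - Z"] by simp
    also have "\<dots> \<le> 1 - (1/2) ^ (m + 2) + (1/2) ^ (m + 4)" using Q W(2) unfolding Q_def by simp
    also have "\<dots> \<le> 1 - (1/2) ^ (Suc m + 2)" by (simp add: power_add eval_nat_numeral)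
    finally show "\<exists>W. Q (Suc m) W \<and> norm (W - Z) \<le> (1/2) ^ (m + 4)"
      using W Q unfolding Q_def by auto
  qed
  then obtain f where f: "\<And>m. Q m (f m)" "\<And>m. norm (f (Suc m) - f m) \<le> (1/2) ^ (m + 4)" by blast
  have "summable (\<lambda>m. f (Suc m) - f m)"
  proof (rule summable_comparison_test'[where N = 0])
    show "summable (\<lambda>m. (1/2::real) ^ m)" by (rule summable_geometric) simp
    show "norm (f (Suc m) - f m) \<le> (1/2) ^ m" for m
      using f(2)[of m] by (rule order_trans) (simp add: power_add power_le_one)
  qed
  then have "convergent (\<lambda>n. \<Sum>i<n. f (Suc i) - f i)" by (simp add: summable_iff_convergent)
  then have "convergent (\<lambda>n. (f n - f 0) + f 0)"
    unfolding sum_lessThan_telescope by (intro convergent_add convergent_const)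
  then obtain W where W: "f \<longlonglongrightarrow> W" by (auto simp: convergent_def)
  have "\<rho> (f m) = \<rho> X'" for m using f(1) unfolding Q_def by blast
  then have "\<rho> W = \<rho> X'" using hom_tendsto[OF W] by (simp add: LIMSEQ_const_iff)
  moreover have "W ^ k = 0"
  proof -
    have "norm (f m ^ k) \<le> (1/2) ^ m" for m using f(1)[of m] unfolding Q_def \<delta>_def by auto
    then have "(\<lambda>m. f m ^ k) \<longlonglongrightarrow> 0"
      by (intro Lim_null_comparison[OF always_eventually[OF allI] LIMSEQ_power_zero]) auto
    then show ?thesis using tendsto_power[OF W, of k] LIMSEQ_unique by blast
  qed
  ultimately show ?thesis
    using c by (intro exI[where x = "inverse c *\<^sub>R W"]) (auto simp: X'_def hom_scaleR scaleR_power)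
qed

end

subsection \<open>The bounded families over all C*-algebras on a type\<close>

text \<open>
  Every carrier-based C*-algebra on a subset of \<open>'a\<close> is a coordinate of the algebra of bounded families
  indexed by all such C*-algebras.  This makes the type class results available for them.
\<close>

typedef 'a cfam = "{F :: 'a cstar \<Rightarrow> 'a. (\<forall>A. if cstar_algebra A then F A \<in> carrier A else F A = undefined) \<and>
    (\<exists>K. \<forall>A. cstar_algebra A \<longrightarrow> nrm A (F A) \<le> K)}"
proof -
  have "nrm A \<zero>\<^bsub>A\<^esub> \<le> 0" "\<zero>\<^bsub>A\<^esub> \<in> carrier A" if "cstar_algebra A" for A :: "'a cstar"
  proof -
    interpret cstar_algebra A by fact
    show "\<zero>\<^bsub>A\<^esub> \<in> carrier A" "nrm A \<zero>\<^bsub>A\<^esub> \<le> 0" using nrm_eq_zero_iff[of "\<zero>\<^bsub>A\<^esub>"] by auto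
  qed
  then show ?thesis
    by (intro exI[where x = "\<lambda>A. if cstar_algebra A then \<zero>\<^bsub>A\<^esub> else undefined"]) auto
qed

definition cfun :: "('a cstar \<Rightarrow> 'a) \<Rightarrow> 'a cfam" where
  "cfun F = Abs_cfam (\<lambda>A. if cstar_algebra A then F A else undefined)"

lemma cfam_closed [simp]: "cstar_algebra A \<Longrightarrow> Rep_cfam F A \<in> carrier A"
  using Rep_cfam[of F] by (auto dest: spec[where x = A])

lemma cfam_bounded: "\<exists>K. \<forall>A. cstar_algebra A \<longrightarrow> nrm A (Rep_cfam F A) \<le> K"
  using Rep_cfam[of F] by auto

lemma cfun_rep:
  assumes "\<And>A. cstar_algebra A \<Longrightarrow> F A \<in> carrier A" "\<And>A. cstar_algebra A \<Longrightarrow> nrm A (F A) \<le> K" "cstar_algebra A"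
  shows "Rep_cfam (cfun F) A = F A"
  unfolding cfun_def using assms by (subst Abs_cfam_inverse) auto

lemma cfam_eqI:
  assumes "\<And>A. cstar_algebra A \<Longrightarrow> Rep_cfam F A = Rep_cfam G A"
  shows "F = G"
proof -
  have "Rep_cfam F A = Rep_cfam G A" for A
    using Rep_cfam[of F] Rep_cfam[of G] assms by (cases "cstar_algebra A") (auto dest!: spec[where x = A])
  then show ?thesis by (simp add: Rep_cfam_inject[symmetric] ext)
qed

section \<open>Elementary consequences of the carrier-based axioms\<close>

context cstar_algebra
begin

lemma nrm_zero: "nrm A \<zero> = 0"
  by (simp add: nrm_eq_zero_iff)

lemma scale_zero: "c \<odot> \<zero> = \<zero>"
  using nrm_scale[of \<zero> c] nrm_eq_zero_iff[OF scale_closed[of \<zero> c]] by (simp add: nrm_zero)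

lemma nrm_minus: assumes "x \<in> carrier A" shows "nrm A (\<ominus> x) = nrm A x"
proof -
  have "x \<oplus> (- 1) \<odot> x = (1 + - 1) \<odot> x" using assms by (simp only: scale_add_left scale_one)
  also have "\<dots> = \<zero>" using nrm_scale[OF assms, of 0] nrm_eq_zero_iff[OF scale_closed[OF assms, of 0]] by simp
  finally have "\<ominus> x = (- 1) \<odot> x" using assms scale_closed minus_equality a_comm by metis
  then show ?thesis using nrm_scale[OF assms, of "- 1"] by simp
qed

lemma mult_zero: "x \<in> carrier A \<Longrightarrow> x \<otimes> \<zero> = \<zero>" "x \<in> carrier A \<Longrightarrow> \<zero> \<otimes> x = \<zero>"
proof -
  assume x: "x \<in> carrier A"
  have "nrm A (x \<otimes> \<zero>) \<le> 0" "nrm A (\<zero> \<otimes> x) \<le> 0"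
    using nrm_mult[OF x zero_closed] nrm_mult[OF zero_closed x] by (simp_all add: nrm_zero)
  then show "x \<otimes> \<zero> = \<zero>" "\<zero> \<otimes> x = \<zero>"
    using nrm_nonneg nrm_eq_zero_iff mult_closed x zero_closed by (meson order_antisym)+
qed

lemma adj_zero: "adj A \<zero> = \<zero>"
  using adj_scale[of \<zero> 0] nrm_scale[of "adj A \<zero>" 0] nrm_eq_zero_iff
  by (metis adj_closed scale_closed scale_zero complex_cnj_zero mult_zero_left norm_zero zero_closed)

lemma nrm_adj: assumes x: "x \<in> carrier A" shows "nrm A (adj A x) = nrm A x"
proof -
  have le: "nrm A x \<le> nrm A (adj A x)" if x: "x \<in> carrier A" for x
  proof (cases "nrm A x = 0")
    case False
    have "nrm A x * nrm A x \<le> nrm A (adj A x) * nrm A x"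
      using cstar_identity[OF x] nrm_mult[OF adj_closed[OF x] x] by (simp add: power2_eq_square)
    then show ?thesis using False nrm_nonneg[OF x] by simp
  qed (simp add: nrm_nonneg adj_closed x)
  show ?thesis using le[OF x] le[OF adj_closed[OF x]] adj_adj[OF x] by simp
qed

end

definition cfam_scale :: "complex \<Rightarrow> 'a cfam \<Rightarrow> 'a cfam" where
  "cfam_scale c F = cfun (\<lambda>A. c \<odot>\<^bsub>A\<^esub> Rep_cfam F A)"

definition cfam_star :: "'a cfam \<Rightarrow> 'a cfam" where
  "cfam_star F = cfun (\<lambda>A. adj A (Rep_cfam F A))"

lemma abelian_group_cstar: "cstar_algebra A \<Longrightarrow> abelian_group A"
  by (simp add: cstar_algebra_def)

instantiation cfam :: (type) real_normed_algebra
begin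

definition "0 = cfun (\<lambda>A. \<zero>\<^bsub>A\<^esub>)"
definition "F + G = cfun (\<lambda>A. Rep_cfam F A \<oplus>\<^bsub>A\<^esub> Rep_cfam G A)"
definition "- F = cfun (\<lambda>A. \<ominus>\<^bsub>A\<^esub> Rep_cfam F A)"
definition "F - G = F + - (G :: 'a cfam)"
definition "F * G = cfun (\<lambda>A. Rep_cfam F A \<otimes>\<^bsub>A\<^esub> Rep_cfam G A)"
definition "scaleR r F = cfam_scale (complex_of_real r) (F :: 'a cfam)"
text \<open>The inserted 0 makes the set nonempty even if no record on this type were a
  C*-algebra.\<close>

definition "norm F = Sup (insert 0 {nrm A (Rep_cfam F A) | A. cstar_algebra A})"
definition "dist F G = norm (F - G :: 'a cfam)"
definition "sgn F = scaleR (inverse (norm F)) (F :: 'a cfam)"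
definition "uniformity = (INF e\<in>{0<..}. principal {(F, G). dist F (G :: 'a cfam) < e})"
definition "open U = (\<forall>F\<in>U. eventually (\<lambda>(F', G). F' = F \<longrightarrow> G \<in> U) (uniformity :: ('a cfam \<times> 'a cfam) filter))"

lemma nrm_le_norm: assumes "cstar_algebra A" shows "nrm A (Rep_cfam F A) \<le> norm F"
proof -
  obtain K where "\<forall>A. cstar_algebra A \<longrightarrow> nrm A (Rep_cfam F A) \<le> K" using cfam_bounded by blast
  then have "bdd_above (insert 0 {nrm A (Rep_cfam F A) | A. cstar_algebra A})"
    by (auto intro!: bdd_aboveI[where M = K])
  then show ?thesis unfolding norm_cfam_def by (rule cSup_upper[rotated]) (use assms in auto)
qed

lemma norm_cfam_le: "0 \<le> c \<Longrightarrow> (\<And>A. cstar_algebra A \<Longrightarrow> nrm A (Rep_cfam F A) \<le> c) \<Longrightarrow> norm F \<le> c"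
  unfolding norm_cfam_def by (rule cSup_least) auto

lemma norm_cfam_nonneg: "0 \<le> norm (F :: 'a cfam)"
proof -
  obtain K where "\<forall>A. cstar_algebra A \<longrightarrow> nrm A (Rep_cfam F A) \<le> K" using cfam_bounded by blast
  then have "bdd_above (insert 0 {nrm A (Rep_cfam F A) | A. cstar_algebra A})"
    by (auto intro!: bdd_aboveI[where M = "max 0 K"])
  then show ?thesis unfolding norm_cfam_def by (rule cSup_upper[rotated]) auto
qed

lemma rep_zero: "cstar_algebra A \<Longrightarrow> Rep_cfam 0 A = \<zero>\<^bsub>A\<^esub>"
  unfolding zero_cfam_def
  by (rule cfun_rep[where K = 0]) (auto simp: cstar_algebra.nrm_zero cstar_algebra_def abelian_group.axioms abelian_monoid.zero_closed)

lemma rep_add: assumes "cstar_algebra A" shows "Rep_cfam (F + G) A = Rep_cfam F A \<oplus>\<^bsub>A\<^esub> Rep_cfam G A"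
  unfolding plus_cfam_def
proof (rule cfun_rep[where K = "norm F + norm G"])
  fix A :: "'a cstar" assume A: "cstar_algebra A"
  then interpret cstar_algebra A .
  show "Rep_cfam F A \<oplus>\<^bsub>A\<^esub> Rep_cfam G A \<in> carrier A" using A by simp
  show "nrm A (Rep_cfam F A \<oplus>\<^bsub>A\<^esub> Rep_cfam G A) \<le> norm F + norm G"
    using nrm_triangle[OF cfam_closed[OF A] cfam_closed[OF A]] nrm_le_norm[OF A] by (meson add_mono order_trans)
qed (rule assms)

lemma rep_minus: assumes "cstar_algebra A" shows "Rep_cfam (- F) A = \<ominus>\<^bsub>A\<^esub> Rep_cfam F A"
  unfolding uminus_cfam_def
proof (rule cfun_rep[where K = "norm F"])
  fix A :: "'a cstar" assume A: "cstar_algebra A"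
  then interpret cstar_algebra A .
  show "\<ominus>\<^bsub>A\<^esub> Rep_cfam F A \<in> carrier A" using A by simp
  show "nrm A (\<ominus>\<^bsub>A\<^esub> Rep_cfam F A) \<le> norm F"
    using nrm_minus[OF cfam_closed[OF A]] nrm_le_norm[OF A] by simp
qed (rule assms)

lemma rep_mult: assumes "cstar_algebra A" shows "Rep_cfam (F * G) A = Rep_cfam F A \<otimes>\<^bsub>A\<^esub> Rep_cfam G A"
  unfolding times_cfam_def
proof (rule cfun_rep[where K = "norm F * norm G"])
  fix A :: "'a cstar" assume A: "cstar_algebra A"
  then interpret cstar_algebra A .
  show "Rep_cfam F A \<otimes>\<^bsub>A\<^esub> Rep_cfam G A \<in> carrier A" using A by (simp add: mult_closed)
  show "nrm A (Rep_cfam F A \<otimes>\<^bsub>A\<^esub> Rep_cfam G A) \<le> norm F * norm G"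
    by (rule order_trans[OF nrm_mult[OF cfam_closed[OF A] cfam_closed[OF A]]])
      (intro mult_mono nrm_le_norm A norm_cfam_nonneg nrm_nonneg cfam_closed)
qed (rule assms)

lemma rep_cscale: fixes F :: "'a cfam" assumes "cstar_algebra A" shows "Rep_cfam (cfam_scale c F) A = c \<odot>\<^bsub>A\<^esub> Rep_cfam F A"
  unfolding cfam_scale_def
proof (rule cfun_rep[where K = "cmod c * norm F"])
  fix A :: "'a cstar" assume A: "cstar_algebra A"
  then interpret cstar_algebra A .
  show "c \<odot>\<^bsub>A\<^esub> Rep_cfam F A \<in> carrier A" using A by (simp add: scale_closed)
  show "nrm A (c \<odot>\<^bsub>A\<^esub> Rep_cfam F A) \<le> cmod c * norm F"
    unfolding nrm_scale[OF cfam_closed[OF A]] by (intro mult_left_mono nrm_le_norm A) simp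
qed (rule assms)

lemma rep_star: fixes F :: "'a cfam" assumes "cstar_algebra A" shows "Rep_cfam (cfam_star F) A = adj A (Rep_cfam F A)"
  unfolding cfam_star_def
proof (rule cfun_rep[where K = "norm F"])
  fix A :: "'a cstar" assume A: "cstar_algebra A"
  then interpret cstar_algebra A .
  show "adj A (Rep_cfam F A) \<in> carrier A" using A by (simp add: adj_closed)
  show "nrm A (adj A (Rep_cfam F A)) \<le> norm F"
    using nrm_adj[OF cfam_closed[OF A]] nrm_le_norm[OF A] by simp
qed (rule assms)

lemmas rep_simps = rep_zero rep_add rep_minus rep_mult rep_cscale rep_star

lemma cfam_scale_ops:
  fixes F G :: "'a cfam"
  shows "cfam_scale (c + d) F = cfam_scale c F + cfam_scale d F"
    "cfam_scale c (F + G) = cfam_scale c F + cfam_scale c G"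
    "cfam_scale c (cfam_scale d F) = cfam_scale (c * d) F"
    "cfam_scale c F * G = cfam_scale c (F * G)"
    "F * cfam_scale c G = cfam_scale c (F * G)"
    "cfam_scale 1 F = F"
  by (auto intro!: cfam_eqI simp: rep_simps cstar_algebra.scale_add_left cstar_algebra.scale_add_right
      cstar_algebra.scale_scale cstar_algebra.scale_mult_left cstar_algebra.scale_mult_right cstar_algebra.scale_one)

lemma norm_cfam_scale: "norm (cfam_scale c F) = cmod c * norm (F :: 'a cfam)"
proof -
  have sc: "norm (cfam_scale c F) \<le> cmod c * norm F" for c and F :: "'a cfam"
  proof (rule norm_cfam_le)
    fix A :: "'a cstar" assume A: "cstar_algebra A"
    show "nrm A (Rep_cfam (cfam_scale c F) A) \<le> cmod c * norm F"
      using cstar_algebra.nrm_scale[OF A cfam_closed[OF A], of c F] nrm_le_norm[OF A, of F]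
      by (simp add: rep_cscale A mult_left_mono)
  qed (simp add: norm_cfam_nonneg)
  show ?thesis
  proof (cases "c = 0")
    case True
    then show ?thesis using sc[of 0 F] norm_cfam_nonneg[of "cfam_scale 0 F"] by simp
  next
    case False
    have "F = cfam_scale (inverse c) (cfam_scale c F)"
      using False by (simp add: cfam_scale_ops)
    then have "norm F \<le> cmod (inverse c) * norm (cfam_scale c F)" using sc by metis
    then have "cmod c * norm F \<le> norm (cfam_scale c F)"
      using False by (simp add: norm_inverse norm_divide field_simps)
    then show ?thesis using sc[of c F] by simp
  qed
qed

instance
proof
  fix F G H :: "'a cfam" and r s :: real
  note ag = abelian_group_cstar abelian_group.axioms(1)[OF abelian_group_cstar]
  show "F + G + H = F + (G + H)"
    by (rule cfam_eqI) (simp add: rep_simps ag abelian_monoid.a_assoc)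
  show "F + G = G + F"
    by (rule cfam_eqI) (simp add: rep_simps ag abelian_monoid.a_comm)
  show "0 + F = F"
    by (rule cfam_eqI) (simp add: rep_simps ag abelian_monoid.l_zero)
  show "- F + F = 0"
    by (rule cfam_eqI) (simp add: rep_simps ag abelian_group.l_neg)
  show "F - G = F + - G" by (rule minus_cfam_def)
  show "F * G * H = F * (G * H)"
    by (rule cfam_eqI) (simp add: rep_simps cstar_algebra.mult_assoc)
  show "(F + G) * H = F * H + G * H"
    by (rule cfam_eqI) (simp add: rep_simps cstar_algebra.mult_distr_right)
  show "F * (G + H) = F * G + F * H"
    by (rule cfam_eqI) (simp add: rep_simps cstar_algebra.mult_distr_left)
  show "r *\<^sub>R (F + G) = r *\<^sub>R F + r *\<^sub>R G" by (simp add: scaleR_cfam_def cfam_scale_ops)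
  show "(r + s) *\<^sub>R F = r *\<^sub>R F + s *\<^sub>R F" by (simp add: scaleR_cfam_def cfam_scale_ops)
  show "r *\<^sub>R s *\<^sub>R F = (r * s) *\<^sub>R F" by (simp add: scaleR_cfam_def cfam_scale_ops)
  show "1 *\<^sub>R F = F" by (simp add: scaleR_cfam_def cfam_scale_ops)
  show "r *\<^sub>R F * G = r *\<^sub>R (F * G)" by (simp add: scaleR_cfam_def cfam_scale_ops)
  show "F * r *\<^sub>R G = r *\<^sub>R (F * G)" by (simp add: scaleR_cfam_def cfam_scale_ops)
  show "dist F G = norm (F - G)" by (rule dist_cfam_def)
  show "sgn F = inverse (norm F) *\<^sub>R F" by (rule sgn_cfam_def)
  show "uniformity = (INF e\<in>{0<..}. principal {(F, G). dist F (G :: 'a cfam) < e})" by (rule uniformity_cfam_def)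
  show "open U = (\<forall>F\<in>U. eventually (\<lambda>(F', G). F' = F \<longrightarrow> G \<in> U) (uniformity :: ('a cfam \<times> 'a cfam) filter))"
    for U by (rule open_cfam_def)
  show "norm F = 0 \<longleftrightarrow> F = 0"
  proof
    assume "norm F = 0"
    show "F = 0"
    proof (rule cfam_eqI)
      fix A :: "'a cstar" assume A: "cstar_algebra A"
      then have "nrm A (Rep_cfam F A) = 0"
        using nrm_le_norm[OF A, of F] cstar_algebra.nrm_nonneg[OF A cfam_closed[OF A], of F] \<open>norm F = 0\<close> by simp
      then show "Rep_cfam F A = Rep_cfam 0 A" using A by (simp add: rep_zero cstar_algebra.nrm_eq_zero_iff)
    qed
  next
    assume "F = 0"
    then have "norm F \<le> 0" by (intro norm_cfam_le) (auto simp: rep_zero cstar_algebra.nrm_zero)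
    then show "norm F = 0" using norm_cfam_nonneg[of F] by simp
  qed
  show "norm (F + G) \<le> norm F + norm G"
  proof (rule norm_cfam_le)
    fix A :: "'a cstar" assume A: "cstar_algebra A"
    show "nrm A (Rep_cfam (F + G) A) \<le> norm F + norm G"
      using cstar_algebra.nrm_triangle[OF A cfam_closed[OF A] cfam_closed[OF A], of F G]
        nrm_le_norm[OF A, of F] nrm_le_norm[OF A, of G] by (simp add: rep_add A)
  qed (simp add: norm_cfam_nonneg)
  show "norm (r *\<^sub>R F) = \<bar>r\<bar> * norm F" unfolding scaleR_cfam_def norm_cfam_scale by simp
  show "norm (F * G) \<le> norm F * norm G"
  proof (rule norm_cfam_le)
    fix A :: "'a cstar" assume A: "cstar_algebra A"
    show "nrm A (Rep_cfam (F * G) A) \<le> norm F * norm G"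
      unfolding rep_mult[OF A]
      by (rule order_trans[OF cstar_algebra.nrm_mult[OF A cfam_closed[OF A] cfam_closed[OF A]]])
        (intro mult_mono nrm_le_norm A norm_cfam_nonneg cstar_algebra.nrm_nonneg[OF A] cfam_closed)
  qed (simp add: norm_cfam_nonneg)
qed

end

lemma rep_diff: "cstar_algebra A \<Longrightarrow> Rep_cfam (F - G) A = Rep_cfam F A \<ominus>\<^bsub>A\<^esub> Rep_cfam G A"
  by (simp only: minus_cfam_def rep_add rep_minus a_minus_def)

text \<open>Limits are taken coordinatewise. The Cauchy bound is uniform over the coordinates and
  survives the limit, which gives both boundedness of the limit family and convergence in
  norm.\<close>

instance cfam :: (type) banach
proof
  fix X :: "nat \<Rightarrow> 'a cfam" assume "Cauchy X"
  show "convergent X"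
  proof -
    note rd = rep_diff
    have C: "\<exists>N. \<forall>m\<ge>N. \<forall>n\<ge>N. norm (X m - X n) < e" if "0 < e" for e
      using \<open>Cauchy X\<close> that unfolding Cauchy_def dist_norm by blast
    have "\<exists>l\<in>carrier A. (\<lambda>n. nrm A (Rep_cfam (X n) A \<ominus>\<^bsub>A\<^esub> l)) \<longlonglongrightarrow> 0" if A: "cstar_algebra A" for A :: "'a cstar"
    proof (rule cstar_algebra.complete[OF A])
      show "\<forall>e>0. \<exists>N. \<forall>m\<ge>N. \<forall>n\<ge>N. nrm A (Rep_cfam (X m) A \<ominus>\<^bsub>A\<^esub> Rep_cfam (X n) A) < e"
      proof (intro allI impI)
        fix e :: real assume "0 < e"
        from C[OF this] obtain N where "\<forall>m\<ge>N. \<forall>n\<ge>N. norm (X m - X n) < e" by blast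
        then show "\<exists>N. \<forall>m\<ge>N. \<forall>n\<ge>N. nrm A (Rep_cfam (X m) A \<ominus>\<^bsub>A\<^esub> Rep_cfam (X n) A) < e"
          unfolding rd[OF A, symmetric] by (meson nrm_le_norm[OF A] le_less_trans)
      qed
    qed (use A in auto)
    then obtain l where l: "\<And>A :: 'a cstar. cstar_algebra A \<Longrightarrow> l A \<in> carrier A"
      "\<And>A. cstar_algebra A \<Longrightarrow> (\<lambda>n. nrm A (Rep_cfam (X n) A \<ominus>\<^bsub>A\<^esub> l A)) \<longlonglongrightarrow> 0" by metis
    have close: "nrm A (Rep_cfam (X n) A \<ominus>\<^bsub>A\<^esub> l A) \<le> e"
      if A: "cstar_algebra A" and N: "\<forall>m\<ge>N. \<forall>n\<ge>N. norm (X m - X n) < e" "n \<ge> N" for A :: "'a cstar" and n N e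
    proof -
      interpret cstar_algebra A by fact
      have le: "nrm A (Rep_cfam (X n) A \<ominus>\<^bsub>A\<^esub> l A) \<le> e + nrm A (Rep_cfam (X m) A \<ominus>\<^bsub>A\<^esub> l A)" if "m \<ge> N" for m
      proof -
        have cl: "Rep_cfam (X n) A \<in> carrier A" "Rep_cfam (X m) A \<in> carrier A" "l A \<in> carrier A" using A l by auto
        have "Rep_cfam (X n) A \<ominus>\<^bsub>A\<^esub> l A = (Rep_cfam (X n) A \<ominus>\<^bsub>A\<^esub> Rep_cfam (X m) A) \<oplus>\<^bsub>A\<^esub> (Rep_cfam (X m) A \<ominus>\<^bsub>A\<^esub> l A)"
          using cl by (simp add: a_minus_def a_assoc r_neg1)
        then have "nrm A (Rep_cfam (X n) A \<ominus>\<^bsub>A\<^esub> l A) \<le> nrm A (Rep_cfam (X n) A \<ominus>\<^bsub>A\<^esub> Rep_cfam (X m) A) + nrm A (Rep_cfam (X m) A \<ominus>\<^bsub>A\<^esub> l A)"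
          using nrm_triangle cl by simp
        also have "nrm A (Rep_cfam (X n) A \<ominus>\<^bsub>A\<^esub> Rep_cfam (X m) A) \<le> norm (X n - X m)"
          using nrm_le_norm[OF A, of "X n - X m"] by (simp add: rd[OF A])
        finally show ?thesis using N that by fastforce
      qed
      have "(\<lambda>m. e + nrm A (Rep_cfam (X m) A \<ominus>\<^bsub>A\<^esub> l A)) \<longlonglongrightarrow> e + 0"
        by (intro tendsto_add tendsto_const l A)
      from LIMSEQ_le_const[OF this] le show ?thesis by auto
    qed
    from C[of 1] obtain N where N: "\<forall>m\<ge>N. \<forall>n\<ge>N. norm (X m - X n) < 1" by auto
    define L where "L = cfun l"
    have L: "Rep_cfam L A = l A" if A: "cstar_algebra A" for A
      unfolding L_def
    proof (rule cfun_rep[OF l(1) _ A])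
      fix A :: "'a cstar" assume A: "cstar_algebra A"
      then interpret cstar_algebra A .
      have cl: "Rep_cfam (X N) A \<in> carrier A" "l A \<in> carrier A" using A l by auto
      have "l A = Rep_cfam (X N) A \<oplus>\<^bsub>A\<^esub> \<ominus>\<^bsub>A\<^esub> (Rep_cfam (X N) A \<ominus>\<^bsub>A\<^esub> l A)"
        using cl by (simp add: a_minus_def minus_add r_neg2)
      then have "nrm A (l A) \<le> nrm A (Rep_cfam (X N) A) + nrm A (Rep_cfam (X N) A \<ominus>\<^bsub>A\<^esub> l A)"
        using nrm_triangle cl nrm_minus by (metis a_inv_closed minus_closed)
      also have "\<dots> \<le> norm (X N) + 1" using close[OF A N] nrm_le_norm[OF A] by (intro add_mono) auto
      finally show "nrm A (l A) \<le> norm (X N) + 1" .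
    qed
    have "\<exists>N. \<forall>n\<ge>N. dist (X n) L < e" if "0 < e" for e
    proof -
      from C[of "e/2"] that obtain N where N: "\<forall>m\<ge>N. \<forall>n\<ge>N. norm (X m - X n) < e / 2" by auto
      have "norm (X n - L) \<le> e / 2" if "n \<ge> N" for n
        by (rule norm_cfam_le) (use close[OF _ N that] \<open>0 < e\<close> in \<open>auto simp: rd L\<close>)
      then show ?thesis unfolding dist_norm using that by (intro exI[where x = N]) fastforce
    qed
    then show ?thesis
      unfolding convergent_def lim_sequentially by blast
  qed
qed

instantiation cfam :: (type) cstar0
begin

definition "cscale = (cfam_scale :: complex \<Rightarrow> 'a cfam \<Rightarrow> 'a cfam)"
definition "star = (cfam_star :: 'a cfam \<Rightarrow> 'a cfam)"

instance
proof
  fix F G :: "'a cfam" and c d :: complex and r :: real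
  show "cscale (complex_of_real r) F = r *\<^sub>R F" by (simp add: scaleR_cfam_def cscale_cfam_def)
  show "cscale (c + d) F = cscale c F + cscale d F" "cscale c (F + G) = cscale c F + cscale c G"
    "cscale c (cscale d F) = cscale (c * d) F" "cscale c F * G = cscale c (F * G)" "F * cscale c G = cscale c (F * G)"
    by (simp_all add: cscale_cfam_def cfam_scale_ops)
  show "norm (cscale c F) = cmod c * norm F" by (simp add: cscale_cfam_def norm_cfam_scale)
  show "star (star F) = F" unfolding star_cfam_def
    by (rule cfam_eqI) (simp add: rep_simps cstar_algebra.adj_adj)
  show "star (F + G) = star F + star G" unfolding star_cfam_def
    by (rule cfam_eqI) (simp add: rep_simps cstar_algebra.adj_add)
  show "star (cscale c F) = cscale (cnj c) (star F)" unfolding star_cfam_def cscale_cfam_def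
    by (rule cfam_eqI) (simp add: rep_simps cstar_algebra.adj_scale)
  show "star (F * G) = star G * star F" unfolding star_cfam_def
    by (rule cfam_eqI) (simp add: rep_simps cstar_algebra.adj_mult)
  show "norm (star F * F) = (norm F)\<^sup>2"
    unfolding star_cfam_def
  proof (rule antisym)
    have id: "nrm A (Rep_cfam (cfam_star F * F) A) = (nrm A (Rep_cfam F A))\<^sup>2" if A: "cstar_algebra A" for A :: "'a cstar"
      using A by (simp add: rep_simps cstar_algebra.cstar_identity)
    show "norm (cfam_star F * F) \<le> (norm F)\<^sup>2"
      by (rule norm_cfam_le) (auto simp: id intro!: power_mono nrm_le_norm cstar_algebra.nrm_nonneg)
    have "norm F \<le> sqrt (norm (cfam_star F * F))"
    proof (rule norm_cfam_le)
      fix A :: "'a cstar" assume A: "cstar_algebra A"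
      have "(nrm A (Rep_cfam F A))\<^sup>2 \<le> norm (cfam_star F * F)" using nrm_le_norm[OF A, of "cfam_star F * F"] by (simp add: id[OF A])
      then show "nrm A (Rep_cfam F A) \<le> sqrt (norm (cfam_star F * F))" by (rule real_le_rsqrt)
    qed (simp add: norm_cfam_nonneg)
    then have "(norm F)\<^sup>2 \<le> (sqrt (norm (cfam_star F * F)))\<^sup>2" by (intro power_mono norm_cfam_nonneg)
    then show "(norm F)\<^sup>2 \<le> norm (cfam_star F * F)" by (simp add: norm_cfam_nonneg)
  qed
qed

end

lemma rep_cscale': "cstar_algebra A \<Longrightarrow> Rep_cfam (cscale c F) A = c \<odot>\<^bsub>A\<^esub> Rep_cfam F A"
  by (simp add: cscale_cfam_def rep_cscale)

lemma rep_star': "cstar_algebra A \<Longrightarrow> Rep_cfam (star F) A = adj A (Rep_cfam F A)"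
  by (simp add: star_cfam_def rep_star)

lemmas rep_cfam = rep_zero rep_add rep_minus rep_diff rep_mult rep_cscale' rep_star'

subsection \<open>Unitization\<close>

datatype 'b unitz = Unitz (base: 'b) (scal: complex)

definition uop :: "'b::cstar0 unitz \<Rightarrow> 'b \<Rightarrow> 'b" where
  "uop x v = base x * v + cscale (scal x) v"

lemma unitz_eqI: "base x = base y \<Longrightarrow> scal x = scal y \<Longrightarrow> x = y"
  by (rule unitz.expand) simp

lemma bounded_linear_uop: "bounded_linear (uop x)"
  unfolding uop_def[abs_def]
  by (intro bounded_linear_add bounded_linear_mult_right bounded_linear_cscale)

text \<open>The value at \<open>star a\<close>, together with the C*-identity, shows that the
  operator norm is attained; the unitization norm therefore extends the given one.\<close>

lemma onorm_left_mult: "onorm (\<lambda>v. a * v) = norm (a::'b::cstar0)"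
proof (rule antisym)
  show "onorm (\<lambda>v. a * v) \<le> norm a" by (rule onorm_bound) (auto simp: norm_mult_ineq)
  have "norm (a * star a) \<le> onorm (\<lambda>v. a * v) * norm (star a)"
    by (rule onorm[OF bounded_linear_mult_right])
  then have "norm a * norm a \<le> onorm (\<lambda>v. a * v) * norm a"
    using norm_star_mult[of "star a"] by (simp add: power2_eq_square)
  then show "norm a \<le> onorm (\<lambda>v. a * v)"
    by (cases "a = 0") (auto simp: onorm_zero)
qed

instantiation unitz :: (cstar0) real_normed_algebra_1
begin

definition "0 = Unitz (0::'a) 0"
definition "1 = Unitz (0::'a) 1"
definition "x + y = Unitz (base x + base y :: 'a) (scal x + scal y)"
definition "- x = Unitz (- base x :: 'a) (- scal x)"
definition "x - y = Unitz (base x - base y :: 'a) (scal x - scal y)"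
definition "x * y = Unitz (base x * base y + cscale (scal y) (base x) + cscale (scal x) (base y) :: 'a) (scal x * scal y)"
definition "scaleR r x = Unitz (r *\<^sub>R base x :: 'a) (complex_of_real r * scal x)"
text \<open>If the algebra already has a unit e, then the formal unit minus e acts as zero, so the
  operator norm alone would only be a seminorm. The maximum with the scalar part separates points
  and keeps the C*-identity.\<close>

definition "norm x = max (onorm (uop (x :: 'a unitz))) (cmod (scal x))"
definition "dist x y = norm (x - y :: 'a unitz)"
definition "sgn x = scaleR (inverse (norm x)) (x :: 'a unitz)"
definition "uniformity = (INF e\<in>{0<..}. principal {(x, y). dist x (y :: 'a unitz) < e})"
definition "open U = (\<forall>x\<in>U. eventually (\<lambda>(x', y). x' = x \<longrightarrow> y \<in> U) (uniformity :: ('a unitz \<times> 'a unitz) filter))"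

lemmas unitz_defs = zero_unitz_def one_unitz_def plus_unitz_def uminus_unitz_def minus_unitz_def
  times_unitz_def scaleR_unitz_def

lemma uop_ops:
  fixes x y :: "'a unitz"
  shows "uop (x + y) = (\<lambda>v. uop x v + uop y v)" "uop (x * y) = (\<lambda>v. uop x (uop y v))"
    "uop (r *\<^sub>R x) = (\<lambda>v. r *\<^sub>R uop x v)"
  by (auto simp: uop_def fun_eq_iff unitz_defs cscale_add_left cscale_add_right cscale_mult_left cscale_mult_right
      cscale_cscale algebra_simps simp flip: cscale_of_real)

instance
proof
  fix x y z :: "'a unitz" and r s :: real
  show "x + y + z = x + (y + z)" "x + y = y + x" "0 + x = x" "- x + x = 0" "x - y = x + - y"
    by (auto intro!: unitz_eqI simp: unitz_defs)
  show "x * y * z = x * (y * z)" "(x + y) * z = x * z + y * z" "x * (y + z) = x * y + x * z" "1 * x = x" "x * 1 = x"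
    by (auto intro!: unitz_eqI simp: unitz_defs cscale_add_left cscale_add_right cscale_mult_left cscale_mult_right
      cscale_cscale algebra_simps)
  show "(0::'a unitz) \<noteq> 1" by (simp add: unitz_defs)
  show "r *\<^sub>R (x + y) = r *\<^sub>R x + r *\<^sub>R y" "(r + s) *\<^sub>R x = r *\<^sub>R x + s *\<^sub>R x" "r *\<^sub>R s *\<^sub>R x = (r * s) *\<^sub>R x" "1 *\<^sub>R x = x"
    by (auto intro!: unitz_eqI simp: unitz_defs algebra_simps)
  show "r *\<^sub>R x * y = r *\<^sub>R (x * y)" "x * r *\<^sub>R y = r *\<^sub>R (x * y)"
    by (auto intro!: unitz_eqI simp: unitz_defs cscale_cscale algebra_simps simp flip: cscale_of_real)
      (auto simp: cscale_add_right cscale_mult_left cscale_mult_right cscale_cscale mult.commute)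
  show "dist x y = norm (x - y)" by (rule dist_unitz_def)
  show "sgn x = inverse (norm x) *\<^sub>R x" by (rule sgn_unitz_def)
  show "uniformity = (INF e\<in>{0<..}. principal {(x, y). dist x (y :: 'a unitz) < e})" by (rule uniformity_unitz_def)
  show "open U = (\<forall>x\<in>U. eventually (\<lambda>(x', y). x' = x \<longrightarrow> y \<in> U) (uniformity :: ('a unitz \<times> 'a unitz) filter))"
    for U by (rule open_unitz_def)
  show "norm x = 0 \<longleftrightarrow> x = 0"
  proof
    assume n0: "norm x = 0"
    have o: "0 \<le> onorm (uop x)" by (rule onorm_pos_le[OF bounded_linear_uop])
    have s: "scal x = 0" using n0 o unfolding norm_unitz_def by (smt (verit) norm_ge_zero zero_less_norm_iff)
    have "onorm (uop x) = 0" using n0 o unfolding norm_unitz_def by (smt (verit) norm_ge_zero)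
    moreover have "uop x = (\<lambda>v. base x * v)" using s by (simp add: uop_def fun_eq_iff)
    ultimately have "base x = 0" using onorm_left_mult[of "base x"] by simp
    with s show "x = 0" by (intro unitz_eqI) (simp_all add: unitz_defs)
  next
    assume "x = 0"
    then have "uop x = (\<lambda>v. 0)" "scal x = 0" by (simp_all add: uop_def unitz_defs fun_eq_iff)
    then show "norm x = 0" by (simp add: norm_unitz_def onorm_zero)
  qed
  show "norm (x + y) \<le> norm x + norm y"
    using onorm_triangle[OF bounded_linear_uop bounded_linear_uop, of x y] norm_triangle_ineq[of "scal x" "scal y"]
    unfolding norm_unitz_def uop_ops by (simp add: plus_unitz_def max_def)
  show "norm (r *\<^sub>R x) = \<bar>r\<bar> * norm x"
    unfolding norm_unitz_def uop_ops onorm_scaleR[OF bounded_linear_uop]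
    by (simp add: scaleR_unitz_def norm_mult max_mult_distrib_left)
  show "norm (x * y) \<le> norm x * norm y"
  proof -
    have "onorm (uop (x * y)) \<le> onorm (uop x) * onorm (uop y)"
      unfolding uop_ops using onorm_compose[OF bounded_linear_uop bounded_linear_uop, of x y] by (simp add: o_def)
    also have "\<dots> \<le> norm x * norm y"
      unfolding norm_unitz_def by (intro mult_mono) (auto simp: onorm_pos_le[OF bounded_linear_uop] le_max_iff_disj)
    finally have "onorm (uop (x * y)) \<le> norm x * norm y" .
    moreover have "cmod (scal (x * y)) \<le> norm x * norm y"
      unfolding norm_unitz_def times_unitz_def by (simp add: norm_mult) (intro mult_mono, auto simp: le_max_iff_disj)
    ultimately show ?thesis by (simp add: norm_unitz_def)
  qed
  have "onorm (uop (1 :: 'a unitz)) \<le> 1"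
    by (rule onorm_bound) (auto simp: uop_def one_unitz_def)
  then show "norm (1 :: 'a unitz) = 1" unfolding norm_unitz_def by (simp add: one_unitz_def)
qed

end

lemma norm_scal_le: "cmod (scal x) \<le> norm (x :: 'a::cstar0 unitz)"
  by (simp add: norm_unitz_def)

lemma norm_Unitz_0: "norm (Unitz a 0) = norm (a::'a::cstar0)"
proof -
  have "uop (Unitz a 0) = (\<lambda>v. a * v)" by (simp add: uop_def fun_eq_iff)
  then show ?thesis by (simp add: norm_unitz_def onorm_left_mult)
qed

lemma norm_Unitz_scal: "norm (Unitz (0::'a::cstar0) c) = cmod c"
proof -
  have "onorm (uop (Unitz (0::'a) c)) \<le> cmod c"
    by (rule onorm_bound) (auto simp: uop_def norm_cscale)
  then show ?thesis by (simp add: norm_unitz_def)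
qed

lemma norm_base_le: "norm (base x) \<le> 2 * norm (x :: 'a::cstar0 unitz)"
proof -
  have "Unitz (base x) 0 = x - Unitz 0 (scal x)" by (simp add: minus_unitz_def)
  then have "norm (base x) \<le> norm x + cmod (scal x)"
    using norm_triangle_ineq4[of x "Unitz 0 (scal x)"] by (metis norm_Unitz_0 norm_Unitz_scal)
  then show ?thesis using norm_scal_le[of x] by simp
qed

lemma norm_unitz_le: "norm (x :: 'a::cstar0 unitz) \<le> norm (base x) + cmod (scal x)"
proof -
  have "x = Unitz (base x) 0 + Unitz 0 (scal x)" by (simp add: plus_unitz_def)
  then show ?thesis using norm_triangle_ineq[of "Unitz (base x) 0" "Unitz 0 (scal x)"]
    by (metis norm_Unitz_0 norm_Unitz_scal)
qed

instance unitz :: (cstar0) banach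
proof
  fix X :: "nat \<Rightarrow> 'a unitz" assume X: "Cauchy X"
  have C: "\<exists>M. \<forall>m\<ge>M. \<forall>n\<ge>M. norm (X m - X n) < e" if "0 < e" for e
    using X that by (simp add: Cauchy_iff)
  have "Cauchy (\<lambda>n. base (X n))"
  proof (rule CauchyI)
    fix e :: real assume "0 < e"
    then obtain M where "\<forall>m\<ge>M. \<forall>n\<ge>M. norm (X m - X n) < e / 2" using C[of "e/2"] by auto
    moreover have "norm (base (X m) - base (X n)) < e" if "norm (X m - X n) < e / 2" for m n
      using norm_base_le[of "X m - X n"] that by (simp add: minus_unitz_def)
    ultimately show "\<exists>M. \<forall>m\<ge>M. \<forall>n\<ge>M. norm (base (X m) - base (X n)) < e" by blast
  qed
  then obtain a where a: "(\<lambda>n. base (X n)) \<longlonglongrightarrow> a" by (auto simp: Cauchy_convergent_iff convergent_def)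
  have "Cauchy (\<lambda>n. scal (X n))"
  proof (rule CauchyI)
    fix e :: real assume "0 < e"
    then obtain M where "\<forall>m\<ge>M. \<forall>n\<ge>M. norm (X m - X n) < e" using C[of e] by auto
    moreover have "norm (scal (X m) - scal (X n)) < e" if "norm (X m - X n) < e" for m n
      using norm_scal_le[of "X m - X n"] that by (simp add: minus_unitz_def)
    ultimately show "\<exists>M. \<forall>m\<ge>M. \<forall>n\<ge>M. norm (scal (X m) - scal (X n)) < e" by blast
  qed
  then obtain c where c: "(\<lambda>n. scal (X n)) \<longlonglongrightarrow> c" by (auto simp: Cauchy_convergent_iff convergent_def)
  have "(\<lambda>n. norm (base (X n) - a) + norm (scal (X n) - c)) \<longlonglongrightarrow> 0 + 0"
    by (intro tendsto_add tendsto_norm_zero LIM_zero a c)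
  then have lim: "(\<lambda>n. norm (base (X n) - a) + norm (scal (X n) - c)) \<longlonglongrightarrow> 0" by simp
  have le: "norm (X n - Unitz a c) \<le> norm (base (X n) - a) + norm (scal (X n) - c)" for n
    using norm_unitz_le[of "X n - Unitz a c"] by (simp add: minus_unitz_def)
  from Lim_null_comparison[OF always_eventually[OF allI[OF le]] lim]
  have "(\<lambda>n. X n - Unitz a c) \<longlonglongrightarrow> 0" .
  then show "convergent X" unfolding convergent_def using LIM_zero_cancel by blast
qed

instantiation unitz :: (cstar0) cstar1
begin

definition "cscale c x = Unitz (cscale c (base x) :: 'a) (c * scal x)"
definition "star x = Unitz (star (base x) :: 'a) (cnj (scal x))"

instance
proof
  fix x y :: "'a unitz" and c d :: complex and r :: real
  show "cscale (complex_of_real r) x = r *\<^sub>R x" by (simp add: cscale_unitz_def scaleR_unitz_def cscale_of_real)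
  show "cscale (c + d) x = cscale c x + cscale d x" "cscale c (x + y) = cscale c x + cscale c y"
    "cscale c (cscale d x) = cscale (c * d) x"
    by (auto simp: cscale_unitz_def plus_unitz_def cscale_add_left cscale_add_right cscale_cscale algebra_simps)
  show "cscale c x * y = cscale c (x * y)" "x * cscale c y = cscale c (x * y)"
    by (auto simp: cscale_unitz_def times_unitz_def cscale_add_right cscale_mult_left cscale_mult_right cscale_cscale mult_ac)
  have uc: "uop (cscale c x) = (\<lambda>v. cscale c (uop x v))"
    by (auto simp: uop_def cscale_unitz_def cscale_add_right cscale_mult_left cscale_cscale fun_eq_iff)
  have le: "onorm (uop (cscale c x)) \<le> cmod c * onorm (uop x)" for c and x :: "'a unitz"
  proof (rule onorm_bound)
    show "norm (uop (cscale c x) v) \<le> cmod c * onorm (uop x) * norm v" for v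
    proof -
      have "uop (cscale c x) v = cscale c (uop x v)"
        by (simp add: uop_def cscale_unitz_def cscale_add_right cscale_mult_left cscale_cscale)
      then show ?thesis
        using onorm[OF bounded_linear_uop, of x v] by (simp add: norm_cscale mult_left_mono mult.assoc)
    qed
  qed (simp add: onorm_pos_le[OF bounded_linear_uop])
  show "norm (cscale c x) = cmod c * norm x"
  proof (cases "c = 0")
    case True
    then have "cscale c x = 0" by (simp add: cscale_unitz_def zero_unitz_def)
    then show ?thesis using True by simp
  next
    case False
    have "x = cscale (inverse c) (cscale c x)" using False by (simp add: cscale_unitz_def cscale_cscale mult.assoc[symmetric])
    then have "onorm (uop x) \<le> cmod (inverse c) * onorm (uop (cscale c x))" using le by metis
    then have "cmod c * onorm (uop x) \<le> onorm (uop (cscale c x))"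
      using False by (simp add: norm_inverse norm_divide field_simps)
    then have "onorm (uop (cscale c x)) = cmod c * onorm (uop x)" using le[of c x] by simp
    then show ?thesis by (simp add: norm_unitz_def norm_mult cscale_unitz_def max_mult_distrib_left)
  qed
  show "star (star x) = x" "star (x + y) = star x + star y" "star (cscale c x) = cscale (cnj c) (star x)"
    "star (x * y) = star y * star x"
    by (auto simp: star_unitz_def cscale_unitz_def plus_unitz_def times_unitz_def star_add star_mult star_cscale algebra_simps)
  \<comment> \<open>The square of the norm of x v is the norm of \<open>star v\<close> (star x * x)
    v; this gives one half of the C*-identity, and submultiplicativity gives the other.\<close>
  have sq: "(onorm (uop x))\<^sup>2 \<le> onorm (uop (star x * x))" for x :: "'a unitz"
  proof -
    have "onorm (uop x) \<le> sqrt (onorm (uop (star x * x)))"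
    proof (rule onorm_bound)
      fix v
      have "star (uop x v) * uop x v = star v * uop (star x * x) v"
        by (simp add: uop_def star_unitz_def times_unitz_def star_add star_mult star_cscale algebra_simps
            cscale_mult_left cscale_mult_right cscale_cscale cscale_add_right cscale_add_left)
      then have "(norm (uop x v))\<^sup>2 \<le> norm v * norm (uop (star x * x) v)"
        using norm_mult_ineq[of "star v" "uop (star x * x) v"] by (simp flip: norm_star_mult)
      also have "\<dots> \<le> norm v * (onorm (uop (star x * x)) * norm v)"
        by (intro mult_left_mono onorm[OF bounded_linear_uop]) simp
      also have "\<dots> = (sqrt (onorm (uop (star x * x))) * norm v)\<^sup>2"
        by (simp add: power_mult_distrib onorm_pos_le[OF bounded_linear_uop] power2_eq_square)
      finally show "norm (uop x v) \<le> sqrt (onorm (uop (star x * x))) * norm v"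
        by (rule power2_le_imp_le) (simp add: onorm_pos_le[OF bounded_linear_uop])
    qed (simp add: onorm_pos_le[OF bounded_linear_uop])
    then have "(onorm (uop x))\<^sup>2 \<le> (sqrt (onorm (uop (star x * x))))\<^sup>2"
      by (intro power_mono onorm_pos_le[OF bounded_linear_uop])
    then show ?thesis by (simp add: onorm_pos_le[OF bounded_linear_uop])
  qed
  have mult_le: "onorm (uop (x * y)) \<le> onorm (uop x) * onorm (uop y)" for x y :: "'a unitz"
    unfolding uop_ops using onorm_compose[OF bounded_linear_uop bounded_linear_uop, of x y] by (simp add: o_def)
  have le_star: "onorm (uop x) \<le> onorm (uop (star x))" for x :: "'a unitz"
  proof (cases "onorm (uop x) = 0")
    case False
    have "onorm (uop x) * onorm (uop x) \<le> onorm (uop (star x)) * onorm (uop x)"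
      using sq[of x] mult_le[of "star x" x] by (simp add: power2_eq_square)
    then show ?thesis using False onorm_pos_le[OF bounded_linear_uop, of x] by simp
  qed (simp add: onorm_pos_le[OF bounded_linear_uop])
  have ss: "star (star x) = x" by (simp add: star_unitz_def)
  have "onorm (uop (star x)) = onorm (uop x)" using le_star[of x] le_star[of "star x"] unfolding ss by simp
  then have "onorm (uop (star x * x)) = (onorm (uop x))\<^sup>2"
    using sq[of x] mult_le[of "star x" x] by (simp add: power2_eq_square)
  moreover have "cmod (scal (star x * x)) = (cmod (scal x))\<^sup>2"
    by (simp add: star_unitz_def times_unitz_def norm_mult power2_eq_square)
  ultimately show "norm (star x * x) = (norm x)\<^sup>2"
    unfolding norm_unitz_def using onorm_pos_le[OF bounded_linear_uop, of x]
    by (auto simp: max_def power_mono_iff)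
qed

end

subsection \<open>Transfer between carriers and types\<close>

type_synonym 'a big = "'a cfam unitz"

definition single :: "'a cstar \<Rightarrow> 'a \<Rightarrow> 'a cfam" where
  "single A x = cfun (\<lambda>B. if B = A then x else \<zero>\<^bsub>B\<^esub>)"

definition emb :: "'a cstar \<Rightarrow> 'a \<Rightarrow> 'a big" where
  "emb A x = Unitz (single A x) 0"

text \<open>Linear and compatible with \<open>star\<close>, but not multiplicative, because the
  scalar parts contribute; it is multiplicative on elements with scalar part 0.\<close>

definition prj :: "'a cstar \<Rightarrow> 'a big \<Rightarrow> 'a" where
  "prj A F = Rep_cfam (base F) A"

lemma cstar_zero_closed: "cstar_algebra A \<Longrightarrow> \<zero>\<^bsub>A\<^esub> \<in> carrier A"
  by (simp add: abelian_group_cstar abelian_group.axioms(1) abelian_monoid.zero_closed)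

lemma cstar_zero_add: "cstar_algebra A \<Longrightarrow> \<zero>\<^bsub>A\<^esub> \<oplus>\<^bsub>A\<^esub> \<zero>\<^bsub>A\<^esub> = \<zero>\<^bsub>A\<^esub>"
  by (simp add: abelian_group_cstar abelian_group.axioms(1) abelian_monoid.l_zero abelian_monoid.zero_closed)

lemma rep_single:
  assumes "cstar_algebra A" "x \<in> carrier A" "cstar_algebra B"
  shows "Rep_cfam (single A x) B = (if B = A then x else \<zero>\<^bsub>B\<^esub>)"
  unfolding single_def
  by (rule cfun_rep[where K = "nrm A x"])
    (use assms in \<open>auto simp: cstar_zero_closed cstar_algebra.nrm_zero cstar_algebra.nrm_nonneg\<close>)

lemma single_ops:
  assumes A: "cstar_algebra A" and x: "x \<in> carrier A"
  shows "y \<in> carrier A \<Longrightarrow> single A (x \<oplus>\<^bsub>A\<^esub> y) = single A x + single A y"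
    "y \<in> carrier A \<Longrightarrow> single A (x \<otimes>\<^bsub>A\<^esub> y) = single A x * single A y"
    "single A (c \<odot>\<^bsub>A\<^esub> x) = cscale c (single A x)" "single A (adj A x) = star (single A x)"
proof -
  interpret cstar_algebra A by fact
  note simps = rep_single[OF A] rep_cfam x mult_closed a_closed scale_closed adj_closed cstar_zero_add
    cstar_algebra.mult_zero cstar_zero_closed cstar_algebra.scale_zero cstar_algebra.adj_zero
  show "single A (c \<odot>\<^bsub>A\<^esub> x) = cscale c (single A x)" "single A (adj A x) = star (single A x)"
    by (rule cfam_eqI, simp add: simps)+
  assume y: "y \<in> carrier A"
  show "single A (x \<oplus>\<^bsub>A\<^esub> y) = single A x + single A y" "single A (x \<otimes>\<^bsub>A\<^esub> y) = single A x * single A y"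
    by (rule cfam_eqI, simp add: simps y)+
qed

lemma norm_single: assumes "cstar_algebra A" "x \<in> carrier A" shows "norm (single A x) = nrm A x"
proof (rule antisym)
  interpret cstar_algebra A by fact
  show "norm (single A x) \<le> nrm A x"
    by (rule norm_cfam_le) (use assms in \<open>auto simp: rep_single cstar_algebra.nrm_zero nrm_nonneg\<close>)
  show "nrm A x \<le> norm (single A x)"
    using nrm_le_norm[OF assms(1), of "single A x"] by (simp add: rep_single assms)
qed

lemma emb_ops:
  assumes "cstar_algebra A" "x \<in> carrier A"
  shows "y \<in> carrier A \<Longrightarrow> emb A (x \<oplus>\<^bsub>A\<^esub> y) = emb A x + emb A y"
    "y \<in> carrier A \<Longrightarrow> emb A (x \<otimes>\<^bsub>A\<^esub> y) = emb A x * emb A y"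
    "emb A (c \<odot>\<^bsub>A\<^esub> x) = cscale c (emb A x)" "emb A (adj A x) = star (emb A x)"
  unfolding emb_def by (simp_all add: single_ops assms plus_unitz_def times_unitz_def cscale_unitz_def star_unitz_def)

lemma norm_emb: "cstar_algebra A \<Longrightarrow> x \<in> carrier A \<Longrightarrow> norm (emb A x) = nrm A x"
  unfolding emb_def by (simp add: norm_Unitz_0 norm_single)

lemma scal_emb [simp]: "scal (emb A x) = 0"
  by (simp add: emb_def)

lemma prj_emb: "cstar_algebra A \<Longrightarrow> x \<in> carrier A \<Longrightarrow> prj A (emb A x) = x"
  by (simp add: prj_def emb_def rep_single)

lemma prj_closed [simp]: "cstar_algebra A \<Longrightarrow> prj A F \<in> carrier A"
  by (simp add: prj_def)

lemma prj_ops: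
  assumes "cstar_algebra A"
  shows "prj A (F + G) = prj A F \<oplus>\<^bsub>A\<^esub> prj A G" "prj A (F - G) = prj A F \<ominus>\<^bsub>A\<^esub> prj A G"
    "prj A (cscale c F) = c \<odot>\<^bsub>A\<^esub> prj A F" "prj A (star F) = adj A (prj A F)" "prj A 0 = \<zero>\<^bsub>A\<^esub>"
    "prj A (F * G) = prj A F \<otimes>\<^bsub>A\<^esub> prj A G \<oplus>\<^bsub>A\<^esub> scal G \<odot>\<^bsub>A\<^esub> prj A F \<oplus>\<^bsub>A\<^esub> scal F \<odot>\<^bsub>A\<^esub> prj A G"
  unfolding prj_def
  by (simp_all add: assms rep_cfam plus_unitz_def minus_unitz_def times_unitz_def cscale_unitz_def star_unitz_def zero_unitz_def)

lemma scal_ops: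
  "scal (F + G) = scal F + scal G" "scal (F - G) = scal F - scal (G :: 'b::cstar0 unitz)" "scal (F * G) = scal F * scal G"
  "scal (cscale c F) = c * scal F" "scal (star F) = cnj (scal F)" "scal (1 :: 'b unitz) = 1" "scal (0 :: 'b unitz) = 0"
  by (simp_all add: plus_unitz_def minus_unitz_def times_unitz_def cscale_unitz_def star_unitz_def one_unitz_def zero_unitz_def)

lemma scal_power: "scal (F ^ n) = scal (F :: 'b::cstar0 unitz) ^ n"
  by (induction n) (simp_all add: scal_ops)

text \<open>The image of \<open>emb A\<close> is an ideal of the big algebra, and a product with it
  can be computed in A. This is how results proved in the big algebra return to A.\<close>

lemma emb_prj_mult:
  assumes "cstar_algebra A" "x \<in> carrier A"
  shows "emb A x * F = emb A (x \<otimes>\<^bsub>A\<^esub> prj A F \<oplus>\<^bsub>A\<^esub> scal F \<odot>\<^bsub>A\<^esub> x)"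
    "F * emb A x = emb A (prj A F \<otimes>\<^bsub>A\<^esub> x \<oplus>\<^bsub>A\<^esub> scal F \<odot>\<^bsub>A\<^esub> x)"
proof -
  interpret cstar_algebra A by fact
  have cl: "prj A F \<in> carrier A" using assms by simp
  have e: "single A x * base F = single A (x \<otimes>\<^bsub>A\<^esub> prj A F)" "base F * single A x = single A (prj A F \<otimes>\<^bsub>A\<^esub> x)"
    unfolding prj_def using cl[unfolded prj_def]
    by (auto intro!: cfam_eqI simp: rep_single rep_cfam assms mult_closed cstar_algebra.mult_zero)
  show "emb A x * F = emb A (x \<otimes>\<^bsub>A\<^esub> prj A F \<oplus>\<^bsub>A\<^esub> scal F \<odot>\<^bsub>A\<^esub> x)"
    "F * emb A x = emb A (prj A F \<otimes>\<^bsub>A\<^esub> x \<oplus>\<^bsub>A\<^esub> scal F \<odot>\<^bsub>A\<^esub> x)"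
    unfolding emb_def by (simp_all add: times_unitz_def e single_ops assms cl mult_closed scale_closed)
qed

text \<open>All coordinates except A are discarded and the result is placed at C, while the scalar
  part is retained. A *-homomorphism that need not preserve units thereby becomes a unital
  one.\<close>

definition bigmap :: "'a cstar \<Rightarrow> 'b cstar \<Rightarrow> ('a \<Rightarrow> 'b) \<Rightarrow> 'a big \<Rightarrow> 'b big" where
  "bigmap A C f F = Unitz (single C (f (prj A F))) (scal F)"

lemma star_homD:
  assumes "f \<in> star_hom A C"
  shows "x \<in> carrier A \<Longrightarrow> f x \<in> carrier C"
    "x \<in> carrier A \<Longrightarrow> y \<in> carrier A \<Longrightarrow> f (x \<otimes>\<^bsub>A\<^esub> y) = f x \<otimes>\<^bsub>C\<^esub> f y"
    "x \<in> carrier A \<Longrightarrow> y \<in> carrier A \<Longrightarrow> f (x \<oplus>\<^bsub>A\<^esub> y) = f x \<oplus>\<^bsub>C\<^esub> f y"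
    "x \<in> carrier A \<Longrightarrow> f (c \<odot>\<^bsub>A\<^esub> x) = c \<odot>\<^bsub>C\<^esub> f x"
    "x \<in> carrier A \<Longrightarrow> f (adj A x) = adj C (f x)"
  using assms by (auto simp: star_hom_def hom_def)

lemma star_homI:
  assumes "\<And>x. x \<in> carrier A \<Longrightarrow> f x \<in> carrier C"
    "\<And>x y. x \<in> carrier A \<Longrightarrow> y \<in> carrier A \<Longrightarrow> f (x \<otimes>\<^bsub>A\<^esub> y) = f x \<otimes>\<^bsub>C\<^esub> f y"
    "\<And>x y. x \<in> carrier A \<Longrightarrow> y \<in> carrier A \<Longrightarrow> f (x \<oplus>\<^bsub>A\<^esub> y) = f x \<oplus>\<^bsub>C\<^esub> f y"
    "\<And>c x. x \<in> carrier A \<Longrightarrow> f (c \<odot>\<^bsub>A\<^esub> x) = c \<odot>\<^bsub>C\<^esub> f x"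
    "\<And>x. x \<in> carrier A \<Longrightarrow> f (adj A x) = adj C (f x)"
  shows "f \<in> star_hom A C"
  using assms by (auto simp: star_hom_def hom_def)

lemma bigmap_star_homo:
  assumes A: "cstar_algebra A" and C: "cstar_algebra C" and f: "f \<in> star_hom A C"
  shows "star_homo (bigmap A C f)"
proof
  interpret A: cstar_algebra A by fact
  note f = star_homD[OF f]
  have cl: "prj A F \<in> carrier A" "f (prj A F) \<in> carrier C" for F using A f by auto
  fix F G :: "'a big" and c :: complex
  show "bigmap A C f (F + G) = bigmap A C f F + bigmap A C f G"
    by (simp add: bigmap_def prj_ops scal_ops A C f cl single_ops) (simp add: plus_unitz_def)
  show "bigmap A C f (F * G) = bigmap A C f F * bigmap A C f G"
    using A C by (simp add: bigmap_def prj_ops scal_ops f cl A.a_closed A.mult_closed A.scale_closed single_ops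
        cstar_algebra.mult_closed[OF C] cstar_algebra.scale_closed[OF C]
        abelian_monoid.a_closed[OF abelian_group.axioms(1)[OF abelian_group_cstar[OF C]]])
      (simp add: times_unitz_def)
  show "bigmap A C f (cscale c F) = cscale c (bigmap A C f F)"
    by (simp add: bigmap_def prj_ops scal_ops A C f cl single_ops) (simp add: cscale_unitz_def)
  show "bigmap A C f (star F) = star (bigmap A C f F)"
    by (simp add: bigmap_def prj_ops scal_ops A C f cl single_ops) (simp add: star_unitz_def)
  show "bigmap A C f 1 = 1"
  proof -
    have p: "prj A 1 = \<zero>\<^bsub>A\<^esub>" using A by (simp add: prj_def one_unitz_def rep_cfam)
    \<comment> \<open>f 0 = 0 is obtained from homogeneity with the scalar 0.\<close>
    have "0 \<odot>\<^bsub>A\<^esub> \<zero>\<^bsub>A\<^esub> = \<zero>\<^bsub>A\<^esub>" by (rule A.scale_zero)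
    then have "f \<zero>\<^bsub>A\<^esub> = 0 \<odot>\<^bsub>C\<^esub> f \<zero>\<^bsub>A\<^esub>" using f(4)[of "\<zero>\<^bsub>A\<^esub>" 0] by simp
    then have "single C (f \<zero>\<^bsub>A\<^esub>) = cscale 0 (single C (f \<zero>\<^bsub>A\<^esub>))"
      using single_ops(3)[OF C f(1)[OF A.zero_closed], of 0] by simp
    then show ?thesis by (simp add: bigmap_def p scal_ops) (simp add: one_unitz_def)
  qed
qed

lemma bigmap_emb: "cstar_algebra A \<Longrightarrow> x \<in> carrier A \<Longrightarrow> bigmap A C f (emb A x) = emb C (f x)"
  by (simp add: bigmap_def prj_emb) (simp add: emb_def)

subsection \<open>Corners\<close>

definition corner :: "'a::cstar1 \<Rightarrow> 'a cstar" where
  "corner p = \<lparr>carrier = {x. p * x = x \<and> x * p = x}, mult = (*), one = p, zero = 0, add = (+),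
     smult = cscale, adj = star, nrm = norm\<rparr>"

lemma corner_simps [simp]:
  "carrier (corner p) = {x. p * x = x \<and> x * p = x}" "mult (corner p) = (*)" "one (corner p) = p"
  "zero (corner p) = 0" "add (corner p) = (+)" "smult (corner p) = cscale" "adj (corner p) = star" "nrm (corner p) = norm"
  by (simp_all add: corner_def)

lemma abelian_group_corner: "abelian_group (corner (p::'a::cstar1))"
  by (rule abelian_groupI)
    (auto simp: algebra_simps intro!: exI[where x = "- _"] bexI[where x = "- _"])

lemma corner_minus: "x \<in> carrier (corner p) \<Longrightarrow> y \<in> carrier (corner p) \<Longrightarrow> x \<ominus>\<^bsub>corner p\<^esub> y = x - (y::'a::cstar1)"
proof -
  interpret abelian_group "corner p" by (rule abelian_group_corner)
  assume xy: "x \<in> carrier (corner p)" "y \<in> carrier (corner p)"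
  have "\<ominus>\<^bsub>corner p\<^esub> y = - y" by (rule minus_equality) (use xy in auto)
  then show ?thesis by (simp add: a_minus_def)
qed

lemma cstar_algebra_corner:
  fixes p :: "'a::cstar1"
  assumes "star p = p"
  shows "cstar_algebra (corner p)"
proof (intro cstar_algebra.intro cstar_algebra_axioms.intro abelian_group_corner)
  fix x y :: 'a assume "x \<in> carrier (corner p)" "y \<in> carrier (corner p)"
  then show "x \<otimes>\<^bsub>corner p\<^esub> y \<in> carrier (corner p)"
    by (simp add: mult.assoc) (simp flip: mult.assoc)
next
  fix x :: 'a assume x: "x \<in> carrier (corner p)"
  show "adj (corner p) x \<in> carrier (corner p)"
    using x assms by auto (metis star_mult)+
next
  fix s :: "nat \<Rightarrow> 'a"
  assume s: "range s \<subseteq> carrier (corner p)"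
    and C: "\<forall>e>0. \<exists>N. \<forall>m\<ge>N. \<forall>n\<ge>N. nrm (corner p) (s m \<ominus>\<^bsub>corner p\<^esub> s n) < e"
  have sc: "s n \<in> carrier (corner p)" for n using s by auto
  have "Cauchy s" using C corner_minus[OF sc sc] by (simp add: Cauchy_iff)
  then obtain l where l: "s \<longlonglongrightarrow> l" by (auto simp: Cauchy_convergent_iff convergent_def)
  have "(\<lambda>n. p * s n) \<longlonglongrightarrow> p * l" "(\<lambda>n. s n * p) \<longlonglongrightarrow> l * p" by (intro tendsto_intros l)+
  moreover have "p * s n = s n" "s n * p = s n" for n using sc[of n] by auto
  ultimately have lc: "l \<in> carrier (corner p)" using l LIMSEQ_unique by auto
  have "(\<lambda>n. norm (s n - l)) \<longlonglongrightarrow> 0" using tendsto_norm_zero[OF LIM_zero[OF l]] .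
  then show "\<exists>l\<in>carrier (corner p). (\<lambda>n. nrm (corner p) (s n \<ominus>\<^bsub>corner p\<^esub> l)) \<longlonglongrightarrow> 0"
    using lc corner_minus[OF sc lc] by (intro bexI[OF _ lc]) simp
qed (simp_all add: mult.assoc cscale_add_left cscale_add_right cscale_cscale cscale_mult_left cscale_mult_right
    norm_cscale star_add star_cscale star_mult norm_mult_ineq norm_triangle_ineq norm_star_mult distrib_left distrib_right)

context star_homo
begin

text \<open>The corner is a carrier-based algebra with its own unit, so
  \<open>nilpotent_lift\<close> is applied to \<open>bigmap\<close> between the corners and the lift
  is projected back.\<close>

lemma corner_nilpotent_lift:
  assumes k: "k > 0" and p: "star p = p" "p * p = p" and X: "p * X = X" "X * p = X" "\<rho> X ^ k = 0"
  shows "\<exists>Y. p * Y = Y \<and> Y * p = Y \<and> \<rho> Y = \<rho> X \<and> Y ^ k = 0"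
proof -
  define A where "A = corner p"
  define C where "C = corner (\<rho> p)"
  have A: "cstar_algebra A" unfolding A_def by (rule cstar_algebra_corner[OF p(1)])
  have "star (\<rho> p) = \<rho> p" using p by (simp flip: hom_star)
  then have C: "cstar_algebra C" unfolding C_def by (rule cstar_algebra_corner)
  have hom: "\<rho> \<in> star_hom A C"
  proof (rule star_homI)
    fix x assume "x \<in> carrier A"
    then have "\<rho> (p * x) = \<rho> x" "\<rho> (x * p) = \<rho> x" by (simp_all add: A_def)
    then show "\<rho> x \<in> carrier C" by (simp add: C_def hom_mult)
  qed (simp_all add: A_def C_def hom_add hom_cscale hom_star hom_mult)
  interpret big: star_homo "bigmap A C \<rho>" by (rule bigmap_star_homo[OF A C hom])
  have pow: "x ^ Suc n \<in> carrier (corner q) \<and> emb (corner q) x ^ Suc n = emb (corner q) (x ^ Suc n)"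
    if "x \<in> carrier (corner q)" "cstar_algebra (corner q)" for x q :: "'c::cstar1" and n
  proof (induction n)
    case (Suc n)
    have "x ^ Suc n * x \<in> carrier (corner q)" using Suc that by (auto simp: mult.assoc) (metis mult.assoc)
    moreover have "emb (corner q) (x * x ^ Suc n) = emb (corner q) x * emb (corner q) (x ^ Suc n)"
      using emb_ops(2)[OF that(2,1), of "x ^ Suc n"] Suc by simp
    ultimately show ?case using Suc by (simp add: power_commutes mult.assoc)
  qed (use that in simp)
  obtain n where n: "k = Suc n" using k by (cases k) auto
  have XA: "X \<in> carrier A" using X unfolding A_def by simp
  then have rX: "\<rho> X \<in> carrier C" by (rule star_homD(1)[OF hom])
  have "bigmap A C \<rho> (emb A X) ^ k = emb C (\<rho> X) ^ k" by (simp add: bigmap_emb A XA)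
  also have "\<dots> = emb C (\<rho> X ^ k)" using pow[of "\<rho> X" "\<rho> p" n] rX C unfolding C_def n by simp
  also have "\<dots> = emb C (0 \<odot>\<^bsub>C\<^esub> \<rho> X)" unfolding X(3) by (simp add: C_def)
  also have "\<dots> = 0" using emb_ops(3)[OF C rX, of 0] by simp
  finally obtain F where F: "bigmap A C \<rho> F = bigmap A C \<rho> (emb A X)" "F ^ k = 0"
    using big.nilpotent_lift[OF k] by blast
  \<comment> \<open>The scalar part of a nilpotent is a nilpotent complex number, hence 0. Therefore
    \<open>prj\<close> respects the powers of F and F^k = 0 descends to the corner.\<close>
  have "scal F ^ k = 0" using F(2) scal_power[of F k] by (simp add: scal_ops)
  then have sF: "scal F = 0" by simp
  define Y where "Y = prj A F"
  have YA: "Y \<in> carrier A" unfolding Y_def using A by simp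
  have "prj A (F ^ Suc n) = Y ^ Suc n" for n
  proof (induction n)
    case (Suc n)
    have "prj A (F * F ^ Suc n) = prj A F \<otimes>\<^bsub>A\<^esub> prj A (F ^ Suc n) \<oplus>\<^bsub>A\<^esub> 0 \<odot>\<^bsub>A\<^esub> prj A F \<oplus>\<^bsub>A\<^esub> 0 \<odot>\<^bsub>A\<^esub> prj A (F ^ Suc n)"
      unfolding prj_ops(6)[OF A] scal_power sF by simp
    then show ?case unfolding Suc Y_def[symmetric] by (simp add: A_def)
  qed (simp add: Y_def)
  then have "Y ^ k = 0" using F(2) prj_ops(5)[OF A] unfolding n by (metis A_def corner_simps(4))
  moreover have "\<rho> Y = \<rho> X"
  proof -
    have "single C (\<rho> Y) = single C (\<rho> X)"
      using F(1) unfolding bigmap_def Y_def by (simp add: prj_emb A XA)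
    then show ?thesis using rep_single[OF C _ C] rX star_homD(1)[OF hom YA] by (metis (full_types))
  qed
  ultimately show ?thesis using YA unfolding A_def by auto
qed

end

subsection \<open>Idempotents\<close>

lemma neumann_inverse:
  fixes y :: "'a::{real_normed_algebra_1,banach}"
  assumes "norm y < 1"
  obtains t where "(1 - y) * t = 1" "t * (1 - y) = 1"
proof -
  define t where "t = (\<Sum>n. y ^ n)"
  have s: "summable (\<lambda>n. y ^ n)" by (rule complete_algebra_summable_geometric[OF assms])
  have "t = 1 + (\<Sum>n. y ^ Suc n)" unfolding t_def using suminf_split_head[OF s] by simp
  moreover have "(\<Sum>n. y ^ Suc n) = y * t" unfolding t_def power_Suc by (rule suminf_mult[OF s])
  moreover have "(\<Sum>n. y ^ Suc n) = t * y" unfolding t_def power_Suc2 by (rule suminf_mult2[OF s, symmetric])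
  ultimately show ?thesis by (intro that[of t]) (simp_all add: algebra_simps)
qed

lemma left_inverse_unique: "t * s = 1 \<Longrightarrow> s * t' = 1 \<Longrightarrow> t = (t'::'a::monoid_mult)"
  by (metis mult.assoc mult_1_left mult_1_right)

lemma inverse_commute:
  fixes s t z :: "'a::monoid_mult"
  assumes "s * t = 1" "t * s = 1" "z * s = s * z"
  shows "z * t = t * z"
proof -
  have "z * t = (t * s) * (z * t)" using assms by simp
  also have "\<dots> = t * (z * s) * t" by (simp only: mult.assoc assms(3))
  also have "\<dots> = t * z * (s * t)" by (simp only: mult.assoc)
  also have "\<dots> = t * z" using assms by simp
  finally show ?thesis .
qed

text \<open>Strict inequality is what makes the root invertible by a Neumann series. The scalar
  limit at r = norm x is below 1, since its complement has square 1 - r > 0.\<close>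

lemma sqrt_one_minus_norm:
  fixes x :: "'a::{real_normed_algebra_1,banach}"
  assumes "norm x < 1"
  shows "norm (1 - sqrt_one_minus x) < 1"
proof -
  define r where "r = norm x"
  have r: "0 \<le> r" "norm r \<le> 1" "r < 1" using assms unfolding r_def by auto
  have l: "(\<lambda>n. sqrt_iter r n) \<longlonglongrightarrow> lim (sqrt_iter r)" by (rule sqrt_iter_convergent[OF r(2)])
  have le1: "lim (sqrt_iter r) \<le> 1"
    by (rule LIMSEQ_le_const2[OF l]) (use sqrt_iter_real(2)[of r] r in auto)
  have "(1 - lim (sqrt_iter r)) * (1 - lim (sqrt_iter r)) = 1 - r"
    using sqrt_one_minus_square[OF r(2)] by (simp add: sqrt_one_minus_def)
  then have "lim (sqrt_iter r) \<noteq> 1" using r by auto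
  then have lt1: "lim (sqrt_iter r) < 1" using le1 by simp
  have "norm x \<le> 1" using assms by simp
  then have lx: "sqrt_iter x \<longlonglongrightarrow> 1 - sqrt_one_minus x"
    using sqrt_iter_convergent[of x] by (simp add: sqrt_one_minus_def)
  have "norm (1 - sqrt_one_minus x) \<le> lim (sqrt_iter r)"
    by (rule LIMSEQ_le[OF tendsto_norm[OF lx] l]) (use sqrt_iter_norm(1)[of x r] r in \<open>auto simp: r_def\<close>)
  then show ?thesis using lt1 by simp
qed

lemma (in star_homo) hom_sqrt_one_minus:
  assumes "norm x \<le> 1" shows "\<rho> (sqrt_one_minus x) = sqrt_one_minus (\<rho> x)"
proof -
  have "\<rho> (sqrt_iter x n) = sqrt_iter (\<rho> x) n" for n
    by (induction n) (simp_all add: hom_scaleR hom_add hom_mult)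
  then have "(\<lambda>n. \<rho> (1 - sqrt_iter x n)) = (\<lambda>n. 1 - sqrt_iter (\<rho> x) n)" by (simp add: hom_diff hom_one)
  moreover have "norm (\<rho> x) \<le> 1" using hom_norm_le[of x] assms by simp
  ultimately show ?thesis
    using hom_tendsto[OF sqrt_one_minus_lim[OF assms]] sqrt_one_minus_lim[of "\<rho> x"] LIMSEQ_unique by metis
qed

text \<open>For a = 2 e - 1 one has a a = 1 - d with d = -4 (e e - e), a strict contraction.
  Dividing a by the root of 1 - d gives an involution, and E is its spectral idempotent. In the
  image d = 0, so nothing changes there. Self-adjointness of e is only inherited, as most e here are
  not self-adjoint.\<close>

lemma (in star_homo) idempotent_near:
  assumes "norm (e * e - e) < 1 / 4" "\<rho> (e * e - e) = 0"
  obtains E where "E * E = E" "\<rho> E = \<rho> e" "\<And>z. z * e = e * z \<Longrightarrow> z * E = E * z" "star e = e \<Longrightarrow> star E = E"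
proof -
  define d where "d = (-4) *\<^sub>R (e * e - e)"
  define a where "a = 2 *\<^sub>R e - 1"
  define s where "s = sqrt_one_minus d"
  have dn: "norm d < 1" using assms(1) unfolding d_def by simp
  have aa: "a * a = 1 - d"
  proof -
    have four: "(-4) *\<^sub>R w = - w - w - w - w" for w :: 'a
    proof -
      have "(-4) *\<^sub>R w = ((-1) + (-1) + (-1) + (-1)) *\<^sub>R w" by simp
      also have "\<dots> = - w - w - w - w" by (simp only: scaleR_add_left scaleR_minus1_left) simp
      finally show ?thesis .
    qed
    have ad: "a = e + e - 1" "d = - (e * e - e) - (e * e - e) - (e * e - e) - (e * e - e)"
      unfolding a_def d_def by (simp only: scaleR_2, rule four)
    show ?thesis unfolding ad by (simp add: algebra_simps)
  qed
  have ss: "s * s = 1 - d" unfolding s_def by (rule sqrt_one_minus_square) (use dn in simp)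
  obtain t where t: "s * t = 1" "t * s = 1"
    using neumann_inverse[OF sqrt_one_minus_norm[OF dn]] unfolding s_def by auto
  have sz: "z * s = s * z" if "z * e = e * z" for z
    unfolding s_def
  proof (rule sqrt_one_minus_commute)
    have "z * (e * e) = e * e * z" using that by (metis mult.assoc)
    then show "z * d = d * z" unfolding d_def using that by (simp add: algebra_simps)
  qed (use dn in simp)
  have tz: "z * t = t * z" if "z * e = e * z" for z by (rule inverse_commute[OF t sz[OF that]])
  have az: "z * a = a * z" if "z * e = e * z" for z using that unfolding a_def by (simp add: algebra_simps)
  have ea: "a * e = e * a" unfolding a_def by (simp add: algebra_simps)
  have at: "a * t = t * a" by (rule tz[OF ea])
  define E where "E = (1/2) *\<^sub>R (1 + a * t)"
  have att: "(a * t) * (a * t) = 1"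
  proof -
    have "(a * t) * (a * t) = (a * a) * (t * t)" by (metis at mult.assoc)
    also have "\<dots> = (s * s) * (t * t)" by (simp only: aa ss)
    also have "\<dots> = s * (s * t) * t" by (simp only: mult.assoc)
    finally show ?thesis using t by simp
  qed
  have "E * E = (1/4) *\<^sub>R (1 + a * t + (a * t + (a * t) * (a * t)))"
    unfolding E_def by (simp add: algebra_simps)
  also have "\<dots> = E" unfolding att E_def by (simp add: algebra_simps) (simp flip: scaleR_add_left)
  finally have EE: "E * E = E" .
  have "\<rho> d = 0" unfolding d_def using assms(2) by (simp only: hom_scaleR) simp
  then have "\<rho> s = sqrt_one_minus 0" unfolding s_def using hom_sqrt_one_minus[of d] dn by simp
  also have "sqrt_one_minus 0 = (1 :: 'b)"
  proof -
    have "sqrt_iter (0::'b) n = 0" for n by (induction n) auto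
    then have "sqrt_iter (0::'b) = (\<lambda>_. 0)" by (rule ext)
    then show ?thesis by (simp add: sqrt_one_minus_def limI)
  qed
  finally have rs: "\<rho> s = 1" .
  have "\<rho> s * \<rho> t = 1" using t(1) by (simp flip: hom_mult add: hom_one)
  then have "\<rho> t = 1" using rs by simp
  then have rE: "\<rho> E = \<rho> e" unfolding E_def a_def by (simp add: hom_scaleR hom_add hom_mult hom_diff hom_one)
  have zE: "z * E = E * z" if "z * e = e * z" for z
  proof -
    have "z * (a * t) = (a * t) * z" by (metis az[OF that] tz[OF that] mult.assoc)
    then show ?thesis unfolding E_def by (simp add: algebra_simps)
  qed
  have "star E = E" if "star e = e"
  proof -
    have as: "star a = a" unfolding a_def by (simp add: star_diff star_scaleR that)
    have ds: "star d = d" unfolding d_def by (simp only: star_diff star_scaleR star_mult that)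
    have "star s = s" unfolding s_def using dn by (intro sqrt_one_minus_star ds) simp
    then have "star t * s = 1" using t(1) by (metis star_mult star_one)
    then have "star t = t" by (rule left_inverse_unique[OF _ t(1)])
    then show ?thesis unfolding E_def by (simp add: star_scaleR star_add star_mult as at)
  qed
  with EE rE zE show ?thesis by (rule that)
qed

text \<open>The idempotents commute, so Gram-Schmidt is exact: each new e is multiplied by 1 - Q,
  with Q the sum of those already corrected. The factor maps to 1 on the image of e, because the
  images are orthogonal. The commutation clause keeps the induction going.\<close>

lemma (in star_homo) orthogonal_idempotents:
  assumes "finite I" "\<And>i. i \<in> I \<Longrightarrow> e i * e i = e i" "\<And>i j. i \<in> I \<Longrightarrow> j \<in> I \<Longrightarrow> e i * e j = e j * e i"
    "\<And>i j. i \<in> I \<Longrightarrow> j \<in> I \<Longrightarrow> i \<noteq> j \<Longrightarrow> \<rho> (e i * e j) = 0"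
  shows "\<exists>E. (\<forall>i\<in>I. E i * E i = E i \<and> \<rho> (E i) = \<rho> (e i) \<and> (\<forall>z. (\<forall>j\<in>I. z * e j = e j * z) \<longrightarrow> z * E i = E i * z)) \<and>
    (\<forall>i\<in>I. \<forall>j\<in>I. i \<noteq> j \<longrightarrow> E i * E j = 0)"
  using assms
proof (induction I rule: finite_induct)
  case (insert a I)
  have "\<exists>E. (\<forall>i\<in>I. E i * E i = E i \<and> \<rho> (E i) = \<rho> (e i) \<and> (\<forall>z. (\<forall>j\<in>I. z * e j = e j * z) \<longrightarrow> z * E i = E i * z)) \<and>
    (\<forall>i\<in>I. \<forall>j\<in>I. i \<noteq> j \<longrightarrow> E i * E j = 0)"
    by (rule insert.IH; rule insert.prems; simp)
  then obtain E where
    E0: "\<forall>i\<in>I. E i * E i = E i \<and> \<rho> (E i) = \<rho> (e i) \<and> (\<forall>z. (\<forall>j\<in>I. z * e j = e j * z) \<longrightarrow> z * E i = E i * z)"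
    and E1: "\<forall>i\<in>I. \<forall>j\<in>I. i \<noteq> j \<longrightarrow> E i * E j = 0" by (elim exE conjE)
  have E: "E i * E i = E i" "\<rho> (E i) = \<rho> (e i)" if "i \<in> I" for i using E0 that by auto
  have Ez: "z * E i = E i * z" if "\<forall>j\<in>I. z * e j = e j * z" "i \<in> I" for z i using E0 that by blast
  have Eo: "E i * E j = 0" if "i \<in> I" "j \<in> I" "i \<noteq> j" for i j using E1 that by blast
  define Q where "Q = (\<Sum>i\<in>I. E i)"
  have EQ: "E i * Q = E i" "Q * E i = E i" if "i \<in> I" for i
  proof -
    have "E i * Q = (\<Sum>j\<in>I. if j = i then E i else 0)"
      unfolding Q_def sum_distrib_left using that E Eo by (intro sum.cong) auto
    then show "E i * Q = E i" using that insert.hyps by simp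
    have "Q * E i = (\<Sum>j\<in>I. if j = i then E i else 0)"
      unfolding Q_def sum_distrib_right using that E Eo by (intro sum.cong) auto
    then show "Q * E i = E i" using that insert.hyps by simp
  qed
  have QQ: "Q * Q = Q"
  proof -
    have "Q * Q = (\<Sum>i\<in>I. Q * E i)" by (subst (2) Q_def) (simp add: sum_distrib_left)
    also have "\<dots> = (\<Sum>i\<in>I. E i)" using EQ by simp
    finally show ?thesis unfolding Q_def .
  qed
  have Qz: "z * Q = Q * z" if "\<forall>j\<in>I. z * e j = e j * z" for z
    unfolding Q_def sum_distrib_left sum_distrib_right using Ez[OF that] by simp
  have ea: "\<forall>j\<in>I. e a * e j = e j * e a" using insert.prems by auto
  define E' where "E' i = (if i = a then e a * (1 - Q) else E i)" for i
  have E'I: "E' i = E i" if "i \<in> I" for i using that insert.hyps unfolding E'_def by auto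
  have E'a: "E' a = e a * (1 - Q)" unfolding E'_def by simp
  have eaQ: "e a * Q = Q * e a" by (rule Qz[OF ea])
  have idem: "E' a * E' a = E' a"
  proof -
    have "E' a * E' a = (e a * e a) * ((1 - Q) * (1 - Q))"
      unfolding E'a using eaQ by (simp add: algebra_simps) (metis mult.assoc)
    also have "\<dots> = e a * (1 - Q)" using QQ insert.prems(1)[of a] by (simp add: algebra_simps)
    finally show ?thesis unfolding E'a .
  qed
  have "\<rho> (e a) * \<rho> Q = 0"
    unfolding Q_def hom_sum sum_distrib_left
  proof (rule sum.neutral, rule ballI)
    fix i assume i: "i \<in> I"
    then have "\<rho> (e a * e i) = 0" using insert.hyps insert.prems(3)[of a i] by auto
    then show "\<rho> (e a) * \<rho> (E i) = 0" using E(2)[OF i] by (simp add: hom_mult)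
  qed
  then have rho: "\<rho> (E' a) = \<rho> (e a)" unfolding E'a by (simp add: hom_mult hom_diff hom_one algebra_simps)
  have orth: "E' a * E i = 0 \<and> E i * E' a = 0" if "i \<in> I" for i
  proof
    show "E' a * E i = 0" unfolding E'a using EQ[OF that] by (simp add: mult.assoc left_diff_distrib)
    have "E i * E' a = e a * (E i * (1 - Q))"
      unfolding E'a using Ez[OF ea that] by (metis mult.assoc)
    then show "E i * E' a = 0" using EQ[OF that] by (simp add: right_diff_distrib)
  qed
  have "z * E' a = E' a * z" if "\<forall>j\<in>insert a I. z * e j = e j * z" for z
  proof -
    have "z * Q = Q * z" "z * e a = e a * z" using that by (auto intro: Qz)
    then show ?thesis unfolding E'a by (simp add: algebra_simps) (metis mult.assoc)
  qed
  moreover have "z * E' i = E' i * z" if "i \<in> insert a I" "\<forall>j\<in>insert a I. z * e j = e j * z" for z i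
    using that calculation[of z] E'I[of i] Ez[of z i] by (cases "i = a") auto
  moreover have "E' i * E' i = E' i \<and> \<rho> (E' i) = \<rho> (e i)" if "i \<in> insert a I" for i
    using that idem rho E'I[of i] E[of i] by (cases "i = a") auto
  moreover have "E' i * E' j = 0" if "i \<in> insert a I" "j \<in> insert a I" "i \<noteq> j" for i j
    using that orth[of i] orth[of j] Eo[of i j] E'I[of i] E'I[of j] by (cases "i = a"; cases "j = a") auto
  ultimately show ?case by (intro exI[where x = E'] conjI ballI allI impI) auto
qed simp

text \<open>Conjugation by the square root of \<open>\<Sum> E\<^sub>i* E\<^sub>i\<close> turns the idempotents into projections.\<close>

lemma idempotents_similar_projections:
  fixes E :: "'i \<Rightarrow> 'a::cstar1"
  assumes "finite I" and idem: "\<And>i. i \<in> I \<Longrightarrow> E i * E i = E i"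
    and orth: "\<And>i j. i \<in> I \<Longrightarrow> j \<in> I \<Longrightarrow> i \<noteq> j \<Longrightarrow> E i * E j = 0" and one: "(\<Sum>i\<in>I. E i) = 1"
    and h: "h = (\<Sum>i\<in>I. star (E i) * E i)"
  obtains c where "0 < c" "c \<le> 1" "pos (h - of_real (c\<^sup>2))"
    "\<And>i. i \<in> I \<Longrightarrow> star (fc (\<lambda>t. sqrt (max (c\<^sup>2) t)) h * E i * fc (\<lambda>t. inverse (sqrt (max (c\<^sup>2) t))) h)
      = fc (\<lambda>t. sqrt (max (c\<^sup>2) t)) h * E i * fc (\<lambda>t. inverse (sqrt (max (c\<^sup>2) t))) h"
proof -
  define n where "n = real (card I)"
  have "I \<noteq> {}" using one by auto
  then have n: "n \<ge> 1" unfolding n_def using assms(1) by (simp add: Suc_leI card_gt_0_iff)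
  define c where "c = 1 / sqrt n"
  have c: "0 < c" "c \<le> 1" "c\<^sup>2 = 1 / n" unfolding c_def using n by (auto simp: power_divide)
  have hs: "star h = h" unfolding h by (simp add: star_sum star_mult)
  \<comment> \<open>Since the E i sum to 1, this double sum is 2 n h - 2, so h \<ge> 1 / n. This is
    the origin of c.\<close>
  have "pos (\<Sum>i\<in>I. \<Sum>j\<in>I. star (E i - E j) * (E i - E j))"
    by (intro pos_sum pos_star_mult)
  also have "(\<Sum>i\<in>I. \<Sum>j\<in>I. star (E i - E j) * (E i - E j))
    = (\<Sum>i\<in>I. \<Sum>j\<in>I. star (E i) * E i) - (\<Sum>i\<in>I. \<Sum>j\<in>I. star (E i) * E j)
      - (\<Sum>i\<in>I. \<Sum>j\<in>I. star (E j) * E i) + (\<Sum>i\<in>I. \<Sum>j\<in>I. star (E j) * E j)"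
    by (simp add: star_diff sum.distrib sum_subtractf algebra_simps)
  also have "(\<Sum>i\<in>I. \<Sum>j\<in>I. star (E i) * E i) = n *\<^sub>R h"
    unfolding h n_def by (simp add: scaleR_sum_right sum_constant_scaleR del: sum_constant)
  also have "(\<Sum>i\<in>I. \<Sum>j\<in>I. star (E j) * E j) = n *\<^sub>R h"
    unfolding h n_def by (simp add: sum_constant_scaleR del: sum_constant)
  also have "(\<Sum>i\<in>I. \<Sum>j\<in>I. star (E i) * E j) = 1"
    using one by (simp flip: sum_product add: star_sum[symmetric])
  also have "(\<Sum>i\<in>I. \<Sum>j\<in>I. star (E j) * E i) = 1"
    using one by (subst sum.swap) (simp flip: sum_product add: star_sum[symmetric])
  finally have "pos ((1 / (2 * n)) *\<^sub>R (n *\<^sub>R h - 1 - 1 + n *\<^sub>R h))" using n by (intro pos_scaleR) auto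
  also have "(1 / (2 * n)) *\<^sub>R (n *\<^sub>R h - 1 - 1 + n *\<^sub>R h) = h - of_real (c\<^sup>2)"

  proof -
    have "(1 / (2 * n)) *\<^sub>R (n *\<^sub>R h - 1 - 1 + n *\<^sub>R h) = (1 / (2 * n)) *\<^sub>R ((2 * n) *\<^sub>R h - 2 *\<^sub>R 1)"
      by (simp only: mult_2 scaleR_add_left scaleR_2) (simp add: algebra_simps)
    also have "\<dots> = h - (1 / n) *\<^sub>R 1" using n by (simp add: scaleR_diff_right)
    finally show ?thesis unfolding c(3) of_real_def .
  qed
  finally have hp: "pos (h - of_real (c\<^sup>2))" .
  define S where "S = fc (\<lambda>t. sqrt (max (c\<^sup>2) t)) h"
  define T where "T = fc (\<lambda>t. inverse (sqrt (max (c\<^sup>2) t))) h"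
  have cf: "continuous_on UNIV (\<lambda>t::real. sqrt (max (c\<^sup>2) t))" by (intro continuous_intros)
  have nz: "sqrt (max (c\<^sup>2) t) \<noteq> 0" for t using c(1) by (auto simp: max_def)
  have cg: "continuous_on UNIV (\<lambda>t::real. inverse (sqrt (max (c\<^sup>2) t)))" using nz by (intro continuous_intros) auto
  have ST: "star S = S" "star T = T" unfolding S_def T_def by (intro fc_star hs cf cg)+
  have TS: "T * S = 1" "S * T = 1"
    unfolding S_def T_def fc_mult[OF hs cf cg, symmetric] fc_mult[OF hs cg cf, symmetric]
    using nz by (simp_all add: fc_const hs)
  have hb: "between (c\<^sup>2) (norm h) h" unfolding between_def using hp pos_norm_minus[OF hs order_refl] by simp
  have SS: "S * S = h"
  proof -
    have "S * S = fc (\<lambda>t. t) h" unfolding S_def fc_mult[OF hs cf cf, symmetric]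
    proof (rule fc_cong[OF hb])
      show "sqrt (max (c\<^sup>2) t) * sqrt (max (c\<^sup>2) t) = t" if "t \<in> {c\<^sup>2..norm h}" for t
      proof -
        have "0 \<le> t" "max (c\<^sup>2) t = t" using that zero_le_power2[of c] unfolding atLeastAtMost_iff by linarith+
        then show ?thesis by simp
      qed
    qed (intro continuous_intros)+
    then show ?thesis by (simp add: fc_id hs)
  qed
  have proj: "star (S * E i * T) = S * E i * T" if i: "i \<in> I" for i
  proof -
    \<comment> \<open>Orthogonality leaves one summand, so h E i = star (E i) h. Splitting h = S S
      and cancelling roots gives the self-adjointness of S E i T.\<close>
    have "h * E i = (\<Sum>j\<in>I. if j = i then star (E i) * E i else 0)"
      unfolding h sum_distrib_right using i idem orth by (intro sum.cong) (auto simp: mult.assoc)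
    then have 1: "h * E i = star (E i) * E i" using i assms(1) by simp
    then have "star (E i) * h = star (E i) * E i" using hs by (metis star_mult star_star)
    with 1 have "S * S * E i = star (E i) * (S * S)" unfolding SS by simp
    then have "T * (S * S * E i) * T = T * (star (E i) * (S * S)) * T" by simp
    then have "(T * S) * S * E i * T = T * star (E i) * S * (S * T)" by (simp only: mult.assoc)
    then have "S * E i * T = T * star (E i) * S" by (simp add: TS)
    then show ?thesis by (simp add: star_mult ST mult.assoc)
  qed
  show ?thesis using that[OF c(1,2) hp] proj unfolding S_def T_def by blast
qed

subsection \<open>Correcting the norm\<close>

lemma summable_affine_recursion:
  fixes a b :: "nat \<Rightarrow> real"
  assumes "\<And>n. 0 \<le> a n" "\<And>n. a (Suc n) \<le> r * a n + b n" "0 \<le> r" "r < 1" "summable b" "\<And>n. 0 \<le> b n"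
  shows "summable a"
proof (rule summableI_nonneg_bounded)
  have b: "(\<Sum>i<n. b i) \<le> suminf b" for n by (rule sum_le_suminf) (use assms in auto)
  show "(\<Sum>i<n. a i) \<le> (a 0 + suminf b) / (1 - r)" for n
  proof -
    have a: "(\<Sum>i<n. a i) \<le> (\<Sum>i<Suc n. a i)" using assms(1)[of n] by simp
    also have "\<dots> = a 0 + (\<Sum>i<n. a (Suc i))" by (rule sum.lessThan_Suc_shift)
    also have "(\<Sum>i<n. a (Suc i)) \<le> (\<Sum>i<n. r * a i + b i)" by (intro sum_mono assms)
    also have "\<dots> = r * (\<Sum>i<n. a i) + (\<Sum>i<n. b i)" by (simp add: sum.distrib sum_distrib_left)
    finally have "(1 - r) * (\<Sum>i<n. a i) \<le> a 0 + suminf b" using b[of n] by (simp add: algebra_simps)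
    then show ?thesis using assms(4) by (simp add: pos_le_divide_eq mult.commute)
  qed
qed (use assms in auto)

text \<open>On a generalized eigenspace of l, T^(m+1) y = l T^m y + T^m D y with D = T - l.
  Stripping the k factors D one at a time, each stage is an affine recursion of ratio |l| < 1 with
  summable inhomogeneity.\<close>

lemma summable_powers:
  fixes T z :: "'a::cstar1"
  assumes "(T - cscale l 1) ^ k * z = 0" "cmod l < 1"
  shows "summable (\<lambda>m. norm (T ^ m * z))"
proof -
  define D where "D = T - cscale l 1"
  have "summable (\<lambda>m. norm (T ^ m * D ^ (k - r) * z))" for r
  proof (induction r)
    case 0
    show ?case using assms(1) by (simp add: D_def mult.assoc)
  next
    case (Suc r)
    show ?case
    proof (cases "r < k")
      case False
      then show ?thesis using Suc by simp
    next
      case True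
      then have k: "k - r = Suc (k - Suc r)" by simp
      have TD: "T * D = D * T" unfolding D_def by (simp add: algebra_simps cscale_mult_left cscale_mult_right)
      show ?thesis
      proof (rule summable_affine_recursion[OF _ _ _ assms(2) Suc])
        fix m
        have "T ^ Suc m * D ^ (k - Suc r) * z = cscale l (T ^ m * D ^ (k - Suc r) * z) + T ^ m * D ^ (k - r) * z"
        proof -
          have "T ^ Suc m = T ^ m * (cscale l 1 + D)" unfolding D_def by (simp add: power_Suc2 del: power_Suc)
          then show ?thesis unfolding k
            by (simp add: algebra_simps cscale_mult_left cscale_mult_right)
        qed
        also have "norm \<dots> \<le> cmod l * norm (T ^ m * D ^ (k - Suc r) * z) + norm (T ^ m * D ^ (k - r) * z)"
          by (rule order_trans[OF norm_triangle_ineq]) (simp add: norm_cscale)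
        finally show "norm (T ^ Suc m * D ^ (k - Suc r) * z) \<le> cmod l * norm (T ^ m * D ^ (k - Suc r) * z) + norm (T ^ m * D ^ (k - r) * z)" .
      qed auto
    qed
  qed
  from this[of k] show ?thesis by simp
qed

text \<open>
  With \<open>c = (T*T - 1)\<^sub>+\<close>, which vanishes in the quotient, \<open>H = 1 + \<Sum>\<^sub>m T*\<^sup>m c T\<^sup>m\<close> satisfies \<open>T* H T \<le> H\<close>.
\<close>

lemma (in star_homo) contraction_similar:
  assumes sum: "summable (\<lambda>m. norm (T ^ m * z))" and z: "star z = z" "z * T = T * z"
    and cz: "fc (\<lambda>t. max 0 (t - 1)) (star T * T) * z = fc (\<lambda>t. max 0 (t - 1)) (star T * T)"
    and r: "norm (\<rho> T) \<le> 1"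
  obtains S S' where "S * S' = 1" "S' * S = 1" "\<rho> S = 1" "\<rho> S' = 1" "norm (S * T * S') \<le> 1"
proof -
  define c where "c = fc (\<lambda>t. max 0 (t - 1)) (star T * T)"
  have cf: "continuous_on UNIV (\<lambda>t::real. max 0 (t - 1))" by (intro continuous_intros)
  have TT: "star (star T * T) = star T * T" "pos (star T * T)" by (simp_all add: star_mult pos_star_mult)
  have c: "pos c" unfolding c_def by (rule fc_pos[OF pos_imp_between[OF TT(2) order_refl] cf]) simp
  have cz: "c * z = c" using cz unfolding c_def .
  then have zc: "z * c = c" using pos_star[OF c] z(1) by (metis star_mult)
  \<comment> \<open>Because c = z c z and z commutes with T, M m only involves T^m z, whose norms
    are summable. No decay of T^m itself is available.\<close>
  define M where "M m = star (T ^ m) * c * T ^ m" for m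
  have Mz: "M m = star (T ^ m * z) * c * (T ^ m * z)" for m
  proof -
    have zT: "z * T ^ m = T ^ m * z" using z(2) by (metis power_commuting_commutes)
    have "M m = star (T ^ m) * (z * c * z) * T ^ m" unfolding M_def using cz zc by simp
    then have "M m = star (z * T ^ m) * c * (z * T ^ m)" by (simp only: star_mult z(1) mult.assoc)
    then show ?thesis unfolding zT .
  qed
  have "summable M"
  proof (rule summable_comparison_test_ev)
    have "(\<lambda>m. norm (T ^ m * z)) \<longlonglongrightarrow> 0" by (rule summable_LIMSEQ_zero[OF sum])
    then have "\<forall>\<^sub>F m in sequentially. norm (T ^ m * z) < 1" by (rule order_tendstoD) simp
    then show "\<forall>\<^sub>F m in sequentially. norm (M m) \<le> norm c * norm (T ^ m * z)"
    proof eventually_elim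
      case (elim m)
      have "norm (M m) \<le> norm (T ^ m * z) * norm c * norm (T ^ m * z)"
        unfolding Mz by (intro order_trans[OF norm_mult_ineq] mult_right_mono) (auto simp: norm_mult_ineq[of "star _", simplified])
      also have "\<dots> \<le> 1 * norm c * norm (T ^ m * z)" using elim by (intro mult_right_mono) auto
      finally show ?case by simp
    qed
    show "summable (\<lambda>m. norm c * norm (T ^ m * z))" by (intro summable_mult sum)
  qed
  define K where "K = (\<Sum>m. M m)"
  define H where "H = 1 + K"
  have MS: "M (Suc m) = star T * M m * T" for m
    unfolding M_def by (simp add: star_mult power_Suc2 mult.assoc del: power_Suc)
  have "K = M 0 + (\<Sum>m. M (Suc m))" unfolding K_def using suminf_split_head[OF \<open>summable M\<close>] by simp
  also have "(\<Sum>m. M (Suc m)) = star T * K * T"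
    unfolding MS K_def suminf_mult2[OF summable_mult[OF \<open>summable M\<close>], symmetric] suminf_mult[OF \<open>summable M\<close>] ..
  finally have Keq: "K = c + star T * K * T" by (simp add: M_def)
  have "pos K"
  proof (rule pos_closed)
    show "(\<lambda>n. \<Sum>m<n. M m) \<longlonglongrightarrow> K" unfolding K_def by (rule summable_LIMSEQ[OF \<open>summable M\<close>])
    show "pos (\<Sum>m<n. M m)" for n unfolding M_def by (intro pos_sum pos_conj c)
  qed
  then have Hp: "pos (H - 1)" "pos H" unfolding H_def by (auto intro: pos_add)
  have Hs: "star H = H" by (rule pos_star[OF Hp(2)])
  have Hb: "between 1 (norm H) H" unfolding between_def using Hp(1) pos_norm_minus[OF Hs order_refl] by simp
  \<comment> \<open>By K = c + star T K T the difference equals 1 - star T T + c, and 1 - t + max 0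
    (t - 1) is nonnegative for t \<ge> 0.\<close>
  have HT: "pos (H - star T * H * T)"
  proof -
    have "pos (fc (\<lambda>t. 1 - t + max 0 (t - 1)) (star T * T))"
      by (rule fc_pos[OF pos_imp_between[OF TT(2) order_refl]]) (auto intro!: continuous_intros)
    also have "fc (\<lambda>t. 1 - t + max 0 (t - 1)) (star T * T) = 1 - star T * T + c"
      unfolding c_def using TT(1) cf by (simp add: fc_add fc_diff fc_const fc_id continuous_intros)
    also have "\<dots> = H - star T * H * T"
      unfolding H_def by (subst (1) Keq) (simp add: algebra_simps)
    finally show ?thesis .
  qed
  define S where "S = fc (\<lambda>t. sqrt (max 1 t)) H"
  define S' where "S' = fc (\<lambda>t. inverse (sqrt (max 1 t))) H"
  have cs: "continuous_on UNIV (\<lambda>t::real. sqrt (max 1 t))" by (intro continuous_intros)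
  have nz: "sqrt (max 1 t) \<noteq> 0" for t by (auto simp: max_def)
  have cs': "continuous_on UNIV (\<lambda>t::real. inverse (sqrt (max 1 t)))" using nz by (intro continuous_intros) auto
  have SS': "S * S' = 1" "S' * S = 1"
    unfolding S_def S'_def fc_mult[OF Hs cs cs', symmetric] fc_mult[OF Hs cs' cs, symmetric]
    using nz by (simp_all add: fc_const Hs)
  have Sst: "star S = S" "star S' = S'" unfolding S_def S'_def by (intro fc_star Hs cs cs')+
  have SS: "S * S = H"
  proof -
    have "S * S = fc (\<lambda>t. t) H" unfolding S_def fc_mult[OF Hs cs cs, symmetric]
      by (rule fc_cong[OF Hb], (intro continuous_intros)+) (simp add: max_def)
    then show ?thesis by (simp add: fc_id Hs)
  qed
  have "norm (S * T * S') \<le> 1"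
  proof (rule norm_sq_le)
    have "star (S * T * S') * (S * T * S') = S' * (star T * (S * S) * T) * S'"
      by (simp add: star_mult Sst mult.assoc)
    moreover have "S' * H * S' = (S' * S) * (S * S')" by (simp only: SS[symmetric] mult.assoc)
    then have "S' * H * S' = 1" by (simp add: SS')
    ultimately have "of_real (1\<^sup>2) - star (S * T * S') * (S * T * S') = S' * (H - star T * H * T) * S'"
      unfolding SS by (simp add: algebra_simps)
    then show "pos (of_real (1\<^sup>2) - star (S * T * S') * (S * T * S'))"
      using pos_conj[OF HT, of S'] Sst by simp
  qed simp
  moreover have "\<rho> H = 1"
  proof -
    have "norm (star (\<rho> T) * \<rho> T) \<le> 1" unfolding norm_star_mult using r by (simp add: abs_square_le_1)
    then have "between 0 1 (star (\<rho> T) * \<rho> T)" by (intro pos_imp_between pos_star_mult)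
    then have "fc (\<lambda>t. max 0 (t - 1)) (star (\<rho> T) * \<rho> T) = fc (\<lambda>_. 0) (star (\<rho> T) * \<rho> T)"
      by (rule fc_cong) (auto intro!: continuous_intros)
    then have "\<rho> c = 0" unfolding c_def by (simp add: hom_fc TT cf hom_mult hom_star fc_const star_mult)
    then have "\<rho> (M m) = 0" for m unfolding M_def by (simp add: hom_mult)
    moreover have "(\<lambda>n. \<rho> (\<Sum>m<n. M m)) \<longlonglongrightarrow> \<rho> K"
      unfolding K_def by (intro hom_tendsto summable_LIMSEQ \<open>summable M\<close>)
    ultimately have "\<rho> K = 0" by (simp add: hom_sum LIMSEQ_const_iff)
    then show ?thesis unfolding H_def by (simp add: hom_add hom_one)
  qed
  then have "\<rho> S = 1" "\<rho> S' = 1"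
    unfolding S_def S'_def using fc_of_real[OF cs, of 1, where 'a = 'b] fc_of_real[OF cs', of 1, where 'a = 'b]
    by (simp_all add: hom_fc Hs cs cs')
  ultimately show ?thesis using that SS' by blast
qed

subsection \<open>Comaximal polynomials\<close>

text \<open>A Bezout identity, so that divisibility by a product of polynomials can be checked
  factor by factor and the idempotents modulo the product exist.\<close>

definition comaximal :: "'a::comm_ring_1 \<Rightarrow> 'a \<Rightarrow> bool" where
  "comaximal x y \<longleftrightarrow> (\<exists>u v. u * x + v * y = 1)"

lemma comaximal_mult: assumes "comaximal x y" "comaximal x z" shows "comaximal x (y * z)"
proof -
  obtain u v u' v' where *: "u * x + v * y = 1" "u' * x + v' * z = 1" using assms unfolding comaximal_def by blast
  have "1 = (u * x + v * y) * (u' * x + v' * z)" unfolding * by simp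
  also have "\<dots> = (u * (u' * x + v' * z) + v * y * u') * x + v * v' * (y * z)" by (simp add: algebra_simps)
  finally show ?thesis unfolding comaximal_def by metis
qed

lemma comaximal_one: "comaximal x 1"
  unfolding comaximal_def by (intro exI[where x = 0] exI[where x = 1]) simp

lemma comaximal_sym: "comaximal x y \<Longrightarrow> comaximal y x"
  unfolding comaximal_def by (metis add.commute)

lemma comaximal_prod: "(\<And>i. i \<in> I \<Longrightarrow> comaximal x (f i)) \<Longrightarrow> comaximal x (prod f I)"
  by (induction I rule: infinite_finite_induct) (auto intro: comaximal_mult comaximal_one)

lemma comaximal_power: "comaximal x y \<Longrightarrow> comaximal x (y ^ n)"
  by (induction n) (auto intro: comaximal_mult comaximal_one)

lemma comaximal_linear: assumes "a \<noteq> (b::'a::field)" shows "comaximal ([:- a, 1:] ^ m) ([:- b, 1:] ^ n)"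
proof -
  define c where "c = 1 / (b - a)"
  have "(b - a) * c = 1" unfolding c_def using assms by simp
  then have "[:c:] * [:- a, 1:] + [:- c:] * [:- b, 1:] = 1"
    by (simp add: one_pCons algebra_simps)
  then have "comaximal [:- a, 1:] [:- b, 1:]" unfolding comaximal_def by blast
  then show ?thesis by (rule comaximal_power[OF comaximal_sym[OF comaximal_power[OF comaximal_sym]]])
qed

lemma comaximal_mult_dvd: assumes "comaximal x y" "x dvd z" "y dvd z" shows "x * y dvd z"
proof -
  obtain u v where uv: "u * x + v * y = 1" using assms(1) unfolding comaximal_def by blast
  have "x * y dvd z * (u * x) + z * (v * y)"
    by (intro dvd_add) (use mult_dvd_mono[OF assms(3) dvd_triv_right[of x u]] mult_dvd_mono[OF assms(2) dvd_triv_right[of y v]] in \<open>simp_all add: mult.commute\<close>)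
  then show ?thesis using uv by (simp flip: distrib_left)
qed

lemma comaximal_prod_dvd:
  assumes "finite I" "\<And>i j. i \<in> I \<Longrightarrow> j \<in> I \<Longrightarrow> i \<noteq> j \<Longrightarrow> comaximal (f i) (f j)" "\<And>i. i \<in> I \<Longrightarrow> f i dvd z"
  shows "prod f I dvd z"
  using assms
proof (induction I rule: finite_induct)
  case (insert a I)
  then have "prod f I dvd z" by simp
  moreover have "comaximal (f a) (prod f I)" using insert by (intro comaximal_prod) auto
  ultimately show ?case using insert by (simp add: comaximal_mult_dvd)
qed simp

locale linear_powers =
  fixes I :: "'i set" and lam :: "'i \<Rightarrow> complex" and k :: "'i \<Rightarrow> nat"
  assumes fin: "finite I" and inj: "inj_on lam I" and k_pos: "i \<in> I \<Longrightarrow> k i > 0"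
begin

definition pfac :: "'i \<Rightarrow> complex poly" where "pfac i = [:- lam i, 1:] ^ k i"

definition ppoly :: "complex poly" where "ppoly = (\<Prod>i\<in>I. pfac i)"

lemma comaximal_pfac: "i \<in> I \<Longrightarrow> j \<in> I \<Longrightarrow> i \<noteq> j \<Longrightarrow> comaximal (pfac i) (pfac j)"
  unfolding pfac_def using inj by (intro comaximal_linear) (auto dest: inj_onD)

lemma ppoly_dvd: "(\<And>i. i \<in> I \<Longrightarrow> pfac i dvd q) \<Longrightarrow> ppoly dvd q"
  unfolding ppoly_def by (rule comaximal_prod_dvd[OF fin comaximal_pfac])

text \<open>The idempotents of the Chinese remainder theorem: 1 modulo the i-th factor and 0 modulo
  the others. Evaluated at a zero of the polynomial they are the spectral idempotents.\<close>

definition idem_poly :: "'i \<Rightarrow> complex poly" where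
  "idem_poly i = (SOME e. pfac i dvd 1 - e \<and> (\<forall>j\<in>I - {i}. pfac j dvd e))"

lemma idem_poly:
  assumes "i \<in> I"
  shows "pfac i dvd 1 - idem_poly i" "\<And>j. j \<in> I \<Longrightarrow> j \<noteq> i \<Longrightarrow> pfac j dvd idem_poly i"
proof -
  have "comaximal (pfac i) (\<Prod>j\<in>I - {i}. pfac j)" using assms by (intro comaximal_prod comaximal_pfac) auto
  then obtain u v where uv: "u * pfac i + v * (\<Prod>j\<in>I - {i}. pfac j) = 1" unfolding comaximal_def by blast
  have "\<exists>e. pfac i dvd 1 - e \<and> (\<forall>j\<in>I - {i}. pfac j dvd e)"
  proof (intro exI[where x = "v * (\<Prod>j\<in>I - {i}. pfac j)"] conjI ballI)
    show "pfac i dvd 1 - v * (\<Prod>j\<in>I - {i}. pfac j)" unfolding uv[symmetric] by simp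
    show "pfac j dvd v * (\<Prod>j\<in>I - {i}. pfac j)" if "j \<in> I - {i}" for j
      using that fin by (intro dvd_mult dvd_prodI) auto
  qed
  from someI_ex[OF this] show "pfac i dvd 1 - idem_poly i" "\<And>j. j \<in> I \<Longrightarrow> j \<noteq> i \<Longrightarrow> pfac j dvd idem_poly i"
    unfolding idem_poly_def by blast+
qed

lemma idem_poly_orth: assumes "i \<in> I" "j \<in> I" "i \<noteq> j" shows "ppoly dvd idem_poly i * idem_poly j"
proof (rule ppoly_dvd)
  fix l assume "l \<in> I"
  then show "pfac l dvd idem_poly i * idem_poly j"
    using idem_poly(2)[of i l] idem_poly(2)[of j l] assms by (cases "l = i") auto
qed

lemma idem_poly_idem: assumes "i \<in> I" shows "ppoly dvd idem_poly i * idem_poly i - idem_poly i"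
proof (rule ppoly_dvd)
  fix l assume "l \<in> I"
  then have "pfac l dvd idem_poly i * (1 - idem_poly i)"
    using idem_poly(1)[of i] idem_poly(2)[of i l] assms by (cases "l = i") auto
  moreover have "idem_poly i * idem_poly i - idem_poly i = - (idem_poly i * (1 - idem_poly i))" by (simp add: algebra_simps)
  ultimately show "pfac l dvd idem_poly i * idem_poly i - idem_poly i" by simp
qed

lemma idem_poly_pfac: assumes "i \<in> I" shows "ppoly dvd pfac i * idem_poly i"
proof (rule ppoly_dvd)
  fix l assume "l \<in> I"
  then show "pfac l dvd pfac i * idem_poly i" using idem_poly(2)[of i l] assms by (cases "l = i") auto
qed

lemma idem_poly_sum: "ppoly dvd 1 - (\<Sum>i\<in>I. idem_poly i)"
proof (rule ppoly_dvd)
  fix l assume l: "l \<in> I"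
  have "1 - (\<Sum>i\<in>I. idem_poly i) = (1 - idem_poly l) - (\<Sum>i\<in>I - {l}. idem_poly i)"
    using fin l by (simp add: sum.remove[of I l])
  moreover have "pfac l dvd (\<Sum>i\<in>I - {l}. idem_poly i)" using idem_poly(2) l by (intro dvd_sum) auto
  ultimately show "pfac l dvd 1 - (\<Sum>i\<in>I. idem_poly i)" using idem_poly(1)[OF l] by (simp only: dvd_diff)
qed

end

subsection \<open>Lifting contractions\<close>

context poly_eval
begin

lemma pev_dvd: "p dvd q \<Longrightarrow> pev p x = 0 \<Longrightarrow> pev q x = 0"
  by (auto simp: dvd_def pev_mult)

lemma pev_conj:
  assumes "s * t = 1" "t * s = 1"
  shows "pev p (s * x * t) = s * pev p x * t"
proof (induction p)
  case (pCons c p)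
  have "s * x * t * (s * pev p x * t) = s * x * (t * s) * pev p x * t" by (simp only: mult.assoc)
  moreover have "s * emb c * t = emb c" using assms by (simp add: emb_central[of c s, symmetric] mult.assoc)
  ultimately show ?case using pCons assms by (simp add: pev_pCons distrib_left distrib_right mult.assoc)
qed (simp add: assms)

end

lemma (in star_homo) hom_pev: "\<rho> (cp.pev q x) = cp.pev q (\<rho> x)"
  by (induction q) (simp_all add: cp.pev_pCons hom_add hom_mult hom_cscale hom_one)

lemma pos_invertible:
  fixes a :: "'a::cstar1"
  assumes a: "pos (a - of_real c)" "0 < c"
  obtains t where "a * t = 1" "t * a = 1" "star t = t"
proof -
  have as: "star a = a" using pos_star[OF a(1)] by (simp add: star_diff)
  have nz: "max c t \<noteq> 0" for t using a(2) by (auto simp: max_def)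
  have cf: "continuous_on UNIV (\<lambda>t::real. inverse (max c t))" using nz by (intro continuous_intros) auto
  have cg: "continuous_on UNIV (\<lambda>t::real. max c t)" by (intro continuous_intros)
  have ab: "between c (norm a) a" unfolding between_def using a(1) pos_norm_minus[OF as order_refl] by simp
  have "fc (\<lambda>t. max c t) a = fc (\<lambda>t. t) a" by (rule fc_cong[OF ab cg]) (auto intro: continuous_intros)
  then have fa: "fc (\<lambda>t. max c t) a = a" by (simp add: fc_id as)
  show ?thesis
  proof (rule that)
    show "a * fc (\<lambda>t. inverse (max c t)) a = 1"
      by (subst (1) fa[symmetric], subst fc_mult[OF as cg cf, symmetric]) (use nz in \<open>simp add: fc_const as\<close>)
    show "fc (\<lambda>t. inverse (max c t)) a * a = 1"
      by (subst (2) fa[symmetric], subst fc_mult[OF as cf cg, symmetric]) (use nz in \<open>simp add: fc_const as\<close>)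
    show "star (fc (\<lambda>t. inverse (max c t)) a) = fc (\<lambda>t. inverse (max c t)) a" by (rule fc_star[OF as cf])
  qed
qed

text \<open>A contraction acts on its unimodular eigenspaces like a unitary, so these are reducing.\<close>

lemma unimodular_eigenidempotent:
  fixes x f :: "'a::cstar1"
  assumes "norm x \<le> 1" "cmod l = 1" "x * f = cscale l f" "1 - f = (x - cscale l 1) * g"
  shows "star f = f"
proof -
  define y where "y = cscale (cnj l) x"
  have l: "cnj l * l = 1" using complex_norm_square[of l] assms(2) by (simp add: mult.commute)
  have ny: "norm (star y) \<le> 1" unfolding y_def using assms(1,2) by (simp add: norm_cscale)
  have yf: "y * f = f" unfolding y_def by (simp add: cscale_mult_left assms(3) cscale_cscale l)
  then have fy: "star f * star y = star f" by (metis star_mult)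
  \<comment> \<open>With y f = f one finds that - star w w is the conjugate of the positive 1 - y
    star y by f. Both star w w and its negative are positive, so w = 0 and star y f = f.\<close>
  define w where "w = star y * f - f"
  have "star w * w = star f * y * (star y * f) - star f * (y * f) - (star f * star y) * f + star f * f"
    unfolding w_def by (simp add: star_diff star_mult algebra_simps)
  also have "\<dots> = - (star f * (1 - y * star y) * f)" unfolding yf fy by (simp add: algebra_simps)
  finally have ww: "- (star w * w) = star f * (1 - y * star y) * f" by simp
  have "norm (star (star y) * star y) \<le> 1" unfolding norm_star_mult using ny by (simp add: abs_square_le_1)
  then have "pos (of_real 1 - y * star y)" by (intro pos_norm_minus) (auto simp: star_mult)
  then have "pos (- (star w * w))" unfolding ww by (intro pos_conj) simp
  then have "star w * w = 0" by (intro pos_antisym pos_star_mult)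
  then have "w = 0" by (rule star_mult_self_eq_0)
  then have "star (star y * f) = star f" unfolding w_def by simp
  then have "star f = star f * y" by (simp add: star_mult)
  then have "cscale l (star f) = star f * x"
    using l unfolding y_def by (simp add: cscale_mult_right) (metis cscale_cscale cscale_one mult.commute)
  then have "star f * (x - cscale l 1) = 0" by (simp add: right_diff_distrib cscale_mult_right)
  then have "star f * (1 - f) = 0" unfolding assms(4) by (simp flip: mult.assoc)
  then have "star f = star f * f" by (simp add: right_diff_distrib)
  then show ?thesis by (metis star_mult star_star)
qed

context star_homo
begin

lemma lift_orthogonal_idempotents:
  assumes I: "finite I" "I \<noteq> {}" and comm: "\<And>i j. i \<in> I \<Longrightarrow> j \<in> I \<Longrightarrow> e i * e j = e j * e i"
    and near: "\<And>i. i \<in> I \<Longrightarrow> norm (e i * e i - e i) < 1 / 4"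
    and idem: "\<And>i. i \<in> I \<Longrightarrow> \<rho> (e i * e i - e i) = 0"
    and orth: "\<And>i j. i \<in> I \<Longrightarrow> j \<in> I \<Longrightarrow> i \<noteq> j \<Longrightarrow> \<rho> (e i * e j) = 0"
    and one: "\<rho> (\<Sum>i\<in>I. e i) = 1" and x: "\<And>i. i \<in> I \<Longrightarrow> x * e i = e i * x"
  obtains E where "\<And>i. i \<in> I \<Longrightarrow> E i * E i = E i" "\<And>i. i \<in> I \<Longrightarrow> \<rho> (E i) = \<rho> (e i)"
    "\<And>i. i \<in> I \<Longrightarrow> x * E i = E i * x"
    "\<And>i j. i \<in> I \<Longrightarrow> j \<in> I \<Longrightarrow> i \<noteq> j \<Longrightarrow> E i * E j = 0" "(\<Sum>i\<in>I. E i) = 1"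
proof -
  have "\<forall>i\<in>I. \<exists>E. E * E = E \<and> \<rho> E = \<rho> (e i) \<and> (\<forall>z. z * e i = e i * z \<longrightarrow> z * E = E * z)"
  proof
    fix i assume i: "i \<in> I"
    obtain E where "E * E = E" "\<rho> E = \<rho> (e i)" "\<And>z. z * e i = e i * z \<Longrightarrow> z * E = E * z"
      using idempotent_near[OF near[OF i] idem[OF i]] by metis
    then show "\<exists>E. E * E = E \<and> \<rho> E = \<rho> (e i) \<and> (\<forall>z. z * e i = e i * z \<longrightarrow> z * E = E * z)" by blast
  qed
  from bchoice[OF this] obtain F where
    F: "\<forall>i\<in>I. F i * F i = F i \<and> \<rho> (F i) = \<rho> (e i) \<and> (\<forall>z. z * e i = e i * z \<longrightarrow> z * F i = F i * z)" ..
  have F1a: "F i * F i = F i" if "i \<in> I" for i using bspec[OF F that] by (elim conjE)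
  have F1b: "\<rho> (F i) = \<rho> (e i)" if "i \<in> I" for i using bspec[OF F that] by (elim conjE)
  note F1 = F1a F1b
  have F2: "z * F i = F i * z" if "i \<in> I" "z * e i = e i * z" for z i using F that by blast
  have Fc: "F i * F j = F j * F i" if "i \<in> I" "j \<in> I" for i j
  proof (rule F2[OF that(2)])
    show "F i * e j = e j * F i" using F2[OF that(1) comm[OF that(2,1)]] by simp
  qed
  have Fo: "\<rho> (F i * F j) = 0" if "i \<in> I" "j \<in> I" "i \<noteq> j" for i j
    using orth[OF that] F1 that by (simp add: hom_mult)
  have "\<exists>G. (\<forall>i\<in>I. G i * G i = G i \<and> \<rho> (G i) = \<rho> (F i) \<and> (\<forall>z. (\<forall>j\<in>I. z * F j = F j * z) \<longrightarrow> z * G i = G i * z)) \<and>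
    (\<forall>i\<in>I. \<forall>j\<in>I. i \<noteq> j \<longrightarrow> G i * G j = 0)"
    by (rule orthogonal_idempotents; fact I(1) F1(1) Fc Fo)
  then obtain G where G: "\<forall>i\<in>I. G i * G i = G i \<and> \<rho> (G i) = \<rho> (F i) \<and> (\<forall>z. (\<forall>j\<in>I. z * F j = F j * z) \<longrightarrow> z * G i = G i * z)"
    and Go: "\<forall>i\<in>I. \<forall>j\<in>I. i \<noteq> j \<longrightarrow> G i * G j = 0" by (elim exE conjE)
  have G1: "G i * G i = G i" if "i \<in> I" for i using bspec[OF G that] by (elim conjE)
  have "\<rho> (G i) = \<rho> (F i)" if "i \<in> I" for i using bspec[OF G that] by (elim conjE)
  then have G2: "\<rho> (G i) = \<rho> (e i)" if "i \<in> I" for i using F1b that by simp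
  have Gx: "x * G i = G i * x" if "i \<in> I" for i using G that F2[OF _ x] by blast
  have G0: "G i * G j = 0" if "i \<in> I" "j \<in> I" "i \<noteq> j" for i j using Go that by blast
  define L where "L = 1 - (\<Sum>i\<in>I. G i)"
  have GS: "G i * (\<Sum>j\<in>I. G j) = G i" "(\<Sum>j\<in>I. G j) * G i = G i" if "i \<in> I" for i
  proof -
    have "G i * (\<Sum>j\<in>I. G j) = (\<Sum>j\<in>I. if j = i then G i else 0)" "(\<Sum>j\<in>I. G j) * G i = (\<Sum>j\<in>I. if j = i then G i else 0)"
      unfolding sum_distrib_left sum_distrib_right by (intro sum.cong; use G1 G0 that in auto)+
    then show "G i * (\<Sum>j\<in>I. G j) = G i" "(\<Sum>j\<in>I. G j) * G i = G i" using that I(1) by simp_all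
  qed
  have GL: "G i * L = 0" "L * G i = 0" if "i \<in> I" for i
    unfolding L_def using GS[OF that] by (simp_all add: right_diff_distrib left_diff_distrib)
  have "L * (\<Sum>i\<in>I. G i) = 0" unfolding sum_distrib_left using GL by simp
  then have LL: "L * L = L" by (subst (2) L_def) (simp add: right_diff_distrib)
  have rL: "\<rho> L = 0" unfolding L_def hom_diff hom_sum using one G2 by (simp add: hom_one hom_sum)
  have xL: "x * L = L * x" unfolding L_def right_diff_distrib left_diff_distrib sum_distrib_left sum_distrib_right using Gx by simp
  obtain a where a: "a \<in> I" using I(2) by blast
  show ?thesis
  \<comment> \<open>The G i may fail to sum to 1. The defect L is an idempotent with image 0,
    orthogonal to all G i, so adding it to one of them costs nothing in the image.\<close>
  proof (rule that[of "\<lambda>i. G i + (if i = a then L else 0)"])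
    show "(\<Sum>i\<in>I. G i + (if i = a then L else 0)) = 1" using a I(1) by (simp add: sum.distrib L_def)
  qed (use G1 G2 Gx G0 GL LL rL xL in \<open>auto simp: algebra_simps hom_add\<close>)
qed

end

context star_homo
begin

text \<open>The case of projections; here the nilpotent parts live in the corners \<open>p\<^sub>i A p\<^sub>i\<close>.\<close>

lemma lift_along_projections:
  assumes I: "finite I" and proj: "\<And>i. i \<in> I \<Longrightarrow> star (p i) = p i" "\<And>i. i \<in> I \<Longrightarrow> p i * p i = p i"
    and orth: "\<And>i j. i \<in> I \<Longrightarrow> j \<in> I \<Longrightarrow> i \<noteq> j \<Longrightarrow> p i * p j = 0" and one: "(\<Sum>i\<in>I. p i) = 1"
    and comm: "\<And>i. i \<in> I \<Longrightarrow> X * p i = p i * X" and k: "\<And>i. i \<in> I \<Longrightarrow> k i > 0"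
    and nil: "\<And>i. i \<in> I \<Longrightarrow> \<rho> ((X - cscale (lam i) 1) ^ k i * p i) = 0"
  obtains T where "\<rho> T = \<rho> X" "\<And>i. i \<in> I \<Longrightarrow> T * p i = p i * T" "\<And>i. i \<in> I \<Longrightarrow> (T - cscale (lam i) 1) ^ k i * p i = 0"
proof -
  define N where "N i = p i * (X - cscale (lam i) 1)" for i
  have N: "N i = (X - cscale (lam i) 1) * p i" if "i \<in> I" for i
    unfolding N_def using comm[OF that] by (simp add: right_diff_distrib left_diff_distrib cscale_mult_left cscale_mult_right)
  have Npow: "N i ^ Suc n = (X - cscale (lam i) 1) ^ Suc n * p i" if i: "i \<in> I" for i n
  proof (induction n)
    case (Suc n)
    have "N i ^ Suc (Suc n) = N i ^ Suc n * N i" by (rule power_Suc2)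
    also have "\<dots> = (X - cscale (lam i) 1) ^ Suc n * (p i * p i) * (X - cscale (lam i) 1)"
      unfolding Suc unfolding N_def by (simp only: mult.assoc)
    also have "\<dots> = (X - cscale (lam i) 1) ^ Suc n * (p i * (X - cscale (lam i) 1))"
      unfolding proj(2)[OF i] by (simp only: mult.assoc)
    also have "p i * (X - cscale (lam i) 1) = (X - cscale (lam i) 1) * p i" using N[OF i] unfolding N_def .
    also have "(X - cscale (lam i) 1) ^ Suc n * ((X - cscale (lam i) 1) * p i) = (X - cscale (lam i) 1) ^ Suc (Suc n) * p i"
      by (simp only: power_Suc2 mult.assoc)
    finally show ?case .
  qed (use N[OF i] in simp)
  have "\<exists>Y. p i * Y = Y \<and> Y * p i = Y \<and> \<rho> Y = \<rho> (N i) \<and> Y ^ k i = 0" if i: "i \<in> I" for i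
  proof (rule corner_nilpotent_lift[OF k[OF i] proj[OF i]])
    show "p i * N i = N i" unfolding N_def using proj(2)[OF i] by (simp flip: mult.assoc)
    show "N i * p i = N i" unfolding N[OF i] using proj(2)[OF i] by (simp add: mult.assoc)
    obtain n where n: "k i = Suc n" using k[OF i] by (cases "k i") auto
    show "\<rho> (N i) ^ k i = 0" using nil[OF i] unfolding n Npow[OF i, symmetric] by (simp only: hom_power)
  qed
  then have "\<forall>i\<in>I. \<exists>Y. p i * Y = Y \<and> Y * p i = Y \<and> \<rho> Y = \<rho> (N i) \<and> Y ^ k i = 0" ..
  from bchoice[OF this] obtain M where M: "\<forall>i\<in>I. p i * M i = M i \<and> M i * p i = M i \<and> \<rho> (M i) = \<rho> (N i) \<and> M i ^ k i = 0" ..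
  then have M1: "p i * M i = M i" "M i * p i = M i" "\<rho> (M i) = \<rho> (N i)" "M i ^ k i = 0" if "i \<in> I" for i
    using bspec[OF M that] by blast+
  define T where "T = (\<Sum>i\<in>I. cscale (lam i) (p i) + M i)"
  have pM: "p i * M j = 0" "M j * p i = 0" if "i \<in> I" "j \<in> I" "i \<noteq> j" for i j
    using M1[OF that(2)] orth[OF that] orth[OF that(2,1)] that(3) by (metis mult.assoc mult_zero_left mult_zero_right)+
  have pT: "p i * T = cscale (lam i) (p i) + M i" and Tp: "T * p i = cscale (lam i) (p i) + M i" if i: "i \<in> I" for i
  proof -
    have "p i * T = (\<Sum>j\<in>I. if j = i then cscale (lam i) (p i) + M i else 0)"
      unfolding T_def sum_distrib_left using i M1 proj orth pM
      by (intro sum.cong) (auto simp: distrib_left cscale_mult_right)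
    then show "p i * T = cscale (lam i) (p i) + M i" using i I by simp
    have "T * p i = (\<Sum>j\<in>I. if j = i then cscale (lam i) (p i) + M i else 0)"
      unfolding T_def sum_distrib_right using i M1 proj orth pM
      by (intro sum.cong) (auto simp: distrib_right cscale_mult_left)
    then show "T * p i = cscale (lam i) (p i) + M i" using i I by simp
  qed
  show ?thesis
  proof (rule that)
    have "\<rho> T = (\<Sum>i\<in>I. \<rho> (cscale (lam i) (p i) + N i))"
      unfolding T_def hom_sum using M1(3) by (simp add: hom_add)
    also have "\<dots> = \<rho> (\<Sum>i\<in>I. cscale (lam i) (p i) + N i)" by (simp add: hom_sum)
    also have "(\<Sum>i\<in>I. cscale (lam i) (p i) + N i) = (\<Sum>i\<in>I. X * p i)"
      by (intro sum.cong refl) (simp add: N left_diff_distrib cscale_mult_left)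
    also have "\<dots> = X" by (simp add: one flip: sum_distrib_left)
    finally show "\<rho> T = \<rho> X" .
    show "T * p i = p i * T" if "i \<in> I" for i using pT Tp that by simp
    show "(T - cscale (lam i) 1) ^ k i * p i = 0" if i: "i \<in> I" for i
    proof -
      have 1: "(T - cscale (lam i) 1) * p i = M i"
        using Tp[OF i] by (simp add: left_diff_distrib cscale_mult_left)
      have "(T - cscale (lam i) 1) ^ Suc n * p i = M i ^ Suc n" for n
      proof (induction n)
        case (Suc n)
        have "(T - cscale (lam i) 1) ^ Suc (Suc n) * p i = (T - cscale (lam i) 1) ^ Suc n * ((T - cscale (lam i) 1) * p i)"
          by (simp only: power_Suc2 mult.assoc)
        also have "\<dots> = (T - cscale (lam i) 1) ^ Suc n * p i * M i"
          unfolding 1 using M1(1)[OF i] by (simp only: mult.assoc)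
        finally show ?case unfolding Suc by (simp only: power_Suc2)
      qed (simp add: 1)
      moreover obtain n where n: "k i = Suc n" using k[OF i] by (cases "k i") auto
      ultimately show ?thesis using M1(4)[OF i] by simp
    qed
  qed
qed

text \<open>
  \<open>S\<close> is replaced by its compression \<open>P + (1 - P) S (1 - P)\<close>, where \<open>P\<close> is the unimodular part; the
  images agree because the unimodular idempotents are already projections in the quotient.
\<close>

lemma contraction_lift:
  assumes lp: "linear_powers I lam k" and le: "\<And>i. i \<in> I \<Longrightarrow> cmod (lam i) \<le> 1"
    and uni: "\<And>i. i \<in> I \<Longrightarrow> cmod (lam i) = 1 \<Longrightarrow> k i = 1"
    and near: "\<And>i. i \<in> I \<Longrightarrow> norm (cp.pev (linear_powers.idem_poly I lam k i) X * cp.pev (linear_powers.idem_poly I lam k i) X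
       - cp.pev (linear_powers.idem_poly I lam k i) X) < 1 / 4"
    and px: "cp.pev (linear_powers.ppoly I lam k) (\<rho> X) = 0" and nx: "norm (\<rho> X) \<le> 1"
  obtains Y where "\<rho> Y = \<rho> X" "cp.pev (linear_powers.ppoly I lam k) Y = 0" "norm Y \<le> 1"
proof -
  interpret linear_powers I lam k by (rule lp)
  define e where "e i = cp.pev (idem_poly i) X" for i
  define f where "f i = cp.pev (idem_poly i) (\<rho> X)" for i
  have fe: "\<rho> (e i) = f i" for i unfolding e_def f_def by (rule hom_pev)
  have dv: "cp.pev q (\<rho> X) = 0" if "ppoly dvd q" for q using cp.pev_dvd[OF that px] .
  have f1: "f i * f i = f i" if "i \<in> I" for i
    using dv[OF idem_poly_idem[OF that]] unfolding f_def by (simp add: cp.pev_diff cp.pev_mult)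
  have f2: "f i * f j = 0" if "i \<in> I" "j \<in> I" "i \<noteq> j" for i j
    using dv[OF idem_poly_orth[OF that]] unfolding f_def by (simp add: cp.pev_mult)
  have f3: "(\<rho> X - cscale (lam i) 1) ^ k i * f i = 0" if "i \<in> I" for i
    using dv[OF idem_poly_pfac[OF that]] unfolding f_def pfac_def
    by (simp add: cp.pev_mult cp.pev_power cp.pev_linear cscale_minus_left)
  have f4: "(\<Sum>i\<in>I. f i) = 1"
    using dv[OF idem_poly_sum] unfolding f_def by (simp add: cp.pev_diff cp.pev_sum)
  have I: "I \<noteq> {}" using f4 by auto
  have ee: "e i * e j = e j * e i" for i j unfolding e_def by (rule cp.pev_comm2)
  have en: "norm (e i * e i - e i) < 1 / 4" if "i \<in> I" for i unfolding e_def by (rule near[OF that])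
  have eX: "X * e i = e i * X" for i unfolding e_def by (rule cp.pev_comm) (rule refl)
  have e1: "\<rho> (e i * e i - e i) = 0" if "i \<in> I" for i using f1[OF that] by (simp add: hom_diff hom_mult fe)
  have e2: "\<rho> (e i * e j) = 0" if "i \<in> I" "j \<in> I" "i \<noteq> j" for i j using f2[OF that] by (simp add: hom_mult fe)
  have e4: "\<rho> (sum e I) = 1" using f4 by (simp add: hom_sum fe)
  obtain E where E: "\<And>i. i \<in> I \<Longrightarrow> E i * E i = E i" "\<And>i. i \<in> I \<Longrightarrow> \<rho> (E i) = \<rho> (e i)"
    "\<And>i. i \<in> I \<Longrightarrow> X * E i = E i * X"
    "\<And>i j. i \<in> I \<Longrightarrow> j \<in> I \<Longrightarrow> i \<noteq> j \<Longrightarrow> E i * E j = 0" "(\<Sum>i\<in>I. E i) = 1"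
  proof (rule lift_orthogonal_idempotents[OF fin I ee en e1 e2 e4 eX])
    fix E assume *: "\<And>i. i \<in> I \<Longrightarrow> E i * E i = E i" "\<And>i. i \<in> I \<Longrightarrow> \<rho> (E i) = \<rho> (e i)"
      "\<And>i. i \<in> I \<Longrightarrow> X * E i = E i * X"
      "\<And>i j. i \<in> I \<Longrightarrow> j \<in> I \<Longrightarrow> i \<noteq> j \<Longrightarrow> E i * E j = 0" "(\<Sum>i\<in>I. E i) = 1"
    show thesis by (rule that[OF *])
  qed
  note Ef = E(2)[unfolded fe]
  define h where "h = (\<Sum>i\<in>I. star (E i) * E i)"
  obtain c where c: "0 < c" "c \<le> 1" "pos (h - of_real (c\<^sup>2))" and
    pr: "\<And>i. i \<in> I \<Longrightarrow> star (fc (\<lambda>t. sqrt (max (c\<^sup>2) t)) h * E i * fc (\<lambda>t. inverse (sqrt (max (c\<^sup>2) t))) h)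
      = fc (\<lambda>t. sqrt (max (c\<^sup>2) t)) h * E i * fc (\<lambda>t. inverse (sqrt (max (c\<^sup>2) t))) h"
    using idempotents_similar_projections[OF fin E(1) E(4) E(5) h_def] by blast
  define S where "S = fc (\<lambda>t. sqrt (max (c\<^sup>2) t)) h"
  define T where "T = fc (\<lambda>t. inverse (sqrt (max (c\<^sup>2) t))) h"
  have cf: "continuous_on UNIV (\<lambda>t::real. sqrt (max (c\<^sup>2) t))" by (intro continuous_intros)
  have nz: "sqrt (max (c\<^sup>2) t) \<noteq> 0" for t using c(1) by (auto simp: max_def)
  have cg: "continuous_on UNIV (\<lambda>t::real. inverse (sqrt (max (c\<^sup>2) t)))" using nz by (intro continuous_intros) auto
  have hs: "star h = h" unfolding h_def by (simp add: star_sum star_mult)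
  have ST: "star S = S" "star T = T" unfolding S_def T_def by (intro fc_star hs cf cg)+
  have TS: "T * S = 1" "S * T = 1"
    unfolding S_def T_def fc_mult[OF hs cf cg, symmetric] fc_mult[OF hs cg cf, symmetric]
    using nz by (simp_all add: fc_const hs)
  have TS': "T * (S * z) = z" "S * (T * z) = z" for z using TS by (simp_all flip: mult.assoc)
  have hb: "between (c\<^sup>2) (norm h) h" unfolding between_def using c(3) pos_norm_minus[OF hs order_refl] by simp
  have cs: "c \<le> sqrt (max (c\<^sup>2) t)" for t using c(1) by (intro real_le_rsqrt) simp
  \<comment> \<open>S \<ge> c is retained because the compressed S has to stay invertible.\<close>
  have "between c (sqrt (max (c\<^sup>2) (norm h))) S"
    unfolding S_def by (rule fc_between[OF hb cf], intro conjI cs real_sqrt_le_mono max.mono) auto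
  then have Sc: "pos (S - of_real c)" unfolding between_def ..
  define p where "p i = S * E i * T" for i
  have p1: "star (p i) = p i" if "i \<in> I" for i using pr[OF that] unfolding p_def S_def T_def .
  have p2: "p i * p i = p i" if "i \<in> I" for i
    unfolding p_def using E(1)[OF that] by (simp add: mult.assoc TS') (simp flip: mult.assoc)
  have p3: "p i * p j = 0" if "i \<in> I" "j \<in> I" "i \<noteq> j" for i j
  proof -
    have "p i * p j = S * (E i * E j) * T" unfolding p_def by (simp add: mult.assoc TS')
    then show ?thesis using E(4)[OF that] by simp
  qed
  have p4: "(\<Sum>i\<in>I. p i) = 1" unfolding p_def by (simp add: TS E(5) flip: sum_distrib_left sum_distrib_right)
  define X' where "X' = S * X * T"
  have X'p: "X' * p i = p i * X'" if "i \<in> I" for i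
  proof -
    have "X' * p i = S * (X * E i) * T" "p i * X' = S * (E i * X) * T"
      unfolding p_def X'_def by (simp_all add: mult.assoc TS')
    then show ?thesis using E(3)[OF that] by simp
  qed
  have rST: "\<rho> S * \<rho> T = 1" "\<rho> T * \<rho> S = 1" using TS by (simp_all add: hom_one flip: hom_mult)
  have nil: "\<rho> ((X' - cscale (lam i) 1) ^ k i * p i) = 0" if "i \<in> I" for i
  proof -
    have "cp.pev [:- lam i, 1:] X' = S * cp.pev [:- lam i, 1:] X * T" unfolding X'_def by (rule cp.pev_conj[OF TS(2,1)])
    have "cp.pev ([:- lam i, 1:] ^ k i) X' = S * cp.pev ([:- lam i, 1:] ^ k i) X * T"
      unfolding X'_def by (rule cp.pev_conj[OF TS(2,1)])
    then have "(X' - cscale (lam i) 1) ^ k i = S * (X - cscale (lam i) 1) ^ k i * T"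
      by (simp add: cp.pev_power cp.pev_linear cscale_minus_left)
    then have "(X' - cscale (lam i) 1) ^ k i * p i = S * ((X - cscale (lam i) 1) ^ k i * E i) * T"
      unfolding p_def by (simp add: mult.assoc TS')
    then show ?thesis using f3[OF that] by (simp add: hom_mult hom_power hom_diff hom_cscale hom_one Ef[OF that])
  qed
  \<comment> \<open>T1 satisfies the relation exactly and has the image of X', but its norm is
    uncontrolled.\<close>
  obtain T1 where T1: "\<rho> T1 = \<rho> X'" "\<And>i. i \<in> I \<Longrightarrow> T1 * p i = p i * T1"
    "\<And>i. i \<in> I \<Longrightarrow> (T1 - cscale (lam i) 1) ^ k i * p i = 0"
    using lift_along_projections[where I = I and p = p and X = X' and k = k and lam = lam, OF fin p1 p2 p3 p4 X'p k_pos nil] by blast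
  have pT1: "cp.pev ppoly T1 = 0"
  proof -
    have "cp.pev ppoly T1 * p i = 0" if i: "i \<in> I" for i
    proof -
      have "ppoly = (\<Prod>j\<in>I - {i}. pfac j) * pfac i" unfolding ppoly_def using prod.remove[OF fin i] by (simp add: mult.commute)
      then have "cp.pev ppoly T1 * p i = cp.pev (\<Prod>j\<in>I - {i}. pfac j) T1 * ((T1 - cscale (lam i) 1) ^ k i * p i)"
        by (simp add: cp.pev_mult pfac_def cp.pev_power cp.pev_linear cscale_minus_left mult.assoc)
      then show ?thesis using T1(3)[OF i] by simp
    qed
    then have "cp.pev ppoly T1 * (\<Sum>i\<in>I. p i) = 0" unfolding sum_distrib_left by simp
    then show ?thesis using p4 by simp
  qed
  define U where "U = {i\<in>I. cmod (lam i) = 1}"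
  have U: "U \<subseteq> I" "finite U" using fin unfolding U_def by auto
  define P where "P = (\<Sum>i\<in>U. p i)"
  define F where "F = (\<Sum>i\<in>U. f i)"
  have Ps: "star P = P" unfolding P_def star_sum using p1 U by (intro sum.cong) auto
  have pP: "p i * P = p i" "P * p i = p i" if "i \<in> U" for i
  proof -
    have "p i * p j = (if j = i then p i else 0)" "p j * p i = (if j = i then p i else 0)" if "j \<in> U" for j
      using p2[of i] p3[of i j] p3[of j i] that \<open>i \<in> U\<close> U(1) by (cases "j = i"; simp add: subset_iff)+
    then have "p i * P = (\<Sum>j\<in>U. if j = i then p i else 0)" "P * p i = (\<Sum>j\<in>U. if j = i then p i else 0)"
      unfolding P_def sum_distrib_left sum_distrib_right by simp_all
    then show "p i * P = p i" "P * p i = p i" using that U(2) by simp_all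
  qed
  have PP: "P * P = P" using pP by (subst (2) P_def) (simp add: sum_distrib_left, simp add: P_def)
  \<comment> \<open>For unimodular eigenvalues the exponent is 1, so 1 - f i is divisible by x - lam
    i; this is the hypothesis of \<open>unimodular_eigenidempotent\<close>.\<close>
  have fs: "star (f i) = f i" if "i \<in> U" for i
  proof -
    have i: "i \<in> I" "cmod (lam i) = 1" "k i = 1" using that uni unfolding U_def by auto
    obtain g where "1 - idem_poly i = [:- lam i, 1:] * g" using idem_poly(1)[OF i(1)] unfolding pfac_def i(3) by auto
    then have "cp.pev (1 - idem_poly i) (\<rho> X) = cp.pev ([:- lam i, 1:] * g) (\<rho> X)" by simp
    then have "1 - f i = (\<rho> X - cscale (lam i) 1) * cp.pev g (\<rho> X)"
      unfolding f_def cp.pev_diff cp.pev_mult cp.pev_linear by (simp add: cscale_minus_left)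
    moreover have "\<rho> X * f i = cscale (lam i) (f i)" using f3[OF i(1)] unfolding i(3)
      by (simp add: left_diff_distrib cscale_mult_left)
    ultimately show ?thesis using unimodular_eigenidempotent[OF nx i(2)] by blast
  qed
  have fF: "f i * F = (if i \<in> U then f i else 0)" if "i \<in> I" for i
  proof -
    have "f i * F = (\<Sum>j\<in>U. if j = i then f i else 0)"
      unfolding F_def sum_distrib_left using f1 f2 that U by (intro sum.cong) auto
    then show ?thesis using U(2) by simp
  qed
  have "F * F = (\<Sum>i\<in>U. f i * F)" by (subst (1) F_def) (rule sum_distrib_right)
  also have "\<dots> = F" using fF U(1) by (simp add: subset_iff) (simp add: F_def)
  finally have FF: "F * F = F" .
  have "\<rho> h * F = (\<Sum>i\<in>I. star (f i) * (f i * F))" unfolding h_def by (simp add: hom_sum hom_mult hom_star Ef sum_distrib_right mult.assoc)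
  also have "\<dots> = (\<Sum>i\<in>I. if i \<in> U then f i else 0)" using fF f1 fs U(1) by (intro sum.cong refl) (auto simp: subset_iff)
  also have "\<dots> = F" unfolding F_def using fin U by (simp add: sum.If_cases Int_absorb1)
  finally have hF: "\<rho> h * F = F" .
  have sh: "\<rho> S = fc (\<lambda>t. sqrt (max (c\<^sup>2) t)) (\<rho> h)" unfolding S_def by (rule hom_fc[OF hs cf])
  have hs': "star (\<rho> h) = \<rho> h" using hs by (simp flip: hom_star)
  \<comment> \<open>h acts as 1 on F in the image, so its root does too; c \<le> 1 ensures that the
    truncated root takes the value 1 at 1.\<close>
  have "F * fc (\<lambda>t. sqrt (max (c\<^sup>2) t)) 1 = fc (\<lambda>t. sqrt (max (c\<^sup>2) t)) (\<rho> h) * F"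
    by (rule fc_intertwine[OF hs' star_one cf]) (simp add: hF)
  moreover have "c\<^sup>2 \<le> 1" using c by (simp add: power_le_one)
  ultimately have sF: "\<rho> S * F = F" using fc_of_real[OF cf, of 1, where 'a = 'b] unfolding sh by (simp add: max_absorb2)
  have Fs: "star F = F" unfolding F_def star_sum using fs by simp
  have Fs': "F * \<rho> S = F" using sF ST(1) Fs by (metis hom_star star_mult)
  have "F * (\<rho> S * \<rho> T) = F * \<rho> T" using Fs' by (simp flip: mult.assoc)
  then have Ft: "F * \<rho> T = F" using rST by simp
  have rP: "\<rho> P = F"
  proof -
    have "\<rho> P = \<rho> S * F * \<rho> T"
      unfolding P_def p_def F_def hom_sum sum_distrib_left sum_distrib_right using U Ef by (intro sum.cong) (auto simp: hom_mult)
    then show ?thesis using sF Ft by simp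
  qed
  \<comment> \<open>Conjugating back by S itself would turn the unimodular projections into skew
    idempotents, on which Y would not be isometric. S1 fixes P, so these projections survive, and it
    has the same image as S.\<close>
  define S1 where "S1 = P + (1 - P) * S * (1 - P)"
  have Pz: "(1 - P) * P = 0" "P * (1 - P) = 0" using PP by (simp_all add: left_diff_distrib right_diff_distrib)
  have "S1 * P = P * P + (1 - P) * S * ((1 - P) * P)" "P * S1 = P * P + (P * (1 - P)) * S * (1 - P)"
    unfolding S1_def by (simp_all only: distrib_left distrib_right mult.assoc)
  then have S1P: "S1 * P = P" "P * S1 = P" by (simp_all add: Pz PP)
  \<comment> \<open>S1 - c splits into (1 - c) P and the compression of S - c, both positive; hence
    S1 is invertible.\<close>
  have "pos (star (1 - P) * (S - of_real c) * (1 - P))" by (rule pos_conj[OF Sc])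
  moreover have "pos ((1 - c) *\<^sub>R (star P * P))" using c by (intro pos_scaleR pos_star_mult) auto
  ultimately have "pos ((1 - c) *\<^sub>R (star P * P) + star (1 - P) * (S - of_real c) * (1 - P))" by (intro pos_add)
  also have "(1 - c) *\<^sub>R (star P * P) + star (1 - P) * (S - of_real c) * (1 - P) = S1 - of_real c"
    unfolding S1_def star_diff Ps using PP by (simp add: of_real_def algebra_simps)
  finally obtain T2 where T2: "S1 * T2 = 1" "T2 * S1 = 1" "star T2 = T2" using pos_invertible c(1) by blast
  have rS1: "\<rho> S1 = \<rho> S" unfolding S1_def by (simp add: hom_add hom_mult hom_diff hom_one rP sF Fs' FF algebra_simps)
  have rT2: "\<rho> T2 = \<rho> T"
  proof -
    have "\<rho> T2 * \<rho> S1 = 1" using T2 by (simp add: hom_one flip: hom_mult)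
    then show ?thesis unfolding rS1 by (rule left_inverse_unique[OF _ rST(1)])
  qed
  have T2P: "T2 * P = P" using S1P T2 by (metis mult.assoc mult_1_left)
  define Y where "Y = T2 * T1 * S1"
  have rY: "\<rho> Y = \<rho> X"
  proof -
    have "\<rho> Y = (\<rho> T * \<rho> S) * \<rho> X * (\<rho> T * \<rho> S)"
      unfolding Y_def by (simp add: hom_mult rT2 T1(1) rS1 X'_def mult.assoc)
    then show ?thesis by (simp add: rST)
  qed
  have pY: "cp.pev ppoly Y = 0" unfolding Y_def using cp.pev_conj[OF T2(2,1), of ppoly T1] pT1 by simp
  have T1p: "T1 * p i = cscale (lam i) (p i)" if "i \<in> U" for i
  proof -
    have i: "i \<in> I" "cmod (lam i) = 1" "k i = 1" using that uni unfolding U_def by auto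
    from T1(3)[OF i(1)] show ?thesis unfolding i(3) by (simp add: left_diff_distrib cscale_mult_left)
  qed
  have S1p: "S1 * p i = p i" "T2 * p i = p i" "p i * S1 = p i" "p i * T2 = p i" if "i \<in> U" for i
  proof -
    show 1: "S1 * p i = p i" "p i * S1 = p i" using pP[OF that] S1P by (metis mult.assoc)+
    show "T2 * p i = p i" using 1(1) T2(2) by (metis mult.assoc mult_1_left)
    show "p i * T2 = p i" using 1(2) T2(1) by (metis mult.assoc mult_1_right)
  qed
  have Yp: "Y * p i = cscale (lam i) (p i)" "p i * Y = cscale (lam i) (p i)" if "i \<in> U" for i
  proof -
    have "Y * p i = T2 * (T1 * (S1 * p i))" unfolding Y_def by (simp only: mult.assoc)
    then show "Y * p i = cscale (lam i) (p i)" using S1p[OF that] T1p[OF that] by (simp add: cscale_mult_right)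
    have "p i * Y = (p i * T2) * T1 * S1" unfolding Y_def by (simp only: mult.assoc)
    also have "\<dots> = (T1 * p i) * S1" using S1p[OF that] T1(2)[of i] that U(1) by auto
    also have "\<dots> = cscale (lam i) (p i)" using S1p[OF that] T1p[OF that] by (simp add: cscale_mult_left)
    finally show "p i * Y = cscale (lam i) (p i)" .
  qed
  define z where "z = 1 - P"
  have zs: "star z = z" unfolding z_def by (simp add: star_diff Ps)
  have YP: "Y * P = P * Y" unfolding P_def sum_distrib_left sum_distrib_right using Yp by simp
  then have zY: "z * Y = Y * z" unfolding z_def by (simp add: algebra_simps)
  have zS1: "S1 * z = z * S1" unfolding z_def using S1P by (simp add: algebra_simps)
  have YYP: "star Y * Y * P = P"
  proof -
    have "star Y * Y * p i = p i" if "i \<in> U" for i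
    proof -
      have "star (p i * Y) = star (cscale (lam i) (p i))" using Yp[OF that] by simp
      moreover have "star (p i) = p i" using p1 that U by auto
      ultimately have "star Y * p i = cscale (cnj (lam i)) (p i)" by (simp add: star_mult star_cscale)
      then have "star Y * Y * p i = cscale (lam i * cnj (lam i)) (p i)"
        using Yp(1)[OF that] by (simp add: mult.assoc cscale_mult_right cscale_cscale)
      moreover have "lam i * cnj (lam i) = 1" using that complex_norm_square[of "lam i"] unfolding U_def by simp
      ultimately show ?thesis by simp
    qed
    then show ?thesis unfolding P_def sum_distrib_left by simp
  qed
  \<comment> \<open>On P the element star Y Y is the identity, so its excess over 1 lives on z = 1 -
    P. There the eigenvalues have modulus below 1 and the powers of Y are summable.\<close>
  have cz: "fc (\<lambda>t. max 0 (t - 1)) (star Y * Y) * z = fc (\<lambda>t. max 0 (t - 1)) (star Y * Y)"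
  proof -
    have cm: "continuous_on UNIV (\<lambda>t::real. max 0 (t - 1))" by (intro continuous_intros)
    have "P * fc (\<lambda>t. max 0 (t - 1)) 1 = fc (\<lambda>t. max 0 (t - 1)) (star Y * Y) * P"
      by (rule fc_intertwine[OF _ star_one cm]) (simp_all add: star_mult YYP)
    then have "fc (\<lambda>t. max 0 (t - 1)) (star Y * Y) * P = 0" using fc_of_real[OF cm, of 1, where 'a = 'a] by simp
    then show ?thesis unfolding z_def by (simp add: right_diff_distrib)
  qed
  have zsum: "z = (\<Sum>i\<in>I - U. p i)"
    unfolding z_def P_def p4[symmetric] using sum.subset_diff[OF U(1) fin, of p] by simp
  have "summable (\<lambda>m. norm (Y ^ m * z))"
  proof (rule summable_comparison_test')
    have "summable (\<lambda>m. norm (T1 ^ m * p i))" if "i \<in> I - U" for i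
      using that le[of i] by (intro summable_powers[OF T1(3)[of i]]) (auto simp: U_def less_le)
    then show "summable (\<lambda>m. norm T2 * (\<Sum>i\<in>I - U. norm (T1 ^ m * p i)) * norm S1)"
      by (intro summable_mult summable_mult2 summable_sum)
    fix m
    have "Y ^ m * z = T2 * (T1 ^ m * z) * S1"
    proof -
      have "Y ^ m = T2 * T1 ^ m * S1"
        unfolding Y_def using cp.pev_conj[OF T2(2,1), of "[:0,1:] ^ m" T1] by (simp add: cp.pev_power cp.pev_pCons)
      then show ?thesis using zS1 by (simp add: mult.assoc)
    qed
    then have "norm (Y ^ m * z) \<le> norm T2 * norm (T1 ^ m * z) * norm S1"
      by (simp only:) (intro order_trans[OF norm_mult_ineq] mult_right_mono norm_mult_ineq norm_ge_zero)
    also have "norm (T1 ^ m * z) \<le> (\<Sum>i\<in>I - U. norm (T1 ^ m * p i))"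
      unfolding zsum sum_distrib_left by (rule norm_sum)
    finally show "norm (norm (Y ^ m * z)) \<le> norm T2 * (\<Sum>i\<in>I - U. norm (T1 ^ m * p i)) * norm S1"
      by (simp add: mult_left_mono mult_right_mono)
  qed
  then obtain V V' where V: "V * V' = 1" "V' * V = 1" "\<rho> V = 1" "\<rho> V' = 1" "norm (V * Y * V') \<le> 1"
    using contraction_similar[OF _ zs zY cz] nx rY by metis
  show ?thesis
  proof (rule that[OF _ _ V(5)])
    show "\<rho> (V * Y * V') = \<rho> X" by (simp add: hom_mult V rY)
    show "cp.pev ppoly (V * Y * V') = 0" using cp.pev_conj[OF V(1,2), of ppoly Y] pY by simp
  qed
qed

end

subsection \<open>Reduction of the polynomial\<close>

lemma large_eigenvalue:
  fixes x y :: "'a::cstar1"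
  assumes "norm x \<le> 1" "1 < cmod l" "(x - cscale l 1) ^ k * y = 0"
  shows "y = 0"
proof -
  have *: "z = 0" if "(x - cscale l 1) * z = 0" for z
  proof -
    have "x * z = cscale l z" using that by (simp add: left_diff_distrib cscale_mult_left)
    then have "cmod l * norm z \<le> norm x * norm z" by (metis norm_cscale norm_mult_ineq)
    also have "\<dots> \<le> 1 * norm z" using assms(1) by (intro mult_right_mono) auto
    finally have le: "cmod l * norm z \<le> 1 * norm z" .
    show ?thesis
    proof (rule ccontr)
      assume "z \<noteq> 0"
      then have "1 * norm z < cmod l * norm z" by (intro mult_strict_right_mono assms(2)) simp
      with le show False by simp
    qed
  qed
  show ?thesis using assms(3)
  proof (induction k)
    case (Suc k)
    then show ?case using *[of "(x - cscale l 1) ^ k * y"] by (simp add: mult.assoc)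
  qed simp
qed

text \<open>A Jordan block of size 2 would give x^(n+1) z = l^(n+1) z + (n + 1) l^n w, whose second
  term grows linearly while the powers of a contraction stay bounded.\<close>

lemma unimodular_eigenvalue:
  fixes x y :: "'a::cstar1"
  assumes x: "norm x \<le> 1" and l: "cmod l = 1" and k: "(x - cscale l 1) ^ Suc k * y = 0"
  shows "(x - cscale l 1) * y = 0"
proof -
  have *: "(x - cscale l 1) * z = 0" if "(x - cscale l 1) * ((x - cscale l 1) * z) = 0" for z
  proof -
    define w where "w = (x - cscale l 1) * z"
    have xw: "x * w = cscale l w" using that unfolding w_def[symmetric] by (simp add: left_diff_distrib cscale_mult_left)
    have xz: "x * z = cscale l z + w" unfolding w_def by (simp add: left_diff_distrib cscale_mult_left)
    have pw: "x ^ n * w = cscale (l ^ n) w" for n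
      by (induction n) (simp_all add: mult.assoc xw cscale_mult_right cscale_cscale mult.commute)
    have "x ^ Suc n * z = cscale (l ^ Suc n) z + cscale (of_nat (Suc n) * l ^ n) w" for n
    proof (induction n)
      case (Suc n)
      have "x ^ Suc (Suc n) * z = x * (x ^ Suc n * z)" by (simp add: mult.assoc)
      also have "\<dots> = cscale (l ^ Suc (Suc n)) z + (cscale (l ^ Suc n) w + cscale (of_nat (Suc n) * l ^ Suc n) w)"
        unfolding Suc by (simp add: distrib_left cscale_mult_right xz xw cscale_add_right cscale_cscale mult_ac del: of_nat_Suc)
      also have "cscale (l ^ Suc n) w + cscale (of_nat (Suc n) * l ^ Suc n) w = cscale (of_nat (Suc (Suc n)) * l ^ Suc n) w"
        by (simp flip: cscale_add_left add: algebra_simps)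
      finally show ?case .
    qed (simp add: xz)
    then have eq: "cscale (of_nat (Suc n) * l ^ n) w = x ^ Suc n * z - cscale (l ^ Suc n) z" for n by simp
    have "real (Suc n) * norm w \<le> 2 * norm z" for n
    proof -
      have "real (Suc n) * norm w = norm (cscale (of_nat (Suc n) * l ^ n) w)"
        using l by (simp add: norm_cscale norm_mult norm_power del: of_nat_Suc)
      also have "\<dots> \<le> norm (x ^ Suc n * z) + norm (cscale (l ^ Suc n) z)" unfolding eq by (rule norm_triangle_ineq4)
      also have "norm (x ^ Suc n * z) \<le> norm (x ^ Suc n) * norm z" by (rule norm_mult_ineq)
      also have "norm (x ^ Suc n) \<le> 1" by (rule order_trans[OF norm_power_ineq power_le_one]) (use x in auto)
      also have "norm (cscale (l ^ Suc n) z) = norm z" using l by (simp add: norm_cscale norm_power norm_mult)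
      finally show ?thesis by (simp add: mult_right_mono)
    qed
    then have "norm w = 0"
    proof (rule_tac ccontr)
      assume le: "\<And>n. real (Suc n) * norm w \<le> 2 * norm z" and "norm w \<noteq> 0"
      then have w: "norm w > 0" by simp
      obtain n where "2 * norm z / norm w < real n" using reals_Archimedean2 by blast
      then have "2 * norm z < real n * norm w" using w by (simp add: divide_less_eq)
      with le[of n] w show False by (simp add: distrib_right)
    qed
    then show ?thesis unfolding w_def by simp
  qed
  show ?thesis using k
  proof (induction k)
    case (Suc k)
    then have "(x - cscale l 1) * ((x - cscale l 1) * ((x - cscale l 1) ^ k * y)) = 0" by (simp add: mult.assoc)
    from *[OF this] show ?case using Suc.IH by (simp add: mult.assoc)
  qed simp
qed

definition reduced_set :: "'i set \<Rightarrow> ('i \<Rightarrow> complex) \<Rightarrow> 'i set" where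
  "reduced_set I lam = {i\<in>I. cmod (lam i) \<le> 1}"

definition reduced_exp :: "('i \<Rightarrow> complex) \<Rightarrow> ('i \<Rightarrow> nat) \<Rightarrow> 'i \<Rightarrow> nat" where
  "reduced_exp lam k i = (if cmod (lam i) = 1 then 1 else k i)"

lemma linear_powers_reduced:
  "linear_powers I lam k \<Longrightarrow> linear_powers (reduced_set I lam) lam (reduced_exp lam k)"
  unfolding linear_powers_def reduced_set_def reduced_exp_def by (auto intro: inj_on_subset)

context linear_powers
begin

abbreviation "rpoly \<equiv> linear_powers.ppoly (reduced_set I lam) lam (reduced_exp lam k)"

abbreviation "ridem \<equiv> linear_powers.idem_poly (reduced_set I lam) lam (reduced_exp lam k)"

abbreviation "defect i \<equiv> ridem i * ridem i - ridem i"

lemma rpoly_dvd: "rpoly dvd ppoly"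
proof -
  interpret r: linear_powers "reduced_set I lam" lam "reduced_exp lam k" by (rule linear_powers_reduced) unfold_locales
  have "reduced_exp lam k i \<le> k i" if "i \<in> I" for i using k_pos[OF that] by (simp add: reduced_exp_def)
  then have "rpoly dvd (\<Prod>i\<in>reduced_set I lam. pfac i)"
    unfolding r.ppoly_def unfolding pfac_def r.pfac_def
    by (intro prod_dvd_prod le_imp_power_dvd) (auto simp: reduced_set_def)
  also have "\<dots> dvd ppoly" unfolding ppoly_def by (rule prod_dvd_prod_subset) (auto simp: fin reduced_set_def)
  finally show ?thesis .
qed

text \<open>The right factor y will be the unit of a corner: there the relation holds only after
  multiplication by that unit. The factors are exchanged one at a time, moving the current one next
  to y.\<close>

lemma reduce:
  fixes x y :: "'a::cstar1"
  assumes x: "norm x \<le> 1" and "cp.pev ppoly x * y = 0"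
  shows "cp.pev rpoly x * y = 0"
proof -
  interpret r: linear_powers "reduced_set I lam" lam "reduced_exp lam k" by (rule linear_powers_reduced) unfold_locales
  define g where "g i = (if i \<in> reduced_set I lam then r.pfac i else 1)" for i
  have step: "cp.pev (g i) x * z = 0" if "i \<in> I" "cp.pev (pfac i) x * z = 0" for i z
  proof -
    have h: "(x - cscale (lam i) 1) ^ k i * z = 0"
      using that by (simp add: pfac_def cp.pev_power cp.pev_linear cscale_minus_left)
    have g: "cp.pev (r.pfac i) x = (x - cscale (lam i) 1) ^ reduced_exp lam k i"
      by (simp add: r.pfac_def cp.pev_power cp.pev_linear cscale_minus_left)
    show ?thesis
    proof (cases "cmod (lam i) \<le> 1")
      case False
      then show ?thesis using large_eigenvalue[OF x _ h] by (simp add: g_def reduced_set_def)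
    next
      case le: True
      then have gi: "g i = r.pfac i" using that by (simp add: g_def reduced_set_def)
      have "k i > 0" using k_pos[OF that(1)] .
      then obtain n where n: "k i = Suc n" by (cases "k i") auto
      show ?thesis
      proof (cases "cmod (lam i) = 1")
        case True
        then show ?thesis unfolding gi g using unimodular_eigenvalue[OF x True h[unfolded n]] by (simp add: reduced_exp_def)
      next
        case False
        then show ?thesis unfolding gi g using h by (simp add: reduced_exp_def)
      qed
    qed
  qed
  have "cp.pev (prod g J) x * z = 0" if "finite J" "J \<subseteq> I" "cp.pev (prod pfac J) x * z = 0" for J z
    using that
  proof (induction J arbitrary: z rule: finite_induct)
    case (insert a J)
    then have "cp.pev (pfac a) x * (cp.pev (prod pfac J) x * z) = 0" by (simp add: cp.pev_mult mult.assoc)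
    then have "cp.pev (g a) x * (cp.pev (prod pfac J) x * z) = 0" using step insert by auto
    then have "cp.pev (prod pfac J) x * (cp.pev (g a) x * z) = 0"
      using cp.pev_comm2[of "g a" x "prod pfac J"] by (simp flip: mult.assoc)
    then have "cp.pev (prod g J) x * (cp.pev (g a) x * z) = 0" using insert by auto
    then show ?case using insert(1,2) cp.pev_comm2[of "g a" x "prod g J"] by (simp add: cp.pev_mult flip: mult.assoc)
  qed simp
  from this[OF fin order_refl assms(2)[unfolded ppoly_def]] have "cp.pev (prod g I) x * y = 0" .
  moreover have "prod g I = rpoly"
    unfolding r.ppoly_def g_def using prod.inter_restrict[OF fin, of r.pfac "reduced_set I lam"]
    by (simp add: Int_absorb1 reduced_set_def Int_def)
  ultimately show ?thesis by simp
qed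

end

subsection \<open>Polynomials in unital C*-algebras\<close>

lemma emb_zero: assumes "cstar_algebra A" shows "emb A \<zero>\<^bsub>A\<^esub> = 0"
proof -
  have "norm (emb A \<zero>\<^bsub>A\<^esub>) = 0" using assms by (simp add: norm_emb cstar_zero_closed cstar_algebra.nrm_zero)
  then show ?thesis by simp
qed

lemma emb_minus:
  assumes A: "cstar_algebra A" and x: "x \<in> carrier A"
  shows "emb A (\<ominus>\<^bsub>A\<^esub> x) = - emb A x" "y \<in> carrier A \<Longrightarrow> emb A (y \<ominus>\<^bsub>A\<^esub> x) = emb A y - emb A x"
proof -
  interpret cstar_algebra A by (rule A)
  have "emb A (\<ominus>\<^bsub>A\<^esub> x) + emb A x = emb A (\<ominus>\<^bsub>A\<^esub> x \<oplus>\<^bsub>A\<^esub> x)" using x by (simp add: emb_ops(1)[OF A])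
  then show "emb A (\<ominus>\<^bsub>A\<^esub> x) = - emb A x" using x by (simp add: l_neg emb_zero[OF A] eq_neg_iff_add_eq_0)
  then show "emb A (y \<ominus>\<^bsub>A\<^esub> x) = emb A y - emb A x" if "y \<in> carrier A"
    using x that by (simp add: minus_eq emb_ops(1)[OF A])
qed

lemma emb_eq_iff: "cstar_algebra A \<Longrightarrow> x \<in> carrier A \<Longrightarrow> y \<in> carrier A \<Longrightarrow> emb A x = emb A y \<longleftrightarrow> x = y"
  by (metis prj_emb)

context unital_cstar_algebra
begin

abbreviation (input) "unit_emb \<equiv> emb A \<one>"

lemma cstar: "cstar_algebra A" by unfold_locales

lemma monoid: "monoid A"
  by (rule monoidI) (auto simp: mult_closed one_closed mult_assoc one_mult mult_one)

lemma adj_one: "adj A \<one> = \<one>"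
  using one_closed adj_closed adj_mult[of \<one> "adj A \<one>"] adj_adj[of \<one>] by (metis mult_one one_mult)

lemma unit_emb: "star unit_emb = unit_emb" "unit_emb * unit_emb = unit_emb"
  "x \<in> carrier A \<Longrightarrow> unit_emb * emb A x = emb A x" "x \<in> carrier A \<Longrightarrow> emb A x * unit_emb = emb A x"
  using emb_ops[OF cstar one_closed] emb_ops(2)[OF cstar, of x \<one>]
  by (auto simp flip: emb_ops simp: adj_one one_mult mult_one one_closed)

lemma emb_one_mult: "F * unit_emb = emb A (prj A F \<oplus> scal F \<odot> \<one>)" "unit_emb * F = F * unit_emb"
  using emb_prj_mult[OF cstar one_closed, of F] prj_closed[OF cstar, of F] by (simp_all add: one_mult mult_one)

lemma pow_closed: "x \<in> carrier A \<Longrightarrow> x [^] (n::nat) \<in> carrier A"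
  by (rule monoid.nat_pow_closed[OF monoid])

text \<open>The element is the direct sum of x in the corner and the scalar c on its
  complement.\<close>

lemma emb_pow:
  assumes "x \<in> carrier A"
  shows "(emb A x + cscale c (1 - unit_emb)) ^ n = emb A (x [^] n) + cscale (c ^ n) (1 - unit_emb)"
proof (induction n)
  case 0
  then show ?case by (simp add: monoid.nat_pow_0[OF monoid])
next
  case (Suc n)
  define e where "e = unit_emb"
  have e: "e * e = e" "emb A y * e = emb A y" "e * emb A y = emb A y" if "y \<in> carrier A" for y
    unfolding e_def using unit_emb that by auto
  have "(emb A (x [^] n) + cscale (c ^ n) (1 - e)) * (emb A x + cscale c (1 - e))
      = emb A (x [^] n) * emb A x + cscale (c ^ n * c) (1 - e)"
    using e[OF assms] e[OF pow_closed[OF assms, of n]]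
    by (simp add: algebra_simps cscale_mult_left cscale_mult_right cscale_cscale cscale_diff_right cscale_add_right)
  also have "emb A (x [^] n) * emb A x = emb A (x [^] Suc n)"
    using emb_ops(2)[OF cstar pow_closed[OF assms] assms, of n] monoid.nat_pow_Suc[OF monoid, of x n] by simp
  finally show ?case using Suc unfolding e_def power_Suc2 by (simp add: mult.commute)
qed

lemma poly_closed: "x \<in> carrier A \<Longrightarrow> cstar_poly A q x \<in> carrier A"
  unfolding cstar_poly_def by (intro finsum_closed) (auto intro!: scale_closed pow_closed)

lemma emb_finsum:
  "finite J \<Longrightarrow> g \<in> J \<rightarrow> carrier A \<Longrightarrow> emb A (finsum A g J) = (\<Sum>j\<in>J. emb A (g j))"
proof (induction J rule: finite_induct)
  case (insert a J)
  then show ?case using finsum_closed[of g J] by (simp add: emb_ops(1)[OF cstar])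
qed (simp add: emb_zero[OF cstar])

lemma pev_emb:
  assumes x: "x \<in> carrier A"
  shows "cp.pev q (emb A x + cscale c (1 - unit_emb)) = emb A (cstar_poly A q x) + cscale (poly q c) (1 - unit_emb)"
proof -
  define e where "e = unit_emb"
  have "cp.pev q (emb A x + cscale c (1 - e))
      = (\<Sum>i\<le>degree q. cscale (coeff q i) (emb A (x [^] i)) + cscale (coeff q i * c ^ i) (1 - e))"
    unfolding cp.pev_altdef e_def emb_pow[OF x] by (simp add: cscale_mult_left cscale_add_right cscale_cscale)
  also have "\<dots> = (\<Sum>i\<le>degree q. emb A (coeff q i \<odot> x [^] i)) + (\<Sum>i\<le>degree q. cscale (coeff q i * c ^ i) (1 - e))"
    by (simp add: sum.distrib emb_ops(3)[OF cstar pow_closed[OF x]])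
  also have "(\<Sum>i\<le>degree q. emb A (coeff q i \<odot> x [^] i)) = emb A (cstar_poly A q x)"
    unfolding cstar_poly_def by (rule emb_finsum[symmetric]) (auto intro!: scale_closed pow_closed x)
  also have "(\<Sum>i\<le>degree q. cscale (coeff q i * c ^ i) (1 - e)) = cscale (poly q c) (1 - e)"
    unfolding poly_altdef by (rule sum_comp_morphism[of "\<lambda>c. cscale c (1 - e)", unfolded o_def]) (simp_all add: cscale_add_left)
  finally show ?thesis unfolding e_def .
qed

lemma emb_poly:
  assumes x: "x \<in> carrier A"
  shows "emb A (cstar_poly A q x) = cp.pev q (emb A x) * unit_emb"
proof -
  have "cp.pev q (emb A x) * unit_emb = (emb A (cstar_poly A q x) + cscale (poly q 0) (1 - unit_emb)) * unit_emb"
    using pev_emb[OF x, of q 0] by simp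
  also have "\<dots> = emb A (cstar_poly A q x)"
    using unit_emb(4)[OF poly_closed[OF x, of q]] unit_emb(2) by (simp add: algebra_simps cscale_mult_left)
  finally show ?thesis ..
qed

lemma emb_eq_0: "x \<in> carrier A \<Longrightarrow> emb A x = 0 \<longleftrightarrow> x = \<zero>"
  using emb_eq_iff[OF cstar _ zero_closed] emb_zero[OF cstar] by simp

lemma poly_dvd_zero: assumes "x \<in> carrier A" "q dvd r" "cstar_poly A q x = \<zero>" shows "cstar_poly A r x = \<zero>"
proof -
  obtain s where r: "r = s * q" using assms(2) by (metis dvdE mult.commute)
  have "cp.pev q (emb A x) * unit_emb = 0" using emb_poly[OF assms(1), of q] assms(3) emb_zero[OF cstar] by simp
  then have "emb A (cstar_poly A r x) = 0" unfolding emb_poly[OF assms(1)] r cp.pev_mult by (simp add: mult.assoc)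
  then show ?thesis using emb_eq_0 poly_closed assms(1) by blast
qed

lemma reduced_relation:
  assumes "linear_powers I lam k" "satisfies_relation A (linear_powers.ppoly I lam k) x"
  shows "cstar_poly A (linear_powers.rpoly I lam k) x = \<zero>"
proof -
  interpret linear_powers I lam k by fact
  have x: "x \<in> carrier A" "cstar_poly A ppoly x = \<zero>" "nrm A x \<le> 1" using assms(2) unfolding satisfies_relation_def by auto
  have "cp.pev ppoly (emb A x) * unit_emb = 0" using emb_poly[OF x(1), of ppoly] x(2) emb_zero[OF cstar] by simp
  then have "cp.pev rpoly (emb A x) * unit_emb = 0" by (rule reduce[rotated]) (simp add: norm_emb[OF cstar x(1)] x(3))
  then show ?thesis using emb_poly[OF x(1)] emb_eq_0 poly_closed x(1) by metis
qed

text \<open>The two summands live on complementary projections, so 1 minus the square splits into a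
  compression of 1 - star X X and a multiple of 1 - e.\<close>

lemma norm_emb_plus:
  assumes x: "x \<in> carrier A" "nrm A x \<le> 1" "cmod c \<le> 1"
  shows "norm (emb A x + cscale c (1 - unit_emb)) \<le> 1"
proof (rule norm_sq_le)
  define e where "e = unit_emb"
  define X where "X = emb A x"
  have e: "star e = e" "e * e = e" "e * X = X" "X * e = X" unfolding e_def X_def using unit_emb x by auto
  then have es: "e * star X = star X" "star X * e = star X" by (metis star_mult)+
  have "norm (star X * X) \<le> 1" unfolding norm_star_mult X_def norm_emb[OF cstar x(1)] using x nrm_nonneg by (simp add: abs_square_le_1)
  then have "pos (of_real 1 - star X * X)" by (intro pos_norm_minus) (auto simp: star_mult)
  then have 1: "pos (star e * (of_real 1 - star X * X) * e)" by (rule pos_conj)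
  have "(cmod c)\<^sup>2 \<le> 1" using x(3) by (simp add: abs_square_le_1)
  then have 2: "pos ((1 - (cmod c)\<^sup>2) *\<^sub>R (star (1 - e) * (1 - e)))" by (intro pos_scaleR pos_star_mult) auto
  have 3: "star (1 - e) * (1 - e) = 1 - e" using e by (simp add: star_diff algebra_simps)
  have c: "cnj c * c = of_real ((cmod c)\<^sup>2)" by (metis complex_norm_square mult.commute)
  have "star (X + cscale c (1 - e)) * (X + cscale c (1 - e)) = star X * X + cscale (cnj c * c) (star (1 - e) * (1 - e))"
    using e es by (simp add: star_add star_cscale star_diff algebra_simps cscale_mult_left cscale_mult_right cscale_cscale cscale_diff_right cscale_add_right)
  also have "\<dots> = star X * X + (cmod c)\<^sup>2 *\<^sub>R (1 - e)" unfolding 3 c cscale_of_real ..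
  finally have "of_real (1\<^sup>2) - star (X + cscale c (1 - e)) * (X + cscale c (1 - e))
    = star e * (of_real 1 - star X * X) * e + (1 - (cmod c)\<^sup>2) *\<^sub>R (star (1 - e) * (1 - e))"
    unfolding 3 using e es by (simp add: algebra_simps mult.assoc[symmetric])
  then show "pos (of_real (1\<^sup>2) - star (emb A x + cscale c (1 - unit_emb)) * (emb A x + cscale c (1 - unit_emb)))"
    using pos_add[OF 1 2] unfolding X_def e_def by simp
qed simp

end

lemma (in poly_eval) pev_idem:
  assumes "x * e = x' * e" "e * x' = x' * e"
  shows "pev q x * e = pev q x' * e"
proof (induction q)
  case (pCons c q)
  have "x * pev q x * e = x * (e * pev q x')" using pCons pev_comm[OF assms(2), of q] by (simp add: mult.assoc)
  also have "\<dots> = x' * e * pev q x'" using assms by (simp flip: mult.assoc)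
  also have "\<dots> = x' * pev q x' * e" using pev_comm[OF assms(2), of q] by (simp add: mult.assoc)
  finally show ?case by (simp add: pev_pCons distrib_right)
qed simp

text \<open>\<open>contraction_lift\<close> needs the relation relative to the unit of the big
  algebra, where x alone leaves the constant term on the complement of its corner. Filling the
  complement with a root c of the reduced polynomial, |c| \<le> 1, repairs this; hence the reduced
  set must be nonempty.\<close>

lemma unital_contraction_lift:
  fixes B :: "'b cstar" and C :: "'c cstar"
  assumes B: "unital_cstar_algebra B" and C: "unital_cstar_algebra C"
    and f: "f \<in> star_hom B C" "f \<one>\<^bsub>B\<^esub> = \<one>\<^bsub>C\<^esub>" and lp: "linear_powers I lam k"
    and ne: "reduced_set I lam \<noteq> {}" and X: "X \<in> carrier B"
    and near: "\<And>i. i \<in> reduced_set I lam \<Longrightarrow> nrm B (cstar_poly B (linear_powers.defect I lam k i) X) < 1 / 4"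
    and rel: "satisfies_relation C (linear_powers.ppoly I lam k) (f X)"
  obtains Y where "satisfies_relation B (linear_powers.ppoly I lam k) Y" "f Y = f X"
proof -
  interpret linear_powers I lam k by (rule lp)
  interpret r: linear_powers "reduced_set I lam" lam "reduced_exp lam k" by (rule linear_powers_reduced[OF lp])
  interpret B: unital_cstar_algebra B by (rule B)
  interpret C: unital_cstar_algebra C by (rule C)
  interpret star_homo "bigmap B C f" by (rule bigmap_star_homo[OF B.cstar C.cstar f(1)])
  note f1 = star_homD[OF f(1)]
  obtain a where a: "a \<in> reduced_set I lam" using ne by blast
  define c where "c = lam a"
  have c: "cmod c \<le> 1" "poly r.ppoly c = 0"
  proof -
    show "cmod c \<le> 1" using a unfolding c_def reduced_set_def by simp
    have "poly (r.pfac a) c = 0" using r.k_pos[OF a] by (simp add: r.pfac_def c_def)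
    then show "poly r.ppoly c = 0" unfolding r.ppoly_def poly_prod using a r.fin by (auto intro: prod_zero)
  qed
  define Z where "Z = emb B X + cscale c (1 - emb B \<one>\<^bsub>B\<^esub>)"
  have rZ: "bigmap B C f Z = emb C (f X) + cscale c (1 - emb C \<one>\<^bsub>C\<^esub>)"
    unfolding Z_def by (simp add: hom_add hom_cscale hom_diff hom_one bigmap_emb B.cstar X B.one_closed f(2))
  have fX: "f X \<in> carrier C" "nrm C (f X) \<le> 1" using rel unfolding satisfies_relation_def by auto
  obtain W where W: "bigmap B C f W = bigmap B C f Z" "cp.pev r.ppoly W = 0" "norm W \<le> 1"
  proof (rule contraction_lift[OF linear_powers_reduced[OF lp], of Z])
    show "cmod (lam i) \<le> 1" if "i \<in> reduced_set I lam" for i using that by (simp add: reduced_set_def)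
    show "reduced_exp lam k i = 1" if "cmod (lam i) = 1" for i using that by (simp add: reduced_exp_def)
    show "norm (cp.pev (r.idem_poly i) Z * cp.pev (r.idem_poly i) Z - cp.pev (r.idem_poly i) Z) < 1 / 4"
      if i: "i \<in> reduced_set I lam" for i
    proof -
      \<comment> \<open>The defect polynomial is a multiple of the reduced one, so it vanishes at c
        and its value at Z has no part on the complement.\<close>
      have z: "poly (r.idem_poly i * r.idem_poly i - r.idem_poly i) c = 0"
        using r.idem_poly_idem[OF i] c(2) by (elim dvdE) (simp only: poly_mult mult_zero_left)
      then have "cp.pev (r.idem_poly i * r.idem_poly i - r.idem_poly i) Z
          = emb B (cstar_poly B (r.idem_poly i * r.idem_poly i - r.idem_poly i) X)"
        unfolding Z_def B.pev_emb[OF X] z by simp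
      then show ?thesis using near[OF i] by (simp add: cp.pev_mult cp.pev_diff norm_emb[OF B.cstar B.poly_closed[OF X]])
    qed
    show "cp.pev r.ppoly (bigmap B C f Z) = 0"
      unfolding rZ C.pev_emb[OF fX(1)] c(2) C.reduced_relation[OF lp rel] emb_zero[OF C.cstar] by simp
    show "norm (bigmap B C f Z) \<le> 1" unfolding rZ by (rule C.norm_emb_plus[OF fX c(1)])
  qed
  \<comment> \<open>The unit of B is a central projection of the big algebra, so cutting W by it
    preserves both the relation and the norm bound.\<close>
  define Y where "Y = prj B W \<oplus>\<^bsub>B\<^esub> scal W \<odot>\<^bsub>B\<^esub> \<one>\<^bsub>B\<^esub>"
  have Yc: "Y \<in> carrier B" unfolding Y_def using B.cstar by (intro B.a_closed B.scale_closed B.one_closed prj_closed)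
  have eY: "emb B Y = W * emb B \<one>\<^bsub>B\<^esub>" unfolding Y_def by (rule B.emb_one_mult(1)[symmetric])
  have "norm (emb B \<one>\<^bsub>B\<^esub>) \<le> 1"
  proof -
    have "norm (emb B \<one>\<^bsub>B\<^esub>) * norm (emb B \<one>\<^bsub>B\<^esub>) = norm (emb B \<one>\<^bsub>B\<^esub>)"
      using norm_star_mult[of "emb B \<one>\<^bsub>B\<^esub>"] B.unit_emb by (simp add: power2_eq_square)
    then show ?thesis by auto
  qed
  then have "norm (W * emb B \<one>\<^bsub>B\<^esub>) \<le> 1 * 1"
    using W(3) by (intro order_trans[OF norm_mult_ineq] mult_mono) auto
  then have nY: "nrm B Y \<le> 1" using eY norm_emb[OF B.cstar Yc] by simp
  have "emb C (f Y) = bigmap B C f (W * emb B \<one>\<^bsub>B\<^esub>)" unfolding eY[symmetric] bigmap_emb[OF B.cstar Yc] ..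
  also have "\<dots> = bigmap B C f (Z * emb B \<one>\<^bsub>B\<^esub>)" unfolding hom_mult W(1) ..
  also have "Z * emb B \<one>\<^bsub>B\<^esub> = emb B X"
    unfolding Z_def using B.unit_emb(2) B.unit_emb(4)[OF X] by (simp add: algebra_simps cscale_mult_left)
  also have "bigmap B C f (emb B X) = emb C (f X)" by (rule bigmap_emb[OF B.cstar X])
  finally have fY: "f Y = f X" using emb_eq_iff[OF C.cstar f1(1)[OF Yc] fX(1)] by simp
  have "emb B (cstar_poly B r.ppoly Y) = cp.pev r.ppoly (emb B Y) * emb B \<one>\<^bsub>B\<^esub>" by (rule B.emb_poly[OF Yc])
  also have "\<dots> = cp.pev r.ppoly W * emb B \<one>\<^bsub>B\<^esub>"
    by (rule cp.pev_idem) (simp add: eY mult.assoc B.unit_emb, rule B.emb_one_mult(2))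
  finally have "cstar_poly B r.ppoly Y = \<zero>\<^bsub>B\<^esub>" using W(2) B.emb_eq_0 B.poly_closed[OF Yc] by simp
  then have "cstar_poly B ppoly Y = \<zero>\<^bsub>B\<^esub>" by (rule B.poly_dvd_zero[OF Yc rpoly_dvd])
  then show ?thesis using that fY Yc nY unfolding satisfies_relation_def by blast
qed

subsection \<open>Quotients\<close>

text \<open>u = n a / (1 + n a) for a = star b b lies in any left ideal containing b. The squared
  norm of b (1 - u) is the supremum of t / (1 + n t)^2, which is at most 1 / n.\<close>

lemma ideal_approximate_unit:
  fixes b :: "'a::cstar1"
  assumes J: "\<And>a x. x \<in> J \<Longrightarrow> a * x \<in> J" and b: "b \<in> J" and e: "0 < e"
  obtains u where "u \<in> J" "star u = u" "norm (1 - u) \<le> 1" "norm (b * (1 - u)) < e"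
proof -
  obtain n :: nat where n: "1 / e\<^sup>2 < real n" using reals_Archimedean2 by blast
  have e2: "0 < e\<^sup>2" using e by simp
  then have "0 < 1 / e\<^sup>2" by simp
  then have n0: "real n > 0" using n by linarith
  then have n1: "1 / real n < e\<^sup>2" using n e2 by (simp add: divide_less_eq mult.commute)
  define a where "a = star b * b"
  define h where "h t = real n / (1 + real n * max 0 t)" for t
  have pos1: "1 + real n * max 0 t > 0" for t :: real using n0 by (simp add: add_pos_nonneg)
  then have ch: "continuous_on UNIV h" unfolding h_def by (intro continuous_intros) (metis less_irrefl)
  have ci: "continuous_on UNIV (\<lambda>t::real. t)" by (intro continuous_intros)
  have a: "star a = a" "between 0 (norm a) a" unfolding a_def by (auto simp: star_mult intro: pos_imp_between pos_star_mult)
  define u where "u = fc h a * a"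
  have cg: "continuous_on UNIV (\<lambda>t. h t * t)" by (intro continuous_intros ch)
  have u: "u = fc (\<lambda>t. h t * t) a" unfolding u_def fc_mult[OF a(1) ch ci] fc_id[OF a(1)] ..
  have cg': "continuous_on UNIV (\<lambda>t. 1 - h t * t)" by (intro continuous_intros ch)
  have u': "1 - u = fc (\<lambda>t. 1 - h t * t) a" unfolding u using fc_diff[OF a(1) continuous_on_const cg, of 1] by (simp add: fc_const a)
  have g: "1 - h t * t = 1 / (1 + real n * t)" if "t \<ge> 0" for t
    using pos1[of t] that unfolding h_def by (simp add: field_simps)
  show ?thesis
  proof (rule that)
    show "u \<in> J" unfolding u_def a_def using J[OF b, of "fc h (star b * b) * star b"] by (simp add: mult.assoc)
    show us: "star u = u" unfolding u by (rule fc_star[OF a(1) cg])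
    show "norm (1 - u) \<le> 1" unfolding u'
      by (rule fc_norm_le[OF a(2) cg']) (use n0 in \<open>auto simp: g divide_le_eq_1 add_pos_nonneg\<close>)
    have "star (b * (1 - u)) * (b * (1 - u)) = (1 - u) * a * (1 - u)"
      unfolding a_def by (simp add: star_mult star_diff us mult.assoc)
    also have "\<dots> = fc (\<lambda>t. (1 - h t * t) * t * (1 - h t * t)) a"
      unfolding u' by (simp add: fc_mult[OF a(1)] continuous_on_mult cg' ci fc_id a(1))
    finally have eq: "star (b * (1 - u)) * (b * (1 - u)) = fc (\<lambda>t. (1 - h t * t) * t * (1 - h t * t)) a" .
    have "norm (fc (\<lambda>t. (1 - h t * t) * t * (1 - h t * t)) a) \<le> 1 / n"
    proof (rule fc_norm_le[OF a(2)])
      fix t assume "t \<in> {0..norm a}"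
      then have t: "t \<ge> 0" by simp
      have "real n * t \<le> (1 + real n * t) * (1 + real n * t)" using n0 t by (simp add: algebra_simps)
      then have "t / ((1 + real n * t) * (1 + real n * t)) \<le> 1 / n"
        using n0 t by (intro mult_imp_div_pos_le) (auto simp: pos_le_divide_eq mult.commute add_pos_nonneg)
      then show "\<bar>(1 - h t * t) * t * (1 - h t * t)\<bar> \<le> 1 / n" unfolding g[OF t] using n0 t by (simp add: abs_mult mult.commute)
    qed (use n0 cg' ci in \<open>auto intro!: continuous_intros\<close>)
    then have "(norm (b * (1 - u)))\<^sup>2 < e\<^sup>2" unfolding eq[symmetric] norm_star_mult using n1 by simp
    then show "norm (b * (1 - u)) < e" by (rule power2_less_imp_less) (use e in simp)
  qed
qed

locale cstar_quotient = cstar_algebra A for A :: "'a cstar" (structure) +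
  fixes I :: "'a set"
  assumes ideal: "cstar_ideal I A"
begin

lemma cstar: "cstar_algebra A" by unfold_locales

lemma I_subgroup: "abelian_subgroup I A"
  using ideal unfolding cstar_ideal_def by (intro abelian_subgroupI3) (auto intro: abelian_group_axioms)

sublocale I: abelian_subgroup I A by (rule I_subgroup)

lemma I_mem: "x \<in> I \<Longrightarrow> x \<in> carrier A" using I.a_subset by blast

lemma I_closed:
  "x \<in> I \<Longrightarrow> c \<odot> x \<in> I" "a \<in> carrier A \<Longrightarrow> x \<in> I \<Longrightarrow> a \<otimes> x \<in> I" "a \<in> carrier A \<Longrightarrow> x \<in> I \<Longrightarrow> x \<otimes> a \<in> I"
  "x \<in> carrier A \<Longrightarrow> (\<And>e. 0 < e \<Longrightarrow> \<exists>y\<in>I. nrm A (x \<ominus> y) < e) \<Longrightarrow> x \<in> I"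
  using ideal unfolding cstar_ideal_def nrm_closure_def by blast+

lemma J_ideal: "X \<in> emb A ` I \<Longrightarrow> F * X \<in> emb A ` I"
proof -
  assume "X \<in> emb A ` I"
  then obtain x where x: "x \<in> I" "X = emb A x" by blast
  have "prj A F \<otimes> x \<oplus> scal F \<odot> x \<in> I" by (intro I.a_closed I_closed(1,2) x(1) prj_closed cstar)
  then show ?thesis unfolding x(2) emb_prj_mult(2)[OF cstar I_mem[OF x(1)]] by (rule imageI)
qed

text \<open>Ideals are not defined to be self-adjoint. For u as in
  \<open>ideal_approximate_unit\<close>, u (star x) lies in the ideal as a multiple of u and is
  close to star x, and the ideal is closed.\<close>

lemma I_adj: assumes x: "x \<in> I" shows "adj A x \<in> I"
proof (rule I_closed(4))
  note xc = I_mem[OF x]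
  show xa: "adj A x \<in> carrier A" by (rule adj_closed[OF xc])
  fix e :: real assume "0 < e"
  then obtain U where U: "U \<in> emb A ` I" "star U = U" "norm (emb A x * (1 - U)) < e"
    using ideal_approximate_unit[of "emb A ` I" "emb A x" e] J_ideal x by (metis imageI)
  then obtain u where u: "u \<in> I" "U = emb A u" by auto
  have "emb A (adj A x \<ominus> (u \<otimes> adj A x)) = star (emb A x * (1 - U))"
    using u xc xa I_mem[OF u(1)] U(2) mult_closed
    by (simp add: emb_minus[OF cstar] emb_ops[OF cstar] star_mult star_diff algebra_simps)
  then have "nrm A (adj A x \<ominus> (u \<otimes> adj A x)) < e"
    using U(3) norm_emb[OF cstar, of "adj A x \<ominus> (u \<otimes> adj A x)"] xa I_mem[OF u(1)] mult_closed by simp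
  then show "\<exists>y\<in>I. nrm A (adj A x \<ominus> y) < e" using I_closed(3)[OF xa u(1)] by blast
qed

abbreviation cl :: "'a \<Rightarrow> 'a set" where "cl x \<equiv> I +> x"

abbreviation "Q \<equiv> cstar_quot A I"

lemma cl_mem: "y \<in> cl x \<longleftrightarrow> (\<exists>h\<in>I. y = h \<oplus> x)" by (auto simp: a_r_coset_def')

lemma cl_carrier: "y \<in> cl x \<Longrightarrow> x \<in> carrier A \<Longrightarrow> y \<in> carrier A" unfolding cl_mem using I_mem by auto

lemma cl_eqI: "h \<in> I \<Longrightarrow> x \<in> carrier A \<Longrightarrow> cl (h \<oplus> x) = cl x"
  using a_repr_independence[OF _ _ I.a_subgroup, of "h \<oplus> x" x] cl_mem by auto

lemma cl_eq: "y \<in> cl x \<Longrightarrow> x \<in> carrier A \<Longrightarrow> cl y = cl x"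
  unfolding cl_mem using cl_eqI by auto

lemma cl_self: "x \<in> carrier A \<Longrightarrow> x \<in> cl x" by (rule I.a_rcos_self)

lemma Q_carrier: "carrier Q = cl ` carrier A" "\<zero>\<^bsub>Q\<^esub> = I" "\<one>\<^bsub>Q\<^esub> = cl \<one>"
  by (auto simp: cstar_quot_def A_RCOSETS_def')

lemma Q_cases: assumes "X \<in> carrier Q" obtains x where "x \<in> carrier A" "X = cl x"
  using assms unfolding Q_carrier by auto

lemma Q_zero: "\<zero>\<^bsub>Q\<^esub> = cl \<zero>"
  unfolding Q_carrier using I.a_subset by simp

lemma Q_add: "x \<in> carrier A \<Longrightarrow> y \<in> carrier A \<Longrightarrow> cl x \<oplus>\<^bsub>Q\<^esub> cl y = cl (x \<oplus> y)"
  by (simp add: cstar_quot_def I.a_rcos_sum)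

lemma Q_mult: assumes "x \<in> carrier A" "y \<in> carrier A" shows "cl x \<otimes>\<^bsub>Q\<^esub> cl y = cl (x \<otimes> y)"
proof -
  have *: "cl (a \<otimes> b) = cl (x \<otimes> y)" if ab: "a \<in> cl x" "b \<in> cl y" for a b
  proof -
    obtain h k where hk: "h \<in> I" "a = h \<oplus> x" "k \<in> I" "b = k \<oplus> y" using ab unfolding cl_mem by auto
    note c = assms I_mem[OF hk(1)] I_mem[OF hk(3)]
    have "a \<otimes> b = (h \<otimes> b \<oplus> x \<otimes> k) \<oplus> x \<otimes> y"
      unfolding hk(2,4) using c by (simp add: mult_distr_right mult_distr_left mult_closed a_ac)
    moreover have "h \<otimes> b \<oplus> x \<otimes> k \<in> I" using hk c by (intro I.a_closed I_closed(2,3)) (auto simp: hk(4))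
    ultimately show ?thesis using cl_eqI mult_closed[OF assms] by simp
  qed
  have "cl x \<otimes>\<^bsub>Q\<^esub> cl y = (\<Union>a\<in>cl x. \<Union>b\<in>cl y. cl (a \<otimes> b))" by (simp add: cstar_quot_def rcoset_mult_def)
  also have "\<dots> = (\<Union>a\<in>cl x. \<Union>b\<in>cl y. cl (x \<otimes> y))" by (intro SUP_cong refl *)
  finally show ?thesis using cl_self[OF assms(1)] cl_self[OF assms(2)] by auto
qed

lemma Q_scale: assumes "x \<in> carrier A" shows "c \<odot>\<^bsub>Q\<^esub> cl x = cl (c \<odot> x)"
proof -
  have *: "cl (c \<odot> a) = cl (c \<odot> x)" if a: "a \<in> cl x" for a
  proof -
    obtain h where h: "h \<in> I" "a = h \<oplus> x" using a unfolding cl_mem by blast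
    show ?thesis
      unfolding h(2) scale_add_right[OF I_mem[OF h(1)] assms] by (rule cl_eqI[OF I_closed(1)[OF h(1)] scale_closed[OF assms]])
  qed
  have "c \<odot>\<^bsub>Q\<^esub> cl x = (\<Union>a\<in>cl x. cl (c \<odot> a))" by (simp add: cstar_quot_def)
  also have "\<dots> = (\<Union>a\<in>cl x. cl (c \<odot> x))" by (intro SUP_cong refl *)
  also have "\<dots> = cl (c \<odot> x)" using cl_self[OF assms] by blast
  finally show ?thesis .
qed

lemma Q_adj: assumes "x \<in> carrier A" shows "adj Q (cl x) = cl (adj A x)"
proof -
  have *: "cl (adj A a) = cl (adj A x)" if a: "a \<in> cl x" for a
  proof -
    obtain h where h: "h \<in> I" "a = h \<oplus> x" using a unfolding cl_mem by blast
    show ?thesis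
      unfolding h(2) adj_add[OF I_mem[OF h(1)] assms] by (rule cl_eqI[OF I_adj[OF h(1)] adj_closed[OF assms]])
  qed
  have "adj Q (cl x) = (\<Union>a\<in>cl x. cl (adj A a))" by (simp add: cstar_quot_def)
  also have "\<dots> = (\<Union>a\<in>cl x. cl (adj A x))" by (intro SUP_cong refl *)
  also have "\<dots> = cl (adj A x)" using cl_self[OF assms] by blast
  finally show ?thesis .
qed

lemmas Q_ops = Q_add Q_mult Q_scale Q_adj

lemma Q_nrm_le: "x \<in> carrier A \<Longrightarrow> y \<in> cl x \<Longrightarrow> nrm Q (cl x) \<le> nrm A y"
  unfolding cstar_quot_def using cl_carrier nrm_nonneg by (auto intro!: cINF_lower bdd_belowI2[where m = 0])

lemma Q_nrm_ex: assumes x: "x \<in> carrier A" and e: "nrm Q (cl x) < e" obtains y where "y \<in> cl x" "nrm A y < e"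
proof -
  have "bdd_below (nrm A ` cl x)" using cl_carrier x nrm_nonneg by (auto intro!: bdd_belowI2[where m = 0])
  then show ?thesis using e that cINF_less_iff[of "cl x" "nrm A" e] cl_self[OF x] by (auto simp: cstar_quot_def)
qed

lemma Q_nrm_nonneg: "x \<in> carrier A \<Longrightarrow> 0 \<le> nrm Q (cl x)"
  unfolding cstar_quot_def using cl_carrier nrm_nonneg cl_self[of x] by (auto intro!: cINF_greatest)

lemma Q_abelian: "abelian_group Q"
proof (rule abelian_groupI)
  show "\<zero>\<^bsub>Q\<^esub> \<in> carrier Q" unfolding Q_zero by (simp add: Q_carrier)
  fix X assume "X \<in> carrier Q"
  then obtain x where x: "x \<in> carrier A" "X = cl x" by (rule Q_cases)
  show "\<zero>\<^bsub>Q\<^esub> \<oplus>\<^bsub>Q\<^esub> X = X" using x by (simp add: Q_zero Q_ops)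
  show "\<exists>Y\<in>carrier Q. Y \<oplus>\<^bsub>Q\<^esub> X = \<zero>\<^bsub>Q\<^esub>"
    using x by (intro bexI[of _ "cl (\<ominus> x)"]) (auto simp: Q_zero Q_ops l_neg Q_carrier)
qed (auto elim!: Q_cases simp: Q_ops a_ac, simp add: Q_carrier)

lemma Q_minus: assumes "x \<in> carrier A" "y \<in> carrier A" shows "cl x \<ominus>\<^bsub>Q\<^esub> cl y = cl (x \<ominus> y)"
proof -
  interpret Q: abelian_group Q by (rule Q_abelian)
  have "\<ominus>\<^bsub>Q\<^esub> cl y = cl (\<ominus> y)"
    using assms by (intro Q.minus_equality) (auto simp: Q_ops Q_zero l_neg Q_carrier)
  then show ?thesis using assms by (simp add: Q.minus_eq minus_eq Q_ops)
qed

lemma Q_triangle: assumes "x \<in> carrier A" "y \<in> carrier A" shows "nrm Q (cl (x \<oplus> y)) \<le> nrm Q (cl x) + nrm Q (cl y)"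
proof (rule field_le_epsilon)
  fix e :: real assume "0 < e"
  then have lt: "nrm Q (cl x) < nrm Q (cl x) + e / 2" "nrm Q (cl y) < nrm Q (cl y) + e / 2" by auto
  obtain a where a: "a \<in> cl x" "nrm A a < nrm Q (cl x) + e / 2" using Q_nrm_ex[OF assms(1) lt(1)] by blast
  obtain b where b: "b \<in> cl y" "nrm A b < nrm Q (cl y) + e / 2" using Q_nrm_ex[OF assms(2) lt(2)] by blast
  note c = cl_carrier[OF a(1) assms(1)] cl_carrier[OF b(1) assms(2)]
  have "cl (x \<oplus> y) = cl (a \<oplus> b)" using cl_eq[OF a(1) assms(1)] cl_eq[OF b(1) assms(2)] Q_add assms c by metis
  then have "nrm Q (cl (x \<oplus> y)) \<le> nrm A (a \<oplus> b)" using Q_nrm_le[of "a \<oplus> b"] cl_self c by simp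
  also have "\<dots> \<le> nrm A a + nrm A b" by (rule nrm_triangle[OF c])
  finally show "nrm Q (cl (x \<oplus> y)) \<le> nrm Q (cl x) + nrm Q (cl y) + e" using a(2) b(2) by simp
qed

lemma Q_submult: assumes "x \<in> carrier A" "y \<in> carrier A" shows "nrm Q (cl (x \<otimes> y)) \<le> nrm Q (cl x) * nrm Q (cl y)"
proof -
  have "((\<lambda>e. (nrm Q (cl x) + e) * (nrm Q (cl y) + e)) \<longlongrightarrow> (nrm Q (cl x) + 0) * (nrm Q (cl y) + 0)) (at_right 0)"
    by (intro tendsto_intros)
  moreover have "nrm Q (cl (x \<otimes> y)) \<le> (nrm Q (cl x) + e) * (nrm Q (cl y) + e)" if "e > 0" for e
  proof -
    have lt: "nrm Q (cl x) < nrm Q (cl x) + e" "nrm Q (cl y) < nrm Q (cl y) + e" using that by auto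
    obtain a where a: "a \<in> cl x" "nrm A a < nrm Q (cl x) + e" using Q_nrm_ex[OF assms(1) lt(1)] by blast
    obtain b where b: "b \<in> cl y" "nrm A b < nrm Q (cl y) + e" using Q_nrm_ex[OF assms(2) lt(2)] by blast
    note c = cl_carrier[OF a(1) assms(1)] cl_carrier[OF b(1) assms(2)]
    have "cl (x \<otimes> y) = cl (a \<otimes> b)" using cl_eq[OF a(1) assms(1)] cl_eq[OF b(1) assms(2)] Q_mult assms c by metis
    then have "nrm Q (cl (x \<otimes> y)) \<le> nrm A (a \<otimes> b)" using Q_nrm_le[of "a \<otimes> b"] cl_self c mult_closed by simp
    also have "\<dots> \<le> nrm A a * nrm A b" by (rule nrm_mult[OF c])
    also have "\<dots> \<le> (nrm Q (cl x) + e) * (nrm Q (cl y) + e)"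
      using a(2) b(2) nrm_nonneg[OF c(1)] nrm_nonneg[OF c(2)] by (intro mult_mono) auto
    finally show ?thesis .
  qed
  ultimately show ?thesis
    by (intro tendsto_lowerbound[of _ "nrm Q (cl x) * nrm Q (cl y)" "at_right (0::real)"])
      (auto simp: eventually_at_filter trivial_limit_at_right_real)
qed

lemma Q_nrm_scale: assumes x: "x \<in> carrier A" shows "nrm Q (cl (c \<odot> x)) = cmod c * nrm Q (cl x)"
proof -
  have le: "nrm Q (cl (c \<odot> x)) \<le> cmod c * nrm Q (cl x)" if x: "x \<in> carrier A" and "c \<noteq> 0" for x c
  proof (rule field_le_epsilon)
    fix e :: real assume "0 < e"
    then have "nrm Q (cl x) < nrm Q (cl x) + e / cmod c" using \<open>c \<noteq> 0\<close> by simp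
    then obtain a where a: "a \<in> cl x" "nrm A a < nrm Q (cl x) + e / cmod c" using Q_nrm_ex[OF x] by blast
    note ac = cl_carrier[OF a(1) x]
    have "cl (c \<odot> x) = cl (c \<odot> a)" using cl_eq[OF a(1) x] Q_scale x ac by metis
    then have "nrm Q (cl (c \<odot> x)) \<le> nrm A (c \<odot> a)" using Q_nrm_le[of "c \<odot> a"] cl_self ac scale_closed by simp
    also have "\<dots> = cmod c * nrm A a" by (rule nrm_scale[OF ac])
    also have "\<dots> \<le> cmod c * (nrm Q (cl x) + e / cmod c)" using a(2) by (intro mult_left_mono) auto
    also have "\<dots> = cmod c * nrm Q (cl x) + e" using \<open>c \<noteq> 0\<close> by (simp add: distrib_left)
    finally show "nrm Q (cl (c \<odot> x)) \<le> cmod c * nrm Q (cl x) + e" .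
  qed
  show ?thesis
  proof (cases "c = 0")
    case True
    have "0 \<odot> x = \<zero>"
    proof -
      have "nrm A (0 \<odot> x) = 0" using nrm_scale[OF x, of 0] by simp
      then show ?thesis using nrm_eq_zero_iff[OF scale_closed[OF x]] by simp
    qed
    moreover have "nrm Q (cl \<zero>) \<le> 0" using Q_nrm_le[OF zero_closed cl_self[OF zero_closed]] nrm_zero by simp
    ultimately show ?thesis using True Q_nrm_nonneg[OF zero_closed] by simp
  next
    case False
    have "cmod c * nrm Q (cl x) = cmod c * nrm Q (cl (inverse c \<odot> (c \<odot> x)))"
      using False scale_scale[OF x, of "inverse c" c] scale_one[OF x] by simp
    also have "\<dots> \<le> cmod c * (cmod (inverse c) * nrm Q (cl (c \<odot> x)))"
      using False by (intro mult_left_mono le scale_closed x) auto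
    also have "\<dots> = nrm Q (cl (c \<odot> x))" using False by (simp add: norm_inverse)
    finally show ?thesis using le[OF x False] by simp
  qed
qed

lemma Q_nrm_zero: assumes x: "x \<in> carrier A" shows "nrm Q (cl x) = 0 \<longleftrightarrow> cl x = \<zero>\<^bsub>Q\<^esub>"
proof
  assume 0: "nrm Q (cl x) = 0"
  have "x \<in> I"
  proof (rule I_closed(4)[OF x])
    fix e :: real assume "0 < e"
    then obtain y where y: "y \<in> cl x" "nrm A y < e" using Q_nrm_ex[OF x] 0 by metis
    then obtain h where h: "h \<in> I" "y = h \<oplus> x" unfolding cl_mem by blast
    then have "x \<ominus> (\<ominus> h) = y" using I_mem[of h] x by (simp add: minus_eq a_comm)
    then show "\<exists>y\<in>I. nrm A (x \<ominus> y) < e" using h y(2) by (intro bexI[of _ "\<ominus> h"]) auto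
  qed
  then have "cl (x \<oplus> \<zero>) = cl \<zero>" by (intro cl_eqI) auto
  then show "cl x = \<zero>\<^bsub>Q\<^esub>" using x unfolding Q_zero by simp
next
  assume "cl x = \<zero>\<^bsub>Q\<^esub>"
  moreover have "nrm Q (cl \<zero>) \<le> 0" using Q_nrm_le[OF zero_closed cl_self[OF zero_closed]] nrm_zero by simp
  ultimately show "nrm Q (cl x) = 0" using Q_nrm_nonneg[OF zero_closed] unfolding Q_zero by simp
qed

text \<open>The hard inequality compares any z in the coset of star x x with x (1 - u), where u is
  an approximate unit for the kernel part b of z: up to e the norm of b (1 - u) disappears, and x (1
  - u) represents the coset of x.\<close>

lemma Q_cstar_identity: assumes x: "x \<in> carrier A" shows "nrm Q (cl (adj A x \<otimes> x)) = (nrm Q (cl x))\<^sup>2"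
proof (rule antisym)
  have le: "(nrm Q (cl x))\<^sup>2 \<le> nrm A z" if x: "x \<in> carrier A" and z: "z \<in> cl (adj A x \<otimes> x)" for x z
  proof (rule field_le_epsilon)
    fix e :: real assume e: "0 < e"
    define X where "X = emb A x"
    obtain b where b: "b \<in> I" "z = b \<oplus> adj A x \<otimes> x" using z unfolding cl_mem by blast
    note c = x I_mem[OF b(1)] adj_closed[OF x] mult_closed
    have Z: "emb A z = emb A b + star X * X" unfolding b(2) X_def using c by (simp add: emb_ops[OF cstar])
    have zc: "z \<in> carrier A" unfolding b(2) using c by simp
    obtain U where U: "U \<in> emb A ` I" "star U = U" "norm (1 - U) \<le> 1" "norm (emb A b * (1 - U)) < e"
      using ideal_approximate_unit[of "emb A ` I" "emb A b" e] J_ideal b(1) e by (metis imageI)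
    then obtain u where u: "u \<in> I" "U = emb A u" by auto
    note uc = I_mem[OF u(1)]
    have "x \<ominus> x \<otimes> u = (\<ominus> (x \<otimes> u)) \<oplus> x" using x uc by (simp add: minus_eq a_comm mult_closed)
    moreover have "\<ominus> (x \<otimes> u) \<in> I" using I_closed(2)[OF x u(1)] by simp
    ultimately have "x \<ominus> x \<otimes> u \<in> cl x" unfolding cl_mem by blast
    then have "nrm Q (cl x) \<le> norm (emb A (x \<ominus> x \<otimes> u))"
      using Q_nrm_le[OF x] norm_emb[OF cstar, of "x \<ominus> x \<otimes> u"] x uc mult_closed by simp
    also have "emb A (x \<ominus> x \<otimes> u) = X * (1 - U)" unfolding u(2) X_def using x uc mult_closed
      by (simp add: emb_minus[OF cstar] emb_ops[OF cstar] right_diff_distrib)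
    finally have "(nrm Q (cl x))\<^sup>2 \<le> (norm (X * (1 - U)))\<^sup>2" using Q_nrm_nonneg[OF x] by (intro power_mono)
    also have "\<dots> = norm ((1 - U) * (star X * X) * (1 - U))"
      unfolding norm_star_mult[symmetric] by (simp add: star_mult star_diff U(2) mult.assoc)
    also have "(1 - U) * (star X * X) * (1 - U) = (1 - U) * emb A z * (1 - U) - (1 - U) * (emb A b * (1 - U))"
      unfolding Z by (simp add: algebra_simps)
    also have "norm \<dots> \<le> norm ((1 - U) * emb A z * (1 - U)) + norm ((1 - U) * (emb A b * (1 - U)))" by (rule norm_triangle_ineq4)
    also have "norm ((1 - U) * emb A z * (1 - U)) \<le> 1 * norm (emb A z) * 1"
      by (intro order_trans[OF norm_mult_ineq] mult_mono U(3)) auto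
    also have "norm ((1 - U) * (emb A b * (1 - U))) \<le> 1 * e"
      by (rule order_trans[OF norm_mult_ineq], rule mult_mono) (use U(3,4) in auto)
    finally show "(nrm Q (cl x))\<^sup>2 \<le> nrm A z + e" using norm_emb[OF cstar zc] by simp
  qed
  note xx = mult_closed[OF adj_closed[OF x] x]
  show "(nrm Q (cl x))\<^sup>2 \<le> nrm Q (cl (adj A x \<otimes> x))"
    by (rule dense_ge) (meson Q_nrm_ex[OF xx] le[OF x] less_imp_le order_trans)
  have "nrm Q (cl (adj A x)) \<le> nrm Q (cl x)"
  proof (rule dense_ge)
    fix e assume "nrm Q (cl x) < e"
    then obtain a where a: "a \<in> cl x" "nrm A a < e" using Q_nrm_ex[OF x] by blast
    note ac = cl_carrier[OF a(1) x]
    have "cl (adj A x) = cl (adj A a)" using cl_eq[OF a(1) x] Q_adj x ac by metis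
    then have "nrm Q (cl (adj A x)) \<le> nrm A (adj A a)" using Q_nrm_le[of "adj A a"] cl_self ac adj_closed by simp
    then show "nrm Q (cl (adj A x)) \<le> e" using a(2) nrm_adj[OF ac] by simp
  qed
  then have "nrm Q (cl (adj A x)) * nrm Q (cl x) \<le> nrm Q (cl x) * nrm Q (cl x)"
    by (intro mult_right_mono Q_nrm_nonneg[OF x])
  then show "nrm Q (cl (adj A x \<otimes> x)) \<le> (nrm Q (cl x))\<^sup>2"
    using Q_submult[OF adj_closed[OF x] x] by (simp add: power2_eq_square)
qed

text \<open>Increments of a rapidly converging subsequence are represented by elements of norm below
  2^-k. Their series is summed in the big algebra and projected back to A.\<close>

lemma Q_complete:
  assumes s: "range s \<subseteq> carrier Q" and C: "\<forall>e>0. \<exists>N. \<forall>m\<ge>N. \<forall>n\<ge>N. nrm Q (s m \<ominus>\<^bsub>Q\<^esub> s n) < e"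
  shows "\<exists>l\<in>carrier Q. (\<lambda>n. nrm Q (s n \<ominus>\<^bsub>Q\<^esub> l)) \<longlonglongrightarrow> 0"
proof -
  have "\<forall>n. \<exists>x. x \<in> carrier A \<and> s n = cl x" using s unfolding Q_carrier by blast
  then obtain x where x: "\<And>n. x n \<in> carrier A" "\<And>n. s n = cl (x n)" by metis
  have "\<forall>k. \<exists>N. \<forall>m\<ge>N. \<forall>n\<ge>N. nrm Q (s m \<ominus>\<^bsub>Q\<^esub> s n) < (1/2) ^ k" using C by simp
  then obtain N where N: "\<And>k m n. N k \<le> m \<Longrightarrow> N k \<le> n \<Longrightarrow> nrm Q (cl (x m \<ominus> x n)) < (1/2) ^ k"
    unfolding x(2) Q_minus[OF x(1) x(1)] by metis
  \<comment> \<open>Partial sums make r nondecreasing, so that both r k and r (Suc k) lie beyond N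
    k.\<close>
  define r where "r k = (\<Sum>i\<le>k. N i)" for k
  have r: "N k \<le> r k" "N k \<le> r (Suc k)" for k unfolding r_def by (auto intro: member_le_sum trans_le_add1)
  have "\<forall>k. \<exists>d. d \<in> cl (x (r (Suc k)) \<ominus> x (r k)) \<and> nrm A d < (1/2) ^ k"
    using Q_nrm_ex[OF _ N[OF r(2) r(1)]] x(1) by (metis minus_closed)
  then obtain d where d: "\<And>k. d k \<in> cl (x (r (Suc k)) \<ominus> x (r k))" "\<And>k. nrm A (d k) < (1/2) ^ k" by metis
  have dc: "d k \<in> carrier A" for k using cl_carrier[OF d(1)] x(1) by simp
  define P where "P k = (\<Sum>i<k. emb A (d i))" for k
  have "summable (\<lambda>k. emb A (d k))"
  proof (rule summable_comparison_test')
    show "summable (\<lambda>k. (1/2 :: real) ^ k)" by (rule summable_geometric) simp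
    show "norm (emb A (d k)) \<le> (1/2) ^ k" for k using d(2)[of k] norm_emb[OF cstar dc[of k]] by simp
  qed
  then have PL: "P \<longlonglongrightarrow> (\<Sum>k. emb A (d k))" unfolding P_def by (rule summable_LIMSEQ)
  define L where "L = (\<Sum>k. emb A (d k))"
  define y where "y k = x (r 0) \<oplus> prj A (P k)" for k
  define l where "l = x (r 0) \<oplus> prj A L"
  have yc: "y k \<in> carrier A" "l \<in> carrier A" for k unfolding y_def l_def using x(1) cstar by auto
  have xy: "cl (x (r k)) = cl (y k)" for k
  proof (induction k)
    case 0
    then show ?case using x(1) unfolding y_def P_def by (simp add: prj_ops(5)[OF cstar])
  next
    case (Suc k)
    have "y (Suc k) = y k \<oplus> d k"
      unfolding y_def P_def using x(1) dc cstar by (simp add: prj_ops(1) prj_emb a_assoc)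
    then have "cl (y (Suc k)) = cl (x (r k)) \<oplus>\<^bsub>Q\<^esub> cl (x (r (Suc k)) \<ominus> x (r k))"
      using Suc cl_eq[OF d(1)] x(1) dc yc by (simp add: Q_add[symmetric])
    also have "\<dots> = cl (x (r k) \<oplus> (x (r (Suc k)) \<ominus> x (r k)))" using x(1) by (simp add: Q_add)
    also have "x (r k) \<oplus> (x (r (Suc k)) \<ominus> x (r k)) = x (r (Suc k))"
      using a_lcomm[OF x(1)[of "r k"] x(1)[of "r (Suc k)"] a_inv_closed[OF x(1)[of "r k"]]] x(1) by (simp add: minus_eq r_neg)
    finally show ?case ..
  qed
  have near: "nrm Q (cl (x (r k) \<ominus> l)) \<le> 2 * norm (P k - L)" for k
  proof -
    have "cl (x (r k) \<ominus> l) = cl (y k \<ominus> l)" using xy[of k] Q_minus x(1) yc by metis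
    also have "y k \<ominus> l = prj A (P k - L)"
    proof (rule emb_eq_iff[OF cstar, THEN iffD1])
      show "emb A (y k \<ominus> l) = emb A (prj A (P k - L))"
        unfolding y_def l_def using x(1) prj_closed[OF cstar, of "P k"] prj_closed[OF cstar, of L]
        by (simp add: prj_ops[OF cstar] emb_minus[OF cstar] emb_ops(1)[OF cstar])
    qed (use yc cstar in auto)
    finally have "nrm Q (cl (x (r k) \<ominus> l)) \<le> nrm A (prj A (P k - L))" using Q_nrm_le cl_self cstar by simp
    also have "\<dots> \<le> 2 * norm (P k - L)"
      unfolding prj_def using nrm_le_norm[OF cstar] norm_base_le order_trans by blast
    finally show ?thesis .
  qed
  have tri: "nrm Q (cl (x n \<ominus> l)) \<le> nrm Q (cl (x n \<ominus> x m)) + nrm Q (cl (x m \<ominus> l))" for m n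
  proof -
    have "x n \<ominus> l = (x n \<ominus> x m) \<oplus> (x m \<ominus> l)"
      using x(1) yc(2) by (simp add: minus_eq a_assoc r_neg1)
    then show ?thesis using Q_triangle[of "x n \<ominus> x m" "x m \<ominus> l"] x(1) yc(2) by simp
  qed
  have "(\<lambda>n. nrm Q (cl (x n \<ominus> l))) \<longlonglongrightarrow> 0"
  proof (rule LIMSEQ_I)
    fix e :: real assume e: "0 < e"
    have "(\<lambda>k. (1/2 :: real) ^ k + 2 * norm (P k - L)) \<longlonglongrightarrow> 0 + 2 * norm (L - L)"
      unfolding L_def by (intro tendsto_intros PL LIMSEQ_power_zero) simp
    then have "\<forall>\<^sub>F k in sequentially. (1/2) ^ k + 2 * norm (P k - L) < e" using e by (intro order_tendstoD) auto
    then obtain k where k: "(1/2) ^ k + 2 * norm (P k - L) < e" using eventually_happens'[OF sequentially_bot] by blast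
    have "norm (nrm Q (cl (x n \<ominus> l)) - 0) < e" if "n \<ge> N k" for n
      using tri[of n "r k"] N[OF that r(1)] near[of k] k Q_nrm_nonneg[of "x n \<ominus> l"] x(1) yc(2) by simp
    then show "\<exists>no. \<forall>n\<ge>no. norm (nrm Q (cl (x n \<ominus> l)) - 0) < e" by blast
  qed
  then show ?thesis
    using yc(2) unfolding x(2) by (intro bexI[of _ "cl l"]) (auto simp: Q_minus x(1) Q_carrier)
qed

lemma Q_cstar: "cstar_algebra Q"
proof (intro cstar_algebra.intro cstar_algebra_axioms.intro Q_abelian)
  show "\<exists>l\<in>carrier Q. (\<lambda>n. nrm Q (s n \<ominus>\<^bsub>Q\<^esub> l)) \<longlonglongrightarrow> 0"
    if "range s \<subseteq> carrier Q" "\<forall>e>0. \<exists>N. \<forall>m\<ge>N. \<forall>n\<ge>N. nrm Q (s m \<ominus>\<^bsub>Q\<^esub> s n) < e" for s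
    using that by (rule Q_complete)
next
  fix X Y assume "X \<in> carrier Q" "Y \<in> carrier Q"
  then obtain x y where "x \<in> carrier A" "X = cl x" "y \<in> carrier A" "Y = cl y" by (auto elim!: Q_cases)
  then show "X \<otimes>\<^bsub>Q\<^esub> Y \<in> carrier Q" "nrm Q (X \<oplus>\<^bsub>Q\<^esub> Y) \<le> nrm Q X + nrm Q Y" "nrm Q (X \<otimes>\<^bsub>Q\<^esub> Y) \<le> nrm Q X * nrm Q Y"
    "adj Q (X \<oplus>\<^bsub>Q\<^esub> Y) = adj Q X \<oplus>\<^bsub>Q\<^esub> adj Q Y" "adj Q (X \<otimes>\<^bsub>Q\<^esub> Y) = adj Q Y \<otimes>\<^bsub>Q\<^esub> adj Q X"
    by (simp_all add: Q_ops Q_triangle Q_submult mult_closed adj_closed adj_add adj_mult) (simp add: Q_carrier mult_closed)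
next
  fix X c d assume "X \<in> carrier Q"
  then obtain x where "x \<in> carrier A" "X = cl x" by (rule Q_cases)
  then show "c \<odot>\<^bsub>Q\<^esub> X \<in> carrier Q" "(c + d) \<odot>\<^bsub>Q\<^esub> X = c \<odot>\<^bsub>Q\<^esub> X \<oplus>\<^bsub>Q\<^esub> d \<odot>\<^bsub>Q\<^esub> X"
    "(c * d) \<odot>\<^bsub>Q\<^esub> X = c \<odot>\<^bsub>Q\<^esub> (d \<odot>\<^bsub>Q\<^esub> X)" "1 \<odot>\<^bsub>Q\<^esub> X = X" "adj Q X \<in> carrier Q" "adj Q (adj Q X) = X"
    "adj Q (c \<odot>\<^bsub>Q\<^esub> X) = cnj c \<odot>\<^bsub>Q\<^esub> adj Q X" "0 \<le> nrm Q X" "nrm Q X = 0 \<longleftrightarrow> X = \<zero>\<^bsub>Q\<^esub>"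
    "nrm Q (c \<odot>\<^bsub>Q\<^esub> X) = cmod c * nrm Q X" "nrm Q (adj Q X \<otimes>\<^bsub>Q\<^esub> X) = (nrm Q X)\<^sup>2"
    by (simp_all add: Q_ops Q_nrm_scale Q_nrm_nonneg Q_nrm_zero Q_cstar_identity scale_closed adj_closed
        scale_add_left scale_scale scale_one adj_adj adj_scale) (simp_all add: Q_carrier scale_closed adj_closed)
next
  fix X Y Z assume "X \<in> carrier Q" "Y \<in> carrier Q" "Z \<in> carrier Q"
  then obtain x y z where "x \<in> carrier A" "X = cl x" "y \<in> carrier A" "Y = cl y" "z \<in> carrier A" "Z = cl z"
    by (auto elim!: Q_cases)
  then show "X \<otimes>\<^bsub>Q\<^esub> Y \<otimes>\<^bsub>Q\<^esub> Z = X \<otimes>\<^bsub>Q\<^esub> (Y \<otimes>\<^bsub>Q\<^esub> Z)" "(X \<oplus>\<^bsub>Q\<^esub> Y) \<otimes>\<^bsub>Q\<^esub> Z = X \<otimes>\<^bsub>Q\<^esub> Z \<oplus>\<^bsub>Q\<^esub> Y \<otimes>\<^bsub>Q\<^esub> Z"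
    "Z \<otimes>\<^bsub>Q\<^esub> (X \<oplus>\<^bsub>Q\<^esub> Y) = Z \<otimes>\<^bsub>Q\<^esub> X \<oplus>\<^bsub>Q\<^esub> Z \<otimes>\<^bsub>Q\<^esub> Y"
    by (simp_all add: Q_ops mult_closed mult_assoc mult_distr_right mult_distr_left)
next
  fix X Y c assume "X \<in> carrier Q" "Y \<in> carrier Q"
  then obtain x y where "x \<in> carrier A" "X = cl x" "y \<in> carrier A" "Y = cl y" by (auto elim!: Q_cases)
  then show "c \<odot>\<^bsub>Q\<^esub> (X \<oplus>\<^bsub>Q\<^esub> Y) = c \<odot>\<^bsub>Q\<^esub> X \<oplus>\<^bsub>Q\<^esub> c \<odot>\<^bsub>Q\<^esub> Y"
    "(c \<odot>\<^bsub>Q\<^esub> X) \<otimes>\<^bsub>Q\<^esub> Y = c \<odot>\<^bsub>Q\<^esub> (X \<otimes>\<^bsub>Q\<^esub> Y)" "X \<otimes>\<^bsub>Q\<^esub> (c \<odot>\<^bsub>Q\<^esub> Y) = c \<odot>\<^bsub>Q\<^esub> (X \<otimes>\<^bsub>Q\<^esub> Y)"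
    by (simp_all add: Q_ops mult_closed scale_closed scale_add_right scale_mult_left scale_mult_right)
qed

lemma cl_star_hom: "cl \<in> star_hom A Q"
  by (rule star_homI) (simp_all add: Q_ops, simp add: Q_carrier)

end

lemma quot_proj_cl:
  assumes I: "cstar_quotient A I" and J: "cstar_quotient A J" and "I \<subseteq> J" and x: "x \<in> carrier A"
  shows "quot_proj A J (I +>\<^bsub>A\<^esub> x) = J +>\<^bsub>A\<^esub> x"
proof -
  interpret I: cstar_quotient A I by (rule I)
  interpret J: cstar_quotient A J by (rule J)
  have "J +>\<^bsub>A\<^esub> y = J +>\<^bsub>A\<^esub> x" if y: "y \<in> I +>\<^bsub>A\<^esub> x" for y
  proof -
    obtain h where h: "h \<in> I" "y = h \<oplus>\<^bsub>A\<^esub> x" using y unfolding I.cl_mem by blast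
    then have "h \<in> J" using assms(3) by blast
    then show ?thesis unfolding h(2) by (rule J.cl_eqI[OF _ x])
  qed
  then have "quot_proj A J (I +>\<^bsub>A\<^esub> x) = (\<Union>y\<in>I +>\<^bsub>A\<^esub> x. J +>\<^bsub>A\<^esub> x)" unfolding quot_proj_def by simp
  then show ?thesis using I.cl_self[OF x] by auto
qed

lemma quot_proj_star_hom:
  assumes I: "cstar_quotient A I" and J: "cstar_quotient A J" and "I \<subseteq> J"
  shows "quot_proj A J \<in> star_hom (cstar_quot A I) (cstar_quot A J)"
proof -
  interpret I: cstar_quotient A I by (rule I)
  interpret J: cstar_quotient A J by (rule J)
  note p = quot_proj_cl[OF assms]
  show ?thesis
    by (rule star_homI; elim I.Q_cases)
      (simp_all add: I.Q_ops J.Q_ops p I.mult_closed I.scale_closed I.adj_closed, simp add: J.Q_carrier)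
qed

text \<open>This is where n large enters. A short representative of the coset modulo J uses an
  element of J, which is close to an element of some I N; replacing it gives an almost as short
  representative modulo every later I n.\<close>

lemma quot_norm_limit:
  assumes A: "cstar_algebra A" and ideal: "\<And>n. cstar_ideal (I n) A" and inc: "\<And>n. I n \<subseteq> I (Suc n)"
    and J: "cstar_ideal (nrm_closure A (\<Union>n. I n)) A" and x: "x \<in> carrier A"
    and lt: "nrm (cstar_quot A (nrm_closure A (\<Union>n. I n))) (nrm_closure A (\<Union>n. I n) +>\<^bsub>A\<^esub> x) < e"
  shows "\<exists>N. \<forall>n\<ge>N. nrm (cstar_quot A (I n)) (I n +>\<^bsub>A\<^esub> x) < e"
proof -
  have q: "cstar_quotient A (I n)" for n by (intro cstar_quotient.intro A cstar_quotient_axioms.intro ideal)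
  interpret J: cstar_quotient A "nrm_closure A (\<Union>n. I n)" by (intro cstar_quotient.intro A cstar_quotient_axioms.intro J)
  obtain y where y: "y \<in> nrm_closure A (\<Union>n. I n) +>\<^bsub>A\<^esub> x" "nrm A y < e" using J.Q_nrm_ex[OF x lt] by blast
  then obtain h where h: "h \<in> nrm_closure A (\<Union>n. I n)" "y = h \<oplus>\<^bsub>A\<^esub> x" unfolding J.cl_mem by blast
  have hc: "h \<in> carrier A" using h(1) unfolding nrm_closure_def by blast
  have "0 < e - nrm A y" using y(2) by simp
  then obtain g where g: "g \<in> (\<Union>n. I n)" "nrm A (h \<ominus>\<^bsub>A\<^esub> g) < e - nrm A y"
    using h(1) unfolding nrm_closure_def by blast
  then obtain N where N: "g \<in> I N" by blast
  have "nrm (cstar_quot A (I n)) (I n +>\<^bsub>A\<^esub> x) < e" if "N \<le> n" for n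
  proof -
    interpret cstar_quotient A "I n" by (rule q)
    have gn: "g \<in> I n" using N lift_Suc_mono_le[of I, OF inc that] by blast
    note gc = I_mem[OF gn]
    have "nrm Q (cl x) \<le> nrm A (g \<oplus>\<^bsub>A\<^esub> x)" by (rule Q_nrm_le[OF x]) (use gn in \<open>auto simp: cl_mem\<close>)
    also have "\<dots> = norm (emb A y - emb A (h \<ominus>\<^bsub>A\<^esub> g))"
      using gc hc x norm_emb[OF cstar, of "g \<oplus>\<^bsub>A\<^esub> x"] unfolding h(2) by (simp add: emb_ops(1)[OF cstar] emb_minus[OF cstar] add.commute)
    also have "\<dots> \<le> nrm A y + nrm A (h \<ominus>\<^bsub>A\<^esub> g)"
      using gc hc x norm_triangle_ineq4[of "emb A y" "emb A (h \<ominus>\<^bsub>A\<^esub> g)"] unfolding h(2) by (simp add: norm_emb[OF cstar])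
    finally show ?thesis using g(2) by simp
  qed
  then show ?thesis by blast
qed

subsection \<open>Unital corners and *-homomorphisms\<close>

lemma unital_corner: "star p = p \<Longrightarrow> p * p = p \<Longrightarrow> unital_cstar_algebra (corner (p::'a::cstar1))"
  by (intro unital_cstar_algebra.intro cstar_algebra_corner unital_cstar_algebra_axioms.intro) auto

lemma corner_poly:
  fixes p X :: "'a::cstar1"
  assumes p: "star p = p" "p * p = p" and X: "p * X = X" "X * p = X"
  shows "cstar_poly (corner p) q X = cp.pev q X * p"
proof -
  interpret unital_cstar_algebra "corner p" by (rule unital_corner[OF p])
  have pow: "X [^]\<^bsub>corner p\<^esub> i = X ^ i * p" for i :: nat
  proof (induction i)
    case (Suc i)
    have "X [^]\<^bsub>corner p\<^esub> Suc i = X ^ i * (p * X)"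
      unfolding monoid.nat_pow_Suc[OF monoid] Suc by (simp add: mult.assoc)
    also have "\<dots> = X ^ i * (X * p)" unfolding X ..
    finally show ?case by (simp only: power_Suc2 mult.assoc)
  qed (simp add: monoid.nat_pow_0[OF monoid])
  have "finsum (corner p) g S = sum g S" if "finite S" "g \<in> S \<rightarrow> carrier (corner p)" for g :: "nat \<Rightarrow> 'a" and S
    using that
  proof (induction S rule: finite_induct)
    case (insert a S)
    then have "finsum (corner p) g (insert a S) = g a \<oplus>\<^bsub>corner p\<^esub> finsum (corner p) g S" by (intro finsum_insert) auto
    then show ?case using insert by simp
  qed simp
  moreover have "(\<lambda>i. coeff q i \<odot>\<^bsub>corner p\<^esub> (X [^]\<^bsub>corner p\<^esub> i)) \<in> {..degree q} \<rightarrow> carrier (corner p)"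
    using X by (intro Pi_I scale_closed pow_closed) simp
  ultimately have "cstar_poly (corner p) q X = (\<Sum>i\<le>degree q. coeff q i \<odot>\<^bsub>corner p\<^esub> (X [^]\<^bsub>corner p\<^esub> i))"
    unfolding cstar_poly_def by blast
  then show ?thesis unfolding pow cp.pev_altdef by (simp add: sum_distrib_right cscale_mult_left)
qed

lemma star_hom_comp: "f \<in> star_hom A B \<Longrightarrow> g \<in> star_hom B C \<Longrightarrow> (\<lambda>x. g (f x)) \<in> star_hom A C"
  by (rule star_homI) (simp_all add: star_homD)

lemma star_hom_contractive:
  assumes "cstar_algebra A" "cstar_algebra C" "f \<in> star_hom A C" "x \<in> carrier A"
  shows "nrm C (f x) \<le> nrm A x"
proof -
  interpret star_homo "bigmap A C f" by (rule bigmap_star_homo[OF assms(1-3)])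
  show ?thesis
    using hom_norm_le[of "emb A x"] norm_emb[OF assms(2) star_homD(1)[OF assms(3,4)]] norm_emb[OF assms(1,4)]
    by (simp add: bigmap_emb assms)
qed

lemma star_hom_relation:
  assumes A: "unital_cstar_algebra A" and C: "unital_cstar_algebra C" and f: "f \<in> star_hom A C" "f \<one>\<^bsub>A\<^esub> = \<one>\<^bsub>C\<^esub>"
    and x: "satisfies_relation A q x"
  shows "satisfies_relation C q (f x)"
proof -
  interpret A: unital_cstar_algebra A by (rule A)
  interpret C: unital_cstar_algebra C by (rule C)
  interpret star_homo "bigmap A C f" by (rule bigmap_star_homo[OF A.cstar C.cstar f(1)])
  have xc: "x \<in> carrier A" "cstar_poly A q x = \<zero>\<^bsub>A\<^esub>" "nrm A x \<le> 1" using x unfolding satisfies_relation_def by auto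
  note fx = star_homD(1)[OF f(1) xc(1)]
  have "emb C (cstar_poly C q (f x)) = bigmap A C f (cp.pev q (emb A x) * emb A \<one>\<^bsub>A\<^esub>)"
    unfolding C.emb_poly[OF fx] by (simp add: hom_mult hom_pev bigmap_emb A.cstar xc(1) A.one_closed f(2))
  also have "\<dots> = 0" unfolding A.emb_poly[OF xc(1), symmetric] xc(2) by (simp add: emb_zero A.cstar)
  finally have "cstar_poly C q (f x) = \<zero>\<^bsub>C\<^esub>" using C.emb_eq_0[OF C.poly_closed[OF fx]] by simp
  moreover have "nrm C (f x) \<le> 1" using star_hom_contractive[OF A.cstar C.cstar f(1) xc(1)] xc(3) by simp
  ultimately show ?thesis unfolding satisfies_relation_def using fx by simp
qed

lemma nrm_closure_emb:
  assumes A: "cstar_algebra A" and S: "S \<subseteq> carrier A"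
  shows "x \<in> nrm_closure A S \<longleftrightarrow> x \<in> carrier A \<and> emb A x \<in> closure (emb A ` S)"
proof (cases "x \<in> carrier A")
  case True
  interpret cstar_algebra A by (rule A)
  have d: "dist (emb A y) (emb A x) = nrm A (x \<ominus>\<^bsub>A\<^esub> y)" if "y \<in> S" for y
  proof -
    have y: "y \<in> carrier A" using that S by blast
    have "emb A (x \<ominus>\<^bsub>A\<^esub> y) = emb A x - emb A y" by (rule emb_minus(2)[OF A y True])
    then show ?thesis using norm_emb[OF A, of "x \<ominus>\<^bsub>A\<^esub> y"] True y by (simp add: dist_commute dist_norm)
  qed
  show ?thesis unfolding nrm_closure_def closure_approachable using True d by auto
qed (simp add: nrm_closure_def)

lemma closure_op1:
  assumes "\<And>x. x \<in> S \<Longrightarrow> f x \<in> T" "continuous_on UNIV f" "x \<in> closure S"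
  shows "f x \<in> closure T"
  using image_closure_subset[OF continuous_on_subset[OF assms(2) subset_UNIV] closed_closure[of T], of S] assms(1,3)
    closure_subset[of T] by blast

lemma closure_op2:
  assumes "\<And>x y. x \<in> S \<Longrightarrow> y \<in> T \<Longrightarrow> f x y \<in> R" "continuous_on UNIV (\<lambda>z. f (fst z) (snd z))"
    "x \<in> closure S" "y \<in> closure T"
  shows "f x y \<in> closure R"
proof -
  have "(x, y) \<in> closure (S \<times> T)" using assms(3,4) by (simp add: closure_Times)
  from closure_op1[OF _ assms(2) this, of R] show ?thesis using assms(1) by auto
qed

lemma continuous_cscale: "continuous_on UNIV (\<lambda>z. cscale (fst z) (snd z :: 'a::cstar1))"
proof -
  have "bounded_linear (\<lambda>c. cscale c (1::'a))"
  proof (rule bounded_linear_intro)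
    show "cscale (r *\<^sub>R c) (1::'a) = r *\<^sub>R cscale c 1" for r c
      by (simp only: scaleR_conv_of_real[of r c] cscale_cscale[symmetric] cscale_of_real)
    show "norm (cscale c (1::'a)) \<le> norm c * 1" for c by (simp add: norm_cscale)
  qed (rule cscale_add_left)
  then have "continuous_on UNIV (\<lambda>z. cscale (fst z) 1 * (snd z :: 'a))"
    by (intro continuous_intros bounded_linear.continuous_on[of "\<lambda>c. cscale c 1"])
  then show ?thesis by (simp add: cscale_mult_left)
qed

lemma continuous_star: "continuous_on UNIV (star :: 'a::cstar0 \<Rightarrow> 'a)"
proof -
  have "bounded_linear (star :: 'a \<Rightarrow> 'a)"
    by (rule bounded_linear_intro[where K = 1]) (simp_all add: star_add star_scaleR)
  then show ?thesis by (intro linear_continuous_on)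
qed

text \<open>The set on which f and g agree is a closed unital *-subalgebra, and it contains the
  generator.\<close>

lemma star_hom_unique:
  assumes D: "unital_cstar_algebra D" "generated_by D b" "b \<in> carrier D" and Q: "cstar_algebra Q"
    and f: "f \<in> star_hom D Q" and g: "g \<in> star_hom D Q" and one: "f \<one>\<^bsub>D\<^esub> = g \<one>\<^bsub>D\<^esub>" and b: "f b = g b" and x: "x \<in> carrier D"
  shows "f x = g x"
proof -
  interpret D: unital_cstar_algebra D by (rule D(1))
  interpret F: star_homo "bigmap D Q f" by (rule bigmap_star_homo[OF D.cstar Q f])
  interpret G: star_homo "bigmap D Q g" by (rule bigmap_star_homo[OF D.cstar Q g])
  define S where "S = {x \<in> carrier D. bigmap D Q f (emb D x) = bigmap D Q g (emb D x)}"
  have S: "x \<in> S \<longleftrightarrow> x \<in> carrier D \<and> f x = g x" for x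
  proof (cases "x \<in> carrier D")
    case True
    then show ?thesis
      unfolding S_def using emb_eq_iff[OF Q star_homD(1)[OF f True] star_homD(1)[OF g True]] by (simp add: bigmap_emb[OF D.cstar True])
  qed (simp add: S_def)
  have Sc: "S \<subseteq> carrier D" unfolding S_def by blast
  have "unital_cstar_subalgebra S D"
    unfolding unital_cstar_subalgebra_def
  proof (intro conjI allI ballI)
    show "additive_subgroup S D"
    proof (intro additive_subgroup.intro D.add.subgroupI)
      show "S \<noteq> {}" using S D.one_closed one by blast
      fix x y assume "x \<in> S" "y \<in> S"
      then show "x \<oplus>\<^bsub>D\<^esub> y \<in> S" unfolding S_def by (simp add: emb_ops[OF D.cstar] F.hom_add G.hom_add)
      show "\<ominus>\<^bsub>D\<^esub> x \<in> S" using \<open>x \<in> S\<close> F.hom_minus G.hom_minus unfolding S_def by (simp add: emb_minus(1)[OF D.cstar])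
    qed (rule Sc)
    show "\<one>\<^bsub>D\<^esub> \<in> S" using S D.one_closed one by blast
    show "c \<odot>\<^bsub>D\<^esub> x \<in> S" "adj D x \<in> S" if "x \<in> S" for c x
      using that unfolding S_def
      by (simp_all add: emb_ops[OF D.cstar] F.hom_cscale G.hom_cscale F.hom_star G.hom_star D.scale_closed D.adj_closed)
    show "x \<otimes>\<^bsub>D\<^esub> y \<in> S" if "x \<in> S" "y \<in> S" for x y
      using that unfolding S_def by (simp add: emb_ops[OF D.cstar] F.hom_mult G.hom_mult D.mult_closed)
    show "nrm_closure D S = S"
    proof
      have cl: "closed {X. bigmap D Q f X = bigmap D Q g X}"
        by (intro closed_Collect_eq linear_continuous_on F.hom_bounded_linear G.hom_bounded_linear)
      have "closure (emb D ` S) \<subseteq> {X. bigmap D Q f X = bigmap D Q g X}"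
        by (rule closure_minimal[OF _ cl]) (auto simp: S_def)
      then show "nrm_closure D S \<subseteq> S" by (auto simp: nrm_closure_emb[OF D.cstar Sc]) (auto simp: S_def)
      show "S \<subseteq> nrm_closure D S"
      proof
        fix x assume "x \<in> S"
        then show "x \<in> nrm_closure D S"
          unfolding nrm_closure_emb[OF D.cstar Sc] by (intro conjI subsetD[OF Sc] subsetD[OF closure_subset] imageI)
      qed
    qed
  qed
  moreover have "b \<in> S" using S D(3) b by blast
  ultimately have "\<Inter>{S. unital_cstar_subalgebra S D \<and> b \<in> S} \<subseteq> S" by (intro Inter_lower) simp
  then have "x \<in> S" using D(2) x unfolding generated_by_def by blast
  then show ?thesis unfolding S by simp
qed

subsection \<open>The universal property for corners\<close>

text \<open>Words for a countable *-subalgebra generated by two elements, with scalars from a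
  countable dense set; countability of the type yields the enumeration.\<close>

datatype trm = Unit | Gen | Add trm trm | Mul trm trm | Adj trm | Scale nat trm

instance trm :: countable by countable_datatype

primrec ev :: "(nat \<Rightarrow> complex) \<Rightarrow> 'a::cstar1 \<Rightarrow> 'a \<Rightarrow> trm \<Rightarrow> 'a" where
  "ev c p y Unit = p" | "ev c p y Gen = y" | "ev c p y (Add s t) = ev c p y s + ev c p y t"
| "ev c p y (Mul s t) = ev c p y s * ev c p y t" | "ev c p y (Adj t) = star (ev c p y t)"
| "ev c p y (Scale n t) = cscale (c n) (ev c p y t)"

lemma separable_subalgebra:
  fixes p Y :: "'a::cstar1"
  assumes p: "star p = p" "p * p = p" and Y: "p * Y = Y" "Y * p = Y"
  obtains T d where "closed T" "p \<in> T" "Y \<in> T" "T \<subseteq> closure (range (d :: nat \<Rightarrow> 'a))" "\<And>x. x \<in> T \<Longrightarrow> p * x = x \<and> x * p = x"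
    "\<And>x y. x \<in> T \<Longrightarrow> y \<in> T \<Longrightarrow> x + y \<in> T" "\<And>x y. x \<in> T \<Longrightarrow> y \<in> T \<Longrightarrow> x * y \<in> T"
    "\<And>x. x \<in> T \<Longrightarrow> star x \<in> T" "\<And>c x. x \<in> T \<Longrightarrow> cscale c x \<in> T"
proof -
  obtain C :: "complex set" where C: "countable C" "\<And>X. open X \<Longrightarrow> X \<noteq> {} \<Longrightarrow> \<exists>d\<in>C. d \<in> X"
    using countable_dense_setE by blast
  have "C \<noteq> {}" using C(2)[of UNIV] by auto
  then have c: "range (from_nat_into C) = C" using C(1) by (rule range_from_nat_into)
  define c where "c = from_nat_into C"
  note c = c[folded c_def]
  have dense: "z \<in> closure (range c)" for z
    unfolding c closure_approachable
  proof (intro allI impI)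
    fix e :: real assume "0 < e"
    then have "ball z e \<noteq> {}" by simp
    then have "\<exists>d\<in>C. d \<in> ball z e" by (intro C(2)) simp_all
    then show "\<exists>y\<in>C. dist y z < e" by (auto simp: dist_commute)
  qed
  define R where "R = range (ev c p Y)"
  have ev: "ev c p Y t \<in> closure R" for t using closure_subset[of R] unfolding R_def by blast
  show ?thesis
  proof (rule that[of "closure R" "\<lambda>n. ev c p Y (from_nat n)"])
    show "closed (closure R)" by simp
    show "p \<in> closure R" "Y \<in> closure R" using ev[of Unit] ev[of Gen] by simp_all
    have "ev c p Y t \<in> range (\<lambda>n. ev c p Y (from_nat n))" for t by (rule range_eqI[of _ _ "to_nat t"]) simp
    then show "closure R \<subseteq> closure (range (\<lambda>n. ev c p Y (from_nat n)))" unfolding R_def by (intro closure_mono) auto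
    have evp: "p * ev c p Y t = ev c p Y t \<and> ev c p Y t * p = ev c p Y t" for t
    proof (induction t)
      case (Mul s t)
      then show ?case by (metis ev.simps(4) mult.assoc)
    next
      case (Adj t)
      then show ?case using p(1) by (metis ev.simps(5) star_mult)
    qed (use p Y in \<open>auto simp: distrib_left distrib_right cscale_mult_left cscale_mult_right\<close>)
    have "closed {x. p * x = x \<and> x * p = x}"
      by (intro closed_Collect_conj closed_Collect_eq continuous_intros)
    then have "closure R \<subseteq> {x. p * x = x \<and> x * p = x}" by (rule closure_minimal[rotated]) (use evp in \<open>auto simp: R_def\<close>)
    then show "p * x = x \<and> x * p = x" if "x \<in> closure R" for x using that by blast
    show "x + y \<in> closure R" if "x \<in> closure R" "y \<in> closure R" for x y
      by (rule closure_op2[OF _ _ that, of "(+)"])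
        (auto intro!: continuous_intros simp: R_def simp flip: ev.simps(3))
    show "x * y \<in> closure R" if "x \<in> closure R" "y \<in> closure R" for x y
      by (rule closure_op2[OF _ _ that, of "(*)"])
        (auto intro!: continuous_intros simp: R_def simp flip: ev.simps(4))
    show "star x \<in> closure R" if "x \<in> closure R" for x
      by (rule closure_op1[OF _ continuous_star that]) (auto simp: R_def simp flip: ev.simps(5))
    show "cscale z x \<in> closure R" if "x \<in> closure R" for z x
      by (rule closure_op2[OF _ continuous_cscale dense[of z] that]) (auto simp: R_def simp flip: ev.simps(6))
  qed
qed

text \<open>The universal property tests only algebras carried by functions from nat to real. A
  separable subalgebra T containing P and Y is transported there by its distances to a dense
  sequence, the homomorphism is obtained, and T is mapped back into the corner.\<close>

lemma universal_corner:
  fixes P Y :: "'a::cstar1"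
  assumes D: "universal_cstar_algebra q D b" and P: "star P = P" "P * P = P"
    and Y: "satisfies_relation (corner P) q Y"
  obtains f where "f \<in> star_hom D (corner P)" "f \<one>\<^bsub>D\<^esub> = P" "f b = Y"
proof -
  have Yc: "P * Y = Y" "Y * P = Y" using Y unfolding satisfies_relation_def by auto
  obtain T and d :: "nat \<Rightarrow> 'a" where T: "closed T" "P \<in> T" "Y \<in> T" "T \<subseteq> closure (range d)"
    "\<And>x. x \<in> T \<Longrightarrow> P * x = x \<and> x * P = x" "\<And>x y. x \<in> T \<Longrightarrow> y \<in> T \<Longrightarrow> x + y \<in> T" "\<And>x y. x \<in> T \<Longrightarrow> y \<in> T \<Longrightarrow> x * y \<in> T"
    "\<And>x. x \<in> T \<Longrightarrow> star x \<in> T" "\<And>c x. x \<in> T \<Longrightarrow> cscale c x \<in> T"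
  proof (rule separable_subalgebra[OF P Yc], goal_cases)
    case (1 T d)
    show ?case by (rule 1(1)[OF 1(2-10)])
  qed
  have Tm: "x - y \<in> T" "- y \<in> T" "0 \<in> T" if "x \<in> T" "y \<in> T" for x y
    using T(6)[OF that(1) T(9)[OF that(2), of "-1"]] T(9)[OF that(2), of "-1"] T(9)[OF that(2), of 0]
    by (simp_all add: cscale_minus_left)
  define j where "j y = (\<lambda>n. norm (y - d n))" for y
  define i where "i = inv_into T j"
  have inj: "inj_on j T"
  proof (rule inj_onI)
    fix x y assume xy: "x \<in> T" "y \<in> T" "j x = j y"
    have "norm (x - y) \<le> 0"
    proof (rule field_le_epsilon)
      fix e :: real assume "0 < e"
      have "x \<in> closure (range d)" using T(4) xy(1) by (rule subsetD)
      then have "\<exists>y\<in>range d. dist y x < e / 2"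
        \<comment> \<open>If x and y have the same distance to every d n, take d n near x: then y is
          near it too.\<close>
        using closure_approachable[THEN iffD1, THEN spec, THEN mp, of x "range d" "e / 2"] \<open>0 < e\<close> by auto
      then obtain n where n: "dist (d n) x < e / 2" by (elim bexE rangeE) simp
      moreover have "norm (x - d n) = norm (y - d n)" using xy(3) unfolding j_def by (rule fun_cong)
      ultimately show "norm (x - y) \<le> 0 + e"
        using norm_triangle_ineq4[of "x - d n" "y - d n"] by (simp add: dist_norm norm_minus_commute)
    qed
    then show "x = y" by simp
  qed
  have ij: "i (j x) = x" if "x \<in> T" for x unfolding i_def by (rule inv_into_f_f[OF inj that])
  define B :: "(nat \<Rightarrow> real) cstar" where
    "B = \<lparr>carrier = j ` T, mult = (\<lambda>x y. j (i x * i y)), one = j P, zero = j 0, add = (\<lambda>x y. j (i x + i y)),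
      smult = (\<lambda>c x. j (cscale c (i x))), adj = (\<lambda>x. j (star (i x))), nrm = (\<lambda>x. norm (i x))\<rparr>"
  have Bs: "carrier B = j ` T" "mult B = (\<lambda>x y. j (i x * i y))" "one B = j P" "zero B = j 0" "add B = (\<lambda>x y. j (i x + i y))"
    "smult B = (\<lambda>c x. j (cscale c (i x)))" "adj B = (\<lambda>x. j (star (i x)))" "nrm B = (\<lambda>x. norm (i x))"
    unfolding B_def by simp_all
  have T0: "0 \<in> T" using Tm(3) T(2) by blast
  have ab: "abelian_group B"
  proof (rule abelian_groupI)
    fix x assume "x \<in> carrier B"
    then show "\<exists>y\<in>carrier B. y \<oplus>\<^bsub>B\<^esub> x = \<zero>\<^bsub>B\<^esub>"
      using Tm ij by (auto simp: Bs intro!: bexI[of _ "- i x"])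
  qed (use T0 in \<open>auto simp: Bs ij T algebra_simps\<close>)
  interpret B: abelian_group B by (rule ab)
  have Bm: "j x \<ominus>\<^bsub>B\<^esub> j y = j (x - y)" if "x \<in> T" "y \<in> T" for x y
  proof -
    have "\<ominus>\<^bsub>B\<^esub> j y = j (- y)" using that Tm by (intro B.minus_equality) (auto simp: Bs ij)
    then show ?thesis using that Tm by (simp add: B.minus_eq Bs ij)
  qed
  have "cstar_algebra B"
  proof (intro cstar_algebra.intro cstar_algebra_axioms.intro ab)
    fix s :: "nat \<Rightarrow> nat \<Rightarrow> real" assume s: "range s \<subseteq> carrier B" and C: "\<forall>e>0. \<exists>N. \<forall>m\<ge>N. \<forall>n\<ge>N. nrm B (s m \<ominus>\<^bsub>B\<^esub> s n) < e"
    have t: "i (s n) \<in> T" "s n = j (i (s n))" for n :: nat using s ij unfolding Bs by (metis image_iff range_subsetD)+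
    have "nrm B (s m \<ominus>\<^bsub>B\<^esub> s n) = norm (i (s m) - i (s n))" for m n
      by (subst (1 2) t(2)) (simp add: Bm t(1), simp add: Bs ij Tm t(1))
    then have "Cauchy (\<lambda>n. i (s n))" using C by (simp add: Cauchy_iff)
    then obtain l where l: "(\<lambda>n. i (s n)) \<longlonglongrightarrow> l" using Cauchy_convergent convergent_def by blast
    have lT: "l \<in> T" using closed_sequentially[OF T(1) _ l] t(1) by blast
    have "nrm B (s n \<ominus>\<^bsub>B\<^esub> j l) = norm (i (s n) - l)" for n
      by (subst (1) t(2)) (simp add: Bm t(1) lT, simp add: Bs ij Tm t(1) lT)
    then show "\<exists>l\<in>carrier B. (\<lambda>n. nrm B (s n \<ominus>\<^bsub>B\<^esub> l)) \<longlonglongrightarrow> 0"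
      using lT tendsto_norm_zero[OF LIM_zero[OF l]] by (intro bexI[of _ "j l"]) (auto simp: Bs)
  qed (auto simp: Bs ij T T0 mult.assoc distrib_left distrib_right cscale_add_left cscale_add_right cscale_cscale
      cscale_mult_left cscale_mult_right norm_cscale star_add star_cscale star_mult norm_mult_ineq norm_triangle_ineq norm_star_mult)
  then have B: "unital_cstar_algebra B"
    by (intro unital_cstar_algebra.intro unital_cstar_algebra_axioms.intro) (auto simp: Bs ij T)
  have iB: "i \<in> star_hom B (corner P)" by (rule star_homI) (auto simp: Bs ij T)
  have CP: "unital_cstar_algebra (corner P)" by (rule unital_corner[OF P])
  have jY: "j Y \<in> carrier B" using T(3) by (simp add: Bs)
  have rel: "satisfies_relation B q (j Y)"
  proof -
    interpret BB: unital_cstar_algebra B by (rule B)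
    interpret CC: unital_cstar_algebra "corner P" by (rule CP)
    interpret star_homo "bigmap B (corner P) i" by (rule bigmap_star_homo[OF BB.cstar CC.cstar iB])
    have pc: "cstar_poly B q (j Y) \<in> carrier B" by (rule BB.poly_closed[OF jY])
    have "emb (corner P) (i (cstar_poly B q (j Y))) = emb (corner P) (cstar_poly (corner P) q Y)"
      using CC.emb_poly[of Y q] Yc jY T by (simp add: bigmap_emb[OF BB.cstar pc, symmetric] BB.emb_poly[OF jY] hom_mult hom_pev
          bigmap_emb[OF BB.cstar] BB.one_closed Bs ij)
    also have "\<dots> = emb (corner P) 0" using Y unfolding satisfies_relation_def by simp
    finally have "i (cstar_poly B q (j Y)) = 0"
      using emb_eq_iff[OF CC.cstar star_homD(1)[OF iB pc], of 0] by simp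
    then have "cstar_poly B q (j Y) = \<zero>\<^bsub>B\<^esub>" using pc by (auto simp: Bs ij)
    then show ?thesis using jY Y unfolding satisfies_relation_def by (simp add: Bs ij T)
  qed
  obtain f where f: "f \<in> star_hom D B" "f \<one>\<^bsub>D\<^esub> = \<one>\<^bsub>B\<^esub>" "f b = j Y"
    using D B rel unfolding universal_cstar_algebra_def by blast
  show ?thesis
    by (rule that[OF star_hom_comp[OF f(1) iB]]) (simp_all add: f(2,3), simp_all add: Bs ij T)
qed

subsection \<open>Semiprojectivity\<close>

text \<open>Two elements of the union lie in a common I r since the chain increases, so the union is
  closed under the operations; continuity of the operations extends this to the closure.\<close>

lemma cstar_ideal_closure_Union:
  assumes A: "cstar_algebra A" and ideal: "\<And>n::nat. cstar_ideal (I n) A" and inc: "\<And>n. I n \<subseteq> I (Suc n)"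
  shows "cstar_ideal (nrm_closure A (\<Union>n. I n)) A"
proof -
  interpret cstar_algebra A by (rule A)
  have q: "cstar_quotient A (I n)" for n by (intro cstar_quotient.intro A cstar_quotient_axioms.intro ideal)
  define U where "U = (\<Union>n. I n)"
  define K where "K = nrm_closure A U"
  define L where "L = closure (emb A ` U)"
  have Uc: "U \<subseteq> carrier A" unfolding U_def using cstar_quotient.I_mem[OF q] by blast
  have K: "x \<in> K \<longleftrightarrow> x \<in> carrier A \<and> emb A x \<in> L" for x unfolding K_def L_def by (rule nrm_closure_emb[OF A Uc])
  have Ladd: "X + Y \<in> L" if "X \<in> L" "Y \<in> L" for X Y
    unfolding L_def
  proof (rule closure_op2[OF _ _ that[unfolded L_def], of "(+)"])
    fix X Y assume "X \<in> emb A ` U" "Y \<in> emb A ` U"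
    then obtain x y m n where xy: "X = emb A x" "Y = emb A y" "x \<in> I m" "y \<in> I n" unfolding U_def by blast
    define r where "r = max m n"
    interpret r: cstar_quotient A "I r" by (rule q)
    have "I m \<subseteq> I r" "I n \<subseteq> I r" unfolding r_def using lift_Suc_mono_le[of I, OF inc] by auto
    then have xy': "x \<in> I r" "y \<in> I r" using xy by auto
    have "x \<oplus>\<^bsub>A\<^esub> y \<in> U" unfolding U_def using r.I.a_closed[OF xy'] by blast
    moreover have "X + Y = emb A (x \<oplus>\<^bsub>A\<^esub> y)" unfolding xy(1,2) using emb_ops(1)[OF A r.I_mem[OF xy'(1)] r.I_mem[OF xy'(2)]] by simp
    ultimately show "X + Y \<in> emb A ` U" by blast
  qed (intro continuous_intros)
  have op: "f X \<in> L" if f: "\<And>n x. x \<in> I n \<Longrightarrow> f (emb A x) \<in> emb A ` I n" and c: "continuous_on UNIV f" and X: "X \<in> L" for f X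
    unfolding L_def
  proof (rule closure_op1[OF _ c X[unfolded L_def]])
    show "f Z \<in> emb A ` U" if "Z \<in> emb A ` U" for Z using that f unfolding U_def by blast
  qed
  have Lscale: "cscale z X \<in> L" if "X \<in> L" for z X
  proof (rule op[OF _ _ that])
    show "cscale z (emb A x) \<in> emb A ` I n" if "x \<in> I n" for n x
      using cstar_quotient.I_closed(1)[OF q that] emb_ops(3)[OF A cstar_quotient.I_mem[OF q that]] by (metis imageI)
    show "continuous_on UNIV (cscale z :: 'a big \<Rightarrow> _)"
      using continuous_on_compose2[OF continuous_cscale, of UNIV "\<lambda>x. (z, x)"] by (simp add: continuous_intros)
  qed
  have Lmult: "emb A a * X \<in> L" "X * emb A a \<in> L" if "X \<in> L" "a \<in> carrier A" for a X
  proof -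
    show "emb A a * X \<in> L"
    proof (rule op[OF _ _ that(1)])
      show "emb A a * emb A x \<in> emb A ` I n" if "x \<in> I n" for n x
        using cstar_quotient.I_closed(2)[OF q \<open>a \<in> carrier A\<close> that] emb_ops(2)[OF A \<open>a \<in> carrier A\<close> cstar_quotient.I_mem[OF q that]]
        by (metis imageI)
    qed (intro continuous_intros)
    show "X * emb A a \<in> L"
    proof (rule op[OF _ _ that(1)])
      show "emb A x * emb A a \<in> emb A ` I n" if "x \<in> I n" for n x
        using cstar_quotient.I_closed(3)[OF q \<open>a \<in> carrier A\<close> that] emb_ops(2)[OF A cstar_quotient.I_mem[OF q that] \<open>a \<in> carrier A\<close>]
        by (metis imageI)
    qed (intro continuous_intros)
  qed
  have L0: "emb A \<zero>\<^bsub>A\<^esub> \<in> L"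
  proof -
    interpret r: cstar_quotient A "I 0" by (rule q)
    have "\<zero>\<^bsub>A\<^esub> \<in> U" unfolding U_def using r.I.zero_closed by blast
    then show ?thesis unfolding L_def by (intro subsetD[OF closure_subset] imageI)
  qed
  have Kc: "K \<subseteq> carrier A" using K by blast
  have "cstar_ideal K A"
    unfolding cstar_ideal_def
  proof (intro conjI allI ballI)
    show "additive_subgroup K A"
    proof (intro additive_subgroup.intro add.subgroupI)
      show "K \<noteq> {}" using L0 K zero_closed by blast
      fix x y assume "x \<in> K" "y \<in> K"
      then show "x \<oplus>\<^bsub>A\<^esub> y \<in> K" unfolding K by (simp add: emb_ops(1)[OF A] Ladd)
      show "\<ominus>\<^bsub>A\<^esub> x \<in> K" using \<open>x \<in> K\<close> unfolding K using Lscale[of "emb A x" "-1"] by (simp add: emb_minus(1)[OF A] cscale_minus_left)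
    qed (rule Kc)
    show "c \<odot>\<^bsub>A\<^esub> x \<in> K" if "x \<in> K" for c x using that unfolding K by (simp add: emb_ops(3)[OF A] Lscale scale_closed)
    show "a \<otimes>\<^bsub>A\<^esub> x \<in> K" "x \<otimes>\<^bsub>A\<^esub> a \<in> K" if "a \<in> carrier A" "x \<in> K" for a x
      using that unfolding K by (simp_all add: emb_ops(2)[OF A] Lmult mult_closed)
    have "closure (emb A ` K) \<subseteq> L" by (rule closure_minimal) (use K in \<open>auto simp: L_def\<close>)
    then have "nrm_closure A K \<subseteq> K" by (auto simp: nrm_closure_emb[OF A Kc]) (auto simp: K)
    moreover have "K \<subseteq> nrm_closure A K"
    proof
      fix x assume "x \<in> K"
      then show "x \<in> nrm_closure A K"
        unfolding nrm_closure_emb[OF A Kc] by (intro conjI subsetD[OF Kc] subsetD[OF closure_subset] imageI)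
    qed
    ultimately show "nrm_closure A K = K" by blast
  qed
  then show ?thesis unfolding K_def U_def .
qed

lemma prj_mult_scal:
  assumes A: "cstar_algebra A" and "scal F = 0" "scal G = 0"
  shows "prj A (F * G) = prj A F \<otimes>\<^bsub>A\<^esub> prj A G"
proof -
  interpret cstar_algebra A by (rule A)
  have c: "prj A F \<in> carrier A" "prj A G \<in> carrier A" using A by simp_all
  then have "emb A (prj A (F * G)) = emb A (prj A F \<otimes>\<^bsub>A\<^esub> prj A G)"
    using assms by (simp add: prj_ops emb_ops mult_closed scale_closed)
  then show ?thesis using emb_eq_iff[OF A] c A by (simp add: mult_closed)
qed

lemma corner_star_hom:
  assumes "star_homo \<rho>"
  shows "\<rho> \<in> star_hom (corner p) (corner (\<rho> p))"
proof -
  interpret star_homo \<rho> by (rule assms)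
  show ?thesis by (rule star_homI) (simp_all add: hom_add hom_mult hom_cscale hom_star, metis hom_mult)
qed

lemma corner_emb_star_hom:
  assumes A: "unital_cstar_algebra D" and Q: "cstar_algebra Q" and f: "f \<in> star_hom D Q"
  shows "(\<lambda>d. emb Q (f d)) \<in> star_hom D (corner (emb Q (f \<one>\<^bsub>D\<^esub>)))"
proof -
  interpret unital_cstar_algebra D by (rule A)
  note f = star_homD[OF f]
  have "emb Q (f \<one>\<^bsub>D\<^esub>) * emb Q (f d) = emb Q (f d)" "emb Q (f d) * emb Q (f \<one>\<^bsub>D\<^esub>) = emb Q (f d)" if d: "d \<in> carrier D" for d
    using f(2)[OF one_closed d] f(2)[OF d one_closed] emb_ops(2)[OF Q f(1)[OF one_closed] f(1)[OF d]]
      emb_ops(2)[OF Q f(1)[OF d] f(1)[OF one_closed]] by (simp_all add: one_mult mult_one d)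
  then show ?thesis by (intro star_homI) (simp_all add: f emb_ops[OF Q] one_closed)
qed

text \<open>The corner at an embedded element lies in the image of \<open>emb\<close>, which is an
  ideal. There \<open>prj\<close> inverts \<open>emb\<close> and is therefore
  multiplicative.\<close>

lemma corner_prj_star_hom:
  assumes Q: "cstar_algebra Q" and p: "p \<in> carrier Q"
  shows "prj Q \<in> star_hom (corner (emb Q p)) Q" "F \<in> carrier (corner (emb Q p)) \<Longrightarrow> emb Q (prj Q F) = F"
proof -
  interpret cstar_algebra Q by (rule Q)
  have F: "\<exists>y\<in>carrier Q. F = emb Q y" if "F \<in> carrier (corner (emb Q p))" for F
  proof (rule bexI)
    show "F = emb Q (p \<otimes>\<^bsub>Q\<^esub> prj Q F \<oplus>\<^bsub>Q\<^esub> scal F \<odot>\<^bsub>Q\<^esub> p)" using that emb_prj_mult(1)[OF Q p, of F] by simp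
    show "p \<otimes>\<^bsub>Q\<^esub> prj Q F \<oplus>\<^bsub>Q\<^esub> scal F \<odot>\<^bsub>Q\<^esub> p \<in> carrier Q" using p Q by (simp add: mult_closed scale_closed)
  qed
  then show emb: "emb Q (prj Q F) = F" if "F \<in> carrier (corner (emb Q p))" for F using that by (metis prj_emb[OF Q])
  show "prj Q \<in> star_hom (corner (emb Q p)) Q"
  proof (rule star_homI)
    fix X Y assume X: "X \<in> carrier (corner (emb Q p))" and Y: "Y \<in> carrier (corner (emb Q p))"
    have "emb Q (prj Q (X * Y)) = emb Q (prj Q X \<otimes>\<^bsub>Q\<^esub> prj Q Y)"
      using emb[OF X] emb[OF Y] emb[of "X * Y"] X Y emb_ops(2)[OF Q prj_closed[OF Q] prj_closed[OF Q]]
      by (simp add: mult.assoc[of _ Y] flip: mult.assoc[of _ X])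
    then show "prj Q (X \<otimes>\<^bsub>corner (emb Q p)\<^esub> Y) = prj Q X \<otimes>\<^bsub>Q\<^esub> prj Q Y"
      using emb_eq_iff[OF Q prj_closed[OF Q] mult_closed[OF prj_closed[OF Q] prj_closed[OF Q]]] by simp
  qed (simp_all add: Q prj_ops[OF Q])
qed

theorem theorem9:
  fixes n :: nat and lam :: "nat \<Rightarrow> complex" and k :: "nat \<Rightarrow> nat"
    and p :: "complex poly" and D :: "'d cstar" and b :: 'd
  assumes "p = (\<Prod>i\<in>{1..n}. [:- lam i, 1:] ^ k i)"
    and "inj_on lam {1..n}"
    and "\<And>i. i \<in> {1..n} \<Longrightarrow> k i \<ge> 2"
    and "has_representation TYPE('h::complex_hilbert_space) p"
    and "universal_cstar_algebra p D b"
  shows "semiprojective TYPE('a) D"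
  unfolding semiprojective_def
proof (intro allI impI, elim conjE)
  fix A :: "'a cstar" and I :: "nat \<Rightarrow> 'a set" and \<phi>
  assume A: "cstar_algebra A" and ideal: "\<forall>n. cstar_ideal (I n) A" and inc: "\<forall>n. I n \<subseteq> I (Suc n)"
    and phi: "\<phi> \<in> star_hom D (cstar_quot A (nrm_closure A (\<Union>n. I n)))"
  define R where "R = {1..n}"
  have lp: "linear_powers R lam k" unfolding R_def using assms(2,3) by unfold_locales (auto, force)
  interpret linear_powers R lam k by (rule lp)
  have pp: "p = ppoly" unfolding ppoly_def pfac_def assms(1) by (simp add: R_def)
  define R' where "R' = reduced_set R lam"
  interpret r: linear_powers R' lam "reduced_exp lam k" unfolding R'_def by (rule linear_powers_reduced[OF lp])
  have D: "unital_cstar_algebra D" "satisfies_relation D p b" "generated_by D b"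
    using assms(5) unfolding universal_cstar_algebra_def by auto
  interpret D: unital_cstar_algebra D by (rule D(1))
  have bD: "b \<in> carrier D" using D(2) unfolding satisfies_relation_def by blast
  define J where "J = nrm_closure A (\<Union>n. I n)"
  have idJ: "cstar_ideal J A" unfolding J_def using cstar_ideal_closure_Union[of A I] A ideal inc by blast
  interpret A: cstar_algebra A by (rule A)
  interpret q: cstar_quotient A "I n" for n by (intro cstar_quotient.intro A cstar_quotient_axioms.intro) (use ideal in blast)
  interpret Q: cstar_quotient A J by (intro cstar_quotient.intro A cstar_quotient_axioms.intro idJ)
  have IJ: "I m \<subseteq> J" for m
  proof
    fix x assume x: "x \<in> I m"
    have "x \<ominus>\<^bsub>A\<^esub> x = \<zero>\<^bsub>A\<^esub>" using q.I_mem[OF x] by (simp add: A.minus_eq A.r_neg)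
    then show "x \<in> J" unfolding J_def nrm_closure_def using x q.I_mem[OF x] by (auto intro!: bexI[of _ x] simp: A.nrm_zero)
  qed
  have Imono: "I m \<subseteq> I l" if "m \<le> l" for m l using lift_Suc_mono_le[of I, OF _ that] inc by blast
  have qs: "cstar_quotient A (I m)" for m by unfold_locales
  have Qs: "cstar_quotient A J" by unfold_locales
  note phi = phi[folded J_def]
  note phiD = star_homD[OF phi]
  show "\<exists>n. \<exists>\<psi>\<in>star_hom D (cstar_quot A (I n)). \<forall>d\<in>carrier D. \<phi> d = quot_proj A (nrm_closure A (\<Union>n. I n)) (\<psi> d)"
    unfolding J_def[symmetric]
  proof (cases "R' = {}")
    case True
    \<comment> \<open>If all eigenvalues have modulus above 1, the reduced polynomial is 1, so D is
      zero and the zero map lifts.\<close>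
    have "r.ppoly = prod r.pfac R'" by (rule r.ppoly_def)
    also have "\<dots> = 1" using True by simp
    finally have "r.ppoly = 1" .
    then have "cstar_poly D 1 b = \<zero>\<^bsub>D\<^esub>"
      using D.reduced_relation[OF lp, of b] D(2) unfolding pp R'_def by simp
    then have "emb D \<one>\<^bsub>D\<^esub> = 0" using D.emb_poly[OF bD, of 1] by (simp add: emb_zero[OF D.cstar])
    then have "emb D d = 0" if "d \<in> carrier D" for d using D.unit_emb(3)[OF that] by simp
    then have d0: "d = \<zero>\<^bsub>D\<^esub>" if "d \<in> carrier D" for d using D.emb_eq_0 that by blast
    interpret Q0: cstar_algebra "cstar_quot A (I 0)" by (rule q.Q_cstar)
    interpret QJ: cstar_algebra "cstar_quot A J" by (rule Q.Q_cstar)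
    have z: "(\<lambda>_. \<zero>\<^bsub>cstar_quot A (I 0)\<^esub>) \<in> star_hom D (cstar_quot A (I 0))"
      by (rule star_homI) (simp_all add: Q0.mult_zero Q0.scale_zero Q0.adj_zero)
    have "\<phi> \<zero>\<^bsub>D\<^esub> \<oplus>\<^bsub>cstar_quot A J\<^esub> \<phi> \<zero>\<^bsub>D\<^esub> = \<phi> \<zero>\<^bsub>D\<^esub>" using phiD(3)[of "\<zero>\<^bsub>D\<^esub>" "\<zero>\<^bsub>D\<^esub>"] by simp
    then have "\<phi> \<zero>\<^bsub>D\<^esub> = \<zero>\<^bsub>cstar_quot A J\<^esub>" using phiD(1)[of "\<zero>\<^bsub>D\<^esub>"] by (simp add: QJ.add.r_cancel_one)
    moreover have "quot_proj A J \<zero>\<^bsub>cstar_quot A (I 0)\<^esub> = \<zero>\<^bsub>cstar_quot A J\<^esub>"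
      unfolding q.Q_zero Q.Q_zero by (rule quot_proj_cl[OF qs Qs IJ A.zero_closed])
    ultimately show "\<exists>n. \<exists>\<psi>\<in>star_hom D (cstar_quot A (I n)). \<forall>d\<in>carrier D. \<phi> d = quot_proj A J (\<psi> d)"
      using d0 by (intro exI[of _ 0] bexI[OF _ z]) force
  next
    case ne: False
    let ?Q = "cstar_quot A J" and ?q = "\<lambda>m. cstar_quot A (I m)" and ?c = "\<lambda>m x. I m +>\<^bsub>A\<^esub> x" and ?C = "\<lambda>x. J +>\<^bsub>A\<^esub> x"
    have lim: "\<exists>N. \<forall>n\<ge>N. nrm (?q n) (?c n x) < e" if "x \<in> carrier A" "nrm ?Q (?C x) < e" for x e
      unfolding J_def using quot_norm_limit[OF A, of I x e] ideal inc idJ that unfolding J_def by blast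
    \<comment> \<open>The unit of D maps to a projection q of the quotient, in general not a unit; q
      has to be lifted along with x.\<close>
    define q where "q = \<phi> \<one>\<^bsub>D\<^esub>"
    have q: "q \<in> carrier ?Q" "q \<otimes>\<^bsub>?Q\<^esub> q = q" "adj ?Q q = q"
      unfolding q_def using phiD(1)[OF D.one_closed] phiD(2)[OF D.one_closed D.one_closed] phiD(5)[OF D.one_closed]
      by (simp_all add: D.one_mult D.one_closed D.adj_one)
    obtain g where g: "g \<in> carrier A" "q = ?C g" using q(1) by (rule Q.Q_cases)
    \<comment> \<open>Symmetrized so that the idempotent near its class is self-adjoint, hence a
      projection.\<close>
    define h where "h = (1/2) \<odot>\<^bsub>A\<^esub> (g \<oplus>\<^bsub>A\<^esub> adj A g)"
    have hc: "h \<in> carrier A" unfolding h_def using g A.adj_closed A.scale_closed by simp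
    have hs: "adj A h = h" unfolding h_def using g A.adj_closed
      by (simp add: A.adj_scale A.adj_add A.adj_adj A.a_comm)
    have "?C h = (1/2) \<odot>\<^bsub>?Q\<^esub> (?C g \<oplus>\<^bsub>?Q\<^esub> adj ?Q (?C g))"
      using g(1) A.adj_closed unfolding h_def by (simp add: Q.Q_ops)
    also have "\<dots> = (1/2) \<odot>\<^bsub>?Q\<^esub> (q \<oplus>\<^bsub>?Q\<^esub> q)" unfolding g(2)[symmetric] q(3) ..
    also have "\<dots> = q" unfolding g(2) using g(1) A.scale_add_left[OF g(1), of "1/2" "1/2"] A.scale_closed[OF g(1)]
      by (simp add: Q.Q_ops A.scale_add_right A.scale_one)
    finally have Ch: "?C h = q" .
    define z where "z = h \<otimes>\<^bsub>A\<^esub> h \<ominus>\<^bsub>A\<^esub> h"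
    have zc: "z \<in> carrier A" unfolding z_def using hc A.mult_closed by simp
    have Cz: "?C z = \<zero>\<^bsub>?Q\<^esub>"
      unfolding z_def Q.Q_minus[OF A.mult_closed[OF hc hc] hc, symmetric] Q.Q_mult[OF hc hc, symmetric] Ch q(2)
      using q(1) Q.Q_abelian by (simp add: abelian_group.r_neg abelian_group.minus_eq a_minus_def)
    then have "nrm ?Q (?C z) < 1 / 4" using Q.Q_nrm_zero[OF zc] by simp
    then obtain N where N: "nrm (?q N) (?c N z) < 1 / 4" using lim[OF zc] by blast
    interpret rN: star_homo "bigmap (?q N) ?Q (quot_proj A J)"
      by (rule bigmap_star_homo[OF q.Q_cstar Q.Q_cstar quot_proj_star_hom[OF qs Qs IJ]])
    have proj: "quot_proj A J (?c m x) = ?C x" if "x \<in> carrier A" for m x by (rule quot_proj_cl[OF qs Qs IJ that])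
    have cc: "?c m x \<in> carrier (?q m)" "?C x \<in> carrier ?Q" if "x \<in> carrier A" for m x
      using that by (simp_all add: q.Q_carrier Q.Q_carrier)
    define G where "G = emb (?q N) (?c N h)"
    have GG: "G * G - G = emb (?q N) (?c N z)"
    proof -
      have "?c N (h \<otimes>\<^bsub>A\<^esub> h) = ?c N (z \<oplus>\<^bsub>A\<^esub> h)"
        unfolding z_def using hc A.mult_closed[OF hc hc] by (simp add: A.minus_eq A.a_assoc A.l_neg)
      moreover have "G * G = emb (?q N) (?c N (h \<otimes>\<^bsub>A\<^esub> h))"
        unfolding G_def using emb_ops(2)[OF q.Q_cstar cc(1)[OF hc] cc(1)[OF hc], of N] by (simp add: q.Q_ops hc)
      moreover have "emb (?q N) (?c N z) + G = emb (?q N) (?c N (z \<oplus>\<^bsub>A\<^esub> h))"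
        unfolding G_def using emb_ops(1)[OF q.Q_cstar cc(1)[OF zc] cc(1)[OF hc], of N] by (simp add: q.Q_ops hc zc)
      ultimately have "G * G = emb (?q N) (?c N z) + G" by simp
      then show ?thesis by simp
    qed
    have "star G = G" unfolding G_def using emb_ops(4)[OF q.Q_cstar cc(1)[OF hc]] by (simp add: q.Q_ops hc hs)
    moreover have "norm (G * G - G) < 1 / 4" unfolding GG norm_emb[OF q.Q_cstar cc(1)[OF zc]] by (rule N)
    moreover have "bigmap (?q N) ?Q (quot_proj A J) (G * G - G) = 0"
      unfolding GG bigmap_emb[OF q.Q_cstar cc(1)[OF zc]] proj[OF zc] Cz by (rule emb_zero[OF Q.Q_cstar])
    ultimately obtain E where E: "E * E = E" "bigmap (?q N) ?Q (quot_proj A J) E = bigmap (?q N) ?Q (quot_proj A J) G" "star E = E"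
      using rN.idempotent_near by metis
    have rG: "bigmap (?q N) ?Q (quot_proj A J) G = emb ?Q q"
      unfolding G_def bigmap_emb[OF q.Q_cstar cc(1)[OF hc]] proj[OF hc] Ch ..
    \<comment> \<open>The scalar part vanishes, so E is an element of A/I N and not merely of its
      unitization, and its relations descend to a representative a.\<close>
    have "scal E = scal (bigmap (?q N) ?Q (quot_proj A J) E)" by (simp add: bigmap_def)
    then have sE: "scal E = 0" unfolding E(2) rG by simp
    obtain a where a: "a \<in> carrier A" "prj (?q N) E = ?c N a" using q.Q_cases[OF prj_closed[OF q.Q_cstar]] by metis
    interpret qN: cstar_algebra "?q N" by (rule q.Q_cstar)
    have aN: "?c N (a \<otimes>\<^bsub>A\<^esub> a) = ?c N a" "?c N (adj A a) = ?c N a"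
    proof -
      have "?c N a = prj (?q N) (E * E)" unfolding E(1) a(2) ..
      also have "\<dots> = ?c N a \<otimes>\<^bsub>?q N\<^esub> ?c N a"
        unfolding prj_mult_scal[OF q.Q_cstar sE sE] a(2) ..
      finally show "?c N (a \<otimes>\<^bsub>A\<^esub> a) = ?c N a" using a(1) by (simp add: q.Q_ops)
      have "?c N a = prj (?q N) (star E)" unfolding E(3) a(2) ..
      then show "?c N (adj A a) = ?c N a" using a prj_ops(4)[OF q.Q_cstar[of N], of E] by (simp add: q.Q_ops)
    qed
    have "emb ?Q (?C a) = bigmap (?q N) ?Q (quot_proj A J) E"
      unfolding bigmap_def sE a(2) proj[OF a(1)] emb_def ..
    then have Ca: "?C a = q" unfolding E(2) rG using emb_eq_iff[OF Q.Q_cstar cc(2)[OF a(1)] q(1)] by blast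
    have am: "?c m (a \<otimes>\<^bsub>A\<^esub> a) = ?c m a" "?c m (adj A a) = ?c m a" if "N \<le> m" for m
    proof -
      note p = quot_proj_cl[OF qs qs Imono[OF that]]
      show "?c m (a \<otimes>\<^bsub>A\<^esub> a) = ?c m a" using aN(1) p[OF A.mult_closed[OF a(1) a(1)]] p[OF a(1)] by metis
      show "?c m (adj A a) = ?c m a" using aN(2) p[OF A.adj_closed[OF a(1)]] p[OF a(1)] by metis
    qed
    define x where "x = \<phi> b"
    have xc: "x \<in> carrier ?Q" unfolding x_def by (rule phiD(1)[OF bD])
    obtain y where y: "y \<in> carrier A" "x = ?C y" using xc by (rule Q.Q_cases)
    \<comment> \<open>Compression by a puts the class of w into the corner of the projection modulo
      every I m with m \<ge> N, without changing its class modulo J.\<close>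
    define w where "w = a \<otimes>\<^bsub>A\<^esub> (y \<otimes>\<^bsub>A\<^esub> a)"
    have wc: "w \<in> carrier A" unfolding w_def using a y A.mult_closed by simp
    have qx: "q \<otimes>\<^bsub>?Q\<^esub> x = x" "x \<otimes>\<^bsub>?Q\<^esub> q = x"
      unfolding q_def x_def using phiD(2)[OF D.one_closed bD] phiD(2)[OF bD D.one_closed] by (simp_all add: D.one_mult D.mult_one bD)
    have Cw: "?C w = x"
      unfolding w_def using a y A.mult_closed qx by (simp add: Q.Q_mult[symmetric] Ca)
    define P where "P m = emb (?q m) (?c m a)" for m
    define X where "X m = emb (?q m) (?c m w)" for m
    have P: "star (P m) = P m" "P m * P m = P m" if "N \<le> m" for m
      using emb_ops(2)[OF q.Q_cstar cc(1)[OF a(1)] cc(1)[OF a(1)], of m] emb_ops(4)[OF q.Q_cstar cc(1)[OF a(1)], of m] a(1) am[OF that]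
      unfolding P_def by (simp_all add: q.Q_ops)
    have PX: "P m * X m = X m" "X m * P m = X m" if "N \<le> m" for m
    proof -
      have "?c m (a \<otimes>\<^bsub>A\<^esub> w) = ?c m (a \<otimes>\<^bsub>A\<^esub> a) \<otimes>\<^bsub>?q m\<^esub> ?c m (y \<otimes>\<^bsub>A\<^esub> a)"
        unfolding w_def using a(1) y(1) A.mult_closed by (simp add: q.Q_mult A.mult_assoc)
      then have 1: "?c m (a \<otimes>\<^bsub>A\<^esub> w) = ?c m w" unfolding am(1)[OF that] w_def using a(1) y(1) A.mult_closed by (simp add: q.Q_mult)
      have "?c m (w \<otimes>\<^bsub>A\<^esub> a) = ?c m (a \<otimes>\<^bsub>A\<^esub> y) \<otimes>\<^bsub>?q m\<^esub> ?c m (a \<otimes>\<^bsub>A\<^esub> a)"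
        unfolding w_def using a(1) y(1) A.mult_closed by (simp add: q.Q_mult A.mult_assoc)
      then have 2: "?c m (w \<otimes>\<^bsub>A\<^esub> a) = ?c m w" unfolding am(1)[OF that] w_def using a(1) y(1) A.mult_closed by (simp add: q.Q_mult A.mult_assoc)
      show "P m * X m = X m" "X m * P m = X m"
        using 1 2 emb_ops(2)[OF q.Q_cstar cc(1)[OF a(1)] cc(1)[OF wc], of m] emb_ops(2)[OF q.Q_cstar cc(1)[OF wc] cc(1)[OF a(1)], of m]
        unfolding P_def X_def by (simp_all add: q.Q_mult a(1) wc)
    qed
    have QP: "star (emb ?Q q) = emb ?Q q" "emb ?Q q * emb ?Q q = emb ?Q q"
      using emb_ops(2)[OF Q.Q_cstar q(1) q(1)] emb_ops(4)[OF Q.Q_cstar q(1)] q by simp_all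
    have Qx: "emb ?Q q * emb ?Q x = emb ?Q x" "emb ?Q x * emb ?Q q = emb ?Q x"
      using emb_ops(2)[OF Q.Q_cstar q(1) xc] emb_ops(2)[OF Q.Q_cstar xc q(1)] qx by simp_all
    define C where "C = corner (emb ?Q q)"
    have C: "unital_cstar_algebra C" unfolding C_def by (rule unital_corner[OF QP])
    interpret C: unital_cstar_algebra C by (rule C)
    have relC: "satisfies_relation C ppoly (emb ?Q x)"
      unfolding C_def x_def
    proof (rule star_hom_relation[OF D(1) _ _ _ D(2)[unfolded pp], where f = "\<lambda>d. emb ?Q (\<phi> d)"])
      show "unital_cstar_algebra (corner (emb ?Q q))" using C unfolding C_def .
      show "(\<lambda>d. emb ?Q (\<phi> d)) \<in> star_hom D (corner (emb ?Q q))"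
        using corner_emb_star_hom[OF D(1) Q.Q_cstar phi] unfolding q_def .
    qed (simp add: q_def)
    have xC: "emb ?Q x \<in> carrier C" using Qx by (simp add: C_def)
    define s where "s i = r.idem_poly i * r.idem_poly i - r.idem_poly i" for i
    \<comment> \<open>One element of A represents the i-th defect in the corner of every quotient at
      once, so that \<open>quot_norm_limit\<close> can be applied to it.\<close>
    define v where "v i = (let W = cp.pev (s i) (emb A w) in prj A W \<otimes>\<^bsub>A\<^esub> a \<oplus>\<^bsub>A\<^esub> scal W \<odot>\<^bsub>A\<^esub> a)" for i
    have vc: "v i \<in> carrier A" for i unfolding v_def Let_def using a(1) A by (simp add: A.mult_closed A.scale_closed)
    have ev: "emb A (v i) = cp.pev (s i) (emb A w) * emb A a" for i
      unfolding v_def Let_def by (rule emb_prj_mult(2)[OF A a(1), symmetric])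
    have vm: "emb (?q m) (?c m (v i)) = cp.pev (s i) (X m) * P m" for m i
    proof -
      interpret star_homo "bigmap A (?q m) (?c m)" by (rule bigmap_star_homo[OF A q.Q_cstar q.cl_star_hom])
      show ?thesis
        unfolding bigmap_emb[OF A vc, symmetric] ev hom_mult hom_pev by (simp add: bigmap_emb A wc a(1) X_def P_def)
    qed
    have vQ: "emb ?Q (?C (v i)) = cp.pev (s i) (emb ?Q x) * emb ?Q q" for i
    proof -
      interpret star_homo "bigmap A ?Q ?C" by (rule bigmap_star_homo[OF A Q.Q_cstar Q.cl_star_hom])
      show ?thesis
        unfolding bigmap_emb[OF A vc, symmetric] ev hom_mult hom_pev by (simp add: bigmap_emb A wc a(1) Cw Ca)
    qed
    have "\<exists>M. \<forall>m\<ge>M. nrm (?q m) (?c m (v i)) < 1 / 4" if i: "i \<in> R'" for i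
    proof (rule lim[OF vc])
      \<comment> \<open>In the limit quotient the reduced relation holds exactly, so the defects
        vanish there and fall below 1/4 at finite stages.\<close>
      have "cstar_poly C r.ppoly (emb ?Q x) = \<zero>\<^bsub>C\<^esub>" using C.reduced_relation[OF lp relC] unfolding R'_def .
      then have "cstar_poly C (s i) (emb ?Q x) = \<zero>\<^bsub>C\<^esub>"
        unfolding s_def by (rule C.poly_dvd_zero[OF xC r.idem_poly_idem[OF i]])
      then have "cp.pev (s i) (emb ?Q x) * emb ?Q q = 0" unfolding C_def corner_poly[OF QP Qx] by simp
      then have "emb ?Q (?C (v i)) = 0" unfolding vQ .
      then have "nrm ?Q (?C (v i)) = 0" using norm_emb[OF Q.Q_cstar cc(2)[OF vc]] by (metis norm_zero)
      then show "nrm ?Q (?C (v i)) < 1 / 4" by simp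
    qed
    then obtain M where M: "\<And>i m. i \<in> R' \<Longrightarrow> M i \<le> m \<Longrightarrow> nrm (?q m) (?c m (v i)) < 1 / 4" by metis
    define m where "m = Max (insert N (M ` R'))"
    have m: "N \<le> m" "\<And>i. i \<in> R' \<Longrightarrow> M i \<le> m" unfolding m_def using r.fin by auto
    define B where "B = corner (P m)"
    have B: "unital_cstar_algebra B" unfolding B_def by (rule unital_corner[OF P[OF m(1)]])
    define f where "f = bigmap (?q m) ?Q (quot_proj A J)"
    have sf: "star_homo f" unfolding f_def by (rule bigmap_star_homo[OF q.Q_cstar Q.Q_cstar quot_proj_star_hom[OF qs Qs IJ]])
    have fP: "f (P m) = emb ?Q q" unfolding f_def P_def bigmap_emb[OF q.Q_cstar cc(1)[OF a(1)]] proj[OF a(1)] Ca ..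
    have fX: "f (X m) = emb ?Q x" unfolding f_def X_def bigmap_emb[OF q.Q_cstar cc(1)[OF wc]] proj[OF wc] Cw ..
    obtain Y where Y: "satisfies_relation B ppoly Y" "f Y = f (X m)"
    proof (rule unital_contraction_lift[OF B C _ _ lp, of f "X m"])
      show "f \<in> star_hom B C" unfolding B_def C_def fP[symmetric] by (rule corner_star_hom[OF sf])
      show "f \<one>\<^bsub>B\<^esub> = \<one>\<^bsub>C\<^esub>" by (simp add: B_def C_def fP)
      show "reduced_set R lam \<noteq> {}" using ne unfolding R'_def .
      show "X m \<in> carrier B" using PX[OF m(1)] by (simp add: B_def)
      show "nrm B (cstar_poly B (defect i) (X m)) < 1 / 4" if "i \<in> reduced_set R lam" for i
        unfolding R'_def[symmetric] s_def[symmetric] B_def corner_poly[OF P[OF m(1)] PX[OF m(1)]] vm[symmetric]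
        using M[of i m] m(2)[of i] that norm_emb[OF q.Q_cstar cc(1)[OF vc]] unfolding R'_def by simp
      show "satisfies_relation C ppoly (f (X m))" unfolding fX by (rule relC)
    qed
    obtain \<psi> where psi: "\<psi> \<in> star_hom D (corner (P m))" "\<psi> \<one>\<^bsub>D\<^esub> = P m" "\<psi> b = Y"
      using universal_corner[OF assms(5) P[OF m(1)]] Y(1) unfolding pp B_def by metis
    note prjm = corner_prj_star_hom[OF q.Q_cstar[of m] cc(1)[OF a(1)], folded P_def]
    \<comment> \<open>The homomorphism into the corner of the big algebra is brought back to A/I m
      by \<open>prj\<close>.\<close>
    define \<theta> where "\<theta> d = prj (?q m) (\<psi> d)" for d
    have th: "\<theta> \<in> star_hom D (?q m)" unfolding \<theta>_def by (rule star_hom_comp[OF psi(1) prjm(1)])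
    have pth: "emb ?Q (quot_proj A J (\<theta> d)) = f (\<psi> d)" if d: "d \<in> carrier D" for d
      unfolding f_def \<theta>_def using bigmap_emb[OF q.Q_cstar prj_closed[OF q.Q_cstar]] prjm(2)[OF star_homD(1)[OF psi(1) d]] by metis
    have th': "(\<lambda>d. quot_proj A J (\<theta> d)) \<in> star_hom D ?Q" by (rule star_hom_comp[OF th quot_proj_star_hom[OF qs Qs IJ]])
    \<comment> \<open>Both sides are *-homomorphisms on D that agree on the unit and on b.\<close>
    have "\<phi> d = quot_proj A J (\<theta> d)" if d: "d \<in> carrier D" for d
    proof (rule star_hom_unique[OF D(1,3) bD Q.Q_cstar phi th' _ _ d])
      show "\<phi> \<one>\<^bsub>D\<^esub> = quot_proj A J (\<theta> \<one>\<^bsub>D\<^esub>)"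
        using pth[OF D.one_closed] emb_eq_iff[OF Q.Q_cstar q(1) star_homD(1)[OF th' D.one_closed]]
        unfolding psi(2) fP q_def by simp
      show "\<phi> b = quot_proj A J (\<theta> b)"
        using pth[OF bD] emb_eq_iff[OF Q.Q_cstar xc star_homD(1)[OF th' bD]]
        unfolding psi(3) Y(2) fX x_def by simp
    qed
    then show "\<exists>n. \<exists>\<psi>\<in>star_hom D (?q n). \<forall>d\<in>carrier D. \<phi> d = quot_proj A J (\<psi> d)"
      using th by blast
  qed
qed

end
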